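(* Every convex $5$-reflective projective billiard with convex pentagonal domain, pairwise distinct centres $O_0,\dots,O_4$ and no four centres collinear (with itinerary the five sides $0,1,2,3,4$) is obtained as follows: take a nondegenerate real symmetric $3\times3$ matrix $Q$ and vectors $n_0,n_1,n_2\in\mathbb{R}^3$ with $n_i^\top Qn_i\ne0$, with $R_i=I-2n_in_i^\top Q/(n_i^\top Qn_i)$; put $B=-R_2R_1R_0$ and take $w\ne0$ in $\ker(B-I)$; take $n_4$ with $n_4^\top Qw=0$ and $n_4^\top Qn_4\neq0$, with $R_4=I-2n_4n_4^\top Q/(n_4^\top Qn_4)$; set $R_3=BR_4$; the reflection in side $i$ is $R_i$. The parameter space is irreducible of dimension $2+2+2+1=7$, and the moduli space has dimension $7-\dim\mathrm{O}(Q)=4$. In particular the moduli space of convex $5$-reflective projective billiards is irreducible and unirational.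
   Context: A projective billiard here is a polygon $\Omega\subset\mathbb{R}^2$ (with $\mathbb{R}^2$ the affine chart $\{(x,y,1)\}$ of $\mathbb{RP}^2$) with central transversal fields: at a point $p$ of side $i$ the transversal line is the line through $p$ and a fixed centre $O_i$ lying off the line supporting the side. A ray is reflected at $p$ so that the incoming line, outgoing line, tangent line and transversal line have cross ratio $-1$; equivalently the line is reflected by the harmonic homology $H_i=I-2O_iL_i/(L_iO_i)$, where the covector $L_i$ defines the supporting line of side $i$. An orbit is $k$-periodic if the trajectory returns after $k$ reflections to the same point with the same oriented direction. $\Omega$ is $k$-reflective if there are a $k$-periodic orbit $(p_1,\dots,p_k)$ and an open set $U_1\times U_2\subset(\partial\Omega)^2$ containing $(p_1,p_2)$, every point of which begins a $k$-periodic orbit. For such a $5$-reflective pentagon the product $H_4H_3H_2H_1H_0$ of the five homologies in order of impact is scalar, hence equal to $-I$. The parameter space is, for fixed $Q$, the space of the data $([n_0],[n_1],[n_2],[n_4])$ of the construction, each $[n_i]\in\mathbb{RP}^2$ and $[n_4]$ in the projective line $\{n_4^\top Qw=0\}$ ($n_i$ matters only up to scaling). The moduli space is the space of such configurations modulo projective equivalence, i.e. modulo $\mathrm{PGL}_3$; $\mathrm{O}(Q)$ is the orthogonal group of $Q$. Irreducibility and unirationality are in the sense of algebraic geometry. *)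

theory Defs
  imports "HOL-Analysis.Analysis"
begin

section \<open>Irreducibility, Krull dimension and quotients of topological spaces\<close>

definition irreducible_space :: "'a topology \<Rightarrow> bool" where
  "irreducible_space X \<longleftrightarrow> topspace X \<noteq> {} \<and>
     (\<forall>C D. closedin X C \<and> closedin X D \<and> C \<union> D = topspace X \<longrightarrow> C = topspace X \<or> D = topspace X)"

text \<open>Supremum of the lengths of strict chains of irreducible closed subsets
  (by this convention the empty space has dimension 0).\<close>

definition krull_dim :: "'a topology \<Rightarrow> enat" where
  "krull_dim X = Sup {enat k | k. \<exists>C. (\<forall>i\<le>k. closedin X (C i) \<and> irreducible_space (subtopology X (C i)))
                                    \<and> (\<forall>i<k. C i \<subset> C (Suc i))}"

definition quotient_topology :: "'a topology \<Rightarrow> ('a \<Rightarrow> 'b) \<Rightarrow> 'b topology" where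
  "quotient_topology X q =
     topology (\<lambda>U. U \<subseteq> q ` topspace X \<and> openin X {x \<in> topspace X. q x \<in> U})"

lemma openin_quotient_topology:
  "openin (quotient_topology X q) U \<longleftrightarrow> U \<subseteq> q ` topspace X \<and> openin X {x \<in> topspace X. q x \<in> U}"
proof -
  have "istopology (\<lambda>U. U \<subseteq> q ` topspace X \<and> openin X {x \<in> topspace X. q x \<in> U})"
    unfolding istopology_def
  proof (intro conjI allI impI)
    fix S T
    assume S: "S \<subseteq> q ` topspace X \<and> openin X {x \<in> topspace X. q x \<in> S}"
      and T: "T \<subseteq> q ` topspace X \<and> openin X {x \<in> topspace X. q x \<in> T}"
    have "{x \<in> topspace X. q x \<in> S \<inter> T} = {x \<in> topspace X. q x \<in> S} \<inter> {x \<in> topspace X. q x \<in> T}"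
      by auto
    then show "openin X {x \<in> topspace X. q x \<in> S \<inter> T}" using S T by auto
    show "S \<inter> T \<subseteq> q ` topspace X" using S by auto
  next
    fix \<K>
    assume K: "\<forall>K\<in>\<K>. K \<subseteq> q ` topspace X \<and> openin X {x \<in> topspace X. q x \<in> K}"
    have "{x \<in> topspace X. q x \<in> \<Union>\<K>} = (\<Union>K\<in>\<K>. {x \<in> topspace X. q x \<in> K})" by auto
    then show "openin X {x \<in> topspace X. q x \<in> \<Union>\<K>}" using K by auto
    show "\<Union>\<K> \<subseteq> q ` topspace X" using K by auto
  qed
  then show ?thesis by (simp add: quotient_topology_def)
qed

lemma quotient_map_quotient_topology: "quotient_map X (quotient_topology X q) q"
proof -
  have "{x \<in> topspace X. q x \<in> q ` topspace X} = topspace X" by auto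
  then have "openin (quotient_topology X q) (q ` topspace X)"
    by (simp add: openin_quotient_topology)
  then have "topspace (quotient_topology X q) = q ` topspace X"
    by (metis openin_quotient_topology openin_subset openin_topspace subset_antisym)
  then show ?thesis by (auto simp: quotient_map_def openin_quotient_topology)
qed


section \<open>Zariski topologies\<close>

definition zariski_affine :: "'a::euclidean_space topology" where
  "zariski_affine = topology_generated_by {{x. f x \<noteq> 0} | f. real_polynomial_function f}"

quotient_type rp2 = "real^3" / partial: "\<lambda>x y. x \<noteq> 0 \<and> y \<noteq> 0 \<and> (\<exists>c. y = c *\<^sub>R x)"
proof (rule part_equivpI)
  have "(axis 1 1 :: real^3) \<noteq> 0" by (simp add: axis_eq_0_iff)
  then show "\<exists>x::real^3. x \<noteq> 0 \<and> x \<noteq> 0 \<and> (\<exists>c. x = c *\<^sub>R x)"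
    by (metis scaleR_one)
  show "symp (\<lambda>x y::real^3. x \<noteq> 0 \<and> y \<noteq> 0 \<and> (\<exists>c. y = c *\<^sub>R x))"
  proof (rule sympI)
    fix x y :: "real^3"
    assume a: "x \<noteq> 0 \<and> y \<noteq> 0 \<and> (\<exists>c. y = c *\<^sub>R x)"
    then obtain c where "y = c *\<^sub>R x" "c \<noteq> 0" by auto
    then have "x = inverse c *\<^sub>R y" by simp
    with a show "y \<noteq> 0 \<and> x \<noteq> 0 \<and> (\<exists>c. x = c *\<^sub>R y)" by blast
  qed
  show "transp (\<lambda>x y::real^3. x \<noteq> 0 \<and> y \<noteq> 0 \<and> (\<exists>c. y = c *\<^sub>R x))"
    by (rule transpI) (metis scaleR_scaleR)
qed

definition multihomogeneous :: "((real^3)^'i::finite \<Rightarrow> real) \<Rightarrow> bool" where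
  "multihomogeneous f \<longleftrightarrow>
     (\<exists>d::'i \<Rightarrow> nat. \<forall>t x. f (\<chi> i. t i *\<^sub>R x $ i) = (\<Prod>i\<in>UNIV. t i ^ d i) * f x)"

text \<open>The Zariski topology on the real points of a product of copies of the projective plane: the
  basic open sets are the nonvanishing loci of multihomogeneous polynomials (so the choice of
  representatives made by \<^const>\<open>rep_rp2\<close> is irrelevant).\<close>

definition zariski :: "('i::finite \<Rightarrow> rp2) topology" where
  "zariski = topology_generated_by
     {{p. f (\<chi> i. rep_rp2 (p i)) \<noteq> 0} | f. real_polynomial_function f \<and> multihomogeneous f}"

text \<open>Polynomial functions of the first \<open>N\<close> coordinates, that is, on affine \<open>N\<close>-space.\<close>

inductive poly_fun :: "nat \<Rightarrow> ((nat \<Rightarrow> real) \<Rightarrow> real) \<Rightarrow> bool" for N where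
  const: "poly_fun N (\<lambda>x. a)"
| coord: "i < N \<Longrightarrow> poly_fun N (\<lambda>x. x i)"
| add: "poly_fun N f \<Longrightarrow> poly_fun N g \<Longrightarrow> poly_fun N (\<lambda>x. f x + g x)"
| mult: "poly_fun N f \<Longrightarrow> poly_fun N g \<Longrightarrow> poly_fun N (\<lambda>x. f x * g x)"

definition rp2_map :: "real^3^3 \<Rightarrow> rp2 \<Rightarrow> rp2" where
  "rp2_map g p = abs_rp2 (g *v rep_rp2 p)"


section \<open>Convex projective billiards\<close>

definition outer :: "real^3 \<Rightarrow> real^3 \<Rightarrow> real^3^3" where
  "outer x y = (\<chi> i j. x $ i * y $ j)"

text \<open>The harmonic homology with centre \<open>c\<close> whose axis is the line with covector \<open>l\<close>.\<close>

definition homology :: "real^3 \<Rightarrow> real^3 \<Rightarrow> real^3^3" where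
  "homology c l = mat 1 - (2 / (l \<bullet> c)) *\<^sub>R outer c l"

lemma homology_scale:
  assumes "a \<noteq> 0" "b \<noteq> 0"
  shows "homology (a *\<^sub>R c) (b *\<^sub>R l) = homology c l"
  using assms
  by (simp add: homology_def outer_def vec_eq_iff)

definition chart :: "real^2 \<Rightarrow> real^3" where
  "chart p = vector [p $ 1, p $ 2, 1]"

text \<open>Vertices and sides are indexed cyclically by the type \<open>5\<close> of integers modulo 5; side \<open>i\<close>
  joins vertex \<open>i\<close> to vertex \<open>i + 1\<close>.\<close>

definition convex_pentagon :: "(5 \<Rightarrow> real^2) \<Rightarrow> bool" where
  "convex_pentagon v \<longleftrightarrow> inj v \<and>
     (\<forall>i. closed_segment (v i) (v (i + 1)) edge_of convex hull (range v))"

definition side_line :: "(5 \<Rightarrow> real^2) \<Rightarrow> 5 \<Rightarrow> real^3" where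
  "side_line v i = cross3 (chart (v i)) (chart (v (i + 1)))"

definition convex_billiard :: "(5 \<Rightarrow> real^2) \<Rightarrow> (5 \<Rightarrow> rp2) \<Rightarrow> bool" where
  "convex_billiard v c \<longleftrightarrow> convex_pentagon v \<and> (\<forall>i. side_line v i \<bullet> rep_rp2 (c i) \<noteq> 0)"

definition side_reflection :: "(5 \<Rightarrow> real^2) \<Rightarrow> (5 \<Rightarrow> rp2) \<Rightarrow> 5 \<Rightarrow> real^3^3" where
  "side_reflection v c i = homology (rep_rp2 (c i)) (side_line v i)"

text \<open>For \<open>p\<close> on side \<open>i\<close>: the homology, which fixes \<open>p\<close>, maps the line \<open>pa\<close> to the line \<open>pb\<close>.
  Away from the degenerate cases where \<open>pa\<close> is the tangent or the transversal line, this says that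
  \<open>pa\<close> and \<open>pb\<close> are harmonic conjugates with respect to these two lines.\<close>

definition reflected :: "(5 \<Rightarrow> real^2) \<Rightarrow> (5 \<Rightarrow> rp2) \<Rightarrow> 5 \<Rightarrow> real^2 \<Rightarrow> real^2 \<Rightarrow> real^2 \<Rightarrow> bool" where
  "reflected v c i a p b \<longleftrightarrow> chart b \<in> span {chart p, side_reflection v c i *v chart a}"

definition billiard_orbit :: "(5 \<Rightarrow> real^2) \<Rightarrow> (5 \<Rightarrow> rp2) \<Rightarrow> (nat \<Rightarrow> real^2) \<Rightarrow> bool" where
  "billiard_orbit v c p \<longleftrightarrow>
     (\<forall>n. \<exists>i. p n \<in> open_segment (v i) (v (i + 1))) \<and>
     (\<forall>n. p n \<noteq> p (Suc n) \<and> open_segment (p n) (p (Suc n)) \<subseteq> interior (convex hull (range v))) \<and>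
     (\<forall>n i. p (Suc n) \<in> open_segment (v i) (v (i + 1)) \<longrightarrow>
            reflected v c i (p n) (p (Suc n)) (p (Suc (Suc n))))"

definition periodic_orbit :: "(5 \<Rightarrow> real^2) \<Rightarrow> (5 \<Rightarrow> rp2) \<Rightarrow> nat \<Rightarrow> (nat \<Rightarrow> real^2) \<Rightarrow> bool" where
  "periodic_orbit v c k p \<longleftrightarrow> billiard_orbit v c p \<and> p k = p 0 \<and>
     (\<exists>t>0. p (Suc k) - p k = t *\<^sub>R (p (Suc 0) - p 0))"

text \<open>\<open>s\<close> is the itinerary of the central periodic orbit.\<close>

definition reflective_along ::
  "(5 \<Rightarrow> real^2) \<Rightarrow> (5 \<Rightarrow> rp2) \<Rightarrow> nat \<Rightarrow> (nat \<Rightarrow> 5) \<Rightarrow> bool" where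
  "reflective_along v c k s \<longleftrightarrow>
     (\<exists>p U\<^sub>1 U\<^sub>2. periodic_orbit v c k p \<and> (\<forall>j<k. p j \<in> open_segment (v (s j)) (v (s j + 1))) \<and>
        openin (top_of_set (frontier (convex hull (range v)))) U\<^sub>1 \<and>
        openin (top_of_set (frontier (convex hull (range v)))) U\<^sub>2 \<and>
        p 0 \<in> U\<^sub>1 \<and> p (Suc 0) \<in> U\<^sub>2 \<and>
        (\<forall>x\<in>U\<^sub>1. \<forall>y\<in>U\<^sub>2. \<exists>q. periodic_orbit v c k q \<and> q 0 = x \<and> q (Suc 0) = y))"

definition no_four_collinear :: "(5 \<Rightarrow> rp2) \<Rightarrow> bool" where
  "no_four_collinear c \<longleftrightarrow>
     (\<forall>S. card S = 4 \<longrightarrow> \<not> (\<exists>l. l \<noteq> 0 \<and> (\<forall>i\<in>S. l \<bullet> rep_rp2 (c i) = 0)))"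

definition convex_5_reflective :: "(5 \<Rightarrow> real^2) \<Rightarrow> (5 \<Rightarrow> rp2) \<Rightarrow> bool" where
  "convex_5_reflective v c \<longleftrightarrow> convex_billiard v c \<and> inj c \<and> no_four_collinear c \<and>
     reflective_along v c 5 of_nat"


section \<open>The construction and its parameter space\<close>

definition nondegenerate_form :: "real^3^3 \<Rightarrow> bool" where
  "nondegenerate_form Q \<longleftrightarrow> transpose Q = Q \<and> det Q \<noteq> 0"

definition orthogonal_group :: "real^3^3 \<Rightarrow> (real^3^3) set" where
  "orthogonal_group Q = {A. transpose A ** Q ** A = Q}"

definition form_reflection :: "real^3^3 \<Rightarrow> real^3 \<Rightarrow> real^3^3" where
  "form_reflection Q n = mat 1 - (2 / (n \<bullet> (Q *v n))) *\<^sub>R (outer n n ** Q)"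

definition construction ::
  "real^3^3 \<Rightarrow> real^3 \<Rightarrow> real^3 \<Rightarrow> real^3 \<Rightarrow> real^3 \<Rightarrow> real^3 \<Rightarrow> (5 \<Rightarrow> real^3^3) \<Rightarrow> bool" where
  "construction Q n\<^sub>0 n\<^sub>1 n\<^sub>2 w n\<^sub>4 R \<longleftrightarrow>
     n\<^sub>0 \<bullet> (Q *v n\<^sub>0) \<noteq> 0 \<and> n\<^sub>1 \<bullet> (Q *v n\<^sub>1) \<noteq> 0 \<and> n\<^sub>2 \<bullet> (Q *v n\<^sub>2) \<noteq> 0 \<and>
     R 0 = form_reflection Q n\<^sub>0 \<and> R 1 = form_reflection Q n\<^sub>1 \<and> R 2 = form_reflection Q n\<^sub>2 \<and>
     (let B = - (R 2 ** R 1 ** R 0) in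
        w \<noteq> 0 \<and> B *v w = w \<and> n\<^sub>4 \<bullet> (Q *v w) = 0 \<and> n\<^sub>4 \<bullet> (Q *v n\<^sub>4) \<noteq> 0 \<and>
        R 4 = form_reflection Q n\<^sub>4 \<and> R 3 = B ** R 4)"

text \<open>The entries \<open>x 0\<close>, \<open>x 1\<close>, \<open>x 2\<close>, \<open>x 3\<close> are the classes of \<open>n\<^sub>0\<close>, \<open>n\<^sub>1\<close>, \<open>n\<^sub>2\<close>, \<open>n\<^sub>4\<close>
  (in the type \<open>4\<close> the numeral \<open>4\<close> is \<open>0\<close>).\<close>

definition parameter_space :: "real^3^3 \<Rightarrow> (4 \<Rightarrow> rp2) set" where
  "parameter_space Q = {x. \<exists>w R.
     construction Q (rep_rp2 (x 0)) (rep_rp2 (x 1)) (rep_rp2 (x 2)) w (rep_rp2 (x 3)) R}"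

definition parameter_topology :: "real^3^3 \<Rightarrow> (4 \<Rightarrow> rp2) topology" where
  "parameter_topology Q = subtopology zariski (parameter_space Q)"

text \<open>Projective equivalence of the configurations \<open>(Q, x)\<close> and \<open>(Q', y)\<close>; forms, like points, matter
  only up to scaling, since proportional forms have the same reflections.\<close>

definition projectively_equivalent ::
  "real^3^3 \<Rightarrow> (4 \<Rightarrow> rp2) \<Rightarrow> real^3^3 \<Rightarrow> (4 \<Rightarrow> rp2) \<Rightarrow> bool" where
  "projectively_equivalent Q x Q' y \<longleftrightarrow>
     (\<exists>g k. invertible g \<and> k \<noteq> 0 \<and> transpose g ** Q' ** g = k *\<^sub>R Q \<and> (\<forall>i. y i = rp2_map g (x i)))"

definition configuration_moduli :: "real^3^3 \<Rightarrow> (4 \<Rightarrow> rp2) set topology" where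
  "configuration_moduli Q = quotient_topology (parameter_topology Q)
     (\<lambda>x. {y \<in> parameter_space Q. projectively_equivalent Q x Q y})"


section \<open>The moduli space of convex 5-reflective billiards\<close>

text \<open>A configuration consists of five centres (index \<open>Inl i\<close>) and five side lines (index \<open>Inr i\<close>,
  represented by covectors and hence transforming contragrediently).\<close>

definition billiard_configuration :: "(5 \<Rightarrow> real^2) \<Rightarrow> (5 \<Rightarrow> rp2) \<Rightarrow> (5 + 5 \<Rightarrow> rp2)" where
  "billiard_configuration v c = case_sum c (\<lambda>i. abs_rp2 (side_line v i))"

definition pgl_action :: "real^3^3 \<Rightarrow> (5 + 5 \<Rightarrow> rp2) \<Rightarrow> (5 + 5 \<Rightarrow> rp2)" where
  "pgl_action g x = case_sum (\<lambda>i. rp2_map g (x (Inl i)))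
                             (\<lambda>i. rp2_map (transpose (matrix_inv g)) (x (Inr i)))"

definition pgl_orbit :: "(5 + 5 \<Rightarrow> rp2) \<Rightarrow> (5 + 5 \<Rightarrow> rp2) set" where
  "pgl_orbit x = {pgl_action g x | g. invertible g}"

definition moduli_topology :: "(5 + 5 \<Rightarrow> rp2) set topology" where
  "moduli_topology = quotient_topology zariski pgl_orbit"

text \<open>A convex billiard determines its side lines, and the side lines in their cyclic order determine
  the pentagon, so this is the set of projective equivalence classes of billiards. Since orbit maps
  are open, its topology as a subspace is the quotient topology of the union of its orbits.\<close>

definition billiard_moduli_set :: "(5 + 5 \<Rightarrow> rp2) set set" where
  "billiard_moduli_set = {pgl_orbit (billiard_configuration v c) | v c. convex_5_reflective v c}"

definition billiard_moduli :: "(5 + 5 \<Rightarrow> rp2) set topology" where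
  "billiard_moduli = subtopology moduli_topology billiard_moduli_set"

text \<open>Convexity is a semialgebraic condition, so unirationality refers to the Zariski closure: there
  is a dominant rational map to it from an affine space. In homogeneous coordinates the map is given
  by polynomials and defined where none of the ten coordinate vectors vanishes.\<close>

definition unirational :: "(5 + 5 \<Rightarrow> rp2) set set \<Rightarrow> bool" where
  "unirational S \<longleftrightarrow> (\<exists>N (F :: 5 + 5 \<Rightarrow> (nat \<Rightarrow> real) \<Rightarrow> real^3).
     (\<forall>i j. poly_fun N (\<lambda>a. F i a $ j)) \<and> (\<exists>a. \<forall>i. F i a \<noteq> 0) \<and>
     moduli_topology closure_of {pgl_orbit (\<lambda>i. abs_rp2 (F i a)) | a. \<forall>i. F i a \<noteq> 0}
       = moduli_topology closure_of S)"

end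

theory Submission
  imports Defs
begin

text \<open>
  The homology of a side fixes the point of reflection, so it maps the plane of \<open>\<real>\<^sup>3\<close> that is spanned by two
  consecutive points of an orbit to the plane spanned by the second and the third one. If all rays near a given one
  are periodic, the product of the five homologies therefore preserves a whole family of planes, hence also the lines in
  which they intersect. So it is a scalar, and the scalar is \<open>-1\<close> because each of the five homologies has
  determinant \<open>-1\<close> (\<open>reflective_relation\<close>).

  The invariant form comes from this relation alone. A word of length three in the homologies and the reversed word have
  the same trace, and for the numbers \<open>g i j = L i \<bullet> cen j\<close>, where \<open>L i\<close> are the sides and \<open>cen j\<close> the centres, this
  means that \<open>g i j * g j k * g k i = g i k * g k j * g j i\<close>. These are the cocycle conditions for making \<open>g\<close>
  symmetric by a rescaling, and the general position of the sides and centres leaves enough nonzero entries for that.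
  A symmetric \<open>g\<close> says that a symmetric matrix takes the lines to the centres; its inverse is the form, and each
  homology is the reflection of the form in its centre (\<open>invariant_form_exists\<close>, \<open>reflective_construction\<close>).

  The dimensions are computed with chains of irreducible closed sets. In affine space their length is bounded by counting
  polynomials of bounded degree (\<open>irr_chain_zariski_affine\<close>), elsewhere by prolonging a given chain to one in an
  affine space; lower bounds come from explicit chains. Among the quadruples of anisotropic vectors, the parameter space is
  the zero set of the Pfaffian formed from the entries of their Gram matrix (\<open>construction_exists_iff\<close>), and it lies
  between the image of an open set under a polynomial map and the closure of this image (\<open>parameter_space_closure\<close>). The fibres of the map to the moduli space are the orbits of
  the orthogonal group. They are irreducible of dimension three, since the group is generated by reflections, and so
  a chain in the moduli space lifts to one that is longer by three (\<open>config_chain_lift\<close>).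

  Billiards are put into a normal form by moving four of the sides to a standard frame. What remains is a symmetric matrix up
  to scaling that is subject to one equation, which determines one of its entries by the others: there are four
  parameters (\<open>reflective_normal_form\<close>), and they are rational functions of the configuration that are
  invariant under projective maps. So the moduli space is homeomorphic to a set of parameters (\<open>moduli_homeomorphic\<close>).
  This set contains a ball, since, conversely, the relation between the homologies closes up the orbits
  (\<open>reflectiveI\<close>) and all other conditions are open and hold for one explicit pentagon. As a nonzero
  polynomial cannot vanish on a ball, irreducibility, dimension four and unirationality follow.
\<close>

abbreviation real_poly :: "('a::real_normed_vector \<Rightarrow> real) \<Rightarrow> bool" where
  "real_poly \<equiv> real_polynomial_function"

abbreviation poly_map :: "('a::real_normed_vector \<Rightarrow> 'b::real_normed_vector) \<Rightarrow> bool" where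
  "poly_map \<equiv> polynomial_function"

section \<open>Irreducible sets\<close>

abbreviation irreducible_in :: "'a topology \<Rightarrow> 'a set \<Rightarrow> bool" where
 "irreducible_in X S \<equiv> S \<subseteq> topspace X \<and> irreducible_space (subtopology X S)"

lemma irreducible_in_iff_closed:
 "irreducible_in X S \<longleftrightarrow> S \<subseteq> topspace X \<and> S \<noteq> {} \<and>
   (\<forall>C D. closedin X C \<and> closedin X D \<and> S \<subseteq> C \<union> D \<longrightarrow> S \<subseteq> C \<or> S \<subseteq> D)"
proof (cases "S \<subseteq> topspace X")
 case True
 have ts: "topspace (subtopology X S) = S" using True by auto
 show ?thesis
 proof
  assume L: "irreducible_in X S"
  have "S \<subseteq> C \<or> S \<subseteq> D" if "closedin X C" "closedin X D" "S \<subseteq> C \<union> D" for C D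
  proof -
   have "closedin (subtopology X S) (C \<inter> S)" "closedin (subtopology X S) (D \<inter> S)"
    using that by (auto simp: closedin_subtopology)
   moreover have "C \<inter> S \<union> D \<inter> S = S" using that by blast
   ultimately have "C \<inter> S = S \<or> D \<inter> S = S"
    using L ts unfolding irreducible_space_def by metis
   then show ?thesis by blast
  qed
  then show "S \<subseteq> topspace X \<and> S \<noteq> {} \<and>
   (\<forall>C D. closedin X C \<and> closedin X D \<and> S \<subseteq> C \<union> D \<longrightarrow> S \<subseteq> C \<or> S \<subseteq> D)"
   using L ts unfolding irreducible_space_def by metis
 next
  assume R: "S \<subseteq> topspace X \<and> S \<noteq> {} \<and>
   (\<forall>C D. closedin X C \<and> closedin X D \<and> S \<subseteq> C \<union> D \<longrightarrow> S \<subseteq> C \<or> S \<subseteq> D)"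
  have "C = S \<or> D = S"
   if CD: "closedin (subtopology X S) C" "closedin (subtopology X S) D" "C \<union> D = S" for C D
  proof -
   obtain C' D' where "closedin X C'" "C = C' \<inter> S" "closedin X D'" "D = D' \<inter> S"
    using CD by (auto simp: closedin_subtopology)
   moreover have "S \<subseteq> C' \<union> D'" using calculation CD(3) by blast
   ultimately show ?thesis using R by blast
  qed
  then show "irreducible_in X S" using R ts unfolding irreducible_space_def by metis
 qed
qed auto

lemma irreducible_in_iff_open:
 "irreducible_in X S \<longleftrightarrow> S \<subseteq> topspace X \<and> S \<noteq> {} \<and>
   (\<forall>U V. openin X U \<and> openin X V \<and> U \<inter> S \<noteq> {} \<and> V \<inter> S \<noteq> {} \<longrightarrow> U \<inter> V \<inter> S \<noteq> {})"
proof (cases "S \<subseteq> topspace X")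
 case True
 have "(\<forall>C D. closedin X C \<and> closedin X D \<and> S \<subseteq> C \<union> D \<longrightarrow> S \<subseteq> C \<or> S \<subseteq> D) \<longleftrightarrow>
   (\<forall>U V. openin X U \<and> openin X V \<and> U \<inter> S \<noteq> {} \<and> V \<inter> S \<noteq> {} \<longrightarrow> U \<inter> V \<inter> S \<noteq> {})"
  (is "?C \<longleftrightarrow> ?O")
 proof
  assume C: ?C
  show ?O
  proof (intro allI impI, elim conjE)
   fix U V assume h: "openin X U" "openin X V" "U \<inter> S \<noteq> {}" "V \<inter> S \<noteq> {}"
   have "closedin X (topspace X - U)" "closedin X (topspace X - V)" using h by auto
   moreover have "\<not> S \<subseteq> topspace X - U" "\<not> S \<subseteq> topspace X - V" using h by blast+
   ultimately have "\<not> S \<subseteq> (topspace X - U) \<union> (topspace X - V)" using C by blast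
   then show "U \<inter> V \<inter> S \<noteq> {}" using True by blast
  qed
 next
  assume O: ?O
  show ?C
  proof (intro allI impI, elim conjE, rule ccontr)
   fix C D assume h: "closedin X C" "closedin X D" "S \<subseteq> C \<union> D" "\<not> (S \<subseteq> C \<or> S \<subseteq> D)"
   have "openin X (topspace X - C)" "openin X (topspace X - D)" using h by auto
   moreover have "(topspace X - C) \<inter> S \<noteq> {}" "(topspace X - D) \<inter> S \<noteq> {}"
    using h True by blast+
   ultimately have "(topspace X - C) \<inter> (topspace X - D) \<inter> S \<noteq> {}" using O by blast
   then show False using h by blast
  qed
 qed
 then show ?thesis by (simp add: irreducible_in_iff_closed)
next
 case False
 then show ?thesis by blast
qed

lemma irreducible_in_openD:
 assumes "irreducible_in X S" "openin X U" "openin X V" "U \<inter> S \<noteq> {}" "V \<inter> S \<noteq> {}"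
 shows "U \<inter> V \<inter> S \<noteq> {}"
 using assms irreducible_in_iff_open by metis

lemma irreducible_in_closedD:
 assumes "irreducible_in X S" "closedin X C" "closedin X D" "S \<subseteq> C \<union> D"
 shows "S \<subseteq> C \<or> S \<subseteq> D"
 using assms irreducible_in_iff_closed by metis

lemma irreducible_space_iff: "irreducible_space X \<longleftrightarrow> irreducible_in X (topspace X)"
 by simp

lemma irreducible_in_nonempty: "irreducible_in X S \<Longrightarrow> S \<noteq> {}"
 using irreducible_in_iff_open by metis

lemma irreducible_in_between:
 assumes "irreducible_in X S" "S \<subseteq> T" "T \<subseteq> X closure_of S"
 shows "irreducible_in X T"
proof -
 have "T \<subseteq> C \<or> T \<subseteq> D" if "closedin X C" "closedin X D" "T \<subseteq> C \<union> D" for C D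
  using irreducible_in_closedD[OF assms(1) that(1,2)] that assms(2,3) closure_of_minimal[of S C X]
   closure_of_minimal[of S D X] by blast
 then show ?thesis
  using assms irreducible_in_nonempty[OF assms(1)] closure_of_subset_topspace[of X S]
  by (subst irreducible_in_iff_closed) blast
qed

lemma irreducible_in_closure_of:
 "irreducible_in X S \<Longrightarrow> irreducible_in X (X closure_of S)"
 using irreducible_in_between closure_of_subset by blast

lemma irreducible_in_subtopology:
 "irreducible_in (subtopology X T) S \<longleftrightarrow> irreducible_in X S \<and> S \<subseteq> T"
 by (cases "S \<subseteq> T") (auto simp: subtopology_subtopology inf.absorb2)

lemma irreducible_in_image:
 assumes f: "continuous_map X Y f" and S: "irreducible_in X S"
 shows "irreducible_in Y (f ` S)"
proof -
 have sub: "f ` S \<subseteq> topspace Y" using f S by (auto simp: continuous_map_def)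
 have "U \<inter> V \<inter> f ` S \<noteq> {}"
  if h: "openin Y U" "openin Y V" "U \<inter> f ` S \<noteq> {}" "V \<inter> f ` S \<noteq> {}" for U V
 proof -
  let ?U = "{x \<in> topspace X. f x \<in> U}" and ?V = "{x \<in> topspace X. f x \<in> V}"
  have "openin X ?U" "openin X ?V" using f h by (auto simp: continuous_map_def)
  moreover have "?U \<inter> S \<noteq> {}" "?V \<inter> S \<noteq> {}" using h S by blast+
  ultimately have "?U \<inter> ?V \<inter> S \<noteq> {}" using irreducible_in_openD[OF S] by blast
  then show ?thesis by blast
 qed
 then show ?thesis using sub irreducible_in_nonempty[OF S] by (subst irreducible_in_iff_open) blast
qed

lemma irreducible_in_open_part:
 assumes S: "irreducible_in X S" and U: "openin X U" "U \<inter> S \<noteq> {}"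
 shows "irreducible_in X (U \<inter> S)" and "S \<subseteq> X closure_of (U \<inter> S)"
proof -
 have "A \<inter> B \<inter> (U \<inter> S) \<noteq> {}"
  if h: "openin X A" "openin X B" "A \<inter> (U \<inter> S) \<noteq> {}" "B \<inter> (U \<inter> S) \<noteq> {}" for A B
 proof -
  have "(A \<inter> U) \<inter> (B \<inter> U) \<inter> S \<noteq> {}"
   using h U by (intro irreducible_in_openD[OF S]) auto
  then show ?thesis by blast
 qed
 then show "irreducible_in X (U \<inter> S)" using S U by (subst irreducible_in_iff_open) blast
 show "S \<subseteq> X closure_of (U \<inter> S)"
 proof
  fix x assume x: "x \<in> S"
  have "\<exists>y. y \<in> U \<inter> S \<and> y \<in> T" if "x \<in> T \<and> openin X T" for T
   using irreducible_in_openD[OF S U(1), of T] U that x by blast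
  then show "x \<in> X closure_of (U \<inter> S)" using x S by (auto simp: closure_of_def)
 qed
qed

lemma irreducible_in_increasing_union:
 fixes S :: "nat \<Rightarrow> 'a set"
 assumes irr: "\<And>k. irreducible_in X (S k)" and mono: "\<And>k. S k \<subseteq> S (Suc k)"
 shows "irreducible_in X (\<Union>k. S k)"
proof -
 have le: "S j \<subseteq> S k" if "j \<le> k" for j k using lift_Suc_mono_le[of S, OF mono that] .
 have "U \<inter> V \<inter> (\<Union>k. S k) \<noteq> {}"
  if h: "openin X U" "openin X V" "U \<inter> (\<Union>k. S k) \<noteq> {}" "V \<inter> (\<Union>k. S k) \<noteq> {}" for U V
 proof -
  obtain j k where "U \<inter> S j \<noteq> {}" "V \<inter> S k \<noteq> {}" using h by blast
  then have "U \<inter> S (max j k) \<noteq> {}" "V \<inter> S (max j k) \<noteq> {}"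
   using le[of j "max j k"] le[of k "max j k"] by auto
  then have "U \<inter> V \<inter> S (max j k) \<noteq> {}" using irreducible_in_openD[OF irr] h by blast
  then show ?thesis by blast
 qed
 moreover have "(\<Union>k. S k) \<noteq> {}" using irreducible_in_nonempty[OF irr[of 0]] by blast
 moreover have "(\<Union>k. S k) \<subseteq> topspace X" using irr by blast
 ultimately show ?thesis by (subst irreducible_in_iff_open) blast
qed

text \<open>Separate continuity suffices because irreducibility only asks for one common point, which can
 be found by moving one variable at a time.\<close>

lemma irreducible_in_image2:
 assumes S: "irreducible_in X S" and T: "irreducible_in Y T"
  and m1: "\<And>t. t \<in> T \<Longrightarrow> continuous_map (subtopology X S) Z (\<lambda>s. m s t)"
  and m2: "\<And>s. s \<in> S \<Longrightarrow> continuous_map (subtopology Y T) Z (m s)"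
 shows "irreducible_in Z {m s t | s t. s \<in> S \<and> t \<in> T}"
proof -
 have tsS: "topspace (subtopology X S) = S" and tsT: "topspace (subtopology Y T) = T"
  using S T by auto
 have S': "irreducible_in (subtopology X S) S" and T': "irreducible_in (subtopology Y T) T"
  using S T by (simp_all add: irreducible_in_subtopology subtopology_subtopology inf.absorb2)
 have sub: "{m s t | s t. s \<in> S \<and> t \<in> T} \<subseteq> topspace Z"
 proof clarify
  fix s t assume "s \<in> S" "t \<in> T"
  then show "m s t \<in> topspace Z" using m1[of t] tsS unfolding continuous_map_def by blast
 qed
 have "U \<inter> V \<inter> {m s t | s t. s \<in> S \<and> t \<in> T} \<noteq> {}"
  if h: "openin Z U" "openin Z V" "U \<inter> {m s t | s t. s \<in> S \<and> t \<in> T} \<noteq> {}"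
   "V \<inter> {m s t | s t. s \<in> S \<and> t \<in> T} \<noteq> {}" for U V
 proof -
  obtain s1 t1 s2 t2 where st: "s1 \<in> S" "t1 \<in> T" "m s1 t1 \<in> U" "s2 \<in> S" "t2 \<in> T" "m s2 t2 \<in> V"
   using h(3,4) by blast
  have "openin (subtopology X S) {s \<in> S. m s t1 \<in> U}" "openin (subtopology X S) {s \<in> S. m s t2 \<in> V}"
   using m1[OF st(2)] m1[OF st(5)] h tsS unfolding continuous_map_def by metis+
  then have "{s \<in> S. m s t1 \<in> U} \<inter> {s \<in> S. m s t2 \<in> V} \<inter> S \<noteq> {}"
   using st by (intro irreducible_in_openD[OF S']) auto
  then obtain s where s: "s \<in> S" "m s t1 \<in> U" "m s t2 \<in> V" by blast
  have "openin (subtopology Y T) {t \<in> T. m s t \<in> U}" "openin (subtopology Y T) {t \<in> T. m s t \<in> V}"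
   using m2[OF s(1)] h tsT unfolding continuous_map_def by metis+
  then have "{t \<in> T. m s t \<in> U} \<inter> {t \<in> T. m s t \<in> V} \<inter> T \<noteq> {}"
   using st s by (intro irreducible_in_openD[OF T']) auto
  then show ?thesis using s by blast
 qed
 then show ?thesis using sub irreducible_in_nonempty[OF S] irreducible_in_nonempty[OF T]
  by (subst irreducible_in_iff_open) blast
qed

lemma irreducible_in_vimage:
 assumes f: "open_map X Y f"
  and fib: "\<And>y. y \<in> Z \<Longrightarrow> irreducible_in X {x \<in> topspace X. f x = y}"
  and Z: "irreducible_in Y Z"
 shows "irreducible_in X {x \<in> topspace X. f x \<in> Z}"
proof -
 obtain z where "z \<in> Z" using irreducible_in_nonempty[OF Z] by blast
 then have ne: "{x \<in> topspace X. f x \<in> Z} \<noteq> {}" using irreducible_in_nonempty[OF fib] by blast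
 have "U \<inter> V \<inter> {x \<in> topspace X. f x \<in> Z} \<noteq> {}"
  if h: "openin X U" "openin X V" "U \<inter> {x \<in> topspace X. f x \<in> Z} \<noteq> {}"
   "V \<inter> {x \<in> topspace X. f x \<in> Z} \<noteq> {}" for U V
 proof -
  have "openin Y (f ` U)" "openin Y (f ` V)" using f h by (auto simp: open_map_def)
  then have "f ` U \<inter> f ` V \<inter> Z \<noteq> {}" using h by (intro irreducible_in_openD[OF Z]) auto
  then obtain u v where uv: "u \<in> U" "v \<in> V" "f u = f v" "f u \<in> Z" by auto
  have "u \<in> topspace X" "v \<in> topspace X" using uv h openin_subset by blast+
  then have "U \<inter> V \<inter> {x \<in> topspace X. f x = f u} \<noteq> {}"
   using uv h by (intro irreducible_in_openD[OF fib]) auto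
  then show ?thesis using uv by auto
 qed
 then show ?thesis using ne by (subst irreducible_in_iff_open) blast
qed

section \<open>Chains of irreducible closed sets\<close>

definition irr_chain :: "'a topology \<Rightarrow> nat \<Rightarrow> (nat \<Rightarrow> 'a set) \<Rightarrow> bool" where
 "irr_chain X n C \<longleftrightarrow> (\<forall>i\<le>n. closedin X (C i) \<and> irreducible_space (subtopology X (C i))) \<and>
   (\<forall>i<n. C i \<subset> C (Suc i))"

lemma irr_chain_irreducible: "irr_chain X n C \<Longrightarrow> i \<le> n \<Longrightarrow> irreducible_in X (C i)"
 by (auto simp: irr_chain_def dest: closedin_subset)

lemma irr_chain_closed: "irr_chain X n C \<Longrightarrow> i \<le> n \<Longrightarrow> closedin X (C i)"
 by (auto simp: irr_chain_def)

lemma irr_chain_mono: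
 assumes "irr_chain X n C" "i \<le> j" "j \<le> n" shows "C i \<subseteq> C j"
 using assms(2,3)
proof (induction j rule: dec_induct)
 case (step k)
 then have "C k \<subseteq> C (Suc k)" using assms(1) by (simp add: irr_chain_def psubset_imp_subset)
 then show ?case using step by auto
qed auto

lemma krull_dim_ge: "irr_chain X n C \<Longrightarrow> enat n \<le> krull_dim X"
 unfolding krull_dim_def irr_chain_def by (rule Sup_upper) blast

lemma krull_dim_le:
 assumes "\<And>n C. irr_chain X n C \<Longrightarrow> n \<le> m" shows "krull_dim X \<le> enat m"
 unfolding krull_dim_def using assms by (intro Sup_least) (auto simp: irr_chain_def)

lemma irr_chainI_closure:
 assumes irr: "\<And>i. i \<le> n \<Longrightarrow> irreducible_in X (S i)"
  and mono: "\<And>i. i < n \<Longrightarrow> S i \<subseteq> S (Suc i)"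
  and sep: "\<And>i. i < n \<Longrightarrow> \<exists>C. closedin X C \<and> S i \<subseteq> C \<and> \<not> S (Suc i) \<subseteq> C"
 shows "irr_chain X n (\<lambda>i. X closure_of S i)"
 unfolding irr_chain_def
proof (intro conjI allI impI)
 fix i assume i: "i < n"
 obtain C where C: "closedin X C" "S i \<subseteq> C" "\<not> S (Suc i) \<subseteq> C" using sep[OF i] by blast
 have "X closure_of S i \<subseteq> C" using C closure_of_minimal by metis
 moreover have "S (Suc i) \<subseteq> X closure_of S (Suc i)" using irr[of "Suc i"] i closure_of_subset by auto
 ultimately have "X closure_of S i \<noteq> X closure_of S (Suc i)" using C by blast
 then show "X closure_of S i \<subset> X closure_of S (Suc i)" using closure_of_mono[OF mono[OF i]] by blast
next
 fix i assume "i \<le> n"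
 then show "irreducible_space (subtopology X (X closure_of S i))"
  using irreducible_in_closure_of[OF irr] by blast
qed auto

lemma irr_chain_append:
 assumes C: "irr_chain X n C" and D: "irr_chain X m D" and sub: "C n \<subseteq> D 0"
 shows "\<exists>E. irr_chain X (n + m) E"
proof -
 define E where "E i = (if i < n then C i else D (i - n))" for i
 have "closedin X (E i) \<and> irreducible_space (subtopology X (E i))" if "i \<le> n + m" for i
  using that C D by (auto simp: irr_chain_def E_def)
 moreover have "E i \<subset> E (Suc i)" if i: "i < n + m" for i
 proof -
  consider "Suc i < n" | "Suc i = n" | "n \<le> i" by linarith
  then show ?thesis
  proof cases
   case 1 then show ?thesis using C by (auto simp: irr_chain_def E_def)
  next
   case 2
   then have "C i \<subset> C n" using C by (auto simp: irr_chain_def)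
   then show ?thesis using 2 sub by (auto simp: E_def)
  next
   case 3
   then have "D (i - n) \<subset> D (Suc (i - n))" using i D by (auto simp: irr_chain_def)
   then show ?thesis using 3 by (simp add: E_def Suc_diff_le)
  qed
 qed
 ultimately show ?thesis unfolding irr_chain_def by blast
qed

text \<open>The dimension can be computed locally: a chain survives in any open set that meets its
 smallest member, and from there it can be carried along an embedding.\<close>

lemma irr_chain_local_embedding:
 assumes C: "irr_chain X n C" and D: "openin X D" "D \<inter> C 0 \<noteq> {}"
  and h: "embedding_map (subtopology X D) Y h"
 shows "irr_chain Y n (\<lambda>i. Y closure_of (h ` (D \<inter> C i)))"
proof (rule irr_chainI_closure)
 have cont: "continuous_map (subtopology X D) Y h"
  using h by (meson embedding_map_def continuous_map_in_subtopology homeomorphic_imp_continuous_map)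
 have homeo: "homeomorphic_map (subtopology X D) (subtopology Y (h ` D)) h"
  using h D openin_subset[OF D(1)] by (simp add: embedding_map_def inf.absorb2)
 have inj: "inj_on h D"
  using homeo openin_subset[OF D(1)] by (simp add: homeomorphic_eq_everything_map inf.absorb2)
 have meet: "D \<inter> C i \<noteq> {}" if "i \<le> n" for i using irr_chain_mono[OF C, of 0 i] that D by blast
 show "irreducible_in Y (h ` (D \<inter> C i))" if i: "i \<le> n" for i
  using irreducible_in_open_part(1)[OF irr_chain_irreducible[OF C i] D(1) meet[OF i]]
   irreducible_in_image[OF cont] irreducible_in_subtopology[of "D \<inter> C i" X D] by blast
 fix i assume i: "i < n"
 show "h ` (D \<inter> C i) \<subseteq> h ` (D \<inter> C (Suc i))" using C i by (auto simp: irr_chain_def)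
 have "closedin (subtopology X D) (D \<inter> C i)"
  using irr_chain_closed[OF C, of i] i by (auto simp: closedin_subtopology)
 then have "closedin (subtopology Y (h ` D)) (h ` (D \<inter> C i))"
  using homeo by (metis homeomorphic_map_closedness_eq)
 then obtain T where T: "closedin Y T" "h ` (D \<inter> C i) = T \<inter> h ` D" by (auto simp: closedin_subtopology)
 have "\<not> h ` (D \<inter> C (Suc i)) \<subseteq> T"
 proof
  assume "h ` (D \<inter> C (Suc i)) \<subseteq> T"
  then have "h ` (D \<inter> C (Suc i)) \<subseteq> h ` (D \<inter> C i)" using T by blast
  then have "D \<inter> C (Suc i) \<subseteq> C i" using inj_on_image_subset_iff[OF inj] by (metis inf.bounded_iff inf_le1)
  then have "X closure_of (D \<inter> C (Suc i)) \<subseteq> C i"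
   using irr_chain_closed[OF C, of i] i closure_of_minimal by (metis less_imp_le_nat)
  moreover have "C (Suc i) \<subseteq> X closure_of (D \<inter> C (Suc i))"
   using irreducible_in_open_part(2)[OF irr_chain_irreducible[OF C] D(1) meet] i by simp
  moreover have "C i \<subset> C (Suc i)" using C i by (simp add: irr_chain_def)
  ultimately show False by blast
 qed
 then show "\<exists>T. closedin Y T \<and> h ` (D \<inter> C i) \<subseteq> T \<and> \<not> h ` (D \<inter> C (Suc i)) \<subseteq> T"
  using T by blast
qed

lemma krull_dim_embedding:
 assumes "embedding_map X Y h" shows "krull_dim X \<le> krull_dim Y"
 unfolding krull_dim_def[of X]
proof (rule Sup_least, clarify)
 fix k and C :: "nat \<Rightarrow> 'a set"
 assume "\<forall>i\<le>k. closedin X (C i) \<and> irreducible_space (subtopology X (C i))" "\<forall>i<k. C i \<subset> C (Suc i)"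
 then have C: "irr_chain X k C" by (simp add: irr_chain_def)
 have "C 0 \<noteq> {}" "C 0 \<subseteq> topspace X"
  using irreducible_in_nonempty irr_chain_irreducible[OF C, of 0] by auto
 then have "irr_chain Y k (\<lambda>i. Y closure_of (h ` (topspace X \<inter> C i)))"
  using assms by (intro irr_chain_local_embedding[OF C]) auto
 then show "enat k \<le> krull_dim Y" by (rule krull_dim_ge)
qed

lemma krull_dim_homeomorphic_maps:
 assumes "homeomorphic_maps X Y f g" shows "krull_dim X = krull_dim Y"
proof -
 have "embedding_map X Y f" "embedding_map Y X g"
  using assms section_imp_embedding_map
  by (auto simp: homeomorphic_maps_def section_map_def retraction_maps_def)
 then show ?thesis using krull_dim_embedding antisym by metis
qed

text \<open>Additivity of dimensions, in one direction: a chain in the base pulls back, and it can be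
 prolonged downwards inside the closure of one fibre.\<close>

lemma irr_chain_fibration:
 assumes cont: "continuous_map X Y f" and op: "open_map X Y f" and surj: "f ` topspace X = topspace Y"
  and fib: "\<And>y. y \<in> topspace Y \<Longrightarrow> irreducible_in X {x \<in> topspace X. f x = y}"
  and chain: "\<And>y. y \<in> topspace Y \<Longrightarrow>
    \<exists>C. irr_chain X r C \<and> C r \<subseteq> X closure_of {x \<in> topspace X. f x = y}"
  and Z: "irr_chain Y n Z"
 shows "\<exists>C. irr_chain X (r + n) C"
proof -
 define P where "P i = {x \<in> topspace X. f x \<in> Z i}" for i
 obtain z where z: "z \<in> Z 0" using irreducible_in_nonempty[OF irr_chain_irreducible[OF Z]] by blast
 have zY: "z \<in> topspace Y" using z closedin_subset[OF irr_chain_closed[OF Z, of 0]] by blast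
 have clP: "closedin X (P i)" if "i \<le> n" for i
  unfolding P_def using cont irr_chain_closed[OF Z that] by (simp add: closedin_continuous_map_preimage)
 have sub: "X closure_of {x \<in> topspace X. f x = z} \<subseteq> P 0"
  using z clP[of 0] by (intro closure_of_minimal) (auto simp: P_def)
 have "irr_chain X n P"
  unfolding irr_chain_def
 proof (intro conjI allI impI)
  fix i assume i: "i \<le> n"
  show "closedin X (P i)" by (rule clP[OF i])
  have "irreducible_in X (P i)"
   unfolding P_def using fib irr_chain_irreducible[OF Z i]
   by (intro irreducible_in_vimage[OF op]) auto
  then show "irreducible_space (subtopology X (P i))" ..
 next
  fix i assume i: "i < n"
  then have "Z i \<subset> Z (Suc i)" using Z by (auto simp: irr_chain_def)
  moreover have "Z (Suc i) \<subseteq> f ` topspace X"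
   using surj closedin_subset[OF irr_chain_closed[OF Z]] i by (metis Suc_leI)
  ultimately show "P i \<subset> P (Suc i)" unfolding P_def by blast
 qed
 moreover obtain C where "irr_chain X r C" "C r \<subseteq> X closure_of {x \<in> topspace X. f x = z}"
  using chain[OF zY] by blast
 ultimately show ?thesis using irr_chain_append[of X r C n P] sub by blast
qed

section \<open>The Zariski topology of a Euclidean space\<close>

lemma real_polynomial_function_component [intro]:
 fixes f :: "'a::real_normed_vector \<Rightarrow> 'b::euclidean_space"
 shows "poly_map f \<Longrightarrow> real_poly (\<lambda>x. f x \<bullet> b)"
 using polynomial_function_def by (auto simp: o_def bounded_linear_inner_left)

lemma topology_generated_by_base:
 assumes one: "\<And>x. x \<in> U \<Longrightarrow> \<exists>f. P f \<and> r f x" and mult: "\<And>f g. P f \<Longrightarrow> P g \<Longrightarrow> \<exists>h. P h \<and> (\<forall>x. r h x \<longleftrightarrow> r f x \<and> r g x)"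
 shows "generate_topology_on {{x. r f x} | f. P f} U \<Longrightarrow> x \<in> U \<Longrightarrow> \<exists>f. P f \<and> r f x \<and> {y. r f y} \<subseteq> U"
proof (induction arbitrary: x rule: generate_topology_on.induct)
 case (Int a b)
 then obtain f g where "P f" "r f x" "{y. r f y} \<subseteq> a" "P g" "r g x" "{y. r g y} \<subseteq> b" by blast
 then show ?case using mult[of f g] by blast
next
 case (UN K)
 then show ?case by blast
qed auto

lemma topspace_zariski_affine [simp]: "topspace (zariski_affine :: 'a::euclidean_space topology) = UNIV"
proof -
 have "UNIV \<in> {{x::'a. f x \<noteq> 0} | f. real_poly f}"
  by (rule CollectI, rule exI[of _ "\<lambda>x. 1"]) auto
 then show ?thesis unfolding zariski_affine_def topology_generated_by_topspace by blast
qed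

lemma openin_zariski_affine_nonzero:
 "real_poly f \<Longrightarrow> openin zariski_affine {x. f x \<noteq> 0}"
 unfolding zariski_affine_def by (rule topology_generated_by_Basis) auto

lemma openin_zariski_affineE:
 assumes "openin zariski_affine U" "x \<in> U"
 obtains f where "real_poly f" "f x \<noteq> 0" "{y. f y \<noteq> 0} \<subseteq> U"
proof -
 have "\<exists>f. real_poly f \<and> f x \<noteq> 0 \<and> {y. f y \<noteq> 0} \<subseteq> U"
 proof (rule topology_generated_by_base[where r = "\<lambda>f x. f x \<noteq> 0"])
  show "\<exists>f. real_poly f \<and> f x \<noteq> 0" for x :: 'a
   by (rule exI[of _ "\<lambda>x. 1"]) auto
  show "\<exists>h. real_poly h \<and> (\<forall>x. h x \<noteq> 0 \<longleftrightarrow> f x \<noteq> 0 \<and> g x \<noteq> 0)"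
   if "real_poly f" "real_poly g" for f g :: "'a \<Rightarrow> real"
   using that by (intro exI[of _ "\<lambda>x. f x * g x"]) auto
  show "generate_topology_on {{x. f x \<noteq> 0} |f. real_poly f} U"
   using assms by (simp add: zariski_affine_def openin_topology_generated_by_iff)
 qed (rule assms)
 then show ?thesis using that by blast
qed

lemma closedin_zariski_affine_zero:
 assumes "real_poly f" shows "closedin zariski_affine {x. f x = 0}"
proof -
 have "UNIV - {x. f x = 0} = {x. f x \<noteq> 0}" by blast
 then show ?thesis using openin_zariski_affine_nonzero[OF assms] by (simp add: closedin_def)
qed

lemma closedin_zariski_affineE:
 assumes "closedin zariski_affine C" "x \<notin> C"
 obtains f where "real_poly f" "f x \<noteq> 0" "\<And>y. y \<in> C \<Longrightarrow> f y = 0"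
proof -
 have "openin zariski_affine (UNIV - C)" using assms(1) by (simp add: closedin_def)
 then show ?thesis using assms(2) that by (elim openin_zariski_affineE[of _ x]) auto
qed

lemma open_if_zariski_open:
 assumes "openin zariski_affine U" shows "open U"
proof (subst open_subopen, intro ballI)
 fix x assume "x \<in> U"
 then obtain f where f: "real_poly f" "f x \<noteq> 0" "{y. f y \<noteq> 0} \<subseteq> U"
  using assms openin_zariski_affineE by blast
 then have "open {y. f y \<noteq> 0}"
  by (intro open_Collect_neq continuous_on_const continuous_at_imp_continuous_on ballI
    continuous_real_polymonial_function)
 then show "\<exists>T. open T \<and> x \<in> T \<and> T \<subseteq> U" using f by blast
qed

text \<open>A real polynomial has only finitely many zeros on a line along which it does not vanish
 identically, so it cannot vanish on a Euclidean neighbourhood.\<close>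

lemma real_polynomial_function_eq_zero:
 fixes f :: "'a::euclidean_space \<Rightarrow> real"
 assumes f: "real_poly f" and S: "open S" "S \<noteq> {}" and zero: "\<And>x. x \<in> S \<Longrightarrow> f x = 0"
 shows "f y = 0"
proof -
 obtain x e where x: "e > 0" "ball x e \<subseteq> S" using S open_contains_ball by blast
 define g where "g t = f (x + t *\<^sub>R (y - x))" for t :: real
 have "poly_map (\<lambda>t::real. x + t *\<^sub>R (y - x))"
  by (intro polynomial_function_add polynomial_function_const polynomial_function_bounded_linear
    bounded_linear_scaleR_left)
 then have "real_poly (f \<circ> (\<lambda>t. x + t *\<^sub>R (y - x)))"
  using f by (rule real_polynomial_function_compose)
 then have "real_poly g" by (simp add: g_def[abs_def] o_def)
 then obtain a n where a: "g = (\<lambda>t. \<Sum>i\<le>n. a i * t ^ i)" using real_polynomial_function_imp_sum by blast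
 have "\<exists>d>0. \<forall>t. \<bar>t\<bar> < d \<longrightarrow> g t = 0"
 proof (intro exI conjI allI impI)
  show "e / (norm (y - x) + 1) > 0" using x by (simp add: add_nonneg_pos)
  fix t assume t: "\<bar>t\<bar> < e / (norm (y - x) + 1)"
  have "norm (t *\<^sub>R (y - x)) \<le> \<bar>t\<bar> * (norm (y - x) + 1)" by (simp add: mult_left_mono)
  also have "\<dots> < e" using t by (simp add: pos_less_divide_eq add_nonneg_pos)
  finally have "x + t *\<^sub>R (y - x) \<in> ball x e" by (simp add: dist_norm)
  then show "g t = 0" using x zero by (auto simp: g_def)
 qed
 then obtain d where d: "d > 0" "\<And>t. \<bar>t\<bar> < d \<Longrightarrow> g t = 0" by blast
 have "{0<..<d} \<subseteq> {t. (\<Sum>i\<le>n. a i * t ^ i) = 0}" using d a by auto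
 then have "infinite {t. (\<Sum>i\<le>n. a i * t ^ i) = 0}"
  using d infinite_Ioo infinite_super by blast
 then have "\<forall>i\<le>n. a i = 0" using polyfun_finite_roots[of a n] by blast
 then have "g 1 = 0" using a by simp
 then show ?thesis by (simp add: g_def)
qed

lemma irreducible_in_zariski_affine:
 fixes S :: "'a::euclidean_space set"
 assumes "interior S \<noteq> {}" shows "irreducible_in zariski_affine S"
proof -
 have "U \<inter> V \<inter> S \<noteq> {}"
  if h: "openin zariski_affine U" "openin zariski_affine V" "U \<inter> S \<noteq> {}" "V \<inter> S \<noteq> {}" for U V
 proof -
  obtain u v where uv: "u \<in> U" "v \<in> V" using h by blast
  obtain f where f: "real_poly f" "f u \<noteq> 0" "{y. f y \<noteq> 0} \<subseteq> U"
   using openin_zariski_affineE[OF h(1) uv(1)] by blast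
  obtain g where g: "real_poly g" "g v \<noteq> 0" "{y. g y \<noteq> 0} \<subseteq> V"
   using openin_zariski_affineE[OF h(2) uv(2)] by blast
  obtain x where x: "x \<in> interior S" "f x \<noteq> 0"
   using real_polynomial_function_eq_zero[OF f(1) open_interior assms] f by blast
  have "open {y. f y \<noteq> 0}" using f openin_zariski_affine_nonzero open_if_zariski_open by blast
  then have "open (interior S \<inter> {y. f y \<noteq> 0})" by auto
  then obtain y where "y \<in> interior S \<inter> {y. f y \<noteq> 0}" "g y \<noteq> 0"
   using real_polynomial_function_eq_zero[OF g(1)] x g(2) by blast
  then show ?thesis using f g interior_subset by blast
 qed
 moreover have "S \<noteq> {}" using assms by auto
 ultimately show ?thesis by (subst irreducible_in_iff_open) auto
qed

lemma irreducible_in_polynomial_image: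
 fixes U :: "'a::euclidean_space set"
 assumes "continuous_map (subtopology zariski_affine U) X F" "interior U \<noteq> {}"
 shows "irreducible_in X (F ` U)"
 using irreducible_in_image[OF assms(1), of U] irreducible_in_zariski_affine[OF assms(2)]
 by (simp add: irreducible_in_subtopology subtopology_subtopology)

subsection \<open>Rational maps\<close>

text \<open>Clearing denominators in a polynomial of the quotients \<open>N / D\<close>. The scalings \<open>act t\<close> allow \<open>N\<close> and
 \<open>D\<close> to be homogeneous of the same degree: the numerator that results is then homogeneous as well.\<close>

lemma clear_denominators:
 fixes N :: "'y::euclidean_space \<Rightarrow> 'e::euclidean_space"
 assumes f: "real_poly f"
  and N: "poly_map N" and D: "real_poly D"
  and hN: "\<And>t y. N (act t y) = wt t *\<^sub>R N y" and hD: "\<And>t y. D (act t y) = wt t * D y"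
 shows "\<exists>k G. real_poly G \<and> (\<forall>t y. G (act t y) = wt t ^ k * G y) \<and>
   (\<forall>y. D y \<noteq> 0 \<longrightarrow> G y = D y ^ k * f ((1 / D y) *\<^sub>R N y))"
 using f
proof induction
 case (linear f)
 have "real_poly (f \<circ> N)" using N linear by (simp add: polynomial_function_def)
 moreover have "\<forall>t y. (f \<circ> N) (act t y) = wt t ^ 1 * (f \<circ> N) y"
  using linear hN by (simp add: bounded_linear.linear linear_cmul)
 moreover have "\<forall>y. D y \<noteq> 0 \<longrightarrow> (f \<circ> N) y = D y ^ 1 * f ((1 / D y) *\<^sub>R N y)"
 proof (intro allI impI)
  fix y assume "D y \<noteq> 0"
  then show "(f \<circ> N) y = D y ^ 1 * f ((1 / D y) *\<^sub>R N y)"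
   using linear_cmul[OF bounded_linear.linear[OF linear], of "1 / D y" "N y"] by simp
 qed
 ultimately show ?case by blast
next
 case (const c)
 have "\<forall>t y. c = wt t ^ 0 * c" "\<forall>y. D y \<noteq> 0 \<longrightarrow> c = D y ^ 0 * c" by simp_all
 moreover have "real_poly (\<lambda>y::'y. c)" by (rule real_polynomial_function.intros(2))
 ultimately show ?case by blast
next
 case (add f g)
 then obtain k F l G where F: "real_poly F" "\<And>t y. F (act t y) = wt t ^ k * F y"
   "\<And>y. D y \<noteq> 0 \<Longrightarrow> F y = D y ^ k * f ((1 / D y) *\<^sub>R N y)"
  and G: "real_poly G" "\<And>t y. G (act t y) = wt t ^ l * G y"
   "\<And>y. D y \<noteq> 0 \<Longrightarrow> G y = D y ^ l * g ((1 / D y) *\<^sub>R N y)" by blast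
 let ?H = "\<lambda>y. D y ^ l * F y + D y ^ k * G y"
 have "real_poly ?H" using F G D
  by (intro real_polynomial_function.intros(3,4) real_polynomial_function_power)
 moreover have "\<forall>t y. ?H (act t y) = wt t ^ (k + l) * ?H y"
  by (simp add: F(2) G(2) hD power_add power_mult_distrib algebra_simps)
 moreover have "\<forall>y. D y \<noteq> 0 \<longrightarrow> ?H y = D y ^ (k + l) * (f ((1 / D y) *\<^sub>R N y) + g ((1 / D y) *\<^sub>R N y))"
  using F(3) G(3) by (simp add: power_add algebra_simps)
 ultimately show ?case by blast
next
 case (mult f g)
 then obtain k F l G where F: "real_poly F" "\<And>t y. F (act t y) = wt t ^ k * F y"
   "\<And>y. D y \<noteq> 0 \<Longrightarrow> F y = D y ^ k * f ((1 / D y) *\<^sub>R N y)"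
  and G: "real_poly G" "\<And>t y. G (act t y) = wt t ^ l * G y"
   "\<And>y. D y \<noteq> 0 \<Longrightarrow> G y = D y ^ l * g ((1 / D y) *\<^sub>R N y)" by blast
 have "real_poly (\<lambda>y. F y * G y)" using F G by (intro real_polynomial_function.intros(4))
 moreover have "\<forall>t y. F (act t y) * G (act t y) = wt t ^ (k + l) * (F y * G y)"
  by (simp add: F(2) G(2) power_add algebra_simps)
 moreover have "\<forall>y. D y \<noteq> 0 \<longrightarrow> F y * G y = D y ^ (k + l) * (f ((1 / D y) *\<^sub>R N y) * g ((1 / D y) *\<^sub>R N y))"
  using F(3) G(3) by (simp add: power_add algebra_simps)
 ultimately show ?case by blast
qed

lemma continuous_map_into_zariski_affine:
 fixes h :: "'x \<Rightarrow> 'e::euclidean_space"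
 assumes "\<And>f. real_poly f \<Longrightarrow> openin X {x \<in> topspace X. f (h x) \<noteq> 0}"
 shows "continuous_map X zariski_affine h"
proof -
 have A: "openin X (h -` U \<inter> topspace X)"
  if U: "U \<in> {{x. f x \<noteq> 0} |f. real_poly f}" for U
 proof -
  obtain f where f: "real_poly f" "U = {x. f x \<noteq> 0}" using U by auto
  have "h -` U \<inter> topspace X = {x \<in> topspace X. f (h x) \<noteq> 0}" using f(2) by auto
  then show ?thesis using assms[OF f(1)] by simp
 qed
 have eq: "\<Union> {{x::'e. f x \<noteq> 0} |f. real_poly f} = UNIV"
  using topspace_zariski_affine unfolding zariski_affine_def topology_generated_by_topspace .
 have B: "h ` topspace X \<subseteq> \<Union> {{x. f x \<noteq> 0} |f. real_poly f}"
  unfolding eq by (rule subset_UNIV)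
 show ?thesis
  unfolding zariski_affine_def continuous_on_generated_topo_iff
  by (intro conjI allI impI, erule A, rule B)
qed

lemma continuous_map_affine_rational:
 fixes N :: "'y::euclidean_space \<Rightarrow> 'e::euclidean_space"
 assumes N: "poly_map N" and D: "real_poly D" and S: "\<And>u. u \<in> S \<Longrightarrow> D u \<noteq> 0"
 shows "continuous_map (subtopology zariski_affine S) zariski_affine (\<lambda>u. (1 / D u) *\<^sub>R N u)"
proof (rule continuous_map_into_zariski_affine)
 fix f :: "'e \<Rightarrow> real" assume f: "real_poly f"
 obtain k G where G: "real_poly G" "\<forall>y. D y \<noteq> 0 \<longrightarrow> G y = D y ^ k * f ((1 / D y) *\<^sub>R N y)"
  using clear_denominators[OF f N D, of "\<lambda>_ y. y" "\<lambda>_. 1"] by auto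
 have "{u \<in> S. f ((1 / D u) *\<^sub>R N u) \<noteq> 0} = {u. G u \<noteq> 0} \<inter> S" using G(2) S by auto
 then show "openin (subtopology zariski_affine S)
   {x \<in> topspace (subtopology zariski_affine S). f ((1 / D x) *\<^sub>R N x) \<noteq> 0}"
  using openin_zariski_affine_nonzero[OF G(1)] by (auto simp: openin_subtopology)
qed

lemma continuous_map_polynomial:
 fixes F :: "'a::euclidean_space \<Rightarrow> 'b::euclidean_space"
 assumes "poly_map F" shows "continuous_map zariski_affine zariski_affine F"
 using continuous_map_affine_rational[of F "\<lambda>_. 1" UNIV] assms by auto

subsection \<open>The dimension of affine space\<close>

lemma homogeneous_system_solution:
 fixes c :: "'i \<Rightarrow> 'j \<Rightarrow> real"
 assumes "finite J" "finite I" "card J < card I"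
 shows "\<exists>y. (\<exists>i\<in>I. y i \<noteq> 0) \<and> (\<forall>j\<in>J. (\<Sum>i\<in>I. y i * c i j) = 0)"
 using assms
proof (induction J arbitrary: I c rule: finite_induct)
 case empty
 then obtain i where "i \<in> I" by fastforce
 then show ?case by (intro exI[of _ "\<lambda>_. 1"]) auto
next
 case (insert j J)
 show ?case
 proof (cases "\<forall>i\<in>I. c i j = 0")
  case True
  have "card J < card I" using insert by auto
  then obtain y where "\<exists>i\<in>I. y i \<noteq> 0" "\<forall>j\<in>J. (\<Sum>i\<in>I. y i * c i j) = 0"
   using insert.IH[OF insert.prems(1), of c] by blast
  then show ?thesis using True by (intro exI[of _ y]) auto
 next
  case False
  then obtain k where k: "k \<in> I" "c k j \<noteq> 0" by blast
  define d where "d i l = c i l - c i j / c k j * c k l" for i l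
  have "card J < card (I - {k})" using insert k by auto
  then obtain y where y: "\<exists>i\<in>I - {k}. y i \<noteq> 0" "\<forall>l\<in>J. (\<Sum>i\<in>I - {k}. y i * d i l) = 0"
   using insert.IH[of "I - {k}" d] insert.prems by blast
  define s where "s = - (\<Sum>i\<in>I - {k}. y i * (c i j / c k j))"
  define z where "z = y(k := s)"
  have zsum: "(\<Sum>i\<in>I. z i * c i l) = s * c k l + (\<Sum>i\<in>I - {k}. y i * c i l)" for l
  proof -
   have "(\<Sum>i\<in>I. z i * c i l) = z k * c k l + (\<Sum>i\<in>I - {k}. z i * c i l)"
    using insert.prems k by (simp add: sum.remove)
   also have "(\<Sum>i\<in>I - {k}. z i * c i l) = (\<Sum>i\<in>I - {k}. y i * c i l)"
    by (intro sum.cong) (auto simp: z_def)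
   finally show ?thesis by (simp add: z_def)
  qed
  have "(\<Sum>i\<in>I. z i * c i l) = (\<Sum>i\<in>I - {k}. y i * d i l)" for l
   unfolding zsum s_def d_def
   by (simp add: sum_distrib_right sum_distrib_left sum_subtractf algebra_simps)
  moreover have "d i j = 0" for i using k by (simp add: d_def)
  ultimately have "\<forall>l\<in>insert j J. (\<Sum>i\<in>I. z i * c i l) = 0" using y by auto
  moreover have "\<exists>i\<in>I. z i \<noteq> 0" using y by (auto simp: z_def)
  ultimately show ?thesis by blast
 qed
qed

text \<open>Polynomials of degree at most \<open>D\<close> in each coordinate separately: for these, the number of
 monomials is simply a power.\<close>

definition coord_monomial :: "('a::euclidean_space \<Rightarrow> nat) \<Rightarrow> 'a \<Rightarrow> real" where
 "coord_monomial e x = (\<Prod>b\<in>Basis. (x \<bullet> b) ^ e b)"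

abbreviation exponent_box :: "nat \<Rightarrow> ('a::euclidean_space \<Rightarrow> nat) set" where
 "exponent_box D \<equiv> PiE Basis (\<lambda>_. {..D})"

definition box_poly :: "nat \<Rightarrow> ('a::euclidean_space \<Rightarrow> real) \<Rightarrow> bool" where
 "box_poly D f \<longleftrightarrow> (\<exists>c. \<forall>x. f x = (\<Sum>e\<in>exponent_box D. c e * coord_monomial e x))"

lemma finite_exponent_box [simp]: "finite (exponent_box D :: ('a::euclidean_space \<Rightarrow> nat) set)"
 by (simp add: finite_PiE)

lemma box_poly_monomial:
 fixes a :: "'a::euclidean_space \<Rightarrow> nat"
 assumes "a \<in> exponent_box D" shows "box_poly D (coord_monomial a)"
 unfolding box_poly_def
proof (intro exI allI)
 fix x
 have "(\<Sum>e\<in>exponent_box D. (if e = a then 1 else 0) * coord_monomial e x) =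
  (\<Sum>e\<in>exponent_box D. if a = e then coord_monomial e x else 0)"
  by (intro sum.cong) auto
 also have "\<dots> = coord_monomial a x" using assms by (simp add: sum.delta)
 finally show "coord_monomial a x = (\<Sum>e\<in>exponent_box D. (if e = a then 1 else 0) * coord_monomial e x)" ..
qed

lemma box_poly_cmult:
 assumes "box_poly D f" shows "box_poly D (\<lambda>x. t * f x)"
proof -
 obtain c where "\<forall>x. f x = (\<Sum>e\<in>exponent_box D. c e * coord_monomial e x)" using assms box_poly_def by blast
 then have "\<forall>x. t * f x = (\<Sum>e\<in>exponent_box D. (t * c e) * coord_monomial e x)"
  by (simp add: sum_distrib_left mult.assoc)
 then show ?thesis unfolding box_poly_def by (rule exI[of _ "\<lambda>e. t * c e"])
qed

lemma box_poly_add: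
 assumes "box_poly D f" "box_poly D g" shows "box_poly D (\<lambda>x. f x + g x)"
proof -
 obtain c d where "\<forall>x. f x = (\<Sum>e\<in>exponent_box D. c e * coord_monomial e x)"
  "\<forall>x. g x = (\<Sum>e\<in>exponent_box D. d e * coord_monomial e x)" using assms unfolding box_poly_def by auto
 then have "\<forall>x. f x + g x = (\<Sum>e\<in>exponent_box D. (c e + d e) * coord_monomial e x)"
  by (simp add: sum.distrib distrib_right)
 then show ?thesis unfolding box_poly_def by (rule exI[of _ "\<lambda>e. c e + d e"])
qed

lemma box_poly_zero: "box_poly D (\<lambda>x. 0)"
 unfolding box_poly_def by (rule exI[of _ "\<lambda>_. 0"]) simp

lemma box_poly_sum:
 assumes "\<And>i. i \<in> I \<Longrightarrow> box_poly D (f i)" shows "box_poly D (\<lambda>x. \<Sum>i\<in>I. f i x)"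
 using assms
proof (induction I rule: infinite_finite_induct)
 case (insert i I)
 then show ?case using box_poly_add[of D "f i" "\<lambda>x. \<Sum>i\<in>I. f i x"] by simp
qed (simp_all add: box_poly_zero)

lemma box_poly_mult:
 fixes f g :: "'a::euclidean_space \<Rightarrow> real"
 assumes f: "box_poly D f" and g: "box_poly E g" shows "box_poly (D + E) (\<lambda>x. f x * g x)"
proof -
 obtain c d where c: "\<forall>x. f x = (\<Sum>e\<in>exponent_box D. c e * coord_monomial e x)"
  and d: "\<forall>x. g x = (\<Sum>e\<in>exponent_box E. d e * coord_monomial e x)"
  using assms unfolding box_poly_def by auto
 have "box_poly (D + E) (\<lambda>x::'a. (c e * d a) * (coord_monomial e x * coord_monomial a x))"
  if "e \<in> exponent_box D" "a \<in> exponent_box E" for e a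
 proof (rule box_poly_cmult)
  have "restrict (\<lambda>b. e b + a b) Basis \<in> exponent_box (D + E)"
   using that by (auto simp: PiE_iff intro: add_mono)
  then have "box_poly (D + E) (coord_monomial (restrict (\<lambda>b. e b + a b) Basis))"
   by (rule box_poly_monomial)
  moreover have "coord_monomial (restrict (\<lambda>b. e b + a b) Basis) = (\<lambda>x. coord_monomial e x * coord_monomial a x)"
   unfolding coord_monomial_def by (rule ext) (simp add: power_add prod.distrib)
  ultimately show "box_poly (D + E) (\<lambda>x. coord_monomial e x * coord_monomial a x)" by simp
 qed
 then have "box_poly (D + E) (\<lambda>x. \<Sum>e\<in>exponent_box D. \<Sum>a\<in>exponent_box E.
   (c e * d a) * (coord_monomial e x * coord_monomial a x))"
  by (intro box_poly_sum) auto
 moreover have "(\<lambda>x. \<Sum>e\<in>exponent_box D. \<Sum>a\<in>exponent_box E.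
   (c e * d a) * (coord_monomial e x * coord_monomial a x)) = (\<lambda>x. f x * g x)"
  using c d by (intro ext) (simp add: sum_product mult_ac)
 ultimately show ?thesis by simp
qed

lemma box_poly_one: "box_poly 0 (\<lambda>x::'a::euclidean_space. 1)"
proof -
 have "coord_monomial (restrict (\<lambda>_. 0) Basis) = (\<lambda>x::'a. 1)"
  by (rule ext) (simp add: coord_monomial_def)
 moreover have "restrict (\<lambda>_. 0) Basis \<in> exponent_box 0" by auto
 ultimately show ?thesis using box_poly_monomial by metis
qed

lemma box_poly_mono:
 assumes f: "box_poly D f" and "D \<le> E" shows "box_poly E f"
proof -
 have "exponent_box D \<subseteq> (exponent_box E :: ('a \<Rightarrow> nat) set)" using assms(2) by (intro PiE_mono) auto
 then have "box_poly E (\<lambda>x. \<Sum>e\<in>exponent_box D. c e * coord_monomial e x)" for c :: "('a \<Rightarrow> nat) \<Rightarrow> real"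
  by (intro box_poly_sum box_poly_cmult box_poly_monomial) blast
 moreover obtain c where "\<forall>x. f x = (\<Sum>e\<in>exponent_box D. c e * coord_monomial e x)"
  using f unfolding box_poly_def by blast
 then have "f = (\<lambda>x. \<Sum>e\<in>exponent_box D. c e * coord_monomial e x)" by (intro ext) simp
 ultimately show ?thesis by simp
qed

lemma box_poly_power: "box_poly D f \<Longrightarrow> box_poly (n * D) (\<lambda>x. f x ^ n)"
 by (induction n) (use box_poly_one box_poly_mult in \<open>auto simp: add.commute\<close>)

lemma real_polynomial_function_box_poly:
 fixes f :: "'a::euclidean_space \<Rightarrow> real"
 assumes "real_poly f" shows "\<exists>D. box_poly D f"
 using assms
proof induction
 case (linear f)
 have mon: "coord_monomial (restrict (\<lambda>a. if a = b then 1 else 0) Basis) x = x \<bullet> b"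
  if "b \<in> Basis" for b x :: 'a
 proof -
  have "coord_monomial (restrict (\<lambda>a. if a = b then 1 else 0) Basis) x = (\<Prod>a\<in>Basis. if a = b then x \<bullet> b else 1)"
   unfolding coord_monomial_def by (intro prod.cong) auto
  then show ?thesis using that by (simp add: prod.delta)
 qed
 have "box_poly 1 (\<lambda>x. f b * coord_monomial (restrict (\<lambda>a. if a = b then 1 else 0) Basis) x)"
  for b
  by (intro box_poly_cmult box_poly_monomial) auto
 then have "box_poly 1 (\<lambda>x. \<Sum>b\<in>Basis. f b * coord_monomial (restrict (\<lambda>a. if a = b then 1 else 0) Basis) x)"
  by (intro box_poly_sum) auto
 moreover have "(\<lambda>x. \<Sum>b\<in>Basis. f b * coord_monomial (restrict (\<lambda>a. if a = b then 1 else 0) Basis) x) = f"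
 proof
  fix x
  have "f x = f (\<Sum>b\<in>Basis. (x \<bullet> b) *\<^sub>R b)" by (simp add: euclidean_representation)
  also have "\<dots> = (\<Sum>b\<in>Basis. (x \<bullet> b) * f b)"
   using linear by (simp add: bounded_linear.linear linear_sum linear_cmul)
  finally show "(\<Sum>b\<in>Basis. f b * coord_monomial (restrict (\<lambda>a. if a = b then 1 else 0) Basis) x) = f x"
   by (simp add: mon mult.commute)
 qed
 ultimately show ?case by auto
next
 case (const c)
 then show ?case using box_poly_cmult[OF box_poly_one, of c] by auto
next
 case (add f g)
 then obtain D E where "box_poly D f" "box_poly E g" by blast
 then have "box_poly (max D E) f" "box_poly (max D E) g" using box_poly_mono by (metis max.cobounded1 max.cobounded2)+
 then show ?case using box_poly_add by blast
next
 case (mult f g)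
 then show ?case using box_poly_mult by blast
qed

text \<open>The monomials in \<open>g 0, \<dots>, g (k - 1)\<close> with exponents below \<open>B\<close>, enumerated by the number whose
 digits to the base \<open>B\<close> are the exponents.\<close>

primrec digit_monomial :: "(nat \<Rightarrow> 'a \<Rightarrow> real) \<Rightarrow> nat \<Rightarrow> nat \<Rightarrow> nat \<Rightarrow> 'a \<Rightarrow> real" where
 "digit_monomial g B 0 n x = 1"
| "digit_monomial g B (Suc k) n x = g k x ^ (n div B ^ k) * digit_monomial g B k (n mod B ^ k) x"

lemma box_poly_digit_monomial:
 assumes "\<And>i. i < k \<Longrightarrow> box_poly D (g i)" "n < Suc N ^ k"
 shows "box_poly (k * (N * D)) (digit_monomial g (Suc N) k n)"
 using assms
proof (induction k arbitrary: n)
 case 0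
 have "digit_monomial g (Suc N) 0 n = (\<lambda>x. 1)" by (rule ext) simp
 then show ?case using box_poly_one by simp
next
 case (Suc k)
 have "n div Suc N ^ k < Suc N" using Suc.prems(2) by (simp add: less_mult_imp_div_less)
 then have "n div Suc N ^ k * D \<le> N * D" by (intro mult_right_mono) linarith+
 then have "box_poly (N * D) (\<lambda>x. g k x ^ (n div Suc N ^ k))"
  using box_poly_mono box_poly_power[of D "g k" "n div Suc N ^ k"] Suc.prems(1)[of k] by blast
 moreover have "box_poly (k * (N * D)) (digit_monomial g (Suc N) k (n mod Suc N ^ k))"
  using Suc by simp
 ultimately have "box_poly (N * D + k * (N * D))
   (\<lambda>x. g k x ^ (n div Suc N ^ k) * digit_monomial g (Suc N) k (n mod Suc N ^ k) x)"
  by (rule box_poly_mult)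
 moreover have "digit_monomial g (Suc N) (Suc k) n =
   (\<lambda>x. g k x ^ (n div Suc N ^ k) * digit_monomial g (Suc N) k (n mod Suc N ^ k) x)" by (rule ext) simp
 ultimately show ?case by simp
qed

lemma real_polynomial_digit_monomial:
 fixes g :: "nat \<Rightarrow> 'a::real_normed_vector \<Rightarrow> real"
 assumes "\<And>i. i < k \<Longrightarrow> real_poly (g i)"
 shows "real_poly (digit_monomial g B k n)"
 using assms
proof (induction k arbitrary: n)
 case 0
 have "digit_monomial g B 0 n = (\<lambda>x. 1)" by (rule ext) simp
 then show ?case by (simp add: real_polynomial_function.intros(2))
next
 case (Suc k)
 have "real_poly (\<lambda>x. g k x ^ (n div B ^ k) * digit_monomial g B k (n mod B ^ k) x)"
  using Suc by (intro real_polynomial_function.intros(4) real_polynomial_function_power) auto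
 moreover have "digit_monomial g B (Suc k) n =
   (\<lambda>x. g k x ^ (n div B ^ k) * digit_monomial g B k (n mod B ^ k) x)" by (rule ext) simp
 ultimately show ?case by simp
qed

text \<open>If each \<open>g i\<close> vanishes on the \<open>i\<close>-th member of the chain but not on the next one, the \<open>g i\<close> are
 algebraically independent: in a relation on the top member, divide out the largest possible power
 of the last \<open>g i\<close>, which is allowed by irreducibility, and restrict to the member below.\<close>

lemma digit_monomials_independent:
 fixes g :: "nat \<Rightarrow> 'a::euclidean_space \<Rightarrow> real"
 assumes C: "irr_chain zariski_affine k C" and g: "\<And>i. i < k \<Longrightarrow> real_poly (g i)"
  and zero: "\<And>i x. i < k \<Longrightarrow> x \<in> C i \<Longrightarrow> g i x = 0"
  and nz: "\<And>i. i < k \<Longrightarrow> \<exists>x\<in>C (Suc i). g i x \<noteq> 0"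
  and rel: "\<And>x. x \<in> C k \<Longrightarrow> (\<Sum>n<B ^ k. y n * digit_monomial g B k n x) = 0"
  and n: "n < B ^ k"
 shows "y n = 0"
 using assms
proof (induction k arbitrary: y n)
 case 0
 obtain x where "x \<in> C 0" using irreducible_in_nonempty[OF irr_chain_irreducible[OF 0(1)]] by auto
 then show ?case using 0 by force
next
 case (Suc k)
 have Ck: "irr_chain zariski_affine k C" using Suc.prems(1) by (auto simp: irr_chain_def)
 define K where "K = B ^ k"
 define S where "S j x = (\<Sum>r<K. y (j * K + r) * digit_monomial g B k r x)" for j x
 have group: "(\<Sum>n<B ^ Suc k. y n * digit_monomial g B (Suc k) n x) = (\<Sum>j<B. g k x ^ j * S j x)" for x
 proof -
  have "(\<Sum>n<B ^ Suc k. y n * digit_monomial g B (Suc k) n x)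
    = (\<Sum>j<B. \<Sum>n=j*K..<j*K+K. y n * digit_monomial g B (Suc k) n x)"
   by (simp add: sum.nat_group K_def)
  also have "\<dots> = (\<Sum>j<B. g k x ^ j * S j x)"
  proof (rule sum.cong[OF refl])
   fix j
   have qr: "n div K = j \<and> n mod K = n - j * K" if "j * K \<le> n" "n < j * K + K" for n
   proof -
    have "n div K = j" using that by (intro div_nat_eqI) (auto simp: mult.commute)
    then show ?thesis using minus_div_mult_eq_mod[of n K] by simp
   qed
   have "(\<Sum>n=j*K..<j*K+K. y n * digit_monomial g B (Suc k) n x)
    = (\<Sum>r<K. y (j * K + r) * (g k x ^ j * digit_monomial g B k r x))"
    by (rule sum.reindex_bij_witness[of _ "\<lambda>r. j * K + r" "\<lambda>n. n - j * K"])
      (auto simp: K_def[symmetric] qr)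
   then show "(\<Sum>n=j*K..<j*K+K. y n * digit_monomial g B (Suc k) n x) = g k x ^ j * S j x"
    by (simp add: S_def sum_distrib_left mult.left_commute)
  qed
  finally show ?thesis .
 qed
 have polyS: "real_poly (S j)" for j
  unfolding S_def[abs_def] using Suc.prems(2)
  by (intro real_polynomial_function_sum real_polynomial_function.intros(4) real_polynomial_function.intros(2)
    real_polynomial_digit_monomial) auto
 show ?case
 proof (rule ccontr)
  assume yn: "y n \<noteq> 0"
  define Q where "Q j \<longleftrightarrow> (\<exists>r<K. y (j * K + r) \<noteq> 0)" for j
  define j0 where "j0 = (LEAST j. Q j)"
  have K0: "K > 0" using Suc.prems(6) by (cases "B = 0") (auto simp: K_def)
  have "n div K < B" using Suc.prems(6) by (simp add: K_def less_mult_imp_div_less)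
  moreover have Qn: "Q (n div K)"
   unfolding Q_def using yn K0 by (intro exI[of _ "n mod K"]) simp
  ultimately have j0: "j0 < B" "Q j0" unfolding j0_def by (meson LeastI Least_le le_less_trans)+
  have S0: "S j x = 0" if "j < j0" for j x
   using not_less_Least[of j Q] that by (auto simp: j0_def S_def Q_def)
  define h where "h x = (\<Sum>j=j0..<B. g k x ^ (j - j0) * S j x)" for x
  have fac: "(\<Sum>j<B. g k x ^ j * S j x) = g k x ^ j0 * h x" for x
  proof -
   have "(\<Sum>j<B. g k x ^ j * S j x) = (\<Sum>j=j0..<B. g k x ^ j * S j x)"
    using S0 by (intro sum.mono_neutral_right) auto
   also have "\<dots> = (\<Sum>j=j0..<B. g k x ^ j0 * (g k x ^ (j - j0) * S j x))"
    by (intro sum.cong refl) (simp add: power_add[symmetric] mult.assoc[symmetric])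
   finally show ?thesis by (simp add: h_def sum_distrib_left)
  qed
  have "real_poly h"
   unfolding h_def[abs_def] using polyS Suc.prems(2)
   by (intro real_polynomial_function_sum real_polynomial_function.intros(4) real_polynomial_function_power) auto
  then have "closedin zariski_affine {x. h x = 0}" by (rule closedin_zariski_affine_zero)
  moreover have "closedin zariski_affine {x. g k x = 0}"
   using Suc.prems(2) by (intro closedin_zariski_affine_zero) auto
  moreover have "C (Suc k) \<subseteq> {x. g k x = 0} \<union> {x. h x = 0}"
  proof
   fix x assume "x \<in> C (Suc k)"
   then have "g k x ^ j0 * h x = 0" using Suc.prems(5)[of x] group fac by simp
   then show "x \<in> {x. g k x = 0} \<union> {x. h x = 0}" by auto
  qed
  ultimately have "C (Suc k) \<subseteq> {x. h x = 0}"
   using irreducible_in_closedD[OF irr_chain_irreducible[OF Suc.prems(1) order_refl]] Suc.prems(4)[of k]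
   by blast
  then have hz: "h x = 0" if "x \<in> C k" for x
   using that Suc.prems(1) by (auto simp: irr_chain_def)
  have "S j0 x = 0" if x: "x \<in> C k" for x
  proof -
   have "h x = (\<Sum>j=j0..<B. if j = j0 then S j0 x else 0)"
    unfolding h_def using Suc.prems(3)[of k x] x by (intro sum.cong) (auto simp: power_0_left)
   then show ?thesis using hz[OF x] j0 by simp
  qed
  then have "y (j0 * K + r) = 0" if "r < K" for r
   using Suc.IH[OF Ck, of "\<lambda>r. y (j0 * K + r)" r] Suc.prems that by (auto simp: S_def K_def)
  then show False using j0 by (auto simp: Q_def)
 qed
qed

theorem irr_chain_zariski_affine:
 fixes C :: "nat \<Rightarrow> 'a::euclidean_space set"
 assumes C: "irr_chain zariski_affine k C" shows "k \<le> DIM('a)"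
proof (rule ccontr)
 assume k: "\<not> k \<le> DIM('a)"
 let ?m = "DIM('a)"
 have "\<exists>g. real_poly g \<and> (\<forall>x\<in>C i. g x = 0) \<and> (\<exists>x\<in>C (Suc i). g x \<noteq> 0)" if i: "i < k" for i
 proof -
  have "C i \<subset> C (Suc i)" using C i by (simp add: irr_chain_def)
  then obtain x where "x \<in> C (Suc i)" "x \<notin> C i" by blast
  moreover have "closedin zariski_affine (C i)" using C i by (simp add: irr_chain_def)
  ultimately show ?thesis by (elim closedin_zariski_affineE[of _ x]) blast+
 qed
 then obtain g where g: "\<And>i. i < k \<Longrightarrow> real_poly (g i)"
  "\<And>i x. i < k \<Longrightarrow> x \<in> C i \<Longrightarrow> g i x = 0" "\<And>i. i < k \<Longrightarrow> \<exists>x\<in>C (Suc i). g i x \<noteq> 0"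
  by metis
 have "\<forall>i. \<exists>D. i < k \<longrightarrow> box_poly D (g i)" using g real_polynomial_function_box_poly by blast
 then obtain D where D: "\<And>i. i < k \<Longrightarrow> box_poly (D i) (g i)" by metis
 define d where "d = (\<Sum>i<k. D i)"
 have d: "box_poly d (g i)" if "i < k" for i
  using that member_le_sum[of i "{..<k}" D] by (intro box_poly_mono[OF D[OF that]]) (simp add: d_def)
 \<comment> \<open>With \<open>N\<close> large there are more monomials in the \<open>k > m\<close> functions than in the \<open>m\<close> coordinates.\<close>
 define N where "N = Suc (k * d) ^ ?m"
 let ?B = "Suc N"
 let ?E = "k * (N * d)"
 have "card (exponent_box ?E :: ('a \<Rightarrow> nat) set) = Suc ?E ^ ?m" by (simp add: card_PiE)
 also have "\<dots> \<le> (Suc (k * d) * ?B) ^ ?m"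
  by (intro power_mono) (auto simp: algebra_simps)
 also have "\<dots> = N * ?B ^ ?m" by (simp only: power_mult_distrib N_def[symmetric])
 also have "\<dots> < ?B * ?B ^ ?m" by (intro mult_strict_right_mono) auto
 also have "\<dots> \<le> ?B ^ k" using power_increasing[of "Suc ?m" k ?B] k by simp
 finally have card: "card (exponent_box ?E :: ('a \<Rightarrow> nat) set) < card {..<?B ^ k}" by simp
 have "\<forall>n. \<exists>c. n < ?B ^ k \<longrightarrow> (\<forall>x. digit_monomial g ?B k n x =
   (\<Sum>e\<in>exponent_box ?E. c e * coord_monomial e x))"
  using box_poly_digit_monomial[of k d g, OF d] unfolding box_poly_def by blast
 then obtain c where c: "\<And>n x. n < ?B ^ k \<Longrightarrow> digit_monomial g ?B k n x =
   (\<Sum>e\<in>exponent_box ?E. c n e * coord_monomial e x)" by metis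
 obtain y where y: "\<exists>n\<in>{..<?B ^ k}. y n \<noteq> 0"
  "\<forall>e\<in>exponent_box ?E. (\<Sum>n<?B ^ k. y n * c n e) = 0"
  using homogeneous_system_solution[OF finite_exponent_box finite_lessThan card, of c] by blast
 have "(\<Sum>n<?B ^ k. y n * digit_monomial g ?B k n x) = 0" for x
 proof -
  have "(\<Sum>n<?B ^ k. y n * digit_monomial g ?B k n x)
   = (\<Sum>n<?B ^ k. \<Sum>e\<in>exponent_box ?E. y n * c n e * coord_monomial e x)"
   by (intro sum.cong) (auto simp: c sum_distrib_left mult.assoc)
  also have "\<dots> = (\<Sum>e\<in>exponent_box ?E. (\<Sum>n<?B ^ k. y n * c n e) * coord_monomial e x)"
   by (subst sum.swap) (simp add: sum_distrib_right)
  finally show ?thesis using y(2) by simp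
 qed
 then show False using digit_monomials_independent[OF C g] y(1) by blast
qed

section \<open>The projective plane\<close>

lemma rp2_rel: "x \<noteq> 0 \<and> y \<noteq> 0 \<and> (\<exists>c. y = c *\<^sub>R x) \<longleftrightarrow> x \<noteq> 0 \<and> y \<noteq> 0 \<and> abs_rp2 x = abs_rp2 y"
proof -
 have "(\<exists>c. x = c *\<^sub>R x)" for x :: "real^3" by (rule exI[of _ 1]) simp
 then show ?thesis using Quotient3_rel[OF Quotient3_rp2, of x y] by blast
qed

lemma rep_rp2_nonzero [simp]: "rep_rp2 p \<noteq> 0"
 using Quotient3_rep_reflp[OF Quotient3_rp2, of p] by blast

lemma abs_rep_rp2 [simp]: "abs_rp2 (rep_rp2 p) = p"
 by (rule Quotient3_abs_rep[OF Quotient3_rp2])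

lemma abs_rp2_eq_iff: "x \<noteq> 0 \<Longrightarrow> y \<noteq> 0 \<Longrightarrow> abs_rp2 x = abs_rp2 y \<longleftrightarrow> (\<exists>c. y = c *\<^sub>R x)"
 using rp2_rel[of x y] by blast

lemma abs_rp2_scale [simp]:
 assumes "c \<noteq> 0" shows "abs_rp2 (c *\<^sub>R x) = abs_rp2 x"
proof (cases "x = 0")
 case False
 then have "abs_rp2 x = abs_rp2 (c *\<^sub>R x)" using assms by (subst abs_rp2_eq_iff) auto
 then show ?thesis ..
qed simp

lemma rep_abs_rp2:
 assumes "x \<noteq> 0" obtains c where "c \<noteq> 0" "rep_rp2 (abs_rp2 x) = c *\<^sub>R x"
proof -
 have "abs_rp2 x = abs_rp2 (rep_rp2 (abs_rp2 x))" by simp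
 then obtain c where "rep_rp2 (abs_rp2 x) = c *\<^sub>R x" using abs_rp2_eq_iff[of x "rep_rp2 (abs_rp2 x)"] assms by auto
 moreover have "c \<noteq> 0"
 proof
  assume "c = 0"
  then show False using calculation rep_rp2_nonzero[of "abs_rp2 x"] by simp
 qed
 ultimately show ?thesis using that by blast
qed

lemma matrix_vector_mult_eq_0_invertible:
 fixes g :: "real^'n^'n" assumes "invertible g" shows "g *v x = 0 \<longleftrightarrow> x = 0"
 using assms by (metis matrix_left_invertible_ker invertible_left_inverse matrix_vector_mult_0_right)

lemma rp2_map_abs:
 assumes "invertible g" "x \<noteq> 0" shows "rp2_map g (abs_rp2 x) = abs_rp2 (g *v x)"
proof -
 obtain c where "c \<noteq> 0" "rep_rp2 (abs_rp2 x) = c *\<^sub>R x" using rep_abs_rp2[OF assms(2)] .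
 then show ?thesis by (simp add: rp2_map_def matrix_vector_mult_scaleR)
qed

lemma rp2_map_mult:
 assumes "invertible g" "invertible h" shows "rp2_map (g ** h) p = rp2_map g (rp2_map h p)"
proof -
 have "h *v rep_rp2 p \<noteq> 0" using matrix_vector_mult_eq_0_invertible[OF assms(2)] by simp
 then show ?thesis
  using assms by (simp add: rp2_map_def[of h] rp2_map_def[of "g ** h"] rp2_map_abs matrix_vector_mul_assoc)
qed

lemma rp2_map_one [simp]: "rp2_map (mat 1) p = p"
 by (simp add: rp2_map_def)

lemma rp2_map_scale: "c \<noteq> 0 \<Longrightarrow> rp2_map (c *\<^sub>R g) p = rp2_map g p"
 by (simp add: rp2_map_def scaleR_matrix_vector_assoc[symmetric])

section \<open>The Zariski topology of a product of projective planes\<close>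

definition mh_deg :: "('i::finite \<Rightarrow> nat) \<Rightarrow> ((real^3)^'i \<Rightarrow> real) \<Rightarrow> bool" where
 "mh_deg d f \<longleftrightarrow> (\<forall>t x. f (\<chi> i. t i *\<^sub>R x $ i) = (\<Prod>i\<in>UNIV. t i ^ d i) * f x)"

lemma multihomogeneousI: "mh_deg d f \<Longrightarrow> multihomogeneous f"
 unfolding multihomogeneous_def mh_deg_def by blast

lemma mh_deg_const: "mh_deg (\<lambda>_. 0) (\<lambda>x. c)"
 by (simp add: mh_deg_def)

lemma prod_delta_power: "(\<Prod>j\<in>UNIV. (t (j::'i::finite) :: real) ^ (if j = i then 1 else 0)) = t i"
proof -
 have "(\<Prod>j\<in>UNIV. t j ^ (if j = i then 1 else 0)) = (\<Prod>j\<in>UNIV. if j = i then t j else 1)"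
  by (intro prod.cong) auto
 then show ?thesis by simp
qed

lemma mh_deg_linear: "linear l \<Longrightarrow> mh_deg (\<lambda>j. if j = i then 1 else 0) (\<lambda>x. l (x $ i))"
 unfolding mh_deg_def by (simp add: prod_delta_power linear_cmul del: power_0 power_one_right)

lemma mh_deg_inner: "mh_deg (\<lambda>j. if j = i then 1 else 0) (\<lambda>x. l \<bullet> (x $ i))"
 by (rule mh_deg_linear) (simp add: bounded_linear.linear bounded_linear_inner_right)

lemma mh_zero_iff:
 assumes f: "multihomogeneous f" and F: "\<And>i. F i \<noteq> 0"
 shows "f (\<chi> i. rep_rp2 (abs_rp2 (F i))) = 0 \<longleftrightarrow> f (\<chi> i. F i) = 0"
proof -
 have "\<forall>i. \<exists>c. c \<noteq> 0 \<and> rep_rp2 (abs_rp2 (F i)) = c *\<^sub>R F i" using F rep_abs_rp2 by metis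
 then obtain c where c: "\<And>i. c i \<noteq> 0" "\<And>i. rep_rp2 (abs_rp2 (F i)) = c i *\<^sub>R F i" by metis
 obtain d where d: "\<And>t x. f (\<chi> i. t i *\<^sub>R x $ i) = (\<Prod>i\<in>UNIV. t i ^ d i) * f x"
  using f unfolding multihomogeneous_def by blast
 have "f (\<chi> i. rep_rp2 (abs_rp2 (F i))) = (\<Prod>i\<in>UNIV. c i ^ d i) * f (\<chi> i. F i)"
  using d[of c "\<chi> i. F i"] by (simp add: c)
 then show ?thesis using c(1) by simp
qed

lemma topspace_zariski [simp]: "topspace (zariski :: ('i::finite \<Rightarrow> rp2) topology) = UNIV"
proof -
 have "multihomogeneous (\<lambda>x::(real^3)^'i. 1)" by (rule multihomogeneousI[OF mh_deg_const])
 then have "UNIV \<in> {{p::'i \<Rightarrow> rp2. f (\<chi> i. rep_rp2 (p i)) \<noteq> 0} | f. real_poly f \<and> multihomogeneous f}"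
  by (intro CollectI exI[of _ "\<lambda>x. 1"]) auto
 then show ?thesis unfolding zariski_def topology_generated_by_topspace by blast
qed

lemma openin_zariski_nonzero:
 "real_poly f \<Longrightarrow> multihomogeneous f \<Longrightarrow> openin zariski {p. f (\<chi> i. rep_rp2 (p i)) \<noteq> 0}"
 unfolding zariski_def by (rule topology_generated_by_Basis) auto

lemma closedin_zariski_zero:
 assumes "real_poly f" "multihomogeneous f"
 shows "closedin zariski {p. f (\<chi> i. rep_rp2 (p i)) = 0}"
proof -
 have "UNIV - {p. f (\<chi> i. rep_rp2 (p i)) = 0} = {p. f (\<chi> i. rep_rp2 (p i)) \<noteq> 0}" by blast
 then show ?thesis using openin_zariski_nonzero[OF assms] by (simp add: closedin_def)
qed

lemma polynomial_component_vec [intro]: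
 "poly_map F \<Longrightarrow> real_poly (\<lambda>u. F u $ k)"
 for F :: "'a::real_normed_vector \<Rightarrow> real^'n::finite"
 using polynomial_function_def bounded_linear_vec_nth by (auto simp: o_def)

lemma polynomial_vecI:
 fixes F :: "'a::euclidean_space \<Rightarrow> 'b::euclidean_space^'n::finite"
 assumes "\<And>i. poly_map (\<lambda>u. F u $ i)" shows "poly_map F"
 unfolding polynomial_function_iff_Basis_inner
proof
 fix b :: "'b^'n" assume "b \<in> Basis"
 then obtain i c where "b = axis i c" by (auto simp: Basis_vec_def)
 then show "real_poly (\<lambda>x. F x \<bullet> b)"
  using assms[of i] by (simp add: inner_axis real_polynomial_function_component)
qed

lemma continuous_map_into_zariski:
 fixes h :: "'x \<Rightarrow> 'i::finite \<Rightarrow> rp2"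
 assumes "\<And>f. real_poly f \<Longrightarrow> multihomogeneous f \<Longrightarrow>
   openin X {x \<in> topspace X. f (\<chi> i. rep_rp2 (h x i)) \<noteq> 0}"
 shows "continuous_map X zariski h"
proof -
 have A: "openin X (h -` U \<inter> topspace X)"
  if U: "U \<in> {{p. f (\<chi> i. rep_rp2 (p i)) \<noteq> 0} | f. real_poly f \<and> multihomogeneous f}" for U
 proof -
  obtain f where f: "real_poly f" "multihomogeneous f" "U = {p. f (\<chi> i. rep_rp2 (p i)) \<noteq> 0}"
   using U by auto
  have "h -` U \<inter> topspace X = {x \<in> topspace X. f (\<chi> i. rep_rp2 (h x i)) \<noteq> 0}" using f(3) by auto
  then show ?thesis using assms[OF f(1,2)] by simp
 qed
 have eq: "\<Union> {{p :: 'i \<Rightarrow> rp2. f (\<chi> i. rep_rp2 (p i)) \<noteq> 0} | f. real_poly f \<and> multihomogeneous f} = UNIV"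
  using topspace_zariski unfolding zariski_def topology_generated_by_topspace .
 have B: "h ` topspace X \<subseteq> \<Union> {{p. f (\<chi> i. rep_rp2 (p i)) \<noteq> 0} | f. real_poly f \<and> multihomogeneous f}"
  unfolding eq by (rule subset_UNIV)
 show ?thesis
  unfolding zariski_def continuous_on_generated_topo_iff
  by (intro conjI allI impI, erule A, rule B)
qed

lemma continuous_map_abs_polynomial:
 fixes F :: "'i::finite \<Rightarrow> 'a::euclidean_space \<Rightarrow> real^3"
 assumes poly: "\<And>i. poly_map (F i)" and nz: "\<And>u i. u \<in> U \<Longrightarrow> F i u \<noteq> 0"
 shows "continuous_map (subtopology zariski_affine U) zariski (\<lambda>u i. abs_rp2 (F i u))"
proof (rule continuous_map_into_zariski)
 fix f :: "(real^3)^'i \<Rightarrow> real" assume f: "real_poly f" "multihomogeneous f"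
 have "poly_map (\<lambda>u. \<chi> i. F i u)" by (rule polynomial_vecI) (simp add: poly)
 then have "real_poly (f \<circ> (\<lambda>u. \<chi> i. F i u))" using f(1) by (rule real_polynomial_function_compose)
 then have "openin zariski_affine {u. (f \<circ> (\<lambda>u. \<chi> i. F i u)) u \<noteq> 0}" by (rule openin_zariski_affine_nonzero)
 moreover have "{u \<in> U. f (\<chi> i. rep_rp2 (abs_rp2 (F i u))) \<noteq> 0} = {u. (f \<circ> (\<lambda>u. \<chi> i. F i u)) u \<noteq> 0} \<inter> U"
  using mh_zero_iff[OF f(2)] nz by auto
 ultimately show "openin (subtopology zariski_affine U)
   {x \<in> topspace (subtopology zariski_affine U). f (\<chi> i. rep_rp2 (abs_rp2 (F i x))) \<noteq> 0}"
  by (auto simp: openin_subtopology)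
qed

lemma continuous_map_rp2_maps:
 assumes g: "\<And>i::'i::finite. invertible (g i)"
 shows "continuous_map zariski zariski (\<lambda>x i. rp2_map (g i) (x i))"
proof (rule continuous_map_into_zariski)
 fix f :: "(real^3)^'i \<Rightarrow> real" assume f: "real_poly f" "multihomogeneous f"
 let ?G = "\<lambda>y :: (real^3)^'i. \<chi> i. g i *v (y $ i)"
 have lin: "bounded_linear (\<lambda>y :: (real^3)^'i. g i *v (y $ i))" for i
  using bounded_linear_compose[OF matrix_vector_mul_bounded_linear bounded_linear_vec_nth] .
 have "poly_map ?G"
  by (rule polynomial_vecI) (simp add: polynomial_function_bounded_linear[OF lin])
 then have "real_poly (f \<circ> ?G)" using f(1) by (rule real_polynomial_function_compose)
 moreover obtain d where d: "\<And>t x. f (\<chi> i. t i *\<^sub>R x $ i) = (\<Prod>i\<in>UNIV. t i ^ d i) * f x"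
  using f(2) unfolding multihomogeneous_def by blast
 have "(f \<circ> ?G) (\<chi> i. t i *\<^sub>R x $ i) = (\<Prod>i\<in>UNIV. t i ^ d i) * (f \<circ> ?G) x" for t x
  using d[of t "?G x"] by (simp add: matrix_vector_mult_scaleR)
 then have "multihomogeneous (f \<circ> ?G)" unfolding multihomogeneous_def by blast
 ultimately have "openin zariski {p. (f \<circ> ?G) (\<chi> i. rep_rp2 (p i)) \<noteq> 0}" by (intro openin_zariski_nonzero)
 moreover have "f (\<chi> i. rep_rp2 (rp2_map (g i) (p i))) = 0 \<longleftrightarrow> (f \<circ> ?G) (\<chi> i. rep_rp2 (p i)) = 0" for p
  unfolding rp2_map_def using matrix_vector_mult_eq_0_invertible[OF g]
  by (subst mh_zero_iff[OF f(2)]) auto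
 ultimately show "openin zariski {x \<in> topspace zariski. f (\<chi> i. rep_rp2 (rp2_map (g i) (x i))) \<noteq> 0}"
  by simp
qed

text \<open>Quotients of multihomogeneous polynomials of the same degree are well defined and continuous.\<close>

lemma continuous_map_rational:
 fixes N :: "(real^3)^'i::finite \<Rightarrow> 'e::euclidean_space"
 assumes N: "poly_map N" and D: "real_poly D"
  and hN: "\<And>t y. N (\<chi> i. t i *\<^sub>R y $ i) = (\<Prod>i\<in>UNIV. t i ^ d i) *\<^sub>R N y"
  and hD: "mh_deg d D" and S: "\<And>p. p \<in> S \<Longrightarrow> D (\<chi> i. rep_rp2 (p i)) \<noteq> 0"
 shows "continuous_map (subtopology zariski S) zariski_affine
   (\<lambda>p. (1 / D (\<chi> i. rep_rp2 (p i))) *\<^sub>R N (\<chi> i. rep_rp2 (p i)))" (is "continuous_map _ _ ?h")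
proof (rule continuous_map_into_zariski_affine)
 fix f :: "'e \<Rightarrow> real" assume f: "real_poly f"
 obtain k G where G: "real_poly G"
  "\<forall>t y. G (\<chi> i. t i *\<^sub>R y $ i) = (\<Prod>i\<in>UNIV. t i ^ d i) ^ k * G y"
  "\<forall>y. D y \<noteq> 0 \<longrightarrow> G y = D y ^ k * f ((1 / D y) *\<^sub>R N y)"
  using clear_denominators[OF f N D, of "\<lambda>t y. \<chi> i. t i *\<^sub>R y $ i" "\<lambda>t. \<Prod>i\<in>UNIV. t i ^ d i"] hN hD
  unfolding mh_deg_def by blast
 have "mh_deg (\<lambda>i. k * d i) G"
  using G(2) by (simp add: mh_deg_def prod_power_distrib power_mult[symmetric] mult.commute)
 then have "openin zariski {p. G (\<chi> i. rep_rp2 (p i)) \<noteq> 0}"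
  using G multihomogeneousI by (intro openin_zariski_nonzero) auto
 moreover have "{p \<in> S. f (?h p) \<noteq> 0} = {p. G (\<chi> i. rep_rp2 (p i)) \<noteq> 0} \<inter> S" using G(3) S by auto
 ultimately show "openin (subtopology zariski S) {x \<in> topspace (subtopology zariski S). f (?h x) \<noteq> 0}"
  by (auto simp: openin_subtopology)
qed

lemma real_polynomial_inner_nth [intro]: "real_poly (\<lambda>y :: (real^3)^'i::finite. l \<bullet> (y $ i))"
 by (intro real_polynomial_function.intros(1) bounded_linear_compose[OF bounded_linear_inner_right]
   bounded_linear_vec_nth)

lemma closedin_zariski_line: "closedin zariski {p. l \<bullet> rep_rp2 (p i) = 0}"
 using closedin_zariski_zero[OF real_polynomial_inner_nth[of l i] multihomogeneousI[OF mh_deg_inner]] by simp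

section \<open>Reflections of a nondegenerate form\<close>

lemma outer_mult_vec: "outer x y *v z = (y \<bullet> z) *\<^sub>R x"
 by (simp add: outer_def vec_eq_iff matrix_vector_mult_def inner_vec_def sum_distrib_left mult_ac)

lemma cross3_orthogonal_span:
 assumes x: "x \<bullet> a = 0" "x \<bullet> b = 0" and ne: "cross3 a b \<noteq> 0"
 obtains c where "x = c *\<^sub>R cross3 a b"
proof -
 have "cross3 x (cross3 a b) = 0" using x by (simp add: Lagrange)
 then have "cross3 (cross3 a b) x = 0" by (metis cross_skew neg_equal_0_iff_equal)
 then have "collinear {0, cross3 a b, x}" by (simp add: cross_eq_0)
 then have "\<exists>c. x = c *\<^sub>R cross3 a b" using ne by (auto simp: collinear_lemma)
 then show ?thesis using that by blast
qed

locale form =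
 fixes Q :: "real^3^3"
 assumes nondegenerate: "nondegenerate_form Q"
begin

definition p :: "real^3 \<Rightarrow> real^3 \<Rightarrow> real" where "p x y = x \<bullet> (Q *v y)"

lemma p_commute: "p x y = p y x"
 using nondegenerate unfolding nondegenerate_form_def p_def
 by (metis dot_lmul_matrix inner_commute transpose_matrix_vector)

lemma p_linear [simp]:
 "p (x + y) z = p x z + p y z" "p (x - y) z = p x z - p y z" "p (c *\<^sub>R x) z = c * p x z" "p (- x) z = - p x z"
 "p z (x + y) = p z x + p z y" "p z (x - y) = p z x - p z y" "p z (c *\<^sub>R x) = c * p z x" "p z (- x) = - p z x"
 "p 0 z = 0" "p z 0 = 0"
proof -
 show "p (- x) z = - p x z" "p z (- x) = - p z x"
  unfolding p_def using matrix_vector_mult_scaleR[of Q "-1" x] by simp_all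
qed (simp_all add: p_def inner_add_left inner_diff_left inner_add_right inner_diff_right
  matrix_vector_right_distrib matrix_vector_mult_diff_distrib matrix_vector_mult_scaleR)

lemma invertible_Q: "invertible Q"
 using nondegenerate by (simp add: nondegenerate_form_def invertible_det_nz)

lemma Q_eq_0 [simp]: "Q *v x = 0 \<longleftrightarrow> x = 0"
 by (rule matrix_vector_mult_eq_0_invertible[OF invertible_Q])

lemma p_nondegenerate: "(\<And>y. p x y = 0) \<Longrightarrow> x = 0"
proof -
 assume "\<And>y. p x y = 0"
 then have "p (Q *v x) x = 0" by (metis p_commute)
 then show "x = 0" by (simp add: p_def)
qed

lemma p_polynomial [intro]:
 assumes "poly_map f" "poly_map g"
 shows "real_poly (\<lambda>u. p (f u) (g u))"
proof -
 have "real_poly (\<lambda>u. f u \<bullet> b)" if "b \<in> Basis" for b using assms by auto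
 moreover have "poly_map (\<lambda>u. Q *v g u)"
  using polynomial_function_compose[OF assms(2) polynomial_function_bounded_linear[OF matrix_vector_mul_bounded_linear]]
  by (simp add: o_def)
 then have "real_poly (\<lambda>u. (Q *v g u) \<bullet> b)" for b by auto
 ultimately have "real_poly (\<lambda>u. \<Sum>b\<in>Basis. (f u \<bullet> b) * ((Q *v g u) \<bullet> b))"
  by (intro real_polynomial_function_sum real_polynomial_function.intros(4)) auto
 moreover have "p (f u) (g u) = (\<Sum>b\<in>Basis. (f u \<bullet> b) * ((Q *v g u) \<bullet> b))" for u
  unfolding p_def by (rule euclidean_inner)
 ultimately show ?thesis by simp
qed

abbreviation R where "R \<equiv> form_reflection Q"

lemma R_apply: "R n *v x = x - (2 * p n x / p n n) *\<^sub>R n"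
proof -
 have "R n *v x = x - (2 / p n n) *\<^sub>R ((outer n n ** Q) *v x)"
  unfolding form_reflection_def p_def
  by (simp add: matrix_vector_mult_diff_rdistrib scaleR_matrix_vector_assoc)
 then show ?thesis by (simp add: matrix_vector_mul_assoc[symmetric] outer_mult_vec p_def)
qed

definition aniso :: "real^3 \<Rightarrow> bool" where "aniso n \<longleftrightarrow> p n n \<noteq> 0"

lemma R_fixes: "p n x = 0 \<Longrightarrow> R n *v x = x"
 by (simp add: R_apply)

lemma R_self: "aniso n \<Longrightarrow> R n *v n = - n"
 by (simp add: R_apply aniso_def scaleR_2)

lemma R_involution: "aniso n \<Longrightarrow> R n *v (R n *v x) = x"
 by (simp add: R_apply aniso_def field_simps scaleR_left_distrib[symmetric])

lemma R_involution_matrix: "aniso n \<Longrightarrow> R n ** R n = mat 1"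
 by (simp add: matrix_eq R_involution matrix_vector_mul_assoc[symmetric])

lemma R_isometry: "aniso n \<Longrightarrow> p (R n *v x) (R n *v y) = p x y"
 unfolding R_apply aniso_def by (simp add: field_simps p_commute[of x n])

lemma orthogonal_group_iff: "g \<in> orthogonal_group Q \<longleftrightarrow> (\<forall>x y. p (g *v x) (g *v y) = p x y)"
proof -
 have *: "p (g *v x) (g *v y) = x \<bullet> ((transpose g ** Q ** g) *v y)" for x y
  by (simp add: p_def matrix_vector_mul_assoc[symmetric] dot_lmul_matrix[symmetric] vector_transpose_matrix
    del: transpose_matrix_vector)
 show ?thesis
 proof
  assume "g \<in> orthogonal_group Q"
  then show "\<forall>x y. p (g *v x) (g *v y) = p x y" unfolding * by (simp add: orthogonal_group_def p_def)
 next
  assume h: "\<forall>x y. p (g *v x) (g *v y) = p x y"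
  have "(transpose g ** Q ** g) *v y = Q *v y" for y
  proof -
   have "\<forall>x. x \<bullet> ((transpose g ** Q ** g) *v y) = x \<bullet> (Q *v y)"
    using h unfolding * by (simp add: p_def)
   then show ?thesis unfolding vector_eq_ldot .
  qed
  then show "g \<in> orthogonal_group Q" by (simp add: orthogonal_group_def matrix_eq)
 qed
qed

lemma orthogonal_groupD: "g \<in> orthogonal_group Q \<Longrightarrow> p (g *v x) (g *v y) = p x y"
 by (simp add: orthogonal_group_iff)

lemma orthogonal_group_mult:
 "g \<in> orthogonal_group Q \<Longrightarrow> h \<in> orthogonal_group Q \<Longrightarrow> g ** h \<in> orthogonal_group Q"
 by (simp add: orthogonal_group_iff matrix_vector_mul_assoc[symmetric])

lemma orthogonal_group_one: "mat 1 \<in> orthogonal_group Q"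
 by (simp add: orthogonal_group_iff)

lemma orthogonal_group_invertible: "g \<in> orthogonal_group Q \<Longrightarrow> invertible g"
proof -
 assume g: "g \<in> orthogonal_group Q"
 have "x = 0" if "g *v x = 0" for x
 proof (rule p_nondegenerate)
  show "p x y = 0" for y using orthogonal_groupD[OF g, of x y] that by simp
 qed
 then show "invertible g" by (metis invertible_left_inverse matrix_left_invertible_ker)
qed

lemma R_orthogonal: "aniso n \<Longrightarrow> R n \<in> orthogonal_group Q"
 by (simp add: orthogonal_group_iff R_isometry)

lemma R_invertible: "aniso n \<Longrightarrow> invertible (R n)"
 using R_orthogonal orthogonal_group_invertible by blast

subsection \<open>Orthogonal bases\<close>

definition obasis :: "real^3 \<Rightarrow> real^3 \<Rightarrow> real^3 \<Rightarrow> bool" where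
 "obasis a b c \<longleftrightarrow> aniso a \<and> aniso b \<and> aniso c \<and> p a b = 0 \<and> p a c = 0 \<and> p b c = 0"

lemma cross3_Q_nonzero:
 assumes "aniso a" "aniso b" "p a b = 0" shows "cross3 (Q *v a) (Q *v b) \<noteq> 0"
proof
 assume "cross3 (Q *v a) (Q *v b) = 0"
 then have "collinear {0, Q *v a, Q *v b}" by (simp add: cross_eq_0)
 moreover have "a \<noteq> 0" "b \<noteq> 0" using assms by (auto simp: aniso_def)
 ultimately obtain c where "Q *v b = c *\<^sub>R (Q *v a)" by (auto simp: collinear_lemma)
 then have "Q *v (b - c *\<^sub>R a) = 0" by (simp add: matrix_vector_mult_diff_distrib matrix_vector_mult_scaleR)
 then have "b = c *\<^sub>R a" by simp
 then show False using assms by (simp add: aniso_def)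
qed

lemma obasis_orthogonal_zero:
 assumes "obasis a b c" "p x a = 0" "p x b = 0" "p x c = 0" shows "x = 0"
proof -
 note h = assms(1)[unfolded obasis_def]
 have ne: "cross3 (Q *v a) (Q *v b) \<noteq> 0" using h by (intro cross3_Q_nonzero) auto
 obtain s where s: "x = s *\<^sub>R cross3 (Q *v a) (Q *v b)"
  by (rule cross3_orthogonal_span[of x, OF _ _ ne]) (use assms in \<open>auto simp: p_def\<close>)
 obtain t where t: "c = t *\<^sub>R cross3 (Q *v a) (Q *v b)"
  by (rule cross3_orthogonal_span[of c, OF _ _ ne]) (use h in \<open>auto simp: p_def[symmetric] p_commute\<close>)
 have "t \<noteq> 0" using h t by (auto simp: aniso_def)
 then have "x = (s / t) *\<^sub>R c" using s t by simp
 then show ?thesis using assms(4) h by (auto simp: aniso_def)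
qed

lemma obasis_expansion:
 assumes "obasis a b c"
 shows "x = (p x a / p a a) *\<^sub>R a + (p x b / p b b) *\<^sub>R b + (p x c / p c c) *\<^sub>R c"
proof -
 have "x - ((p x a / p a a) *\<^sub>R a + (p x b / p b b) *\<^sub>R b + (p x c / p c c) *\<^sub>R c) = 0"
  using assms by (intro obasis_orthogonal_zero[OF assms])
   (simp_all add: obasis_def aniso_def p_commute[of b a] p_commute[of c a] p_commute[of c b])
 then show ?thesis by simp
qed

lemma obasis_ext:
 assumes "obasis a b c" "g *v a = h *v a" "g *v b = h *v b" "g *v c = h *v c" shows "g = h"
proof -
 have "g *v x = h *v x" for x
  by (subst (1 2) obasis_expansion[OF assms(1), of x])
    (simp add: matrix_vector_right_distrib matrix_vector_mult_scaleR assms)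
 then show ?thesis by (simp add: matrix_eq)
qed

lemma obasis_extend2:
 assumes a: "aniso a" obtains b where "aniso b" "p a b = 0"
proof -
 have "\<exists>b. aniso b \<and> p a b = 0"
 proof (rule ccontr)
  assume "\<not> ?thesis"
  then have iso: "p b b = 0" if "p a b = 0" for b using that by (auto simp: aniso_def)
  \<comment> \<open>By polarization the form would vanish on the orthogonal complement of \<open>a\<close>.\<close>
  have "p b c = 0" if "p a b = 0" "p a c = 0" for b c
   using iso[of "b + c"] iso[of b] iso[of c] that by (simp add: p_commute[of c b])
  then have zero: "b = 0" if b: "p a b = 0" for b
  proof -
   have "p b y = 0" for y
   proof -
    have "p a (y - (p a y / p a a) *\<^sub>R a) = 0" using a by (simp add: aniso_def)
    then have "p b (y - (p a y / p a a) *\<^sub>R a) = 0"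
     using \<open>\<And>c b. \<lbrakk>p a b = 0; p a c = 0\<rbrakk> \<Longrightarrow> p b c = 0\<close> b by blast
    then show ?thesis using b by (simp add: p_commute[of b a])
   qed
   then show ?thesis by (rule p_nondegenerate)
  qed
  have all: "y = (p a y / p a a) *\<^sub>R a" for y
   using zero[of "y - (p a y / p a a) *\<^sub>R a"] a by (simp add: aniso_def)
  have par: "\<exists>t. y = t *\<^sub>R a" for y using all by blast
  obtain s t where st: "axis 1 1 = s *\<^sub>R a" "axis 2 1 = t *\<^sub>R a" using par by metis
  have "a $ 1 * s = 1" "a $ 2 * s = 0" "a $ 1 * t = 0" "a $ 2 * t = 1"
   using arg_cong[OF st(1), of "\<lambda>v. v $ 1"] arg_cong[OF st(1), of "\<lambda>v. v $ 2"]
    arg_cong[OF st(2), of "\<lambda>v. v $ 1"] arg_cong[OF st(2), of "\<lambda>v. v $ 2"] by (auto simp: axis_def mult.commute)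
  then show False by (metis mult_eq_0_iff zero_neq_one)
 qed
 then show ?thesis using that by blast
qed

lemma obasis_extend3:
 assumes "aniso a" "aniso b" "p a b = 0" obtains c where "obasis a b c"
proof -
 let ?c = "cross3 (Q *v a) (Q *v b)"
 have ne: "?c \<noteq> 0" by (rule cross3_Q_nonzero[OF assms])
 have corth: "p ?c a = 0" "p ?c b = 0" by (simp_all add: p_def dot_cross_self)
 then have orth: "p a ?c = 0" "p b ?c = 0" using p_commute by metis+
 have "p ?c ?c \<noteq> 0"
 proof
  assume iso: "p ?c ?c = 0"
  have "p ?c y = 0" for y
  proof -
   let ?y = "y - (p a y / p a a) *\<^sub>R a - (p b y / p b b) *\<^sub>R b"
   have y: "p ?y a = 0" "p ?y b = 0"
    using assms by (simp_all add: aniso_def p_commute[of y] p_commute[of b a])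
   obtain t where "?y = t *\<^sub>R ?c"
    by (rule cross3_orthogonal_span[OF y[unfolded p_def] ne]) (auto simp: p_def)
   then have "p ?c ?y = 0" using iso by simp
   then show ?thesis using corth by simp
  qed
  then show False using p_nondegenerate[of ?c] ne by blast
 qed
 then show ?thesis using that[of ?c] assms orth by (simp add: obasis_def aniso_def)
qed

lemma obasis_extend:
 assumes "aniso a" obtains b c where "obasis a b c"
 using obasis_extend2[OF assms] obasis_extend3[OF assms] by metis

lemma obasis_exists: obtains a b c where "obasis a b c"
proof -
 have "\<exists>a. aniso a"
 proof (rule ccontr)
  assume "\<not> ?thesis"
  then have iso: "p b b = 0" for b by (auto simp: aniso_def)
  have "p b c = 0" for b c using iso[of "b + c"] iso[of b] iso[of c] by (simp add: p_commute[of c b])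
  then have "axis 1 1 = (0 :: real^3)" by (intro p_nondegenerate) auto
  then show False by (simp add: axis_eq_0_iff)
 qed
 then show ?thesis using obasis_extend that by metis
qed

subsection \<open>The orthogonal group is generated by reflections\<close>

primrec refl_word :: "(real^3) list \<Rightarrow> real^3^3" where
 "refl_word [] = mat 1"
| "refl_word (a # as) = R a ** refl_word as"

lemma refl_word_append: "refl_word (as @ bs) = refl_word as ** refl_word bs"
 by (induction as) (simp_all add: matrix_mul_assoc)

lemma refl_word_rev: "\<forall>a\<in>set as. aniso a \<Longrightarrow> refl_word (rev as) ** refl_word as = mat 1"
proof (induction as)
 case (Cons a as)
 have "refl_word (rev (a # as)) ** refl_word (a # as) = refl_word (rev as) ** (R a ** R a) ** refl_word as"
  by (simp add: refl_word_append matrix_mul_assoc)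
 then show ?case using Cons by (simp add: R_involution_matrix)
qed simp

lemma refl_word_orthogonal: "\<forall>a\<in>set as. aniso a \<Longrightarrow> refl_word as \<in> orthogonal_group Q"
 by (induction as) (auto simp: orthogonal_group_one orthogonal_group_mult R_orthogonal)

text \<open>The reflection in \<open>d - e\<close> exchanges the two vectors. If \<open>d - e\<close> is isotropic, \<open>d + e\<close> is not, and the
 reflection in it takes \<open>d\<close> to \<open>- e\<close>.\<close>

lemma refl_word_move:
 assumes "p d d = p e e" "aniso e"
 obtains as where "\<forall>a\<in>set as. aniso a" "refl_word as *v d = e"
  "\<And>f. p f d = 0 \<Longrightarrow> p f e = 0 \<Longrightarrow> refl_word as *v f = f"
proof (cases "aniso (d - e)")
 case True
 have "p (d - e) (d - e) = 2 * p (d - e) d" using assms by (simp add: p_commute[of e d])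
 then have "2 * p (d - e) d / p (d - e) (d - e) = 1"
  using True unfolding aniso_def by (simp del: p_linear)
 then have "R (d - e) *v d = e" by (simp add: R_apply del: p_linear)
 moreover have "R (d - e) *v f = f" if "p f d = 0" "p f e = 0" for f
  using that by (intro R_fixes) (simp add: p_commute[of _ f])
 ultimately show ?thesis using that[of "[d - e]"] True by simp
next
 case False
 then have "p d e = p e e" using assms by (simp add: aniso_def p_commute[of e d])
 then have ni: "aniso (d + e)" using assms by (simp add: aniso_def p_commute[of e d])
 have "p (d + e) (d + e) = 2 * p (d + e) d" using assms by (simp add: p_commute[of e d])
 then have "2 * p (d + e) d / p (d + e) (d + e) = 1"
  using ni unfolding aniso_def by (simp del: p_linear)
 then have "R (d + e) *v d = - e" by (simp add: R_apply del: p_linear)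
 then have "R e *v (R (d + e) *v d) = e" using R_involution[OF assms(2), of e] R_self[OF assms(2)] by simp
 moreover have "R e *v (R (d + e) *v f) = f" if "p f d = 0" "p f e = 0" for f
 proof -
  have "R (d + e) *v f = f" "R e *v f = f" using that by (auto intro!: R_fixes simp: p_commute[of _ f])
  then show ?thesis by simp
 qed
 ultimately show ?thesis using that[of "[e, d + e]"] ni assms(2) by (simp add: matrix_vector_mul_assoc)
qed

text \<open>Move the images of the vectors of an orthogonal basis back one after the other.\<close>

lemma orthogonal_group_refl_word:
 assumes g: "g \<in> orthogonal_group Q"
 obtains as where "\<forall>a\<in>set as. aniso a" "g = refl_word as"
proof -
 obtain a b c where abc: "obasis a b c" using obasis_exists .
 note h = abc[unfolded obasis_def]
 obtain r where r: "\<forall>a\<in>set r. aniso a" "refl_word r *v (g *v a) = a"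
  by (rule refl_word_move[of "g *v a" a]) (use h orthogonal_groupD[OF g] in auto)
 define g1 where "g1 = refl_word r ** g"
 have g1: "g1 \<in> orthogonal_group Q" "g1 *v a = a"
  using r g by (auto simp: g1_def orthogonal_group_mult refl_word_orthogonal matrix_vector_mul_assoc[symmetric])
 have "p a (g1 *v b) = 0" using orthogonal_groupD[OF g1(1), of a b] g1(2) h by simp
 then obtain s where s: "\<forall>a\<in>set s. aniso a" "refl_word s *v (g1 *v b) = b" "refl_word s *v a = a"
  by (rule_tac refl_word_move[of "g1 *v b" b]) (use h orthogonal_groupD[OF g1(1)] in auto)
 define g2 where "g2 = refl_word s ** g1"
 have g2: "g2 \<in> orthogonal_group Q" "g2 *v a = a" "g2 *v b = b"
  using s g1 by (auto simp: g2_def orthogonal_group_mult refl_word_orthogonal matrix_vector_mul_assoc[symmetric])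
 have "p a (g2 *v c) = 0" "p b (g2 *v c) = 0"
  using orthogonal_groupD[OF g2(1), of a c] orthogonal_groupD[OF g2(1), of b c] g2 h by simp_all
 then obtain t where t: "\<forall>a\<in>set t. aniso a" "refl_word t *v (g2 *v c) = c" "refl_word t *v a = a"
  "refl_word t *v b = b"
  by (rule_tac refl_word_move[of "g2 *v c" c]) (use h orthogonal_groupD[OF g2(1)] in auto)
 have "refl_word t ** g2 = mat 1"
  using t g2 by (intro obasis_ext[OF abc]) (simp_all add: matrix_vector_mul_assoc[symmetric])
 then have one: "refl_word (t @ s @ r) ** g = mat 1"
  by (simp add: refl_word_append g1_def g2_def matrix_mul_assoc)
 have all: "\<forall>a\<in>set (t @ s @ r). aniso a" using r s t by auto
 have "g = refl_word (rev (t @ s @ r)) ** refl_word (t @ s @ r) ** g"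
  using refl_word_rev[OF all] by simp
 also have "\<dots> = refl_word (rev (t @ s @ r))" using one by (metis matrix_mul_assoc matrix_mul_rid)
 finally show ?thesis using that all by (metis set_rev)
qed

lemma refl_word_minus_one:
 assumes "obasis a b c" shows "refl_word [a, b, c] = - mat 1"
proof (rule obasis_ext[OF assms])
 note h = assms[unfolded obasis_def]
 have m: "(- mat 1 :: real^3^3) *v x = - x" for x :: "real^3"
  using matrix_vector_mult_diff_rdistrib[of 0 "mat 1 :: real^3^3" x] by simp
 have [simp]: "M *v (- x) = - (M *v x)" for M :: "real^3^3" and x
  using matrix_vector_mult_scaleR[of M "-1" x] by simp
 have "R b *v a = a" "R c *v a = a" "R a *v b = b" "R c *v b = b" "R a *v c = c" "R b *v c = c"
  using h by (auto intro!: R_fixes simp: p_commute)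
 then show "refl_word [a, b, c] *v a = (- mat 1) *v a" "refl_word [a, b, c] *v b = (- mat 1) *v b"
  "refl_word [a, b, c] *v c = (- mat 1) *v c"
  using h by (simp_all add: matrix_vector_mul_assoc[symmetric] R_self m)
qed

end

section \<open>Orbits of the orthogonal group\<close>

lemma closedin_zariski_point: "closedin zariski {y. y i = q}"
proof -
 let ?l = "\<lambda>k v. cross3 (rep_rp2 q) v $ (k::3)"
 have lin: "bounded_linear (?l k)" for k
  unfolding linear_conv_bounded_linear[symmetric] by (rule linearI) (simp_all add: cross_add_right cross_mult_right)
 have "closedin zariski {y. ?l k (rep_rp2 (y i)) = 0}" for k
 proof -
  have "real_poly (\<lambda>x :: (real^3)^'a. ?l k (x $ i))"
   by (intro real_polynomial_function.intros(1) bounded_linear_compose[OF lin] bounded_linear_vec_nth)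
  then show ?thesis
   using closedin_zariski_zero[of "\<lambda>x. ?l k (x $ i)"] multihomogeneousI[OF mh_deg_linear, of "?l k" i]
    bounded_linear.linear[OF lin] by simp
 qed
 then have "closedin zariski (\<Inter>k\<in>UNIV. {y. ?l k (rep_rp2 (y i)) = 0})" by (intro closedin_INT) auto
 moreover have "y i = q \<longleftrightarrow> (\<forall>k. ?l k (rep_rp2 (y i)) = 0)" for y :: "'a \<Rightarrow> rp2"
 proof -
  have "y i = q \<longleftrightarrow> abs_rp2 (rep_rp2 q) = abs_rp2 (rep_rp2 (y i))" by auto
  also have "\<dots> \<longleftrightarrow> collinear {0, rep_rp2 q, rep_rp2 (y i)}"
   by (subst abs_rp2_eq_iff) (auto simp: collinear_lemma)
  also have "\<dots> \<longleftrightarrow> cross3 (rep_rp2 q) (rep_rp2 (y i)) = 0" by (simp add: cross_eq_0)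
  finally show ?thesis by (simp add: vec_eq_iff)
 qed
 then have "{y. y i = q} = (\<Inter>k\<in>UNIV. {y. ?l k (rep_rp2 (y i)) = 0})" by auto
 ultimately show ?thesis by simp
qed

lemma closedin_zariski_affine_singleton: "closedin zariski_affine {a :: 'a::euclidean_space}"
proof -
 have "real_poly (\<lambda>x. \<Sum>b\<in>Basis. ((x - a) \<bullet> b) * ((x - a) \<bullet> b))"
  by (intro real_polynomial_function_sum real_polynomial_function.intros(4) real_polynomial_function_component
    polynomial_function_diff polynomial_function_id polynomial_function_const) auto
 then have "closedin zariski_affine {x. (\<Sum>b\<in>Basis. ((x - a) \<bullet> b) * ((x - a) \<bullet> b)) = 0}"
  by (rule closedin_zariski_affine_zero)
 moreover have "(\<Sum>b\<in>Basis. ((x - a) \<bullet> b) * ((x - a) \<bullet> b)) = 0 \<longleftrightarrow> x = a" for x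
  unfolding euclidean_inner[symmetric] by simp
 ultimately show ?thesis by simp
qed

lemma polynomial_matrix_mult:
 fixes F G :: "'a::euclidean_space \<Rightarrow> real^3^3"
 assumes "poly_map F" "poly_map G"
 shows "poly_map (\<lambda>u. F u ** G u)"
proof (intro polynomial_vecI)
 fix i j
 have comp: "real_poly (\<lambda>u. H u $ k $ l)" if "poly_map H"
  for H :: "'a \<Rightarrow> real^3^3" and k l
  using that polynomial_function_def bounded_linear_compose[OF bounded_linear_vec_nth bounded_linear_vec_nth, of k l]
  by (auto simp: o_def)
 show "poly_map (\<lambda>u. (F u ** G u) $ i $ j)"
  unfolding matrix_matrix_mult_def real_polynomial_function_eq[symmetric]
  by (simp) (intro real_polynomial_function_sum real_polynomial_function.intros(4) comp assms; simp)
qed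

context form
begin

definition act :: "real^3^3 \<Rightarrow> ('i \<Rightarrow> rp2) \<Rightarrow> 'i \<Rightarrow> rp2" where
 "act g x = (\<lambda>i. rp2_map g (x i))"

lemma act_mult: "invertible g \<Longrightarrow> invertible h \<Longrightarrow> act (g ** h) x = act g (act h x)"
 by (simp add: act_def rp2_map_mult)

lemma act_one [simp]: "act (mat 1) x = x"
 by (simp add: act_def)

lemma act_minus [simp]: "act (- g) x = act g x"
 using rp2_map_scale[of "-1" g] by (simp add: act_def)

lemma continuous_map_act: "invertible g \<Longrightarrow> continuous_map zariski zariski (act g :: ('i::finite \<Rightarrow> rp2) \<Rightarrow> 'i \<Rightarrow> rp2)"
 unfolding act_def by (rule continuous_map_rp2_maps)

lemma polynomial_scaleR_const [intro]: "real_poly f \<Longrightarrow> poly_map (\<lambda>u. f u *\<^sub>R v)"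
 by (intro polynomial_function_mult polynomial_function_const) (simp add: real_polynomial_function_eq)

lemma open_aniso: "open (Collect aniso)"
proof -
 have "openin zariski_affine {u. p u u \<noteq> 0}"
  by (intro openin_zariski_affine_nonzero p_polynomial polynomial_function_id)
 moreover have "Collect aniso = {u. p u u \<noteq> 0}" by (auto simp: aniso_def)
 ultimately show ?thesis using open_if_zariski_open by simp
qed

text \<open>The anisotropic vectors of a subspace, given as the image of a linear map.\<close>

lemma irreducible_aniso_image:
 fixes L :: "'a::euclidean_space \<Rightarrow> real^3"
 assumes L: "bounded_linear L" and ne: "aniso (L a)"
 shows "irreducible_in zariski_affine {u \<in> range L. aniso u}"
proof -
 let ?U = "{a. aniso (L a)}"
 have "open ?U"
  using continuous_open_vimage[OF open_aniso linear_continuous_at[OF L]] by (auto simp: vimage_def)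
 then have "interior ?U \<noteq> {}" using ne by (auto simp: interior_open)
 then have "irreducible_in zariski_affine (L ` ?U)"
  using continuous_map_polynomial[OF polynomial_function_bounded_linear[OF L]]
  by (intro irreducible_in_polynomial_image continuous_map_from_subtopology)
 moreover have "L ` ?U = {u \<in> range L. aniso u}" by auto
 ultimately show ?thesis by simp
qed

lemma irreducible_aniso: "irreducible_in zariski_affine (Collect aniso)"
proof -
 obtain a b c where "obasis a b c" using obasis_exists .
 then have "aniso a" by (simp add: obasis_def)
 then show ?thesis using irreducible_aniso_image[OF bounded_linear_ident, of a] by simp
qed

lemma polynomial_mult_vec [intro]: "poly_map (\<lambda>g :: real^3^3. g *v x)"
 by (intro polynomial_function_bounded_linear, unfold linear_conv_bounded_linear[symmetric], rule linearI)
   (simp_all add: matrix_vector_mult_add_rdistrib scaleR_matrix_vector_assoc)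

lemma irreducible_reflect_matrices:
 fixes Y :: "(real^3^3) set"
 assumes Y: "irreducible_in zariski_affine Y" and E: "irreducible_in zariski_affine E" "E \<subseteq> Collect aniso"
 shows "irreducible_in zariski_affine {R u ** y | y u. y \<in> Y \<and> u \<in> E}"
proof (rule irreducible_in_image2[OF Y E(1)])
 show "continuous_map (subtopology zariski_affine Y) zariski_affine (\<lambda>y. R u ** y)" for u
  by (intro continuous_map_from_subtopology continuous_map_polynomial)
    (rule polynomial_matrix_mult[of "\<lambda>_. R u" "\<lambda>y. y"], simp_all add: polynomial_function_id)
 fix y :: "real^3^3"
 let ?N = "\<lambda>u. (p u u *\<^sub>R mat 1 - 2 *\<^sub>R (outer u u ** Q)) ** y"
 have "poly_map (\<lambda>u. outer u u)"
 proof (intro polynomial_vecI)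
  fix i j
  have "poly_map (\<lambda>u::real^3. u $ k)" for k
   by (intro polynomial_function_bounded_linear bounded_linear_vec_nth)
  then show "poly_map (\<lambda>u. outer u u $ i $ j)"
   unfolding outer_def real_polynomial_function_eq[symmetric]
   by (simp) (intro real_polynomial_function.intros(4))
 qed
 then have N: "poly_map ?N"
  by (intro polynomial_matrix_mult polynomial_function_diff polynomial_function_cmul polynomial_function_const
    polynomial_scaleR_const p_polynomial polynomial_function_id)
 have cont: "continuous_map (subtopology zariski_affine E) zariski_affine (\<lambda>u. (1 / p u u) *\<^sub>R ?N u)"
  using E(2) by (intro continuous_map_affine_rational N p_polynomial polynomial_function_id)
   (auto simp: aniso_def)
 have eq: "(1 / p u u) *\<^sub>R ?N u = R u ** y" if "u \<in> E" for u
 proof -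
  have "p u u \<noteq> 0" using that E(2) by (auto simp: aniso_def)
  then have eq: "(1 / p u u) *\<^sub>R (p u u *\<^sub>R mat 1 - 2 *\<^sub>R (outer u u ** Q)) = R u"
   by (simp add: form_reflection_def p_def scaleR_diff_right)
  have "(1 / p u u) *\<^sub>R ?N u = ((1 / p u u) *\<^sub>R (p u u *\<^sub>R mat 1 - 2 *\<^sub>R (outer u u ** Q))) ** y"
   by (rule scalar_matrix_assoc)
  then show ?thesis unfolding eq .
 qed
 show "continuous_map (subtopology zariski_affine E) zariski_affine (\<lambda>u. R u ** y)"
  by (rule continuous_map_eq[OF cont]) (rule eq, simp)
qed

lemma continuous_map_act_group:
 fixes x :: "'i::finite \<Rightarrow> rp2"
 shows "continuous_map (subtopology zariski_affine (orthogonal_group Q)) zariski (\<lambda>g. act g x)"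
 unfolding act_def rp2_map_def
 by (intro continuous_map_abs_polynomial polynomial_mult_vec)
  (simp add: matrix_vector_mult_eq_0_invertible[OF orthogonal_group_invertible])

lemma irreducible_act_image:
 fixes x :: "'i::finite \<Rightarrow> rp2"
 assumes "irreducible_in zariski_affine S" "S \<subseteq> orthogonal_group Q"
 shows "irreducible_in zariski ((\<lambda>g. act g x) ` S)"
 by (rule irreducible_in_image[OF continuous_map_act_group]) (use assms in \<open>unfold irreducible_in_subtopology, blast\<close>)

definition orbit :: "('i \<Rightarrow> rp2) \<Rightarrow> ('i \<Rightarrow> rp2) set" where
 "orbit x = {act g x | g. g \<in> orthogonal_group Q}"

text \<open>Up to the sign, which acts trivially, every isometry is a product of an even number of
 reflections; and a product of \<open>2 k\<close> reflections is also one of \<open>2 k + 2\<close>.\<close>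

lemma irreducible_orbit:
 fixes x :: "'i::finite \<Rightarrow> rp2"
 shows "irreducible_in zariski (orbit x)"
proof -
 define I where "I k = {refl_word as | as. length as = k \<and> (\<forall>a\<in>set as. aniso a)}" for k
 have I_Suc: "I (Suc k) = {R u ** y | y u. y \<in> I k \<and> u \<in> Collect aniso}" for k
 proof (intro equalityI subsetI)
  fix z assume "z \<in> I (Suc k)"
  then obtain as where as: "z = refl_word as" "length as = Suc k" "\<forall>a\<in>set as. aniso a" by (auto simp: I_def)
  then obtain b bs where "as = b # bs" by (cases as) auto
  then show "z \<in> {R u ** y | y u. y \<in> I k \<and> u \<in> Collect aniso}" using as by (auto simp: I_def)
 next
  fix z assume "z \<in> {R u ** y | y u. y \<in> I k \<and> u \<in> Collect aniso}"
  then obtain as u where "z = R u ** refl_word as" "length as = k" "\<forall>a\<in>set as. aniso a" "aniso u"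
   by (auto simp: I_def)
  then show "z \<in> I (Suc k)" unfolding I_def by (intro CollectI exI[of _ "u # as"]) auto
 qed
 have irr: "irreducible_in zariski_affine (I k)" for k
 proof (induction k)
  case 0
  have "I 0 = {mat 1}" by (auto simp: I_def)
  then show ?case by (subst irreducible_in_iff_open) auto
 next
  case (Suc k)
  then show ?case using irreducible_reflect_matrices[OF Suc irreducible_aniso] by (simp add: I_Suc)
 qed
 obtain a b c where abc: "obasis a b c" using obasis_exists .
 then have ni: "aniso a" "aniso b" "aniso c" by (auto simp: obasis_def)
 have "I (2 * k) \<subseteq> I (2 * Suc k)" for k
 proof
  fix z assume "z \<in> I (2 * k)"
  then obtain as where as: "z = refl_word as" "length as = 2 * k" "\<forall>a\<in>set as. aniso a" by (auto simp: I_def)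
  have "refl_word (a # a # as) = refl_word as" using R_involution_matrix[OF ni(1)] by (simp add: matrix_mul_assoc)
  then show "z \<in> I (2 * Suc k)" using as ni unfolding I_def by (intro CollectI exI[of _ "a # a # as"]) auto
 qed
 then have irrU: "irreducible_in zariski_affine (\<Union>k. I (2 * k))"
  using irr by (intro irreducible_in_increasing_union) auto
 have U: "(\<Union>k. I (2 * k)) \<subseteq> orthogonal_group Q" using refl_word_orthogonal by (auto simp: I_def)
 have "orbit x = (\<lambda>g. act g x) ` (\<Union>k. I (2 * k))"
 proof (intro equalityI subsetI)
  fix z assume "z \<in> orbit x"
  then obtain g where g: "g \<in> orthogonal_group Q" "z = act g x" by (auto simp: orbit_def)
  then obtain as where as: "\<forall>a\<in>set as. aniso a" "g = refl_word as" using orthogonal_group_refl_word by metis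
  show "z \<in> (\<lambda>g. act g x) ` (\<Union>k. I (2 * k))"
  proof (cases "even (length as)")
   case True
   then obtain k where "length as = 2 * k" by (elim evenE)
   then have "g \<in> I (2 * k)" using as by (auto simp: I_def)
   then show ?thesis using g(2) by blast
  next
   case False
   then have "even (length (a # b # c # as))" by simp
   then obtain k where k: "length (a # b # c # as) = 2 * k" by (elim evenE)
   have "(- mat 1) ** g = - g"
    by (simp add: vec_eq_iff matrix_matrix_mult_def mat_def if_distrib if_distribR sum.delta cong: if_cong)
   then have "refl_word ([a, b, c] @ as) = - g" using refl_word_minus_one[OF abc] as by (simp only: refl_word_append)
   then have "- g \<in> I (2 * k)" unfolding I_def using k as ni by (intro CollectI exI[of _ "a # b # c # as"]) auto
   then show ?thesis using g(2) act_minus[of g x] by (intro image_eqI[of _ _ "- g"]) auto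
  qed
 qed (use U in \<open>auto simp: orbit_def\<close>)
 then show ?thesis using irreducible_act_image[OF irrU U] by simp
qed

subsection \<open>Every orbit has dimension three\<close>

lemma aniso_sum:
 assumes "aniso a" "aniso b" "p a b = 0"
 obtains s where "s \<noteq> 0" "aniso (a + s *\<^sub>R b)"
proof (cases "p a a + p b b = 0")
 case True
 then have "aniso (a + 2 *\<^sub>R b)" using assms by (auto simp: aniso_def p_commute[of b a])
 then show ?thesis using that[of 2] by simp
next
 case False
 then have "aniso (a + 1 *\<^sub>R b)" using assms by (auto simp: aniso_def p_commute[of b a])
 then show ?thesis using that[of 1] by simp
qed

definition plane :: "real^3 \<Rightarrow> real^3 \<Rightarrow> (real^3) set" where
 "plane b c = {s *\<^sub>R b + t *\<^sub>R c | s t. aniso (s *\<^sub>R b + t *\<^sub>R c)}"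

lemma irreducible_plane:
 assumes "aniso b" shows "irreducible_in zariski_affine (plane b c)"
proof -
 let ?L = "\<lambda>u::real \<times> real. fst u *\<^sub>R b + snd u *\<^sub>R c"
 have "bounded_linear ?L" by (intro bounded_linear_intros)
 moreover have "{u \<in> range ?L. aniso u} = plane b c"
  unfolding plane_def image_def by auto
 moreover have "aniso (?L (1, 0))" using assms by simp
 ultimately show ?thesis using irreducible_aniso_image[of ?L "(1, 0)"] by simp
qed

lemma plane_aniso: "plane b c \<subseteq> Collect aniso"
 by (auto simp: plane_def)

lemma planeI: "u = s *\<^sub>R b + t *\<^sub>R c \<Longrightarrow> aniso u \<Longrightarrow> u \<in> plane b c"
 by (auto simp: plane_def)

text \<open>The rotations about \<open>a\<close> move every other anisotropic line.\<close>

lemma reflections_move_line: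
 assumes abc: "obasis a b c" and m: "aniso m" "\<And>t. m \<noteq> t *\<^sub>R a"
 obtains n n' where "n \<in> plane b c" "n' \<in> plane b c" "\<And>t. R n' *v m \<noteq> t *\<^sub>R (R n *v m)"
proof -
 note h = abc[unfolded obasis_def aniso_def]
 have comm: "p b a = 0" "p c a = 0" "p c b = 0" using h p_commute by metis+
 have bc: "b \<in> plane b c" "c \<in> plane b c"
  using planeI[of b 1 b 0 c] planeI[of c 0 b 1 c] abc by (auto simp: obasis_def)
 have "\<exists>n\<in>plane b c. \<exists>n'\<in>plane b c. \<forall>t. R n' *v m \<noteq> t *\<^sub>R (R n *v m)"
 proof (rule ccontr)
  assume "\<not> ?thesis"
  then have par: "\<exists>t. R n' *v m = t *\<^sub>R (R n *v m)" if "n \<in> plane b c" "n' \<in> plane b c" for n n'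
   using that by blast
  obtain t where t: "R c *v m = t *\<^sub>R (R b *v m)" using par bc by blast
  have ta: "p m a = t * p m a" using arg_cong[OF t, of "\<lambda>v. p v a"] comm by (simp add: R_apply)
  have tb: "p m b = - t * p m b"
   using arg_cong[OF t, of "\<lambda>v. p v b"] comm h by (simp add: R_apply p_commute[of _ m] algebra_simps)
  have tc: "- p m c = t * p m c"
   using arg_cong[OF t, of "\<lambda>v. p v c"] comm h by (simp add: R_apply p_commute[of _ m] algebra_simps)
  have a0: "p m a = 0"
  proof (rule ccontr)
   assume "p m a \<noteq> 0"
   then have "t = 1" using ta by simp
   then have "p m b = 0" "p m c = 0" using tb tc by simp_all
   then have "m = (p m a / p a a) *\<^sub>R a" using obasis_expansion[OF abc, of m] by simp
   then show False using m(2) by blast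
  qed
  obtain s where s: "s \<noteq> 0" "aniso (b + s *\<^sub>R c)"
   using aniso_sum[of b c] h by (auto simp: aniso_def)
  let ?n = "b + s *\<^sub>R c"
  have "?n \<in> plane b c" using planeI[of ?n 1 b s c] s by simp
  then obtain r where r: "R ?n *v m = r *\<^sub>R (R b *v m)" using par bc by blast
  define \<beta> \<gamma> B C where d: "\<beta> = p m b" "\<gamma> = p m c" "B = p b b" "C = p c c"
  have D: "B + s\<^sup>2 * C \<noteq> 0" using s(2) h comm by (simp add: aniso_def d power2_eq_square)
  define X where "X = (\<beta> + s * \<gamma>) / (B + s\<^sup>2 * C)"
  have X: "X * (B + s\<^sup>2 * C) = \<beta> + s * \<gamma>" using D by (simp add: X_def)
  have Rn: "R ?n *v m = m - (2 * X) *\<^sub>R ?n"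
   unfolding R_apply X_def d using h comm by (simp add: p_commute[of _ m] power2_eq_square)
  have Rb: "R b *v m = m - (2 * \<beta> / B) *\<^sub>R b" unfolding R_apply d by (simp add: p_commute[of b m])
  have "\<beta> - 2 * X * B = - r * \<beta>"
   using arg_cong[OF r, of "\<lambda>v. p v b"] h comm unfolding Rn Rb by (simp add: d algebra_simps)
  moreover have "\<gamma> - 2 * X * (s * C) = r * \<gamma>"
   using arg_cong[OF r, of "\<lambda>v. p v c"] h comm unfolding Rn Rb by (simp add: d algebra_simps)
  ultimately have "(\<beta> - 2 * X * B) * \<gamma> + (\<gamma> - 2 * X * (s * C)) * \<beta> = 0" by algebra
  then have "\<beta> * \<gamma> = X * (B * \<gamma> + s * C * \<beta>)" by algebra
  then have "\<beta> * \<gamma> * (B + s\<^sup>2 * C) = (\<beta> + s * \<gamma>) * (B * \<gamma> + s * C * \<beta>)"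
   unfolding X[symmetric] by algebra
  then have "s * (C * \<beta>\<^sup>2 + B * \<gamma>\<^sup>2) = 0" by (simp add: algebra_simps power2_eq_square)
  then have z: "C * \<beta>\<^sup>2 + B * \<gamma>\<^sup>2 = 0" using s by simp
  have me: "m = (\<beta> / B) *\<^sub>R b + (\<gamma> / C) *\<^sub>R c" using obasis_expansion[OF abc, of m] a0 by (simp add: d)
  have "p m m = \<beta> / B * p b m + \<gamma> / C * p c m"
   using arg_cong[OF me, of "\<lambda>v. p v m"] by (simp only: p_linear)
  then have "p m m = (C * \<beta>\<^sup>2 + B * \<gamma>\<^sup>2) / (B * C)"
   using h by (simp add: d p_commute[of b m] p_commute[of c m] field_simps power2_eq_square)
  then show False using z m(1) by (simp add: aniso_def)
 qed
 then show ?thesis using that by blast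
qed

lemma p_rep_abs: "v \<noteq> 0 \<Longrightarrow> p b (rep_rp2 (abs_rp2 v)) = 0 \<longleftrightarrow> p b v = 0"
 by (rule rep_abs_rp2[of v]) auto

lemma closedin_polar: "closedin zariski {y. p b (rep_rp2 (y i)) = 0}"
proof -
 have "p b r = (Q *v b) \<bullet> r" for r by (metis p_commute p_def inner_commute)
 then show ?thesis using closedin_zariski_line[of "Q *v b" i] by simp
qed

text \<open>A chain of irreducible sets of isometries: two rotations about \<open>a\<close> are told apart; then \<open>a\<close> stays fixed;
 \<open>a\<close> moves in a plane; no restriction.\<close>

lemma isometry_chain:
 assumes abc: "obasis a b c" and n: "n \<in> plane b c" "n' \<in> plane b c"
 obtains S :: "nat \<Rightarrow> (real^3^3) set" where "\<And>k. irreducible_in zariski_affine (S k)" "\<And>k. S k \<subseteq> orthogonal_group Q"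
  "\<And>k. k < 3 \<Longrightarrow> S k \<subseteq> S (Suc k)" "S 0 = {R a ** R n}" "R a ** R n' \<in> S 1"
  "\<And>g. g \<in> S 1 \<Longrightarrow> p b (g *v a) = 0" "\<exists>g\<in>S 2. p b (g *v a) \<noteq> 0"
  "\<And>g. g \<in> S 2 \<Longrightarrow> p c (g *v a) = 0" "\<exists>g\<in>S 3. p c (g *v a) \<noteq> 0"
proof -
 note h = abc[unfolded obasis_def]
 have comm: "p b a = 0" "p c a = 0" "p c b = 0" using h p_commute by metis+
 define E where "E k = (if k = Suc 0 then plane a 0 else if k = 2 then plane a b else Collect aniso)" for k :: nat
 define Y where "Y = {R u ** y | y u. y \<in> {mat 1} \<and> u \<in> plane b c}"
 define S where "S k = (if k = 0 then {R a ** R n} else {R u ** y | y u. y \<in> Y \<and> u \<in> E k})" for k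
 have E: "irreducible_in zariski_affine (E k)" "E k \<subseteq> Collect aniso" for k
  using h irreducible_plane irreducible_aniso plane_aniso by (auto simp: E_def)
 have Emono: "E k \<subseteq> E (Suc k)" if "k \<ge> 1" for k
  using that h plane_aniso by (auto simp: E_def plane_def) (metis add.right_neutral scale_zero_left)
 have aE: "a \<in> E 1" using planeI[of a 1 a 0 0] h by (simp add: E_def)
 have "irreducible_in zariski_affine {mat 1 :: real^3^3}" by (subst irreducible_in_iff_open) auto
 then have Y: "irreducible_in zariski_affine Y"
  unfolding Y_def using h irreducible_plane plane_aniso by (intro irreducible_reflect_matrices) auto
 have nY: "R n \<in> Y" "R n' \<in> Y" using n by (auto simp: Y_def)
 have irr: "irreducible_in zariski_affine (S k)" for k
 proof (cases "k = 0")
  case True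
  then show ?thesis unfolding S_def by (subst irreducible_in_iff_open) auto
 next
  case False
  then show ?thesis unfolding S_def using irreducible_reflect_matrices[OF Y E] by simp
 qed
 have fixa: "y *v a = a" if "y \<in> Y" for y
 proof -
  obtain u where u: "y = R u" "u \<in> plane b c" using \<open>y \<in> Y\<close> by (auto simp: Y_def)
  then have "p u a = 0" using comm by (auto simp: plane_def)
  then show ?thesis using u R_fixes by simp
 qed
 have YO: "Y \<subseteq> orthogonal_group Q" using plane_aniso R_orthogonal by (auto simp: Y_def)
 have sub: "S k \<subseteq> orthogonal_group Q" for k
  using h E(2) YO n plane_aniso[of b c] unfolding S_def by (auto split: if_splits intro!: orthogonal_group_mult R_orthogonal)
 have mono: "S k \<subseteq> S (Suc k)" if "k < 3" for k
  using that nY aE Emono[of k] unfolding S_def by (cases "k = 0") (auto 4 3)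
 have orth: "p d (g *v a) = 0" if o: "g \<in> S k" "k \<noteq> 0" "p d a = 0" "\<And>u. u \<in> E k \<Longrightarrow> p d u = 0" for d g k
 proof -
  obtain y u where "g = R u ** y" "y \<in> Y" "u \<in> E k" using o(1,2) by (auto simp: S_def)
  then show ?thesis using fixa o(3,4) by (simp add: matrix_vector_mul_assoc[symmetric] R_apply)
 qed
 have move: "\<exists>g\<in>S k. p d (g *v a) \<noteq> 0"
  if d: "aniso d" "p a d = 0" and k: "\<And>s. aniso (a + s *\<^sub>R d) \<Longrightarrow> a + s *\<^sub>R d \<in> E k" "k \<noteq> 0" for d k
 proof -
  obtain s where s: "s \<noteq> 0" "aniso (a + s *\<^sub>R d)" using aniso_sum d h by metis
  have "p d (R (a + s *\<^sub>R d) *v a) \<noteq> 0" using s d h by (auto simp: R_apply aniso_def p_commute[of d a])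
  then have "p d ((R (a + s *\<^sub>R d) ** R n) *v a) \<noteq> 0" using fixa[OF nY(1)] by (simp add: matrix_vector_mul_assoc[symmetric])
  moreover have "R (a + s *\<^sub>R d) ** R n \<in> S k" using k(1)[OF s(2)] k(2) nY by (auto simp: S_def)
  ultimately show ?thesis by blast
 qed
 show ?thesis
 proof (rule that[of S, OF irr sub mono])
  show "S 0 = {R a ** R n}" "R a ** R n' \<in> S 1" using nY aE by (auto simp: S_def)
  show "p b (g *v a) = 0" if "g \<in> S 1" for g by (rule orth[OF that]) (auto simp: comm E_def plane_def)
  show "p c (g *v a) = 0" if "g \<in> S 2" for g by (rule orth[OF that]) (auto simp: comm E_def plane_def)
  show "\<exists>g\<in>S 2. p b (g *v a) \<noteq> 0"
   using h planeI[of _ 1 a _ b] by (intro move) (auto simp: E_def)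
  show "\<exists>g\<in>S 3. p c (g *v a) \<noteq> 0" using h by (intro move) (auto simp: E_def)
 qed
qed

lemma below_3: "k < 3 \<Longrightarrow> P 0 \<Longrightarrow> P 1 \<Longrightarrow> P 2 \<Longrightarrow> P k" for k :: nat
 by (metis One_nat_def less_Suc_eq less_one numeral_2_eq_2 numeral_3_eq_3)

lemma orbit_chain:
 fixes x :: "'i::finite \<Rightarrow> rp2"
 assumes ni: "aniso (rep_rp2 (x i))" "aniso (rep_rp2 (x j))" and ne: "x i \<noteq> x j"
 shows "\<exists>S. (\<forall>k\<le>3. irreducible_in zariski (S k) \<and> S k \<subseteq> orbit x) \<and> (\<forall>k<3. S k \<subseteq> S (Suc k)) \<and>
   (\<forall>k<3::nat. \<exists>C. closedin zariski C \<and> S k \<subseteq> C \<and> \<not> S (Suc k) \<subseteq> C)"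
proof -
 define a m where am: "a = rep_rp2 (x i)" "m = rep_rp2 (x j)"
 obtain b c where abc: "obasis a b c" using obasis_extend[of a] ni am by auto
 have "m \<noteq> t *\<^sub>R a" for t
 proof
  assume "m = t *\<^sub>R a"
  then have "abs_rp2 a = abs_rp2 m" by (subst abs_rp2_eq_iff) (auto simp: am)
  then show False using ne by (simp add: am)
 qed
 then obtain n n' where n: "n \<in> plane b c" "n' \<in> plane b c" "\<And>t. R n' *v m \<noteq> t *\<^sub>R (R n *v m)"
  using reflections_move_line[OF abc, of m] ni am by metis
 obtain T where T: "\<And>k. irreducible_in zariski_affine (T k)" "\<And>k. T k \<subseteq> orthogonal_group Q"
  "\<And>k. k < 3 \<Longrightarrow> T k \<subseteq> T (Suc k)" "T 0 = {R a ** R n}" "R a ** R n' \<in> T 1"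
  "\<And>g. g \<in> T 1 \<Longrightarrow> p b (g *v a) = 0" "\<exists>g\<in>T 2. p b (g *v a) \<noteq> 0"
  "\<And>g. g \<in> T 2 \<Longrightarrow> p c (g *v a) = 0" "\<exists>g\<in>T 3. p c (g *v a) \<noteq> 0"
  using isometry_chain[OF abc n(1,2)] by blast
 define S where "S k = (\<lambda>g. act g x) ` T k" for k
 have polar: "\<exists>C. closedin zariski C \<and> S k \<subseteq> C \<and> \<not> S (Suc k) \<subseteq> C"
  if "\<And>g. g \<in> T k \<Longrightarrow> p d (g *v a) = 0" "\<exists>g\<in>T (Suc k). p d (g *v a) \<noteq> 0" for d k
 proof (intro exI conjI)
  have nth: "p d (rep_rp2 (act g x i)) = 0 \<longleftrightarrow> p d (g *v a) = 0" if "g \<in> T l" for g l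
  proof -
   have "invertible g" using T(2) that orthogonal_group_invertible by blast
   then have "g *v a \<noteq> 0" by (simp add: matrix_vector_mult_eq_0_invertible am)
   then show ?thesis by (simp add: act_def rp2_map_def am[symmetric] p_rep_abs)
  qed
  show "closedin zariski {y. p d (rep_rp2 (y i)) = 0}" by (rule closedin_polar)
  show "S k \<subseteq> {y. p d (rep_rp2 (y i)) = 0}" "\<not> S (Suc k) \<subseteq> {y. p d (rep_rp2 (y i)) = 0}"
   using that nth by (auto simp: S_def)
 qed
 have "\<exists>C. closedin zariski C \<and> S k \<subseteq> C \<and> \<not> S (Suc k) \<subseteq> C" if k: "k < 3" for k
  using k
 proof (rule below_3)
  let ?q = "rp2_map (R a ** R n) (x j)"
  have inv: "invertible (R a)" "invertible (R n)" "invertible (R n')"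
   using abc n plane_aniso R_invertible unfolding obasis_def by blast+
  have "rp2_map (R a ** R n') (x j) \<noteq> ?q"
  proof
   assume "rp2_map (R a ** R n') (x j) = ?q"
   then have "rp2_map (R a) (rp2_map (R a ** R n') (x j)) = rp2_map (R a) ?q" by simp
   moreover have "rp2_map (R a) (rp2_map (R a ** X) q) = rp2_map X q" if "invertible X" for X q
   proof -
    have "R a ** (R a ** X) = X" using abc by (simp add: matrix_mul_assoc R_involution_matrix obasis_def)
    then show ?thesis using rp2_map_mult[OF inv(1) invertible_mult[OF inv(1) that], of q] by simp
   qed
   ultimately have "rp2_map (R n') (x j) = rp2_map (R n) (x j)" using inv by metis
   then have "abs_rp2 (R n *v m) = abs_rp2 (R n' *v m)" by (simp add: rp2_map_def am)
   moreover have "R n *v m \<noteq> 0" "R n' *v m \<noteq> 0"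
    using matrix_vector_mult_eq_0_invertible[OF inv(2)] matrix_vector_mult_eq_0_invertible[OF inv(3)]
    by (simp_all add: am)
   ultimately show False using n(3) by (simp add: abs_rp2_eq_iff)
  qed
  then have "\<not> S (Suc 0) \<subseteq> {y. y j = ?q}" using T(5) by (auto simp: S_def act_def)
  moreover have "S 0 \<subseteq> {y. y j = ?q}" by (simp add: S_def T(4) act_def)
  ultimately show "\<exists>C. closedin zariski C \<and> S 0 \<subseteq> C \<and> \<not> S (Suc 0) \<subseteq> C" using closedin_zariski_point by blast
  show "\<exists>C. closedin zariski C \<and> S 1 \<subseteq> C \<and> \<not> S (Suc 1) \<subseteq> C" "\<exists>C. closedin zariski C \<and> S 2 \<subseteq> C \<and> \<not> S (Suc 2) \<subseteq> C"
   using polar[of 1 b] polar[of 2 c] T(6-9) by (simp_all add: eval_nat_numeral)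
 qed
 moreover have "S k \<subseteq> S (Suc k)" if "k < 3" for k unfolding S_def by (rule image_mono[OF T(3)[OF that]])
 moreover have "S k \<subseteq> orbit x" for k using T(2) by (auto simp: S_def orbit_def)
 moreover have "irreducible_in zariski (S k)" for k unfolding S_def by (rule irreducible_act_image[OF T(1,2)])
 ultimately show ?thesis by (intro exI[of _ S]) blast
qed

subsection \<open>The dimension of the orthogonal group\<close>

lemma closedin_orthogonal_group: "closedin zariski_affine (orthogonal_group Q)"
proof -
 have "closedin zariski_affine {g. p (g *v x) (g *v y) - p x y = 0}" for x y
  by (intro closedin_zariski_affine_zero real_polynomial_function_diff p_polynomial polynomial_mult_vec
    real_polynomial_function.intros(2))
 then have "closedin zariski_affine (\<Inter>z\<in>UNIV. {g. p (g *v fst z) (g *v snd z) - p (fst z) (snd z) = 0})"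
  by (intro closedin_INT) auto
 moreover have "orthogonal_group Q = (\<Inter>z\<in>UNIV. {g. p (g *v fst z) (g *v snd z) - p (fst z) (snd z) = 0})"
  by (auto simp: orthogonal_group_iff)
 ultimately show ?thesis by simp
qed

lemma irr_chain_orthogonal_group: "\<exists>C. irr_chain (subtopology zariski_affine (orthogonal_group Q)) 3 C"
proof -
 let ?O = "subtopology zariski_affine (orthogonal_group Q)"
 obtain a b c where abc: "obasis a b c" using obasis_exists .
 note h = abc[unfolded obasis_def]
 have bc: "b \<in> plane b c" "c \<in> plane b c" using planeI[of b 1 b 0 c] planeI[of c 0 b 1 c] h by auto
 obtain S where S: "\<And>k. irreducible_in zariski_affine (S k)" "\<And>k. S k \<subseteq> orthogonal_group Q"
  "\<And>k. k < 3 \<Longrightarrow> S k \<subseteq> S (Suc k)" "S 0 = {R a ** R b}" "R a ** R c \<in> S 1"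
  "\<And>g. g \<in> S 1 \<Longrightarrow> p b (g *v a) = 0" "\<exists>g\<in>S 2. p b (g *v a) \<noteq> 0"
  "\<And>g. g \<in> S 2 \<Longrightarrow> p c (g *v a) = 0" "\<exists>g\<in>S 3. p c (g *v a) \<noteq> 0"
  using isometry_chain[OF abc bc] by blast
 have cl: "closedin zariski_affine {g. p e (g *v a) = 0}" for e
  by (intro closedin_zariski_affine_zero p_polynomial polynomial_mult_vec polynomial_function_const)
 have "\<exists>C. closedin zariski_affine C \<and> S k \<subseteq> C \<and> \<not> S (Suc k) \<subseteq> C" if k: "k < 3" for k
  using k
 proof (rule below_3)
  have "R a ** R c \<noteq> R a ** R b"
  proof
   assume "R a ** R c = R a ** R b"
   then have "R a ** (R a ** R c) = R a ** (R a ** R b)" by simp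
   then have "R c = R b" using h by (simp add: matrix_mul_assoc R_involution_matrix)
   then have "p (R c *v c) c = p (R b *v c) c" by (simp only:)
   then show False using h by (simp add: R_self R_fixes aniso_def)
  qed
  then have "\<not> S (Suc 0) \<subseteq> {R a ** R b}" using S(5) by auto
  then show "\<exists>C. closedin zariski_affine C \<and> S 0 \<subseteq> C \<and> \<not> S (Suc 0) \<subseteq> C"
   using closedin_zariski_affine_singleton S(4) by (intro exI[of _ "{R a ** R b}"]) simp
  show "\<exists>C. closedin zariski_affine C \<and> S 1 \<subseteq> C \<and> \<not> S (Suc 1) \<subseteq> C"
   using S(6,7) cl[of b] by (intro exI[of _ "{g. p b (g *v a) = 0}"]) (auto simp: eval_nat_numeral)
  show "\<exists>C. closedin zariski_affine C \<and> S 2 \<subseteq> C \<and> \<not> S (Suc 2) \<subseteq> C"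
   using S(8,9) cl[of c] by (intro exI[of _ "{g. p c (g *v a) = 0}"]) (auto simp: eval_nat_numeral)
 qed
 then have sep: "\<exists>C. closedin ?O C \<and> S k \<subseteq> C \<and> \<not> S (Suc k) \<subseteq> C" if k: "k < 3" for k
  using k S(2)[of k] by (metis (no_types, lifting) closedin_subtopology_Int_closed le_inf_iff inf_commute)
 have "irreducible_in ?O (S k)" for k unfolding irreducible_in_subtopology using S(1,2) by blast
 then have "irr_chain ?O 3 (\<lambda>k. ?O closure_of S k)" using S(3) sep by (intro irr_chainI_closure) auto
 then show ?thesis by blast
qed

text \<open>Multiplying a chain in the orthogonal group by longer and longer products of one-parameter
 families of matrices, which relax the six equations for the Gram matrix of a basis one after the
 other, gives a chain in the space of all matrices that is longer by six.\<close>

lemma irr_chain_orthogonal_group_le: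
 assumes Z: "irr_chain (subtopology zariski_affine (orthogonal_group Q)) k Z" shows "k \<le> 3"
proof -
 let ?O = "orthogonal_group Q"
 obtain a b c where abc: "obasis a b c" using obasis_exists .
 note h = abc[unfolded obasis_def aniso_def]
 have comm: "p b a = 0" "p c a = 0" "p c b = 0" using h p_commute by metis+
 have Z': "irr_chain zariski_affine k Z"
  unfolding irr_chain_def
 proof (intro conjI allI impI)
  fix i assume i: "i \<le> k"
  have "closedin (subtopology zariski_affine ?O) (Z i)" using Z i by (simp add: irr_chain_def)
  then show "closedin zariski_affine (Z i)"
   using closedin_orthogonal_group closedin_closed_subtopology by blast
  show "irreducible_space (subtopology zariski_affine (Z i))"
   using irr_chain_irreducible[OF Z i] irreducible_in_subtopology[of "Z i" zariski_affine ?O] by blast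
 qed (use Z in \<open>auto simp: irr_chain_def\<close>)
 have ZO: "Z k \<subseteq> ?O" using irr_chain_irreducible[OF Z order_refl] by auto
 define A where "A x y = (1 / p y y) *\<^sub>R outer x (Q *v y)" for x y
 have A: "A x y *v z = (p y z / p y y) *\<^sub>R x" for x y z
  by (simp add: A_def scaleR_matrix_vector_assoc[symmetric] outer_mult_vec p_commute[of y z])
    (simp add: p_def inner_commute)
 define N where "N = (\<lambda>i::nat. [A a a, A b b, A c c, A a b, A a c, A b c] ! i)"
 define M where "M i s = mat 1 + s *\<^sub>R N i" for i s
 define S where "S = rec_nat (Z k) (\<lambda>i Y. {y ** M i s | y s. y \<in> Y})"
 have S0: "S 0 = Z k" and SSuc: "S (Suc i) = {y ** M i s | y s. y \<in> S i}" for i by (simp_all add: S_def)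
 have Sn: "S 1 = {y ** M 0 s | y s. y \<in> S 0}" "S 2 = {y ** M 1 s | y s. y \<in> S 1}"
  "S 3 = {y ** M 2 s | y s. y \<in> S 2}" "S 4 = {y ** M 3 s | y s. y \<in> S 3}"
  "S 5 = {y ** M 4 s | y s. y \<in> S 4}"
  using SSuc[of 0] SSuc[of 1] SSuc[of 2] SSuc[of 3] SSuc[of 4] by (simp_all add: eval_nat_numeral)
 have M0: "y ** M i 0 = y" for y i by (simp add: M_def)
 have mono: "S i \<subseteq> S (Suc i)" for i
 proof
  fix y assume "y \<in> S i"
  then show "y \<in> S (Suc i)" unfolding SSuc by (intro CollectI exI[of _ y] exI[of _ 0]) (simp add: M0)
 qed
 have irr: "irreducible_in zariski_affine (S i)" for i
 proof (induction i)
  case 0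
  then show ?case using irr_chain_irreducible[OF Z' order_refl] by (simp add: S0)
 next
  case (Suc i)
  have "poly_map (M i)"
   unfolding M_def[abs_def] by (intro polynomial_function_add polynomial_function_const polynomial_scaleR_const
     real_polynomial_function.intros(1) bounded_linear_ident)
  then have "continuous_map (subtopology zariski_affine UNIV) zariski_affine (\<lambda>s. y ** M i s)" for y :: "real^3^3"
   using polynomial_matrix_mult[of "\<lambda>_. y" "M i"]
   by (intro continuous_map_from_subtopology continuous_map_polynomial) auto
  moreover have "continuous_map (subtopology zariski_affine (S i)) zariski_affine (\<lambda>y. y ** M i s)" for s
   by (intro continuous_map_from_subtopology continuous_map_polynomial polynomial_matrix_mult
     polynomial_function_const polynomial_function_id)
  moreover have "irreducible_in zariski_affine (UNIV :: real set)"
   by (rule irreducible_in_zariski_affine) simp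
  ultimately have "irreducible_in zariski_affine {y ** M i s | y s. y \<in> S i \<and> s \<in> UNIV}"
   using Suc by (intro irreducible_in_image2) auto
  then show ?case by (simp add: SSuc)
 qed
 define G where "G x y g = p (g *v x) (g *v y)" for x y and g :: "real^3^3"
 have G: "G a a g = p a a" "G b b g = p b b" "G c c g = p c c" "G a b g = 0" "G a c g = 0" "G b c g = 0"
  if "g \<in> ?O" for g using orthogonal_groupD[OF that] h by (simp_all add: G_def)
 have Gcomm: "G x y g = G y x g" for x y g unfolding G_def by (rule p_commute)
 have polyG: "real_poly (G x y)" for x y unfolding G_def[abs_def]
  by (intro p_polynomial polynomial_mult_vec)
 have prod_apply: "(g ** M i s) *v x = g *v x + s *\<^sub>R (g *v (N i *v x))" for g i s x
  by (simp add: M_def matrix_vector_mul_assoc[symmetric] matrix_vector_mult_add_rdistrib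
    matrix_vector_right_distrib scaleR_matrix_vector_assoc[symmetric] matrix_vector_mult_scaleR)
 have N: "N 0 = A a a" "N 1 = A b b" "N 2 = A c c" "N 3 = A a b" "N 4 = A a c" "N 5 = A b c"
  by (simp_all add: N_def eval_nat_numeral)
 note upd = prod_apply N N(2)[unfolded One_nat_def] A h comm matrix_vector_mult_scaleR
 have K0: "G a a g = p a a \<and> G b b g = p b b \<and> G c c g = p c c \<and> G a b g = 0 \<and> G a c g = 0 \<and> G b c g = 0"
  if "g \<in> S 0" for g using that ZO G by (auto simp: S0)
 have K1: "G b b g = p b b \<and> G c c g = p c c \<and> G a b g = 0 \<and> G a c g = 0 \<and> G b c g = 0"
  if "g \<in> S 1" for g
 proof -
  obtain y s where y: "y \<in> S 0" "g = y ** M 0 s" using \<open>g \<in> S 1\<close> unfolding Sn(1) by blast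
  show ?thesis using K0[OF y(1)] unfolding y(2) G_def by (simp add: upd)
 qed
 have K2: "G c c g = p c c \<and> G a b g = 0 \<and> G a c g = 0 \<and> G b c g = 0" if "g \<in> S 2" for g
 proof -
  obtain y s where y: "y \<in> S 1" "g = y ** M 1 s" using \<open>g \<in> S 2\<close> unfolding Sn(2) by blast
  show ?thesis using K1[OF y(1)] unfolding y(2) G_def by (simp add: upd)
 qed
 have K3: "G a b g = 0 \<and> G a c g = 0 \<and> G b c g = 0" if "g \<in> S 3" for g
 proof -
  obtain y s where y: "y \<in> S 2" "g = y ** M 2 s" using \<open>g \<in> S 3\<close> unfolding Sn(3) by blast
  show ?thesis using K2[OF y(1)] unfolding y(2) G_def by (simp add: upd)
 qed
 have K4: "G a c g = 0 \<and> G b c g = 0" if "g \<in> S 4" for g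
 proof -
  obtain y s where y: "y \<in> S 3" "g = y ** M 3 s" using \<open>g \<in> S 4\<close> unfolding Sn(4) by blast
  show ?thesis using K3[OF y(1)] unfolding y(2) G_def by (simp add: upd)
 qed
 have K5: "G b c g * G a a g - G a b g * G a c g = 0" if "g \<in> S 5" for g
 proof -
  obtain y s where y: "y \<in> S 4" "g = y ** M 4 s" using \<open>g \<in> S 5\<close> unfolding Sn(5) by blast
  show ?thesis using K4[OF y(1)] unfolding y(2) G_def
   by (simp add: upd p_commute[of "y *v b" "y *v a"])
 qed
 obtain z where z: "z \<in> Z k" using irreducible_in_nonempty[OF irr_chain_irreducible[OF Z' order_refl]] by blast
 have zS: "z \<in> S i" for i by (induction i) (use z S0 mono in auto)
 have w: "z ** M i 2 \<in> S (Suc i)" for i using zS[of i] by (auto simp: SSuc)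
 have Gz: "G a a z = p a a" "G b b z = p b b" "G c c z = p c c" "G a b z = 0" "G a c z = 0" "G b c z = 0"
  using G z ZO by blast+
 have Gz': "G b a z = 0" "G c a z = 0" "G c b z = 0" using Gz Gcomm by metis+
 have sep: "\<exists>C. closedin zariski_affine C \<and> S i \<subseteq> C \<and> \<not> S (Suc i) \<subseteq> C" if i: "i < 6" for i
 proof -
  have crit: ?thesis if "real_poly f" "\<And>g. g \<in> S i \<Longrightarrow> f g = 0" "f (z ** M i 2) \<noteq> 0" for f
   using closedin_zariski_affine_zero[OF that(1)] that(2,3) w[of i] by (intro exI[of _ "{g. f g = 0}"]) auto
  have cst: "real_poly (\<lambda>g. G x y g - r)" for x y r
   by (intro real_polynomial_function_diff polyG real_polynomial_function.intros(2))
  consider "i = 0" | "i = 1" | "i = 2" | "i = 3" | "i = 4" | "i = 5" using i by linarith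
  then show ?thesis
  proof cases
   case 1
   show ?thesis
    by (rule crit[OF cst[of a a "p a a"]]) (use 1 K0 Gz h in \<open>auto simp: G_def upd\<close>)
  next
   case 2
   show ?thesis
    by (rule crit[OF cst[of b b "p b b"]]) (use 2 K1 Gz h in \<open>auto simp: G_def upd\<close>)
  next
   case 3
   show ?thesis
    by (rule crit[OF cst[of c c "p c c"]]) (use 3 K2 Gz h in \<open>auto simp: G_def upd\<close>)
  next
   case 4
   show ?thesis
    by (rule crit[OF cst[of a b 0]]) (use 4 K3 Gz h in \<open>auto simp: G_def upd\<close>)
  next
   case 5
   show ?thesis
    by (rule crit[OF cst[of a c 0]]) (use 5 K4 Gz h in \<open>auto simp: G_def upd\<close>)
  next
   case 6
   have "real_poly (\<lambda>g. G b c g * G a a g - G a b g * G a c g)"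
    by (intro real_polynomial_function_diff real_polynomial_function.intros(4) polyG)
   then show ?thesis
    by (rule crit) (use 6 K5 Gz Gz' h in \<open>auto simp: G_def upd\<close>)
  qed
 qed
 have "irr_chain zariski_affine 6 (\<lambda>i. zariski_affine closure_of S i)"
  using irr mono sep by (intro irr_chainI_closure) auto
 moreover have "Z k \<subseteq> zariski_affine closure_of S 0"
  using closure_of_subset[of "S 0" zariski_affine] by (simp add: S0)
 ultimately obtain E where "irr_chain (zariski_affine :: (real^3^3) topology) (k + 6) E"
  using irr_chain_append[OF Z'] by blast
 then have "k + 6 \<le> DIM(real^3^3)" by (rule irr_chain_zariski_affine)
 then show ?thesis by simp
qed

theorem krull_dim_orthogonal_group: "krull_dim (subtopology zariski_affine (orthogonal_group Q)) = 3"
proof (rule antisym)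
 show "krull_dim (subtopology zariski_affine (orthogonal_group Q)) \<le> 3"
  unfolding numeral_eq_enat by (rule krull_dim_le) (rule irr_chain_orthogonal_group_le)
 show "3 \<le> krull_dim (subtopology zariski_affine (orthogonal_group Q))"
  using irr_chain_orthogonal_group krull_dim_ge by (metis numeral_eq_enat)
qed

end

section \<open>The parameter space\<close>

lemma embedding_mapI:
 assumes h: "continuous_map X Y h" and g: "continuous_map (subtopology Y (h ` topspace X)) X g"
  and gh: "\<And>x. x \<in> topspace X \<Longrightarrow> g (h x) = x"
 shows "embedding_map X Y h"
proof -
 have "h ` topspace X \<subseteq> topspace Y" using h by (auto simp: continuous_map_def)
 then have "homeomorphic_maps X (subtopology Y (h ` topspace X)) h g"
  unfolding homeomorphic_maps_def using h g gh by (auto simp: continuous_map_in_subtopology inf.absorb2)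
 then show ?thesis unfolding embedding_map_def homeomorphic_map_maps by blast
qed

lemma polynomial_cross3 [intro]:
 fixes f g :: "'a::euclidean_space \<Rightarrow> real^3"
 assumes "poly_map f" "poly_map g"
 shows "poly_map (\<lambda>u. cross3 (f u) (g u))"
proof (rule polynomial_vecI)
 have c: "real_poly (\<lambda>u. f u $ k)" "real_poly (\<lambda>u. g u $ k)" for k
  using assms by auto
 have "\<forall>i. real_poly (\<lambda>u. cross3 (f u) (g u) $ i)"
  unfolding forall_3
  by (simp add: cross3_def) (intro conjI real_polynomial_function_diff real_polynomial_function.intros(4) c)
 then show "poly_map (\<lambda>u. cross3 (f u) (g u) $ i)" for i
  by (simp add: real_polynomial_function_eq)
qed

lemma polynomial_nth [intro]: "poly_map (\<lambda>y :: 'b::euclidean_space^'n::finite. y $ i)"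
 by (intro polynomial_function_bounded_linear bounded_linear_vec_nth)

lemma all_4: "(\<forall>i::4. P i) \<longleftrightarrow> P 0 \<and> P 1 \<and> P 2 \<and> P 3"
proof -
 have "(4::4) = 0" by (simp add: iszero_def[symmetric])
 note e = this
 show ?thesis by (subst forall_4, subst e, blast)
qed

context form
begin

definition axis_vec :: "real^3 \<Rightarrow> real^3 \<Rightarrow> real^3 \<Rightarrow> real^3" where
 "axis_vec a b c = p b c *\<^sub>R a - p a c *\<^sub>R b + p a b *\<^sub>R c"

definition pfaff :: "real^3 \<Rightarrow> real^3 \<Rightarrow> real^3 \<Rightarrow> real^3 \<Rightarrow> real" where
 "pfaff a b c d = p b c * p a d - p a c * p b d + p a b * p c d"

lemma pfaff_axis: "pfaff a b c d = p (axis_vec a b c) d"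
 by (simp add: pfaff_def axis_vec_def)

lemma pfaff_scale: "pfaff (s *\<^sub>R a) (t *\<^sub>R b) (u *\<^sub>R c) (v *\<^sub>R d) = s * t * u * v * pfaff a b c d"
 by (simp add: pfaff_def algebra_simps)

text \<open>The axis of the rotation \<open>- R c R b R a\<close>. In the Clifford algebra of the form, it is the vector part
 of the product \<open>c b a\<close>.\<close>

lemma axis_vec_fixed:
 assumes "aniso a" "aniso b" "aniso c"
 shows "R c *v (R b *v (R a *v axis_vec a b c)) = - axis_vec a b c"
proof -
 let ?w = "axis_vec a b c"
 have comm: "p b a = p a b" "p c a = p a c" "p c b = p b c" by (rule p_commute)+
 have "p a ?w = p b c * p a a" by (simp add: axis_vec_def comm)
 then have 1: "R a *v ?w = ?w - (2 * p b c) *\<^sub>R a" using assms(1) by (simp add: R_apply aniso_def)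
 have "p b (?w - (2 * p b c) *\<^sub>R a) = - p a c * p b b" by (simp add: axis_vec_def comm)
 then have 2: "R b *v (?w - (2 * p b c) *\<^sub>R a) = ?w - (2 * p b c) *\<^sub>R a + (2 * p a c) *\<^sub>R b"
  using assms(2) by (simp add: R_apply aniso_def)
 have 3: "?w - (2 * p b c) *\<^sub>R a + (2 * p a c) *\<^sub>R b = - ?w + (2 * p a b) *\<^sub>R c"
  by (simp add: axis_vec_def vec_eq_iff algebra_simps)
 have "p c (- ?w + (2 * p a b) *\<^sub>R c) = p a b * p c c" by (simp add: axis_vec_def comm)
 then have "R c *v (- ?w + (2 * p a b) *\<^sub>R c) = - ?w"
  using assms(3) by (simp add: R_apply aniso_def del: p_linear)
 then show ?thesis by (simp add: 1 2 3)
qed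

lemma fixed_vector_axis:
 assumes ni: "aniso a" "aniso b" "aniso c"
  and fx: "R c *v (R b *v (R a *v w)) = - w" and ne: "axis_vec a b c \<noteq> 0"
 obtains t where "w = t *\<^sub>R axis_vec a b c"
proof -
 have comm: "p b a = p a b" "p c a = p a c" "p c b = p b c" by (rule p_commute)+
 define \<alpha> \<beta> \<gamma> where d: "\<alpha> = p a w / p a a" "\<beta> = p b (R a *v w) / p b b" "\<gamma> = p c w / p c c"
 have "R b *v (R a *v w) = R c *v (R c *v (R b *v (R a *v w)))" using R_involution[OF ni(3)] by simp
 also have "\<dots> = - (R c *v w)" using fx matrix_vector_mult_scaleR[of "R c" "-1" w] by simp
 finally have "w - (2 * \<alpha>) *\<^sub>R a - (2 * \<beta>) *\<^sub>R b = - (w - (2 * \<gamma>) *\<^sub>R c)"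
  by (simp add: R_apply[of b] d) (simp add: R_apply)
 then have "2 *\<^sub>R w = 2 *\<^sub>R (\<alpha> *\<^sub>R a + \<beta> *\<^sub>R b + \<gamma> *\<^sub>R c)"
  by (simp add: scaleR_2 algebra_simps)
 then have w: "w = \<alpha> *\<^sub>R a + \<beta> *\<^sub>R b + \<gamma> *\<^sub>R c" by simp
 have "p a w = \<alpha> * p a a" "p c w = \<gamma> * p c c" using ni by (simp_all add: d aniso_def)
 then have 1: "\<beta> * p a b + \<gamma> * p a c = 0" "\<alpha> * p a c + \<beta> * p b c = 0"
  using arg_cong[OF w, of "p a"] arg_cong[OF w, of "p c"] by (simp_all add: comm)
 have "p b (R a *v w) = \<beta> * p b b" using ni by (simp add: d aniso_def)
 moreover have "p b (R a *v w) = p b w - 2 * \<alpha> * p a b" by (simp add: R_apply d comm)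
 ultimately have 2: "\<gamma> * p b c = \<alpha> * p a b" using arg_cong[OF w, of "p b"] by (simp add: comm)
 have "p b c \<noteq> 0 \<or> p a c \<noteq> 0 \<or> p a b \<noteq> 0" using ne by (auto simp: axis_vec_def)
 then have "\<exists>t. w = t *\<^sub>R axis_vec a b c"
 proof (elim disjE)
  assume z: "p b c \<noteq> 0"
  then have "\<beta> = - (\<alpha> / p b c) * p a c" "\<gamma> = \<alpha> / p b c * p a b" using 1(2) 2 by (auto simp: field_simps)
  then show ?thesis using z w by (intro exI[of _ "\<alpha> / p b c"]) (simp add: axis_vec_def algebra_simps)
 next
  assume z: "p a c \<noteq> 0"
  then have "\<alpha> = - (\<beta> / p a c) * p b c" "\<gamma> = - (\<beta> / p a c) * p a b" using 1 by (auto simp: field_simps)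
  then show ?thesis using z w by (intro exI[of _ "- \<beta> / p a c"]) (simp add: axis_vec_def algebra_simps)
 next
  assume z: "p a b \<noteq> 0"
  then have "\<alpha> = \<gamma> / p a b * p b c" "\<beta> = - (\<gamma> / p a b) * p a c" using 1(1) 2 by (auto simp: field_simps)
  then show ?thesis using z w by (intro exI[of _ "\<gamma> / p a b"]) (simp add: axis_vec_def algebra_simps)
 qed
 then show ?thesis using that by blast
qed

lemma axis_vec_zero:
 assumes "aniso a" "aniso b" "aniso c" and z: "axis_vec a b c = 0"
 shows "obasis a b c"
proof -
 have comm: "p b a = p a b" "p c a = p a c" "p c b = p b c" by (rule p_commute)+
 have "p a (axis_vec a b c) = p b c * p a a" "p c (axis_vec a b c) = p a b * p c c"
  by (simp_all add: axis_vec_def comm)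
 then have "p b c = 0" "p a b = 0" using z assms by (auto simp: aniso_def)
 moreover have "p a c *\<^sub>R b = 0" using z calculation by (simp add: axis_vec_def)
 then have "p a c = 0" using assms by (auto simp: aniso_def)
 ultimately show ?thesis using assms by (simp add: obasis_def)
qed

text \<open>If the axis vector of the first three reflections is nonzero, \<open>w\<close> is a multiple of it, so the condition on the last vector
 is that the Pfaffian vanishes. Otherwise the three vectors are orthogonal, \<open>B\<close> is the identity, and \<open>w\<close> can be any
 vector orthogonal to the last one.\<close>

lemma construction_exists_iff:
 "(\<exists>w S. construction Q a b c w d S) \<longleftrightarrow>
   aniso a \<and> aniso b \<and> aniso c \<and> aniso d \<and> pfaff a b c d = 0"
proof -
 have "(\<exists>w S. construction Q a b c w d S) \<longleftrightarrow> aniso a \<and> aniso b \<and> aniso c \<and> aniso d \<and>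
   (\<exists>w. w \<noteq> 0 \<and> R c *v (R b *v (R a *v w)) = - w \<and> p d w = 0)" (is "?L \<longleftrightarrow> ?M")
 proof -
  let ?B = "- (R c ** R b ** R a)"
  have B: "?B *v w = w \<longleftrightarrow> R c *v (R b *v (R a *v w)) = - w" for w
  proof -
   have "?B *v w = - (R c *v (R b *v (R a *v w)))"
    using matrix_vector_mult_diff_rdistrib[of 0 "R c ** R b ** R a" w]
    by (simp add: matrix_vector_mul_assoc matrix_mul_assoc)
   then show ?thesis by (metis minus_equation_iff)
  qed
  define S where "S i = (if i = 0 then R a else if i = 1 then R b else if i = 2 then R c
    else if i = 4 then R d else ?B ** R d)" for i :: 5
  have S: "S 0 = R a" "S 1 = R b" "S 2 = R c" "S 4 = R d" "S 3 = ?B ** R d" by (simp_all add: S_def)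
  show ?thesis
  proof
   assume ?L
   then show ?M by (auto simp: construction_def Let_def B aniso_def p_def)
  next
   assume M: ?M
   then obtain w where "w \<noteq> 0" "R c *v (R b *v (R a *v w)) = - w" "p d w = 0" by blast
   then have "construction Q a b c w d S"
    using M by (simp add: construction_def Let_def B S aniso_def p_def)
   then show ?L by blast
  qed
 qed
 also have "\<dots> \<longleftrightarrow> aniso a \<and> aniso b \<and> aniso c \<and> aniso d \<and> pfaff a b c d = 0"
 proof (intro conj_cong refl)
  assume ni: "aniso a" "aniso b" "aniso c" "aniso d"
  show "(\<exists>w. w \<noteq> 0 \<and> R c *v (R b *v (R a *v w)) = - w \<and> p d w = 0) \<longleftrightarrow> pfaff a b c d = 0" (is "?W \<longleftrightarrow> _")
  proof (cases "axis_vec a b c = 0")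
   case True
   then have abc: "obasis a b c" using axis_vec_zero ni by blast
   note h = abc[unfolded obasis_def]
   have "refl_word [c, b, a] *v w = - w" for w
   proof -
    have "obasis c b a" using h by (auto simp: obasis_def p_commute)
    then have "refl_word [c, b, a] *v w = (- mat 1) *v w" by (simp only: refl_word_minus_one)
    then show ?thesis using matrix_vector_mult_diff_rdistrib[of 0 "mat 1 :: real^3^3" w] by simp
   qed
   then have all: "R c *v (R b *v (R a *v w)) = - w" for w by (simp add: matrix_vector_mul_assoc matrix_mul_assoc)
   have dn: "Q *v d \<noteq> 0" using ni by (auto simp: aniso_def)
   have "\<exists>w. w \<noteq> 0 \<and> p d w = 0"
   proof (rule ccontr)
    obtain e f where "obasis d e f" using obasis_extend[OF ni(4)] .
    moreover assume "\<not> ?thesis"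
    ultimately have "e = 0 \<or> p d e \<noteq> 0" "p d e = 0" "p e e \<noteq> 0" by (auto simp: obasis_def aniso_def)
    then show False by auto
   qed
   then show ?thesis using all True by (simp add: pfaff_axis)
  next
   case False
   show ?thesis
   proof
    assume ?W
    then obtain w where w: "w \<noteq> 0" "R c *v (R b *v (R a *v w)) = - w" "p d w = 0" by blast
    obtain t where t: "w = t *\<^sub>R axis_vec a b c" using fixed_vector_axis[OF ni(1-3) w(2) False] .
    then have "p (axis_vec a b c) d = 0" using w by (auto simp: p_commute[of d])
    then show "pfaff a b c d = 0" by (simp add: pfaff_axis)
   next
    assume "pfaff a b c d = 0"
    then show ?W using False axis_vec_fixed[OF ni(1-3)]
     by (intro exI[of _ "axis_vec a b c"]) (simp add: pfaff_axis p_commute[of d])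
   qed
  qed
 qed
 finally show ?thesis .
qed

definition admissible :: "(real^3)^4 \<Rightarrow> bool" where
 "admissible y \<longleftrightarrow> (\<forall>i. aniso (y $ i)) \<and> pfaff (y $ 0) (y $ 1) (y $ 2) (y $ 3) = 0"

abbreviation reps :: "('i::finite \<Rightarrow> rp2) \<Rightarrow> (real^3)^'i" where
 "reps x \<equiv> \<chi> i. rep_rp2 (x i)"

lemma parameter_space_eq: "parameter_space Q = {x. admissible (reps x)}"
 unfolding parameter_space_def construction_exists_iff admissible_def all_4 by auto

lemma pfaff_poly: "real_poly (\<lambda>y :: (real^3)^4. pfaff (y $ 0) (y $ 1) (y $ 2) (y $ 3))"
 unfolding pfaff_def
 by (intro real_polynomial_function_diff real_polynomial_function.intros(3,4) p_polynomial polynomial_nth)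

lemma prod_4: "(\<Prod>i\<in>UNIV. f (i::4)) = f 0 * f 1 * f 2 * (f 3 :: real)"
proof -
 have "(UNIV :: 4 set) = {0, 1, 2, 3}" using all_4[of "\<lambda>i. i \<in> {0, 1, 2, 3}"] by auto
 then show ?thesis unfolding \<open>UNIV = {0, 1, 2, 3}\<close> by (simp add: mult.assoc)
qed

lemma pfaff_mh: "multihomogeneous (\<lambda>y :: (real^3)^4. pfaff (y $ 0) (y $ 1) (y $ 2) (y $ 3))"
 unfolding multihomogeneous_def
 by (rule exI[of _ "\<lambda>_. 1"]) (simp add: prod_4 pfaff_def algebra_simps)

lemma aniso_scale: "c \<noteq> 0 \<Longrightarrow> aniso (c *\<^sub>R v) \<longleftrightarrow> aniso v"
 by (simp add: aniso_def)

lemma aniso_nonzero: "aniso v \<Longrightarrow> v \<noteq> 0"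
 by (auto simp: aniso_def)

lemma aniso_rep_abs: "v \<noteq> 0 \<Longrightarrow> aniso (rep_rp2 (abs_rp2 v)) \<longleftrightarrow> aniso v"
 by (rule rep_abs_rp2[of v]) (auto simp: aniso_scale)

lemma admissible_abs:
 assumes "admissible y" shows "(\<lambda>i. abs_rp2 (y $ i)) \<in> parameter_space Q"
proof -
 have nz: "y $ i \<noteq> 0" for i using assms aniso_nonzero by (auto simp: admissible_def)
 have "pfaff (reps (\<lambda>i. abs_rp2 (y $ i)) $ 0) (reps (\<lambda>i. abs_rp2 (y $ i)) $ 1) (reps (\<lambda>i. abs_rp2 (y $ i)) $ 2)
   (reps (\<lambda>i. abs_rp2 (y $ i)) $ 3) = 0"
  using mh_zero_iff[OF pfaff_mh, of "\<lambda>i. y $ i"] nz assms by (simp add: admissible_def)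
 then show ?thesis using assms nz by (simp add: parameter_space_eq admissible_def aniso_rep_abs)
qed

lemma admissible_reps: "x \<in> parameter_space Q \<Longrightarrow> admissible (reps x)"
 by (simp add: parameter_space_eq)

subsection \<open>Irreducibility\<close>

definition generic_point :: "(real^3)^4 \<Rightarrow> 4 \<Rightarrow> real^3" where
 "generic_point y i = (if i = 3 then cross3 (Q *v axis_vec (y $ 0) (y $ 1) (y $ 2)) (y $ 3) else y $ i)"

definition generic_domain :: "((real^3)^4) set" where
 "generic_domain = {y. \<forall>i. aniso (generic_point y i)}"

definition generic_part :: "(4 \<Rightarrow> rp2) set" where
 "generic_part = (\<lambda>y i. abs_rp2 (generic_point y i)) ` generic_domain"

lemma polynomial_axis_vec:
 assumes "poly_map f" "poly_map g" "poly_map h"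
 shows "poly_map (\<lambda>u. axis_vec (f u) (g u) (h u))"
 unfolding axis_vec_def using assms
 by (intro polynomial_function_add polynomial_function_diff polynomial_function_mult)
   (auto simp: real_polynomial_function_eq[symmetric])

lemma polynomial_Q: "poly_map f \<Longrightarrow> poly_map (\<lambda>u. Q *v f u)"
 using polynomial_function_compose[of f "(*v) Q"] polynomial_function_bounded_linear[OF matrix_vector_mul_bounded_linear[of Q]]
 by (simp add: o_def)

lemma polynomial_generic_point: "poly_map (\<lambda>y. generic_point y i)"
 by (cases "i = 3") (auto simp: generic_point_def intro!: polynomial_cross3 polynomial_Q polynomial_axis_vec)

lemma open_aniso_family:
 assumes "\<And>i::'i::finite. poly_map (F i)"
 shows "openin zariski_affine {u::'a::euclidean_space. \<forall>i. aniso (F i u)}"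
proof -
 have "openin zariski_affine {u. aniso (F i u)}" for i
  unfolding aniso_def by (intro openin_zariski_affine_nonzero p_polynomial assms)
 then have "openin zariski_affine (\<Inter>i\<in>UNIV. {u. aniso (F i u)})" by (intro openin_INT2) auto
 moreover have "(\<Inter>i\<in>UNIV. {u. aniso (F i u)}) = {u. \<forall>i. aniso (F i u)}" by auto
 ultimately show ?thesis by simp
qed

lemma generic_point_admissible:
 assumes "y \<in> generic_domain" shows "admissible (\<chi> i. generic_point y i)"
proof -
 have "p (axis_vec (y $ 0) (y $ 1) (y $ 2)) (cross3 (Q *v axis_vec (y $ 0) (y $ 1) (y $ 2)) (y $ 3)) = 0"
  by (subst p_commute) (simp add: p_def dot_cross_self)
 then show ?thesis
  using assms by (simp add: admissible_def generic_domain_def pfaff_axis) (simp add: generic_point_def)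
qed

lemma generic_part_subset: "generic_part \<subseteq> parameter_space Q"
proof -
 have "(\<lambda>i. abs_rp2 (generic_point y i)) \<in> parameter_space Q" if "y \<in> generic_domain" for y
  using admissible_abs[OF generic_point_admissible[OF that]] by simp
 then show ?thesis by (auto simp: generic_part_def)
qed

lemma admissible_generic:
 assumes "admissible y" "axis_vec (y $ 0) (y $ 1) (y $ 2) \<noteq> 0"
 shows "(\<lambda>i. abs_rp2 (y $ i)) \<in> generic_part"
proof -
 define v where "v = Q *v axis_vec (y $ 0) (y $ 1) (y $ 2)"
 define u where "u = (1 / (v \<bullet> v)) *\<^sub>R cross3 (y $ 3) v"
 define z where "z = (\<chi> i. if i = 3 then u else y $ i)"
 have v: "v \<noteq> 0" using assms(2) by (simp add: v_def)
 have "p (y $ 3) (axis_vec (y $ 0) (y $ 1) (y $ 2)) = 0"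
  using assms(1) by (subst p_commute) (simp add: admissible_def pfaff_axis)
 then have "y $ 3 \<bullet> v = 0" by (simp add: p_def v_def)
 then have "cross3 v u = y $ 3"
  using v by (simp add: u_def cross_mult_right Lagrange inner_commute)
 then have gp: "generic_point z i = y $ i" for i by (simp add: generic_point_def z_def v_def)
 then have "z \<in> generic_domain" using assms(1) by (simp add: generic_domain_def admissible_def)
 then show ?thesis unfolding generic_part_def by (rule image_eqI[rotated]) (simp add: gp)
qed

text \<open>Where the first three vectors are mutually orthogonal, the fourth one is not restricted. Such a
 configuration is a limit of generic ones, along a curve on which one of the three is moved.\<close>

lemma admissible_curve:
 assumes y: "admissible y" and ax: "axis_vec (y $ 0) (y $ 1) (y $ 2) = 0"
 obtains v where "\<And>t. pfaff ((y + t *\<^sub>R v) $ 0) ((y + t *\<^sub>R v) $ 1) ((y + t *\<^sub>R v) $ 2) ((y + t *\<^sub>R v) $ 3) = 0"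
  "\<And>t. t \<noteq> 0 \<Longrightarrow> axis_vec ((y + t *\<^sub>R v) $ 0) ((y + t *\<^sub>R v) $ 1) ((y + t *\<^sub>R v) $ 2) \<noteq> 0"
proof -
 define a b c d where n: "a = y $ 0" "b = y $ 1" "c = y $ 2" "d = y $ 3"
 have ob: "obasis a b c" using y ax unfolding n by (intro axis_vec_zero) (auto simp: admissible_def)
 note h = ob[unfolded obasis_def aniso_def]
 have comm: "p b a = 0" "p c a = 0" "p c b = 0" using h p_commute by metis+
 show ?thesis
 proof (cases "p c d = 0 \<and> p a d = 0")
  case True
  define v :: "(real^3)^4" where "v = axis 0 b"
  have v: "(y + t *\<^sub>R v) $ 0 = a + t *\<^sub>R b" "(y + t *\<^sub>R v) $ 1 = b" "(y + t *\<^sub>R v) $ 2 = c" "(y + t *\<^sub>R v) $ 3 = d" for t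
   by (simp_all add: v_def axis_def n)
  have "axis_vec (a + t *\<^sub>R b) b c = (t * p b b) *\<^sub>R c" for t using h by (simp add: axis_vec_def comm)
  moreover have "c \<noteq> 0" using h by auto
  ultimately show ?thesis using that[of v] True h unfolding v pfaff_axis by auto
 next
  case False
  define e where "e = (p c d / p c c) *\<^sub>R c - (p a d / p a a) *\<^sub>R a"
  define v :: "(real^3)^4" where "v = axis 1 e"
  have v: "(y + t *\<^sub>R v) $ 0 = a" "(y + t *\<^sub>R v) $ 1 = b + t *\<^sub>R e" "(y + t *\<^sub>R v) $ 2 = c" "(y + t *\<^sub>R v) $ 3 = d" for t
   by (simp_all add: v_def axis_def n)
  have w: "axis_vec a (b + t *\<^sub>R e) c = (t * p c d) *\<^sub>R a - (t * p a d) *\<^sub>R c" for t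
   using h by (simp add: axis_vec_def comm e_def)
  have "axis_vec a (b + t *\<^sub>R e) c \<noteq> 0" if "t \<noteq> 0" for t
  proof
   assume "axis_vec a (b + t *\<^sub>R e) c = 0"
   then have "p a ((t * p c d) *\<^sub>R a - (t * p a d) *\<^sub>R c) = 0" "p c ((t * p c d) *\<^sub>R a - (t * p a d) *\<^sub>R c) = 0"
    using w by simp_all
   then show False using that h comm False by auto
  qed
  moreover have "pfaff a (b + t *\<^sub>R e) c d = 0" for t unfolding pfaff_axis w by simp
  ultimately show ?thesis using that[of v] unfolding v by blast
 qed
qed

lemma parameter_space_closure: "parameter_space Q \<subseteq> zariski closure_of generic_part"
proof
 fix x assume x: "x \<in> parameter_space Q"
 let ?y = "reps x"
 have y: "admissible ?y" by (rule admissible_reps[OF x])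
 have xy: "x = (\<lambda>i. abs_rp2 (?y $ i))" by simp
 show "x \<in> zariski closure_of generic_part"
 proof (cases "axis_vec (?y $ 0) (?y $ 1) (?y $ 2) = 0")
  case False
  then have "x \<in> generic_part" using admissible_generic[OF y] xy by simp
  then show ?thesis using closure_of_subset[of generic_part zariski] by auto
 next
  case True
  obtain v where v: "\<And>t. pfaff ((?y + t *\<^sub>R v) $ 0) ((?y + t *\<^sub>R v) $ 1) ((?y + t *\<^sub>R v) $ 2) ((?y + t *\<^sub>R v) $ 3) = 0"
   "\<And>t. t \<noteq> 0 \<Longrightarrow> axis_vec ((?y + t *\<^sub>R v) $ 0) ((?y + t *\<^sub>R v) $ 1) ((?y + t *\<^sub>R v) $ 2) \<noteq> 0"
   using admissible_curve[OF y True] by blast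
  define F where "F i t = (?y + t *\<^sub>R v) $ i" for i and t :: real
  have F: "poly_map (F i)" for i
  proof -
   have "F i = (\<lambda>t. ?y $ i + t *\<^sub>R (v $ i))" by (rule ext) (simp add: F_def)
   then show ?thesis
    by (simp add: polynomial_function_add polynomial_function_const polynomial_scaleR_const
      real_polynomial_function.intros(1) bounded_linear_ident)
  qed
  define U where "U = {t. \<forall>i. aniso (F i t)}"
  have U: "openin zariski_affine U" unfolding U_def by (rule open_aniso_family) (rule F)
  have U0: "0 \<in> U" using y by (simp add: U_def F_def admissible_def)
  have cont: "continuous_map (subtopology zariski_affine U) zariski (\<lambda>t i. abs_rp2 (F i t))"
   using F aniso_nonzero by (intro continuous_map_abs_polynomial) (auto simp: U_def)
  have "\<exists>z. z \<in> generic_part \<and> z \<in> T" if T: "x \<in> T" "openin zariski T" for T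
  proof -
   have "openin (subtopology zariski_affine U) {t \<in> U. (\<lambda>i. abs_rp2 (F i t)) \<in> T}"
    using cont T(2) by (simp add: continuous_map_def)
   then have "openin zariski_affine {t \<in> U. (\<lambda>i. abs_rp2 (F i t)) \<in> T}"
    using U openin_open_subtopology by blast
   then have op: "open {t \<in> U. (\<lambda>i. abs_rp2 (F i t)) \<in> T}" by (rule open_if_zariski_open)
   have "0 \<in> {t \<in> U. (\<lambda>i. abs_rp2 (F i t)) \<in> T}" using U0 T(1) by (simp add: F_def)
   then obtain e where e: "e > 0" "ball 0 e \<subseteq> {t \<in> U. (\<lambda>i. abs_rp2 (F i t)) \<in> T}"
    using op open_contains_ball by blast
   have "e / 2 \<in> ball 0 e" using e(1) by simp
   then have t: "e / 2 \<in> U" "(\<lambda>i. abs_rp2 (F i (e / 2))) \<in> T" using e(2) by blast+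
   have "admissible (?y + (e / 2) *\<^sub>R v)" using t(1) v(1)[of "e / 2"] by (simp add: admissible_def U_def F_def)
   then have "(\<lambda>i. abs_rp2 (F i (e / 2))) \<in> generic_part"
    using admissible_generic[of "?y + (e / 2) *\<^sub>R v"] v(2)[of "e / 2"] e(1) by (simp add: F_def)
   then show ?thesis using t(2) by blast
  qed
  then show ?thesis by (auto simp: closure_of_def)
 qed
qed

lemma obasis_unit:
 obtains a b c where "obasis a b c" "p a a = 1 \<or> p a a = -1" "p b b = 1 \<or> p b b = -1" "p c c = 1 \<or> p c c = -1"
proof -
 obtain a b c where h: "obasis a b c" using obasis_exists .
 define u where "u v = (1 / sqrt \<bar>p v v\<bar>) *\<^sub>R v" for v
 have n: "p (u v) (u v) = 1 \<or> p (u v) (u v) = -1" if "aniso v" for v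
 proof -
  have "p (u v) (u v) = p v v / \<bar>p v v\<bar>" by (simp add: u_def power2_eq_square[symmetric] field_simps)
  then show ?thesis using that by (auto simp: aniso_def abs_if)
 qed
 have "p (u v) (u v) \<noteq> 0" if "aniso v" for v using n[OF that] by auto
 moreover have "p (u v) (u v') = 0" if "p v v' = 0" for v v' using that by (simp add: u_def)
 ultimately have "obasis (u a) (u b) (u c)" using h by (simp add: obasis_def aniso_def)
 then show ?thesis using that n h by (auto simp: obasis_def)
qed

subsection \<open>An explicit family of configurations\<close>

text \<open>In terms of an orthogonal basis, a configuration whose first vector is the first basis vector.\<close>

definition family :: "real^3 \<Rightarrow> real^3 \<Rightarrow> real^3 \<Rightarrow> 4 \<Rightarrow> real \<times> real \<times> real \<times> real \<Rightarrow> real^3" where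
 "family a b c i u = (case u of (s, t, r, h) \<Rightarrow>
   if i = 0 then a else if i = 1 then a + s *\<^sub>R b else if i = 2 then a + t *\<^sub>R b + r *\<^sub>R c
   else (r * p c c) *\<^sub>R a + (r * p c c * h) *\<^sub>R b - ((p a a + s * t * p b b) + (t - s) * p b b * h) *\<^sub>R c)"

lemma family_simps:
 "family a b c 0 (s, t, r, h) = a" "family a b c 1 (s, t, r, h) = a + s *\<^sub>R b"
 "family a b c 2 (s, t, r, h) = a + t *\<^sub>R b + r *\<^sub>R c"
 "family a b c 3 (s, t, r, h) = (r * p c c) *\<^sub>R a + (r * p c c * h) *\<^sub>R b
   - ((p a a + s * t * p b b) + (t - s) * p b b * h) *\<^sub>R c"
 by (simp_all add: family_def)

lemma obasis_commuted:
 assumes "obasis a b c" shows "p b a = 0" "p c a = 0" "p c b = 0"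
 using assms p_commute unfolding obasis_def by metis+

lemma family_gram:
 assumes h: "obasis a b c"
 shows "p (family a b c 0 (s, t, r, h)) (family a b c 0 (s, t, r, h)) = p a a"
  "p (family a b c 1 (s, t, r, h)) (family a b c 1 (s, t, r, h)) = p a a + s\<^sup>2 * p b b"
  "p (family a b c 2 (s, t, r, h)) (family a b c 2 (s, t, r, h)) = p a a + t\<^sup>2 * p b b + r\<^sup>2 * p c c"
  "p (family a b c 3 (s, t, r, h)) (family a b c 3 (s, t, r, h)) = (r * p c c)\<^sup>2 * p a a + (r * p c c * h)\<^sup>2 * p b b
    + ((p a a + s * t * p b b) + (t - s) * p b b * h)\<^sup>2 * p c c"
  "p (family a b c 0 (s, t, r, h)) (family a b c 1 (s, t, r, h)) = p a a"
  "p (family a b c 0 (s, t, r, h)) (family a b c 2 (s, t, r, h)) = p a a"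
  "p (family a b c 1 (s, t, r, h)) (family a b c 2 (s, t, r, h)) = p a a + s * t * p b b"
  "p (family a b c 0 (s, t, r, h)) (family a b c 3 (s, t, r, h)) = r * p c c * p a a"
  "p (family a b c 1 (s, t, r, h)) (family a b c 3 (s, t, r, h)) = r * p c c * (p a a + s * h * p b b)"
  "p (family a b c 2 (s, t, r, h)) (family a b c 3 (s, t, r, h)) = r * p c c * (p a a + t * h * p b b)
    - r * p c c * ((p a a + s * t * p b b) + (t - s) * p b b * h)"
 unfolding family_simps by (simp_all add: h[unfolded obasis_def] obasis_commuted[OF h] power2_eq_square algebra_simps)

lemma family_admissible:
 assumes "obasis a b c" "\<forall>i. aniso (family a b c i u)" shows "admissible (\<chi> i. family a b c i u)"
proof -
 obtain s t r h where "u = (s, t, r, h)" by (cases u) auto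
 then show ?thesis
  using assms by (simp add: admissible_def pfaff_def family_gram) (simp add: algebra_simps)
qed

lemma family_polynomial: "poly_map (family a b c i)"
proof -
 have [intro]: "real_poly (\<lambda>u::real \<times> real \<times> real \<times> real. fst u)"
  "real_poly (\<lambda>u::real \<times> real \<times> real \<times> real. fst (snd u))"
  "real_poly (\<lambda>u::real \<times> real \<times> real \<times> real. fst (snd (snd u)))"
  "real_poly (\<lambda>u::real \<times> real \<times> real \<times> real. snd (snd (snd u)))"
  by (intro real_polynomial_function.intros(1) bounded_linear_intros)+
 have "poly_map (\<lambda>u :: real \<times> real \<times> real \<times> real.
   if i = 0 then a else if i = 1 then a + fst u *\<^sub>R b else if i = 2 then a + fst (snd u) *\<^sub>R b + fst (snd (snd u)) *\<^sub>R c
   else (fst (snd (snd u)) * p c c) *\<^sub>R a + (fst (snd (snd u)) * p c c * snd (snd (snd u))) *\<^sub>R b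
    - ((p a a + fst u * fst (snd u) * p b b) + (fst (snd u) - fst u) * p b b * snd (snd (snd u))) *\<^sub>R c)"
  by (cases "i = 0"; cases "i = 1"; cases "i = 2"; simp;
    intro polynomial_function_add polynomial_function_diff polynomial_scaleR_const polynomial_function_const
     real_polynomial_function.intros(2,3,4) real_polynomial_function_diff; fast)
 then show ?thesis by (rule back_subst[of poly_map]) (auto simp: family_def split: prod.splits)
qed

text \<open>Parameter values for which all vectors are anisotropic, whatever the signature of the form.\<close>

lemma family_aniso:
 assumes "obasis a b c" and unit: "p a a = 1 \<or> p a a = -1" "p b b = 1 \<or> p b b = -1" "p c c = 1 \<or> p c c = -1"
  and u: "u \<in> {(2,2,5,2), (2,2,5,3), (2,2,6,2), (2,3,5,2), (3,2,5,2)}"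
 shows "\<forall>i. aniso (family a b c i u)"
 using unit u unfolding all_4 aniso_def
 by (auto simp: family_gram[OF assms(1)])

subsection \<open>Dimension\<close>

lemma topspace_parameter [simp]: "topspace (parameter_topology Q) = parameter_space Q"
 by (simp add: parameter_topology_def)

lemma parameter_space_nonempty: "\<exists>y. y \<in> generic_domain"
proof -
 obtain a b c where abc: "obasis a b c" "p a a = 1 \<or> p a a = -1" "p b b = 1 \<or> p b b = -1" "p c c = 1 \<or> p c c = -1"
  using obasis_unit .
 let ?u = "(2,2,5,2) :: real \<times> real \<times> real \<times> real"
 let ?y = "\<chi> i. family a b c i ?u"
 have "admissible ?y" using family_admissible[OF abc(1)] family_aniso[OF abc, of ?u] by blast
 moreover have "axis_vec (?y $ 0) (?y $ 1) (?y $ 2) \<noteq> 0"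
 proof
  assume "axis_vec (?y $ 0) (?y $ 1) (?y $ 2) = 0"
  then have "obasis (?y $ 0) (?y $ 1) (?y $ 2)" using \<open>admissible ?y\<close> by (intro axis_vec_zero) (auto simp: admissible_def)
  then show False using abc(2) family_gram(5)[OF abc(1), of 2 2 5 2] by (auto simp: obasis_def)
 qed
 ultimately have "(\<lambda>i. abs_rp2 (?y $ i)) \<in> generic_part" by (rule admissible_generic)
 then show ?thesis by (auto simp: generic_part_def)
qed

theorem irreducible_parameter_space: "irreducible_in zariski (parameter_space Q)"
proof -
 have op: "openin zariski_affine generic_domain"
  unfolding generic_domain_def by (rule open_aniso_family) (rule polynomial_generic_point)
 then have "open generic_domain" by (rule open_if_zariski_open)
 then have "interior generic_domain \<noteq> {}" using parameter_space_nonempty by (auto simp: interior_open)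
 moreover have "continuous_map (subtopology zariski_affine generic_domain) zariski (\<lambda>y i. abs_rp2 (generic_point y i))"
  by (intro continuous_map_abs_polynomial polynomial_generic_point) (auto simp: generic_domain_def dest: aniso_nonzero)
 ultimately have "irreducible_in zariski generic_part"
  unfolding generic_part_def by (intro irreducible_in_polynomial_image)
 then show ?thesis using generic_part_subset parameter_space_closure by (rule irreducible_in_between)
qed

text \<open>Normalising the vectors of a configuration by linear functionals embeds the part of the parameter
 space near a given configuration into an affine subspace of dimension 8, where it is contained in a
 hypersurface. A chain in it is prolonged by this affine subspace and by larger ones.\<close>

lemma irr_chain_parameter_space_le:
 assumes Z: "irr_chain (parameter_topology Q) k Z" shows "k \<le> 7"
proof -
 obtain x where x: "x \<in> Z 0" using irreducible_in_nonempty[OF irr_chain_irreducible[OF Z, of 0]] by auto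
 have xP: "x \<in> parameter_space Q" using x irr_chain_irreducible[OF Z, of 0] by auto
 define m where "m i = rep_rp2 (x i)" for i
 have m: "aniso (m i)" for i using admissible_reps[OF xP] by (auto simp: admissible_def m_def)
 define l where "l i (y :: (real^3)^4) = p (m i) (y $ i)" for i y
 define d where "d y = (\<Prod>i\<in>UNIV. l i y)" for y
 define N where "N y = (\<chi> i. (\<Prod>j\<in>UNIV - {i}. l j y) *\<^sub>R (y $ i))" for y
 define D where "D = {z. \<forall>i. l i (reps z) \<noteq> 0}"
 have lpoly: "real_poly (l i)" for i
  unfolding l_def[abs_def] by (intro p_polynomial polynomial_function_const polynomial_nth)
 have lsc: "l j (\<chi> i. t i *\<^sub>R y $ i) = t j * l j y" for j t y by (simp add: l_def)
 have lmh: "mh_deg (\<lambda>j. if j = i then 1 else 0) (l i)" for i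
  unfolding mh_deg_def by (simp add: lsc prod_delta_power del: power_0 power_one_right)
 have dsc: "d (\<chi> i. t i *\<^sub>R y $ i) = (\<Prod>i\<in>UNIV. t i ^ 1) * d y" for t y
  by (simp add: d_def lsc prod.distrib)
 have Nsc: "N (\<chi> i. t i *\<^sub>R y $ i) = (\<Prod>i\<in>UNIV. t i ^ 1) *\<^sub>R N y" for t y
 proof -
  have "(\<Prod>j\<in>UNIV - {i}. l j (\<chi> i. t i *\<^sub>R y $ i)) * t i = (\<Prod>i\<in>UNIV. t i) * (\<Prod>j\<in>UNIV - {i}. l j y)" for i
   by (simp add: lsc prod.distrib prod.remove[of UNIV i t])
  then show ?thesis by (simp add: N_def vec_eq_iff mult.assoc[symmetric])
 qed
 have dpoly: "real_poly d" unfolding d_def[abs_def] by (intro real_polynomial_function_prod lpoly) auto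
 have Npoly: "poly_map N"
  by (rule polynomial_vecI) (auto simp: N_def real_polynomial_function_eq[symmetric]
    intro!: polynomial_function_mult polynomial_nth real_polynomial_function_prod lpoly)
 have Ddef: "z \<in> D \<longleftrightarrow> d (reps z) \<noteq> 0" for z by (simp add: D_def d_def)
 define h where "h z = (1 / d (reps z)) *\<^sub>R N (reps z)" for z
 have hi: "h z $ i = (1 / l i (reps z)) *\<^sub>R rep_rp2 (z i)" if "z \<in> D" for z i
  using that by (simp add: h_def N_def d_def D_def prod.remove[of UNIV i])
 have openD: "openin zariski D"
 proof -
  have "mh_deg (\<lambda>_. 1) d" unfolding mh_deg_def using dsc by simp
  then have "openin zariski {z. d (reps z) \<noteq> 0}" using dpoly multihomogeneousI by (intro openin_zariski_nonzero) auto
  then show ?thesis by (simp add: Ddef Collect_mem_eq flip: Ddef)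
 qed
 have cont: "continuous_map (subtopology zariski D) zariski_affine h"
  unfolding h_def[abs_def] using dsc
  by (intro continuous_map_rational[where d = "\<lambda>_. 1"] Npoly dpoly Nsc) (auto simp: mh_deg_def Ddef)
 let ?X = "parameter_topology Q"
 let ?D = "D \<inter> parameter_space Q"
 have XD: "subtopology ?X ?D = subtopology zariski ?D"
  by (simp add: parameter_topology_def subtopology_subtopology inf.absorb2)
 have emb: "embedding_map (subtopology ?X ?D) zariski_affine h"
 proof (rule embedding_mapI)
  show "continuous_map (subtopology ?X ?D) zariski_affine h"
   unfolding XD using continuous_map_from_subtopology[OF cont, of ?D] by (simp add: subtopology_subtopology inf.absorb2)
  show inv: "(\<lambda>i. abs_rp2 (h z $ i)) = z" if "z \<in> topspace (subtopology ?X ?D)" for z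
   using that by (auto simp: hi D_def)
  have hD: "h ` topspace (subtopology ?X ?D) \<subseteq> {y. \<forall>i. y $ i \<noteq> 0}"
   by (auto simp: hi D_def)
  have "continuous_map (subtopology zariski_affine {y. \<forall>i. y $ i \<noteq> 0}) zariski (\<lambda>(y :: (real^3)^4) i. abs_rp2 (y $ i))"
   by (intro continuous_map_abs_polynomial polynomial_nth) auto
  then have "continuous_map (subtopology zariski_affine (h ` topspace (subtopology ?X ?D))) zariski (\<lambda>y i. abs_rp2 (y $ i))"
   using continuous_map_from_subtopology_mono[OF _ hD] by blast
  moreover have "(\<lambda>y i. abs_rp2 (y $ i)) ` (h ` topspace (subtopology ?X ?D)) \<subseteq> ?D"
   using inv by auto
  ultimately show "continuous_map (subtopology zariski_affine (h ` topspace (subtopology ?X ?D)))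
   (subtopology ?X ?D) (\<lambda>y i. abs_rp2 (y $ i))"
   unfolding XD by (simp add: continuous_map_in_subtopology image_subset_iff Pi_iff)
 qed
 have DX: "openin ?X ?D" using openD by (auto simp: parameter_topology_def openin_subtopology)
 have xD: "x \<in> ?D" using xP m by (simp add: D_def l_def m_def[symmetric] aniso_def)
 define C where "C i = zariski_affine closure_of (h ` (?D \<inter> Z i))" for i
 have C: "irr_chain zariski_affine k C"
  unfolding C_def using x xD by (intro irr_chain_local_embedding[OF Z DX _ emb]) auto
 \<comment> \<open>The affine subspaces.\<close>
 define J where "J j = (if j = 0 then UNIV else if j = 1 then {1,2,3} else if j = 2 then {2,3} else if j = 3 then {3} else ({} :: 4 set))"
  for j :: nat
 define A where "A j = {y. \<forall>i\<in>J j. l i y = 1}" for j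
 define pr where "pr j y = (\<chi> i. if i \<in> J j then y $ i + ((1 - l i y) / p (m i) (m i)) *\<^sub>R m i else y $ i)" for j y
 have prA: "pr j y \<in> A j" for j y using m by (simp add: A_def pr_def l_def aniso_def)
 have prid: "pr j y = y" if "y \<in> A j" for j y using that by (simp add: A_def pr_def vec_eq_iff)
 have rangeA: "pr j ` UNIV = A j" for j
 proof (intro equalityI subsetI)
  fix y assume "y \<in> A j"
  then show "y \<in> pr j ` UNIV" using prid[of y j] by (metis rangeI)
 qed (use prA in auto)
 have prpoly: "poly_map (pr j)" for j
 proof (rule polynomial_vecI)
  fix i
  have "poly_map (\<lambda>y. y $ i + ((1 - l i y) * (1 / p (m i) (m i))) *\<^sub>R m i)"
   by (intro polynomial_function_add polynomial_nth polynomial_scaleR_const real_polynomial_function.intros(2,4)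
     real_polynomial_function_diff lpoly)
  then show "poly_map (\<lambda>y. pr j y $ i)" by (cases "i \<in> J j") (simp_all add: pr_def polynomial_nth)
 qed
 have irrA: "irreducible_in zariski_affine (A j)" for j
 proof -
  have "continuous_map (subtopology zariski_affine UNIV) zariski_affine (pr j)"
   using continuous_map_polynomial[OF prpoly] by simp
  then show ?thesis using irreducible_in_polynomial_image[of UNIV zariski_affine "pr j"] rangeA by simp
 qed
 define pf where "pf = (\<lambda>y :: (real^3)^4. pfaff (y $ 0) (y $ 1) (y $ 2) (y $ 3))"
 have pfpoly: "real_poly pf" unfolding pf_def by (rule pfaff_poly)
 have "h z \<in> {y. pf y = 0} \<inter> A 0" if z: "z \<in> ?D" for z
 proof -
  have "pfaff (rep_rp2 (z 0)) (rep_rp2 (z 1)) (rep_rp2 (z 2)) (rep_rp2 (z 3)) = 0"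
   using z admissible_reps[of z] by (simp add: admissible_def)
  then have "pf (h z) = 0" using z by (simp add: pf_def hi pfaff_scale)
  moreover have "h z \<in> A 0" using z by (simp add: A_def hi l_def) (simp add: D_def l_def)
  ultimately show ?thesis by simp
 qed
 then have "h ` (?D \<inter> Z k) \<subseteq> {y. pf y = 0} \<inter> A 0" by blast
 moreover have clA: "closedin zariski_affine (A j)" for j
 proof -
  have "closedin zariski_affine {y. l i y - 1 = 0}" for i
   by (intro closedin_zariski_affine_zero real_polynomial_function_diff lpoly real_polynomial_function.intros(2))
  then have "closedin zariski_affine (topspace zariski_affine \<inter> (\<Inter>i\<in>J j. {y. l i y - 1 = 0}))"
   using closedin_topspace[of "zariski_affine :: ((real^3)^4) topology"]
   by (cases "J j = {}") (auto intro!: closedin_Int closedin_INT)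
  moreover have "topspace zariski_affine \<inter> (\<Inter>i\<in>J j. {y. l i y - 1 = 0}) = A j" by (auto simp: A_def)
  ultimately show ?thesis by simp
 qed
 ultimately have Ck: "C k \<subseteq> {y. pf y = 0}" "C k \<subseteq> A 0"
  using closedin_zariski_affine_zero[OF pfpoly] closure_of_minimal unfolding C_def by (metis le_inf_iff)+
 define S where "S j = (if j = 0 then C k else A (j - 1))" for j
 have "irr_chain zariski_affine 5 (\<lambda>j. zariski_affine closure_of S j)"
 proof (rule irr_chainI_closure)
  show "irreducible_in zariski_affine (S j)" for j
   using irrA irr_chain_irreducible[OF C order_refl] by (simp add: S_def)
  have Jmono: "J (Suc j) \<subseteq> J j" for j by (auto simp: J_def)
  show "S j \<subseteq> S (Suc j)" for j
   using Ck(2) Jmono[of "j - 1"] by (cases j) (auto simp: S_def A_def)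
  fix j :: nat assume j: "j < 5"
  show "\<exists>K. closedin zariski_affine K \<and> S j \<subseteq> K \<and> \<not> S (Suc j) \<subseteq> K"
  proof (cases "j = 0")
   case True
   have "\<not> A 0 \<subseteq> {y. pf y = 0}"
   proof
    assume sub: "A 0 \<subseteq> {y. pf y = 0}"
    have z: "pf y = 0" if y: "\<And>i. l i y \<noteq> 0" for y
    proof -
     have "(\<chi> i. (1 / l i y) *\<^sub>R y $ i) \<in> A 0" using y by (simp add: A_def lsc)
     then have "pf (\<chi> i. (1 / l i y) *\<^sub>R y $ i) = 0" using sub by blast
     moreover have "multihomogeneous pf" unfolding pf_def by (rule pfaff_mh)
     then obtain e where "\<And>t x. pf (\<chi> i. t i *\<^sub>R x $ i) = (\<Prod>i\<in>UNIV. t i ^ e i) * pf x"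
      unfolding multihomogeneous_def by blast
     ultimately show ?thesis using y by simp
    qed
    have "open {y. d y \<noteq> 0}" using dpoly openin_zariski_affine_nonzero open_if_zariski_open by blast
    moreover have "pf y = 0" if "y \<in> {y. d y \<noteq> 0}" for y using z that by (auto simp: d_def)
    moreover have "(\<chi> i. m i) \<in> {y. d y \<noteq> 0}" using m by (simp add: d_def l_def aniso_def)
    ultimately have "pf y = 0" for y using real_polynomial_function_eq_zero[OF pfpoly, of "{y. d y \<noteq> 0}" y] by blast
    from this[of "\<chi> i. m 0"] show False using m[of 0] by (simp add: pf_def pfaff_def aniso_def)
   qed
   then show ?thesis using True Ck closedin_zariski_affine_zero[OF pfpoly] by (auto simp: S_def)
  next
   case False
   have "J (j - 1) \<noteq> J j" using j False
    by (auto simp: J_def set_eq_iff all_4 split: if_splits)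
   then obtain i where i: "i \<in> J (j - 1)" "i \<notin> J j" using Jmono[of "j - 1"] False by auto
   define y where "y = pr j 0"
   have y: "y \<in> A j" unfolding y_def by (rule prA)
   have "y $ i = 0" using i by (simp add: y_def pr_def)
   then have "l i y = 0" by (simp add: l_def)
   then have "\<not> (\<forall>i\<in>J (j - 1). l i y = 1)" using i by force
   then have "y \<notin> A (j - 1)" by (simp add: A_def)
   then show ?thesis using y False clA[of "j - 1"] by (intro exI[of _ "A (j - 1)"]) (auto simp: S_def)
  qed
 qed
 moreover have "C k \<subseteq> zariski_affine closure_of S 0"
  using closure_of_subset[of "S 0" zariski_affine] by (simp add: S_def)
 ultimately obtain E where "irr_chain (zariski_affine :: ((real^3)^4) topology) (k + 5) E"
  using irr_chain_append[OF C] by blast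
 then have "k + 5 \<le> DIM((real^3)^4)" by (rule irr_chain_zariski_affine)
 then show ?thesis by simp
qed

subsection \<open>The moduli space of configurations\<close>

definition config_class :: "(4 \<Rightarrow> rp2) \<Rightarrow> (4 \<Rightarrow> rp2) set" where
 "config_class x = {y \<in> parameter_space Q. projectively_equivalent Q x Q y}"

lemma similitude_orthogonal:
 assumes g: "invertible g" "k \<noteq> 0" "transpose g ** Q ** g = k *\<^sub>R Q"
 obtains c where "c \<noteq> 0" "c *\<^sub>R g \<in> orthogonal_group Q"
proof -
 \<comment> \<open>In odd dimension the factor of a similitude is a square: \<open>k ^ 3 = (det g)\<^sup>2\<close>.\<close>
 have "det (k *\<^sub>R Q) = k ^ 3 * det Q" by (simp add: det_3 power3_eq_cube algebra_simps)
 then have "(det g)\<^sup>2 * det Q = k ^ 3 * det Q"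
  using arg_cong[OF g(3), of det] by (simp add: det_mul power2_eq_square)
 then have "k ^ 3 = (det g)\<^sup>2" using nondegenerate by (simp add: nondegenerate_form_def)
 then have "k > 0" using g(2) by (metis zero_le_power2 zero_less_power_eq odd_numeral less_eq_real_def linorder_neqE_linordered_idom not_less zero_le_power_eq)
 define c where "c = 1 / sqrt k"
 have c: "c \<noteq> 0" "c * c * k = 1" using \<open>k > 0\<close> by (simp_all add: c_def field_simps)
 have "transpose (c *\<^sub>R g) ** Q ** (c *\<^sub>R g) = (c * c) *\<^sub>R (transpose g ** Q ** g)"
  by (simp add: transpose_scalar matrix_scalar_ac scalar_matrix_assoc[symmetric])
 then have "c *\<^sub>R g \<in> orthogonal_group Q" using g(3) c by (simp add: orthogonal_group_def)
 then show ?thesis using that c by blast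
qed

lemma projectively_equivalent_iff: "projectively_equivalent Q x Q y \<longleftrightarrow> y \<in> orbit x"
proof
 assume "projectively_equivalent Q x Q y"
 then obtain g k where g: "invertible g" "k \<noteq> 0" "transpose g ** Q ** g = k *\<^sub>R Q" "y = act g x"
  unfolding projectively_equivalent_def act_def by blast
 obtain c where c: "c \<noteq> 0" "c *\<^sub>R g \<in> orthogonal_group Q" using similitude_orthogonal[OF g(1-3)] .
 have "y = act (c *\<^sub>R g) x" using g c by (simp add: act_def rp2_map_scale)
 then show "y \<in> orbit x" using c by (auto simp: orbit_def)
next
 assume "y \<in> orbit x"
 then obtain g where g: "g \<in> orthogonal_group Q" "y = act g x" by (auto simp: orbit_def)
 then show "projectively_equivalent Q x Q y"
  unfolding projectively_equivalent_def using orthogonal_group_invertible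
  by (intro exI[of _ g] exI[of _ 1]) (auto simp: act_def orthogonal_group_def)
qed

lemma parameter_space_act:
 assumes "g \<in> orthogonal_group Q" "x \<in> parameter_space Q" shows "act g x \<in> parameter_space Q"
proof -
 have "admissible (\<chi> i. g *v (reps x $ i))"
  using admissible_reps[OF assms(2)] orthogonal_groupD[OF assms(1)]
  by (simp add: admissible_def pfaff_def aniso_def)
 from admissible_abs[OF this] show ?thesis
  by (simp add: act_def rp2_map_def)
qed

lemma config_class_orbit: "x \<in> parameter_space Q \<Longrightarrow> config_class x = orbit x"
 using parameter_space_act by (auto simp: config_class_def projectively_equivalent_iff orbit_def)

lemma orbit_refl: "x \<in> orbit x"
 unfolding orbit_def using orthogonal_group_one by (intro CollectI exI[of _ "mat 1"]) simp

lemma orthogonal_group_inverse: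
 assumes g: "g \<in> orthogonal_group Q" obtains h where "h \<in> orthogonal_group Q" "h ** g = mat 1" "g ** h = mat 1"
proof -
 obtain as where as: "\<forall>a\<in>set as. aniso a" "g = refl_word as" using orthogonal_group_refl_word[OF g] .
 have "refl_word (rev as) ** g = mat 1" using refl_word_rev[OF as(1)] as by simp
 moreover have "g ** refl_word (rev as) = mat 1"
  using refl_word_rev[of "rev as"] as by simp
 moreover have "refl_word (rev as) \<in> orthogonal_group Q" using as by (intro refl_word_orthogonal) auto
 ultimately show ?thesis using that by blast
qed

lemma orbit_eq_iff: "orbit x = orbit y \<longleftrightarrow> (\<exists>g\<in>orthogonal_group Q. y = act g x)"
proof
 assume "orbit x = orbit y"
 then have "y \<in> orbit x" using orbit_refl by blast
 then show "\<exists>g\<in>orthogonal_group Q. y = act g x" by (auto simp: orbit_def)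
next
 have sub: "orbit (act g z) \<subseteq> orbit z" if "g \<in> orthogonal_group Q" for g z
  using that orthogonal_group_mult orthogonal_group_invertible by (auto simp: orbit_def act_mult[symmetric])
 assume "\<exists>g\<in>orthogonal_group Q. y = act g x"
 then obtain g where g: "g \<in> orthogonal_group Q" "y = act g x" by blast
 obtain h where h: "h \<in> orthogonal_group Q" "h ** g = mat 1" using orthogonal_group_inverse[OF g(1)] by blast
 have "x = act h y" using g h orthogonal_group_invertible by (simp add: act_mult[symmetric])
 then show "orbit x = orbit y" using sub[OF g(1), of x] sub[OF h(1), of y] g(2) by simp
qed

lemma config_quotient: "quotient_map (parameter_topology Q) (configuration_moduli Q) config_class"
 unfolding configuration_moduli_def config_class_def[abs_def] by (rule quotient_map_quotient_topology)

lemma config_class_eq_iff: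
 "x \<in> parameter_space Q \<Longrightarrow> y \<in> parameter_space Q \<Longrightarrow> config_class x = config_class y \<longleftrightarrow> (\<exists>g\<in>orthogonal_group Q. y = act g x)"
 by (simp only: config_class_orbit orbit_eq_iff)

lemma config_open_map: "open_map (parameter_topology Q) (configuration_moduli Q) config_class"
 unfolding open_map_def
proof (intro allI impI)
 fix U assume U: "openin (parameter_topology Q) U"
 have UP: "U \<subseteq> parameter_space Q" using openin_subset[OF U] by simp
 have "openin (parameter_topology Q) {x \<in> parameter_space Q. act g x \<in> U}" if g: "g \<in> orthogonal_group Q" for g
 proof -
  have "continuous_map zariski zariski (act g :: (4 \<Rightarrow> rp2) \<Rightarrow> _)"
   by (rule continuous_map_act[OF orthogonal_group_invertible[OF g]])
  then have "continuous_map (parameter_topology Q) (parameter_topology Q) (act g)"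
   unfolding parameter_topology_def using parameter_space_act[OF g]
   by (auto simp: continuous_map_in_subtopology continuous_map_from_subtopology)
  then show ?thesis using U by (simp add: continuous_map_def)
 qed
 then have op: "openin (parameter_topology Q) (\<Union>g\<in>orthogonal_group Q. {x \<in> parameter_space Q. act g x \<in> U})"
  by (intro openin_Union) auto
 have eq: "{x \<in> topspace (parameter_topology Q). config_class x \<in> config_class ` U}
   = (\<Union>g\<in>orthogonal_group Q. {x \<in> parameter_space Q. act g x \<in> U})"
 proof (intro equalityI subsetI)
  fix x assume "x \<in> {x \<in> topspace (parameter_topology Q). config_class x \<in> config_class ` U}"
  then obtain u where u: "x \<in> parameter_space Q" "u \<in> U" "config_class x = config_class u" by auto
  then show "x \<in> (\<Union>g\<in>orthogonal_group Q. {x \<in> parameter_space Q. act g x \<in> U})"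
   using config_class_eq_iff[of x u] UP by auto
 next
  fix x assume "x \<in> (\<Union>g\<in>orthogonal_group Q. {x \<in> parameter_space Q. act g x \<in> U})"
  then obtain g where g: "g \<in> orthogonal_group Q" "x \<in> parameter_space Q" "act g x \<in> U" by auto
  then have "config_class x = config_class (act g x)" using config_class_eq_iff[of x "act g x"] UP by blast
  then show "x \<in> {x \<in> topspace (parameter_topology Q). config_class x \<in> config_class ` U}"
   using g by auto
 qed
 have sub: "config_class ` U \<subseteq> topspace (configuration_moduli Q)"
  using config_quotient UP unfolding quotient_map_def by auto
 have "openin (parameter_topology Q) {x \<in> topspace (parameter_topology Q). config_class x \<in> config_class ` U} =
   openin (configuration_moduli Q) (config_class ` U)"
  using config_quotient sub by (simp add: quotient_map_def)
 from iffD1[OF this] op[folded eq] show "openin (configuration_moduli Q) (config_class ` U)" .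
qed

lemma config_fibre:
 assumes x: "x \<in> parameter_space Q"
 shows "{y \<in> topspace (parameter_topology Q). config_class y = config_class x} = orbit x"
proof -
 have "config_class y = config_class x \<longleftrightarrow> y \<in> orbit x" if "y \<in> parameter_space Q" for y
  using config_class_eq_iff[OF x that] by (auto simp: orbit_def)
 then show ?thesis using parameter_space_act[OF _ x] by (auto simp: orbit_def)
qed

lemma orbit_subset: "x \<in> parameter_space Q \<Longrightarrow> orbit x \<subseteq> parameter_space Q"
 using parameter_space_act by (auto simp: orbit_def)

lemma irreducible_in_parameter:
 "irreducible_in zariski S \<Longrightarrow> S \<subseteq> parameter_space Q \<Longrightarrow> irreducible_in (parameter_topology Q) S"
 unfolding parameter_topology_def by (rule iffD2[OF irreducible_in_subtopology], rule conjI)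

lemma closedin_parameter: "closedin zariski C \<Longrightarrow> closedin (parameter_topology Q) (C \<inter> parameter_space Q)"
 unfolding parameter_topology_def by (auto simp: closedin_subtopology)

text \<open>Since the Pfaffian does not vanish on four equal vectors, two of the lines of a configuration
 differ, and so every orbit is three-dimensional.\<close>

lemma config_fibre_chain:
 assumes x: "x \<in> parameter_space Q"
 shows "\<exists>C. irr_chain (parameter_topology Q) 3 C \<and>
  C 3 \<subseteq> parameter_topology Q closure_of {y \<in> topspace (parameter_topology Q). config_class y = config_class x}"
proof -
 have ni: "aniso (rep_rp2 (x i))" for i using admissible_reps[OF x] by (simp add: admissible_def)
 have "\<exists>i. x i \<noteq> x 0"
 proof (rule ccontr)
  assume "\<not> ?thesis"
  then have "x 1 = x 0" "x 2 = x 0" "x 3 = x 0" by blast+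
  then have "pfaff (rep_rp2 (x 0)) (rep_rp2 (x 0)) (rep_rp2 (x 0)) (rep_rp2 (x 0)) = 0"
   using admissible_reps[OF x] by (simp add: admissible_def)
  then show False using ni[of 0] by (simp add: pfaff_def aniso_def)
 qed
 then obtain i where i: "x i \<noteq> x 0" by blast
 obtain S where S: "\<forall>k\<le>3. irreducible_in zariski (S k) \<and> S k \<subseteq> orbit x" "\<forall>k<3. S k \<subseteq> S (Suc k)"
   "\<forall>k<3::nat. \<exists>C. closedin zariski C \<and> S k \<subseteq> C \<and> \<not> S (Suc k) \<subseteq> C"
  using orbit_chain[OF ni ni i] by blast
 have SP: "S k \<subseteq> parameter_space Q" if "k \<le> 3" for k using S(1) that orbit_subset[OF x] by blast
 have "irr_chain (parameter_topology Q) 3 (\<lambda>k. parameter_topology Q closure_of S k)"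
 proof (rule irr_chainI_closure)
  show "irreducible_in (parameter_topology Q) (S k)" if "k \<le> 3" for k
   using irreducible_in_parameter S(1) SP that by blast
  show "S k \<subseteq> S (Suc k)" if "k < 3" for k using S(2) that by blast
  fix k :: nat assume k: "k < 3"
  then obtain C where "closedin zariski C" "S k \<subseteq> C" "\<not> S (Suc k) \<subseteq> C" using S(3) by blast
  then show "\<exists>C. closedin (parameter_topology Q) C \<and> S k \<subseteq> C \<and> \<not> S (Suc k) \<subseteq> C"
   using closedin_parameter SP[of k] k by (intro exI[of _ "C \<inter> parameter_space Q"]) auto
 qed
 moreover have "parameter_topology Q closure_of S 3 \<subseteq> parameter_topology Q closure_of orbit x"
  using S(1) by (intro closure_of_mono) auto
 ultimately show ?thesis unfolding config_fibre[OF x] by blast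
qed

text \<open>All fibres of the map to the moduli space are orbits of dimension three.\<close>

lemma config_chain_lift:
 assumes "irr_chain (configuration_moduli Q) n Z" shows "\<exists>C. irr_chain (parameter_topology Q) (3 + n) C"
proof (rule irr_chain_fibration[OF _ config_open_map _ _ _ assms])
 show "continuous_map (parameter_topology Q) (configuration_moduli Q) config_class"
  using config_quotient by (rule quotient_imp_continuous_map)
 show surj: "config_class ` topspace (parameter_topology Q) = topspace (configuration_moduli Q)"
  using config_quotient by (rule quotient_imp_surjective_map)
 fix y assume "y \<in> topspace (configuration_moduli Q)"
 then obtain x where x: "x \<in> parameter_space Q" "y = config_class x" using surj by auto
 show "irreducible_in (parameter_topology Q) {z \<in> topspace (parameter_topology Q). config_class z = y}"
  unfolding x(2) config_fibre[OF x(1)]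
  using irreducible_in_parameter[OF irreducible_orbit orbit_subset[OF x(1)]] by simp
 show "\<exists>C. irr_chain (parameter_topology Q) 3 C \<and>
   C 3 \<subseteq> parameter_topology Q closure_of {z \<in> topspace (parameter_topology Q). config_class z = y}"
  unfolding x(2) by (rule config_fibre_chain[OF x(1)])
qed

text \<open>Invariant equations define closed sets in the moduli space.\<close>

definition invariant_form :: "((real^3)^4 \<Rightarrow> real) \<Rightarrow> bool" where
 "invariant_form G \<longleftrightarrow> real_poly G \<and> multihomogeneous G \<and>
   (\<forall>g\<in>orthogonal_group Q. \<forall>y. G (\<chi> i. g *v (y $ i)) = G y)"

lemma invariant_form_act:
 assumes G: "invariant_form G" and g: "g \<in> orthogonal_group Q"
 shows "G (reps (act g x)) = 0 \<longleftrightarrow> G (reps x) = 0"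
proof -
 have "g *v rep_rp2 (x i) \<noteq> 0" for i
  using matrix_vector_mult_eq_0_invertible[OF orthogonal_group_invertible[OF g]] by simp
 then have "G (reps (act g x)) = 0 \<longleftrightarrow> G (\<chi> i. g *v rep_rp2 (x i)) = 0"
  unfolding act_def rp2_map_def using G by (intro mh_zero_iff) (auto simp: invariant_form_def)
 also have "G (\<chi> i. g *v rep_rp2 (x i)) = G (reps x)"
  using G g unfolding invariant_form_def by (metis (no_types, lifting) vec_lambda_beta vec_lambda_unique)
 finally show ?thesis .
qed

lemma closedin_config:
 assumes G: "invariant_form G"
 shows "closedin (configuration_moduli Q) (config_class ` {x \<in> parameter_space Q. G (reps x) = 0})"
  and "x \<in> parameter_space Q \<Longrightarrow> config_class x \<in> config_class ` {x \<in> parameter_space Q. G (reps x) = 0} \<longleftrightarrow> G (reps x) = 0"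
proof -
 let ?C = "{x \<in> parameter_space Q. G (reps x) = 0}"
 show iff: "config_class x \<in> config_class ` ?C \<longleftrightarrow> G (reps x) = 0" if x: "x \<in> parameter_space Q" for x
 proof
  assume "config_class x \<in> config_class ` ?C"
  then obtain z where z: "z \<in> ?C" "config_class x = config_class z" by blast
  then obtain g where "g \<in> orthogonal_group Q" "z = act g x" using config_class_eq_iff[OF x, of z] by blast
  then show "G (reps x) = 0" using invariant_form_act[OF G] z by blast
 qed (use x in blast)
 have "closedin zariski {x. G (reps x) = 0}"
  using G by (intro closedin_zariski_zero) (auto simp: invariant_form_def)
 then have "closedin (parameter_topology Q) ({x. G (reps x) = 0} \<inter> parameter_space Q)" by (rule closedin_parameter)
 moreover have "{x. G (reps x) = 0} \<inter> parameter_space Q = ?C" by auto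
 ultimately have cl: "closedin (parameter_topology Q) ?C" by simp
 have eq: "{x \<in> topspace (parameter_topology Q). config_class x \<in> config_class ` ?C} = ?C"
  using iff by auto
 have "config_class ` ?C \<subseteq> topspace (configuration_moduli Q)"
  using quotient_imp_surjective_map[OF config_quotient] by auto
 then have "closedin (parameter_topology Q) {x \<in> topspace (parameter_topology Q). config_class x \<in> config_class ` ?C} =
   closedin (configuration_moduli Q) (config_class ` ?C)"
  using config_quotient by (simp add: quotient_map_closedin)
 moreover have "closedin (parameter_topology Q) {x \<in> topspace (parameter_topology Q). config_class x \<in> config_class ` ?C}"
  unfolding eq by (rule cl)
 ultimately show "closedin (configuration_moduli Q) (config_class ` ?C)" by (rule iffD1)
qed

lemma invariant_form_1:
 assumes ij: "i \<noteq> j"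
 shows "invariant_form (\<lambda>y. \<kappa> * (p (y $ i) (y $ j) * p (y $ i) (y $ j)) - \<mu> * (p (y $ i) (y $ i) * p (y $ j) (y $ j)))"
 unfolding invariant_form_def
proof (intro conjI ballI allI)
 let ?G = "\<lambda>y :: (real^3)^4. \<kappa> * (p (y $ i) (y $ j) * p (y $ i) (y $ j)) - \<mu> * (p (y $ i) (y $ i) * p (y $ j) (y $ j))"
 show "real_poly ?G"
  by (intro real_polynomial_function_diff real_polynomial_function.intros(2,4) p_polynomial polynomial_nth)
 show "multihomogeneous ?G" unfolding multihomogeneous_def
  by (rule exI[of _ "\<lambda>k. (if k = i then 1 else 0) + (if k = i then 1 else 0) + ((if k = j then 1 else 0) + (if k = j then 1 else 0))"])
    (simp only: power_add prod.distrib prod_delta_power vec_lambda_beta p_linear, simp add: algebra_simps)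
qed (simp add: orthogonal_groupD)

lemma invariant_form_2:
 shows "invariant_form (\<lambda>y. \<kappa> * (p (y $ i) (y $ j) * p (y $ i) (y $ j) * p (y $ k) (y $ k))
   - \<mu> * (p (y $ k) (y $ j) * p (y $ k) (y $ j) * p (y $ i) (y $ i)))"
 unfolding invariant_form_def
proof (intro conjI ballI allI)
 let ?G = "\<lambda>y :: (real^3)^4. \<kappa> * (p (y $ i) (y $ j) * p (y $ i) (y $ j) * p (y $ k) (y $ k))
   - \<mu> * (p (y $ k) (y $ j) * p (y $ k) (y $ j) * p (y $ i) (y $ i))"
 show "real_poly ?G"
  by (intro real_polynomial_function_diff real_polynomial_function.intros(2,4) p_polynomial polynomial_nth)
 show "multihomogeneous ?G" unfolding multihomogeneous_def
  by (rule exI[of _ "\<lambda>l. (if l = i then 1 else 0) + (if l = i then 1 else 0) + ((if l = j then 1 else 0) + (if l = j then 1 else 0))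
     + ((if l = k then 1 else 0) + (if l = k then 1 else 0))"])
    (simp only: power_add prod.distrib prod_delta_power vec_lambda_beta p_linear, simp add: algebra_simps)
qed (simp add: orthogonal_groupD)

text \<open>The four parameters of the explicit family are released one after the other; each can be read
 off, up to finitely many choices, from an invariant once the ones released later are known.\<close>

lemma irr_chain_config: "\<exists>C. irr_chain (configuration_moduli Q) 4 C"
proof -
 obtain a b c where abc: "obasis a b c" and u: "p a a = 1 \<or> p a a = -1" "p b b = 1 \<or> p b b = -1" "p c c = 1 \<or> p c c = -1"
  using obasis_unit .
 let ?M = "configuration_moduli Q"
 define \<pi> :: "nat \<Rightarrow> real \<times> real \<times> real \<times> real \<Rightarrow> real \<times> real \<times> real \<times> real" where
  "\<pi> k u = (case u of (s, t, r, h) \<Rightarrow> (if k \<ge> 4 then s else 2, if k \<ge> 3 then t else 2, if k \<ge> 2 then r else 5, if k \<ge> 1 then h else 2))" for k u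
 define conf where "conf u i = abs_rp2 (family a b c i u)" for u i
 define U where "U k = {u. \<forall>i. aniso (family a b c i (\<pi> k u))}" for k
 define S where "S k = (\<lambda>u. config_class (conf (\<pi> k u))) ` U k" for k
 have \<pi>poly: "poly_map (\<pi> k)" for k
 proof -
  have 1: "poly_map (\<lambda>u::real \<times> real \<times> real \<times> real. fst u)"
   "poly_map (\<lambda>u::real \<times> real \<times> real \<times> real. fst (snd u))"
   "poly_map (\<lambda>u::real \<times> real \<times> real \<times> real. fst (snd (snd u)))"
   "poly_map (\<lambda>u::real \<times> real \<times> real \<times> real. snd (snd (snd u)))"
   by (intro polynomial_function_bounded_linear bounded_linear_intros)+
  have 2: "poly_map (\<lambda>u. (f u, g u))" if "poly_map f" "poly_map g"
   for f :: "real \<times> real \<times> real \<times> real \<Rightarrow> 'a::euclidean_space" and g :: "_ \<Rightarrow> 'b::euclidean_space"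
   using that unfolding polynomial_function_iff_Basis_inner by (auto simp: Basis_prod_def)
  have 3: "poly_map (\<lambda>u. if P then f u else g u)" if "poly_map f" "poly_map g"
   for f g :: "real \<times> real \<times> real \<times> real \<Rightarrow> real" and P using that by (cases P) auto
  have "poly_map (\<lambda>u. (if k \<ge> 4 then fst u else (2::real), if k \<ge> 3 then fst (snd u) else (2::real),
    if k \<ge> 2 then fst (snd (snd u)) else (5::real), if k \<ge> 1 then snd (snd (snd u)) else (2::real)))"
   by (intro 2 3 1 polynomial_function_const)
  then show ?thesis by (rule back_subst[of poly_map]) (auto simp: \<pi>_def split: prod.splits)
 qed
 have fpoly: "poly_map (\<lambda>u. family a b c i (\<pi> k u))" for i k
  using polynomial_function_compose[OF \<pi>poly family_polynomial] by (simp add: o_def)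
 have confP: "conf (\<pi> k v) \<in> parameter_space Q" if "v \<in> U k" for k v
  using admissible_abs[OF family_admissible[OF abc, of "\<pi> k v"]] that by (simp add: U_def conf_def[abs_def])
 have irr: "irreducible_in ?M (S k)" for k
 proof -
  have op: "openin zariski_affine (U k)" unfolding U_def by (rule open_aniso_family) (rule fpoly)
  have "(2,2,5,2) \<in> U k" using family_aniso[OF abc u, of "(2,2,5,2)"] by (simp add: U_def \<pi>_def)
  then have int: "interior (U k) \<noteq> {}" using open_if_zariski_open[OF op] by (auto simp: interior_open)
  have "continuous_map (subtopology zariski_affine (U k)) zariski (\<lambda>u i. abs_rp2 (family a b c i (\<pi> k u)))"
   by (intro continuous_map_abs_polynomial fpoly) (auto simp: U_def dest: aniso_nonzero)
  then have "continuous_map (subtopology zariski_affine (U k)) (parameter_topology Q) (\<lambda>u. conf (\<pi> k u))"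
   using confP unfolding parameter_topology_def by (simp add: continuous_map_in_subtopology conf_def[abs_def] Pi_iff image_subset_iff)
  then have "continuous_map (subtopology zariski_affine (U k)) ?M (config_class \<circ> (\<lambda>u. conf (\<pi> k u)))"
   using quotient_imp_continuous_map[OF config_quotient] by (rule continuous_map_compose)
  from irreducible_in_polynomial_image[OF this int] show ?thesis by (simp add: S_def o_def)
 qed
 have mono: "S k \<subseteq> S (Suc k)" for k
 proof
  fix z assume "z \<in> S k"
  then obtain v where v: "v \<in> U k" "z = config_class (conf (\<pi> k v))" by (auto simp: S_def)
  have "\<pi> (Suc k) (\<pi> k v) = \<pi> k v" by (cases v) (auto simp: \<pi>_def)
  then show "z \<in> S (Suc k)" using v unfolding S_def U_def by (intro image_eqI[of _ _ "\<pi> k v"]) auto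
 qed
 have sep: "\<exists>C. closedin ?M C \<and> S k \<subseteq> C \<and> \<not> S (Suc k) \<subseteq> C"
  if G: "invariant_form G" "\<And>s t r h. G (\<chi> i. family a b c i (\<pi> k (s, t, r, h))) = 0" "G (\<chi> i. family a b c i (\<pi> (Suc k) w)) \<noteq> 0"
    "\<pi> (Suc k) w \<in> {(2,2,5,2), (2,2,5,3), (2,2,6,2), (2,3,5,2), (3,2,5,2)}" for G k w
 proof (intro exI conjI)
  let ?C = "config_class ` {x \<in> parameter_space Q. G (reps x) = 0}"
  have zero: "config_class (conf (\<pi> l v)) \<in> ?C \<longleftrightarrow> G (\<chi> i. family a b c i (\<pi> l v)) = 0" if "v \<in> U l" for l v
  proof -
   have "config_class (conf (\<pi> l v)) \<in> ?C \<longleftrightarrow> G (reps (conf (\<pi> l v))) = 0"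
    by (rule closedin_config(2)[OF G(1) confP[OF that]])
   also have "\<dots> \<longleftrightarrow> G (\<chi> i. family a b c i (\<pi> l v)) = 0"
    unfolding conf_def using G(1) that aniso_nonzero
    by (intro mh_zero_iff) (auto simp: invariant_form_def U_def)
   finally show ?thesis .
  qed
  show "closedin ?M ?C" by (rule closedin_config(1)[OF G(1)])
  have "G (\<chi> i. family a b c i (\<pi> k v)) = 0" for v using G(2) by (cases v) blast
  then show "S k \<subseteq> ?C" using zero unfolding S_def by blast
  have "w \<in> U (Suc k)" using family_aniso[OF abc u G(4)] by (simp add: U_def)
  then show "\<not> S (Suc k) \<subseteq> ?C" using zero[of w "Suc k"] G(3) unfolding S_def by blast
 qed
 have "irr_chain ?M 4 (\<lambda>k. ?M closure_of S k)"
 proof (rule irr_chainI_closure)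
  show "irreducible_in ?M (S k)" for k by (rule irr)
  show "S k \<subseteq> S (Suc k)" for k by (rule mono)
  fix k :: nat assume "k < 4"
  then consider "k = 0" | "k = 1" | "k = 2" | "k = 3" by linarith
  then show "\<exists>C. closedin ?M C \<and> S k \<subseteq> C \<and> \<not> S (Suc k) \<subseteq> C"
  proof cases
   case 1
   show ?thesis
    by (rule sep[of _ k "(2,2,5,3)", OF invariant_form_2[of "p a a * (p a a + 4 * p b b)" 1 3 0 "(p a a + 4 * p b b)\<^sup>2"]])
     (use 1 u in \<open>auto simp: \<pi>_def family_gram[OF abc] power2_eq_square algebra_simps\<close>)
  next
   case 2
   show ?thesis
    by (rule sep[of _ k "(2,2,6,2)", OF invariant_form_1[of 0 2 "p a a + 4 * p b b + 25 * p c c" "p a a"]])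
     (use 2 u in \<open>auto simp: \<pi>_def family_gram[OF abc] power2_eq_square algebra_simps\<close>)
  next
   case 3
   show ?thesis
    by (rule sep[of _ k "(2,3,5,2)", OF invariant_form_2[of "p a a * (p a a + 4 * p b b)" 1 2 0 "(p a a + 4 * p b b)\<^sup>2"]])
     (use 3 u in \<open>auto simp: \<pi>_def family_gram[OF abc] power2_eq_square algebra_simps\<close>)
  next
   case 4
   show ?thesis
    by (rule sep[of _ k "(3,2,5,2)", OF invariant_form_1[of 0 1 "p a a + 4 * p b b" "p a a"]])
     (use 4 u in \<open>auto simp: \<pi>_def family_gram[OF abc] power2_eq_square algebra_simps\<close>)
  qed
 qed
 then show ?thesis by blast
qed

theorem krull_dim_parameter_space: "krull_dim (parameter_topology Q) = 7"
proof (rule antisym)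
 show "krull_dim (parameter_topology Q) \<le> 7"
  unfolding numeral_eq_enat by (rule krull_dim_le) (rule irr_chain_parameter_space_le)
 obtain C where "irr_chain (parameter_topology Q) (3 + 4) C" using irr_chain_config config_chain_lift by blast
 then have "enat (3 + 4) \<le> krull_dim (parameter_topology Q)" by (rule krull_dim_ge)
 then show "7 \<le> krull_dim (parameter_topology Q)" by (simp add: numeral_eq_enat)
qed

theorem krull_dim_configuration_moduli: "krull_dim (configuration_moduli Q) = 4"
proof (rule antisym)
 have "n \<le> 4" if "irr_chain (configuration_moduli Q) n Z" for n Z
  using config_chain_lift[OF that] irr_chain_parameter_space_le by fastforce
 then show "krull_dim (configuration_moduli Q) \<le> 4" unfolding numeral_eq_enat by (rule krull_dim_le)
 show "4 \<le> krull_dim (configuration_moduli Q)"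
  using irr_chain_config krull_dim_ge unfolding numeral_eq_enat by blast
qed

end

section \<open>Products of five homologies\<close>

lemma all_5: "(\<forall>i::5. P i) \<longleftrightarrow> P 0 \<and> P 1 \<and> P 2 \<and> P 3 \<and> P 4"
proof -
 have "card {0, 1, 2, 3, 4 :: 5} = CARD(5)" by simp
 then have "{0, 1, 2, 3, 4} = (UNIV :: 5 set)" by (intro card_subset_eq) auto
 then have "(\<forall>i::5. P i) \<longleftrightarrow> (\<forall>i\<in>{0, 1, 2, 3, 4}. P i)" by simp
 then show ?thesis by simp
qed

lemma homology_apply:
 "homology a l *v x = x - (2 * (l \<bullet> x) / (l \<bullet> a)) *\<^sub>R a"
 by (simp add: homology_def matrix_vector_mult_diff_rdistrib scaleR_matrix_vector_assoc[symmetric] outer_mult_vec)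

lemma trace_outer: "trace (outer a b) = a \<bullet> b"
 by (simp add: trace_def outer_def inner_vec_def)

lemma trace_scaleR: "trace (c *\<^sub>R (A :: real^3^3)) = c * trace A"
 by (simp add: trace_def sum_distrib_left)

lemma matrix_inv_mult:
 fixes A :: "real^'n^'n"
 assumes "invertible A" shows "matrix_inv A ** A = mat 1" "A ** matrix_inv A = mat 1"
proof -
 have "A ** matrix_inv A = mat 1 \<and> matrix_inv A ** A = mat 1"
  using assms unfolding matrix_inv_def invertible_def by (rule someI_ex)
 then show "matrix_inv A ** A = mat 1" "A ** matrix_inv A = mat 1" by blast+
qed

lemma uminus_matrix_mult:
 fixes A B :: "real^3^3"
 shows "(- A) ** B = - (A ** B)" "A ** (- B) = - (A ** B)"
 by (simp_all add: matrix_matrix_mult_def vec_eq_iff sum_negf)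

lemma uminus_matrix_vec: "(- (A :: real^3^3)) *v x = - (A *v x)" "A *v (- x) = - (A *v x)"
 using matrix_vector_mult_diff_rdistrib[of 0 A x] matrix_vector_mult_diff_distrib[of A 0 x] by simp_all

lemma rotate_relation:
 fixes a b c d e :: "real^3^3"
 assumes "a ** b ** c ** d ** e = - mat 1" "e ** e = mat 1"
 shows "e ** a ** b ** c ** d = - mat 1"
proof -
 have "a ** b ** c ** d = (a ** b ** c ** d ** e) ** e" using assms(2) by (simp add: matrix_mul_assoc[symmetric])
 then have "a ** b ** c ** d = - e" by (simp add: assms(1) uminus_matrix_mult)
 then have "e ** (a ** b ** c ** d) = - mat 1" using assms(2) by (simp add: uminus_matrix_mult)
 then show ?thesis by (simp add: matrix_mul_assoc)
qed

text \<open>The relation turns a word of length three in the involutions and its reversal into products of the same factors, up to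
 cyclic order.\<close>

lemma trace_reversal:
 fixes a b c d e :: "real^3^3"
 assumes rel: "e ** d ** c ** b ** a = - mat 1"
  and inv: "a ** a = mat 1" "b ** b = mat 1" "c ** c = mat 1" "d ** d = mat 1" "e ** e = mat 1"
 shows "trace (a ** b ** c) = trace (c ** b ** a)" and "trace (a ** b ** d) = trace (d ** b ** a)"
proof -
 have cancel: "x ** (x ** y) = y" if "x ** x = mat 1" for x y :: "real^3^3"
  using that by (simp add: matrix_mul_assoc)
 have rel': "e ** (d ** (c ** (b ** a))) = - mat 1" using rel by (simp add: matrix_mul_assoc)
 have "d ** (c ** (b ** a)) = e ** (e ** (d ** (c ** (b ** a))))" by (simp only: cancel inv)
 then have 1: "d ** (c ** (b ** a)) = - e" by (simp add: rel' uminus_matrix_mult)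
 have "c ** (b ** a) = d ** (d ** (c ** (b ** a)))" by (simp only: cancel inv)
 then have 2: "c ** (b ** a) = - (d ** e)" by (simp add: 1 uminus_matrix_mult)
 have "b ** a = c ** (c ** (b ** a))" by (simp only: cancel inv)
 then have 3: "b ** a = - (c ** (d ** e))" by (simp add: 2 uminus_matrix_mult)
 have "(b ** a) ** (a ** b) = mat 1" by (simp add: matrix_mul_assoc[symmetric] cancel inv)
 then have "e ** d ** c = (e ** d ** c) ** ((b ** a) ** (a ** b))" by simp
 also have "\<dots> = (e ** d ** c ** b ** a) ** (a ** b)" by (simp only: matrix_mul_assoc)
 also have "\<dots> = - (a ** b)" by (simp add: rel uminus_matrix_mult)
 finally have 4: "a ** b = - (e ** d ** c)" by simp
 have "trace (a ** b ** c) = trace (- (e ** d))"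
  unfolding 4 using inv by (simp add: uminus_matrix_mult matrix_mul_assoc[symmetric])
 also have "\<dots> = trace (- (d ** e))" using trace_mul_sym[of e d] trace_scaleR[of "-1"] by simp
 finally show "trace (a ** b ** c) = trace (c ** b ** a)" using 2 by (simp add: matrix_mul_assoc)
 have "trace (a ** b ** d) = trace (- (e ** (d ** c ** d)))"
  unfolding 4 by (simp add: uminus_matrix_mult matrix_mul_assoc)
 also have "\<dots> = trace (- ((d ** c ** d) ** e))" using trace_mul_sym[of e "d ** c ** d"] trace_scaleR[of "-1"] by simp
 also have "\<dots> = trace (d ** (b ** a))" unfolding 3 by (simp add: uminus_matrix_mult matrix_mul_assoc)
 finally show "trace (a ** b ** d) = trace (d ** b ** a)" by (simp add: matrix_mul_assoc)
qed

text \<open>If in a symmetric relation on five points every point is related to at least two others, there is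
 a point related to three others, or four points on which the relation is a path (the latter for a
 pentagon).\<close>

lemma five_vertex_graph:
 fixes N :: "5 \<Rightarrow> 5 \<Rightarrow> bool"
 assumes sym: "\<And>i j. N i j \<Longrightarrow> N j i"
  and deg: "\<And>i j k l. distinct [i, j, k, l] \<Longrightarrow> N i j \<or> N i k \<or> N i l"
 shows "\<exists>a b c d. distinct [a, b, c, d] \<and>
   (N d a \<and> N d b \<and> N d c \<or> N a b \<and> N b c \<and> N c d \<and> \<not> N a c \<and> \<not> N a d \<and> \<not> N b d)" (is "\<exists>a b c d. ?P a b c d")
proof (rule ccontr)
 assume "\<not> ?thesis"
 then have no: "\<not> ?P a b c d" for a b c d by blast
 have core: False if d: "distinct [v, x, y, z, w]" and N: "N v x" "N v y" "\<not> N v z" "\<not> N v w" for v x y z w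
 proof -
  have "\<not> N x z \<or> \<not> N x w" using no[of v z w x] sym N(1) d by auto
  moreover have "\<not> N y z \<or> \<not> N y w" using no[of v z w y] sym N(2) d by auto
  moreover have "N z x \<or> N z y \<or> N z w" using deg[of z x y w] d by auto
  moreover have "N w x \<or> N w y \<or> N w z" using deg[of w x y z] d by auto
  moreover have "N z x \<or> N z y" using deg[of z x y v] d N sym by auto
  moreover have "N w x \<or> N w y" using deg[of w x y v] d N sym by auto
  moreover have "N z w"
  proof (rule ccontr)
   assume "\<not> N z w"
   then have "N z x" "N z y" using deg[of z x w v] deg[of z y w v] d N sym by auto
   moreover have "N w x" "N w y" using deg[of w x z v] deg[of w y z v] d N sym \<open>\<not> N z w\<close> by auto
   ultimately show False using no[of v z w x] sym N(1) d by auto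
  qed
  ultimately consider "N z x" "\<not> N x w" | "N z y" "\<not> N y w" using sym by blast
  then show False
  proof cases
   case 1
   then show ?thesis using no[of w z x v] \<open>N z w\<close> sym N d by auto
  next
   case 2
   then show ?thesis using no[of w z y v] \<open>N z w\<close> sym N d by auto
  qed
 qed
 have three: "\<not> (N 0 j \<and> N 0 k \<and> N 0 l)" if "distinct [0, j, k, l]" for j k l
  using no[of j k l 0] that by auto
 note t = three[of 1 2 3] three[of 1 2 4] three[of 1 3 4] three[of 2 3 4]
 note d0 = deg[of 0 1 2 3] deg[of 0 1 2 4] deg[of 0 1 3 4] deg[of 0 2 3 4]
 note c = core[of 0 1 2 3 4] core[of 0 1 3 2 4] core[of 0 1 4 2 3] core[of 0 2 3 1 4] core[of 0 2 4 1 3] core[of 0 3 4 1 2]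
 show False using t d0 c by (simp, blast)
qed

locale five_homologies =
 fixes L :: "5 \<Rightarrow> real^3" and cen :: "5 \<Rightarrow> real^3"
 assumes unit: "L i \<bullet> cen i = 1"
  and rel: "homology (cen 4) (L 4) ** homology (cen 3) (L 3) ** homology (cen 2) (L 2) **
    homology (cen 1) (L 1) ** homology (cen 0) (L 0) = - mat 1"
  and lines: "distinct [i, j, k] \<Longrightarrow> L i \<bullet> cross3 (L j) (L k) \<noteq> 0"
  and centres: "card S = 4 \<Longrightarrow> (\<And>i. i \<in> S \<Longrightarrow> l \<bullet> cen i = 0) \<Longrightarrow> l = 0"
begin

definition H :: "5 \<Rightarrow> real^3^3" where "H i = homology (cen i) (L i)"

definition g :: "5 \<Rightarrow> 5 \<Rightarrow> real" where "g i j = L i \<bullet> cen j"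

lemma H_apply: "H i *v x = x - (2 * (L i \<bullet> x)) *\<^sub>R cen i"
 by (simp add: H_def homology_apply unit)

lemma H_involution: "H i ** H i = mat 1"
 by (simp add: matrix_eq matrix_vector_mul_assoc[symmetric] H_apply inner_diff_right unit)

lemma relations:
 "H 4 ** H 3 ** H 2 ** H 1 ** H 0 = - mat 1" "H 0 ** H 4 ** H 3 ** H 2 ** H 1 = - mat 1"
 "H 1 ** H 0 ** H 4 ** H 3 ** H 2 = - mat 1" "H 2 ** H 1 ** H 0 ** H 4 ** H 3 = - mat 1"
 "H 3 ** H 2 ** H 1 ** H 0 ** H 4 = - mat 1"
proof -
 show 1: "H 4 ** H 3 ** H 2 ** H 1 ** H 0 = - mat 1" using rel by (simp add: H_def)
 show 2: "H 0 ** H 4 ** H 3 ** H 2 ** H 1 = - mat 1" by (rule rotate_relation[OF 1 H_involution])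
 show 3: "H 1 ** H 0 ** H 4 ** H 3 ** H 2 = - mat 1" by (rule rotate_relation[OF 2 H_involution])
 show 4: "H 2 ** H 1 ** H 0 ** H 4 ** H 3 = - mat 1" by (rule rotate_relation[OF 3 H_involution])
 show "H 3 ** H 2 ** H 1 ** H 0 ** H 4 = - mat 1" by (rule rotate_relation[OF 4 H_involution])
qed

lemma g_diag [simp]: "g i i = 1"
 by (simp add: g_def unit)

lemma trace_H3:
 "trace (H i ** H j ** H k) = - 3 + 4 * (g i j * g j i + g j k * g k j + g i k * g k i) - 8 * (g i j * g j k * g k i)"
proof -
 have tr1: "trace (mat 1 :: real^3^3) = 3" by (simp add: trace_I)
 have expand: "H i ** H j ** H k = mat 1 - 2 *\<^sub>R outer (cen i) (L i) - 2 *\<^sub>R outer (cen j) (L j) - 2 *\<^sub>R outer (cen k) (L k)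
   + (4 * g i j) *\<^sub>R outer (cen i) (L j) + (4 * g j k) *\<^sub>R outer (cen j) (L k) + (4 * g i k) *\<^sub>R outer (cen i) (L k)
   - (8 * g i j * g j k) *\<^sub>R outer (cen i) (L k)"
  unfolding matrix_eq
 proof
  fix x
  have "(mat 1 - 2 *\<^sub>R outer (cen i) (L i) - 2 *\<^sub>R outer (cen j) (L j) - 2 *\<^sub>R outer (cen k) (L k)
   + (4 * g i j) *\<^sub>R outer (cen i) (L j) + (4 * g j k) *\<^sub>R outer (cen j) (L k) + (4 * g i k) *\<^sub>R outer (cen i) (L k)
   - (8 * g i j * g j k) *\<^sub>R outer (cen i) (L k)) *v x =
   x - (2 * (L i \<bullet> x)) *\<^sub>R cen i - (2 * (L j \<bullet> x)) *\<^sub>R cen j - (2 * (L k \<bullet> x)) *\<^sub>R cen k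
   + (4 * g i j * (L j \<bullet> x)) *\<^sub>R cen i + (4 * g j k * (L k \<bullet> x)) *\<^sub>R cen j + (4 * g i k * (L k \<bullet> x)) *\<^sub>R cen i
   - (8 * g i j * g j k * (L k \<bullet> x)) *\<^sub>R cen i"
   by (simp add: matrix_vector_mult_diff_rdistrib matrix_vector_mult_add_rdistrib
     scaleR_matrix_vector_assoc[symmetric] outer_mult_vec)
  then show "(H i ** H j ** H k) *v x = (mat 1 - 2 *\<^sub>R outer (cen i) (L i) - 2 *\<^sub>R outer (cen j) (L j) - 2 *\<^sub>R outer (cen k) (L k)
   + (4 * g i j) *\<^sub>R outer (cen i) (L j) + (4 * g j k) *\<^sub>R outer (cen j) (L k) + (4 * g i k) *\<^sub>R outer (cen i) (L k)
   - (8 * g i j * g j k) *\<^sub>R outer (cen i) (L k)) *v x"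
   by (simp add: matrix_vector_mul_assoc[symmetric] H_apply inner_diff_right g_def algebra_simps)
 qed
 show ?thesis
  unfolding expand
  by (simp add: trace_add trace_sub trace_scaleR trace_outer tr1 inner_commute[of "cen _"] unit g_def[symmetric] algebra_simps)
qed

text \<open>The traces of a product of three homologies and of its reversal, which agree by the relation, differ only in these two
 cyclic products.\<close>

lemma triple: "g i j * g j k * g k i = g i k * g k j * g j i"
proof -
 have red: "g i j * g j k * g k i = g i k * g k j * g j i" if "trace (H i ** H j ** H k) = trace (H k ** H j ** H i)" for i j k
  using that unfolding trace_H3 by (simp add: algebra_simps)
 note inv = H_involution
 note t0 = trace_reversal[OF relations(1) inv inv inv inv inv]
 note t1 = trace_reversal[OF relations(2) inv inv inv inv inv]
 note t2 = trace_reversal[OF relations(3) inv inv inv inv inv]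
 note t3 = trace_reversal[OF relations(4) inv inv inv inv inv]
 note t4 = trace_reversal[OF relations(5) inv inv inv inv inv]
 note facts = t0[THEN red] t1[THEN red] t2[THEN red] t3[THEN red] t4[THEN red]
 have "\<forall>i j k. g i j * g j k * g k i = g i k * g k j * g j i"
  unfolding all_5 using facts by (simp add: mult_ac)
 then show ?thesis by blast
qed

lemma H_covector: "l v* H j = l - (2 * (l \<bullet> cen j)) *\<^sub>R L j"
proof -
 have "(l v* H j) \<bullet> x = (l - (2 * (l \<bullet> cen j)) *\<^sub>R L j) \<bullet> x" for x
  by (simp only: dot_lmul_matrix H_apply) (simp add: inner_diff_left inner_diff_right)
 then show ?thesis using vector_eq_rdot by blast
qed

lemma H_covector_involution: "(l v* H j) v* H j = l"
 using H_involution[of j] by (simp add: vector_matrix_mul_assoc)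

lemma fourth_zero:
 assumes rel: "H a ** H b ** H c ** H d ** H i = - mat 1" and distinct: "distinct [i, a, b, c, d]"
  and three: "g i a = 0 \<and> g i b = 0 \<and> g i c = 0 \<or> g i a = 0 \<and> g i b = 0 \<and> g i d = 0 \<or>
    g i a = 0 \<and> g i c = 0 \<and> g i d = 0 \<or> g i b = 0 \<and> g i c = 0 \<and> g i d = 0"
 shows "g i a = 0 \<and> g i b = 0 \<and> g i c = 0 \<and> g i d = 0"
proof -
 have fixed: "L i v* H j = L i" if "g i j = 0" for j using that by (simp add: H_covector g_def)
 have zeroI: "g i j = 0" if "L i v* H j = L i" for j
 proof -
  have "L j \<noteq> 0" using unit[of j] by auto
  then show ?thesis using that by (simp add: H_covector g_def)
 qed
 have "L i v* H i = - L i" by (simp add: H_covector unit scaleR_2)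
 moreover have "L i v* (H a ** H b ** H c ** H d ** H i) = - L i"
  unfolding rel using H_covector by (simp add: vec_eq_iff vector_matrix_mult_def mat_def sum_negf if_distrib sum.delta cong: if_cong)
 ultimately have "((((L i v* H a) v* H b) v* H c) v* H d) v* H i = L i v* H i"
  by (simp add: vector_matrix_mul_assoc)
 then have eq: "(((L i v* H a) v* H b) v* H c) v* H d = L i" using H_covector_involution by metis
 have mv: "x v* H j = y \<Longrightarrow> x = y v* H j" for x y j using H_covector_involution by metis
 from three show ?thesis
 proof (elim disjE conjE)
  assume z: "g i a = 0" "g i b = 0" "g i c = 0"
  then have "L i v* H d = L i" using eq by (simp add: fixed)
  then show ?thesis using z zeroI by blast
 next
  assume z: "g i a = 0" "g i b = 0" "g i d = 0"
  then have "L i v* H c = L i" using mv[of "L i v* H c" d "L i"] eq by (simp add: fixed)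
  then show ?thesis using z zeroI by blast
 next
  assume z: "g i a = 0" "g i c = 0" "g i d = 0"
  then have "(L i v* H b) v* H c = L i" using mv[of "(L i v* H b) v* H c" d "L i"] eq by (simp add: fixed)
  then have "L i v* H b = L i" using mv[of "L i v* H b" c "L i"] z by (simp add: fixed)
  then show ?thesis using z zeroI by blast
 next
  assume z: "g i b = 0" "g i c = 0" "g i d = 0"
  then have "((L i v* H a) v* H b) v* H c = L i" using mv[of "((L i v* H a) v* H b) v* H c" d "L i"] eq by (simp add: fixed)
  then have "(L i v* H a) v* H b = L i" using mv[of "(L i v* H a) v* H b" c "L i"] z by (simp add: fixed)
  then have "L i v* H a = L i" using mv[of "L i v* H a" b "L i"] z by (simp add: fixed)
  then show ?thesis using z zeroI by blast
 qed
qed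

lemma lines_zero:
 assumes "distinct [i, j, k]" "L i \<bullet> x = 0" "L j \<bullet> x = 0" "L k \<bullet> x = 0" shows "x = 0"
proof -
 have det: "L i \<bullet> cross3 (L j) (L k) \<noteq> 0" by (rule lines[OF assms(1)])
 then have ne: "cross3 (L j) (L k) \<noteq> 0" by auto
 obtain c where c: "x = c *\<^sub>R cross3 (L j) (L k)"
  by (rule cross3_orthogonal_span[OF _ _ ne, of x]) (use assms in \<open>auto simp: inner_commute\<close>)
 then show ?thesis using assms(2) det by simp
qed

lemma no_three_zeros:
 assumes d: "distinct [i, j, k, l]" and z: "g i j = 0" "g i k = 0" "g i l = 0"
 shows False
proof -
 have cases: "P" if "\<And>a b c d. {a, b, c, d} = UNIV - {i} \<Longrightarrow> distinct [i, a, b, c, d] \<Longrightarrow>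
   H a ** H b ** H c ** H d ** H i = - mat 1 \<Longrightarrow> P" for P
 proof -
  have U: "UNIV = {0, 1, 2, 3, 4 :: 5}" using all_5[of "\<lambda>i. i \<in> {0, 1, 2, 3, 4}"] by auto
  consider "i = 0" | "i = 1" | "i = 2" | "i = 3" | "i = 4" using all_5[of "\<lambda>i. i = 0 \<or> i = 1 \<or> i = 2 \<or> i = 3 \<or> i = 4"] by auto
  then show ?thesis
  proof cases
   case 1
   have "{4, 3, 2, 1} = UNIV - {0 :: 5}" unfolding U by auto
   then show ?thesis using 1 relations(1) by (intro that[of 4 3 2 1]) simp_all
  next
   case 2
   have "{0, 4, 3, 2} = UNIV - {1 :: 5}" unfolding U by auto
   then show ?thesis using 2 relations(2) by (intro that[of 0 4 3 2]) simp_all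
  next
   case 3
   have "{1, 0, 4, 3} = UNIV - {2 :: 5}" unfolding U by auto
   then show ?thesis using 3 relations(3) by (intro that[of 1 0 4 3]) simp_all
  next
   case 4
   have "{2, 1, 0, 4} = UNIV - {3 :: 5}" unfolding U by auto
   then show ?thesis using 4 relations(4) by (intro that[of 2 1 0 4]) simp_all
  next
   case 5
   have "{3, 2, 1, 0} = UNIV - {4 :: 5}" unfolding U by auto
   then show ?thesis using 5 relations(5) by (intro that[of 3 2 1 0]) simp_all
  qed
 qed
 show False
 proof (rule cases)
  fix a b c e assume U: "{a, b, c, e} = UNIV - {i}" and dd: "distinct [i, a, b, c, e]"
   and rel: "H a ** H b ** H c ** H e ** H i = - mat 1"
  have "{j, k, l} \<subseteq> {a, b, c, e}" using U d by auto
  then have "g i a = 0 \<and> g i b = 0 \<and> g i c = 0 \<or> g i a = 0 \<and> g i b = 0 \<and> g i e = 0 \<or>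
    g i a = 0 \<and> g i c = 0 \<and> g i e = 0 \<or> g i b = 0 \<and> g i c = 0 \<and> g i e = 0"
   using d z by auto
  then have all: "g i a = 0 \<and> g i b = 0 \<and> g i c = 0 \<and> g i e = 0" using fourth_zero[OF rel dd] by blast
  have "card {a, b, c, e} = 4" using dd by simp
  then have "L i = 0" using all by (intro centres[of "{a, b, c, e}"]) (auto simp: g_def)
  then show False using unit[of i] by simp
 qed
qed

text \<open>A centre \<open>cen j\<close> on the line \<open>L i\<close> lies on at most one other line. If \<open>cen i\<close> were not on
 \<open>L j\<close>, the identities for triples would put two further centres on \<open>L i\<close>.\<close>

lemma zero_symmetric:
 assumes z: "g i j = 0" shows "g j i = 0"
proof (rule ccontr)
 assume nz: "g j i \<noteq> 0"
 have ij: "i \<noteq> j" using z by auto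
 have "card (UNIV - {i, j} :: 5 set) = 3" using ij by (simp add: card_Diff_subset)
 then obtain k l m where klm: "UNIV - {i, j} = {k, l, m}" "k \<noteq> l" "l \<noteq> m" "k \<noteq> m" unfolding card_3_iff by blast
 have d: "distinct [i, j, k, l, m]" using klm ij by auto
 have one: "g i n = 0 \<or> g n j = 0" for n using triple[of i j n] z nz by auto
 have two: "\<not> (g n j = 0 \<and> g n' j = 0)" if "distinct [i, n, n']" for n n'
  using lines_zero[OF that, of "cen j"] z unit[of j] by (auto simp: g_def)
 have "(g i k = 0 \<and> g i l = 0) \<or> (g i k = 0 \<and> g i m = 0) \<or> (g i l = 0 \<and> g i m = 0)"
  using one[of k] one[of l] one[of m] two[of k l] two[of k m] two[of l m] d by auto
 then show False
  using no_three_zeros[of i j k l] no_three_zeros[of i j k m] no_three_zeros[of i j l m] z d by auto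
qed

lemma symmetrizer:
 obtains a b c d \<mu> where "distinct [a, b, c, d]" "\<And>i. \<mu> i \<noteq> 0"
  "\<And>i j. i \<in> {a, b, c, d} \<Longrightarrow> j \<in> {a, b, c, d} \<Longrightarrow> g i j * \<mu> j = g j i * \<mu> i"
proof -
 have "\<exists>a b c d. distinct [a, b, c, d] \<and>
   (g d a \<noteq> 0 \<and> g d b \<noteq> 0 \<and> g d c \<noteq> 0 \<or>
   g a b \<noteq> 0 \<and> g b c \<noteq> 0 \<and> g c d \<noteq> 0 \<and> \<not> g a c \<noteq> 0 \<and> \<not> g a d \<noteq> 0 \<and> \<not> g b d \<noteq> 0)"
  using zero_symmetric no_three_zeros by (intro five_vertex_graph) blast+
 then obtain a b c d where d: "distinct [a, b, c, d]"
  and alt: "g d a \<noteq> 0 \<and> g d b \<noteq> 0 \<and> g d c \<noteq> 0 \<or>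
   g a b \<noteq> 0 \<and> g b c \<noteq> 0 \<and> g c d \<noteq> 0 \<and> g a c = 0 \<and> g a d = 0 \<and> g b d = 0" by auto
 have "\<exists>\<mu>. (\<forall>i. \<mu> i \<noteq> 0) \<and> (\<forall>i\<in>{a, b, c, d}. \<forall>j\<in>{a, b, c, d}. g i j * \<mu> j = g j i * \<mu> i)"
  using alt
 proof (elim disjE)
  assume n: "g d a \<noteq> 0 \<and> g d b \<noteq> 0 \<and> g d c \<noteq> 0"
  then have n': "g a d \<noteq> 0" "g b d \<noteq> 0" "g c d \<noteq> 0" using zero_symmetric by blast+
  define \<mu> where "\<mu> i = (if i \<in> {a, b, c} then g i d / g d i else 1)" for i
  have "\<mu> i \<noteq> 0" for i using n n' by (auto simp: \<mu>_def)
  moreover have "g i j * \<mu> j = g j i * \<mu> i" if "i \<in> {a, b, c, d}" "j \<in> {a, b, c, d}" for i j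
  proof -
   have \<mu>: "\<mu> k = g k d / g d k \<and> g d k \<noteq> 0" if "k \<in> {a, b, c, d}" for k
    using that n d by (auto simp: \<mu>_def)
   show ?thesis using \<mu>[OF that(1)] \<mu>[OF that(2)] triple[of i j d] by (simp add: field_simps)
  qed
  ultimately show ?thesis by blast
 next
  assume n: "g a b \<noteq> 0 \<and> g b c \<noteq> 0 \<and> g c d \<noteq> 0 \<and> g a c = 0 \<and> g a d = 0 \<and> g b d = 0"
  then have n': "g b a \<noteq> 0" "g c b \<noteq> 0" "g d c \<noteq> 0" "g c a = 0" "g d a = 0" "g d b = 0"
   using zero_symmetric by blast+
  define \<mu> where "\<mu> i = (if i = b then g b a / g a b else if i = c then g b a / g a b * (g c b / g b c)
    else if i = d then g b a / g a b * (g c b / g b c) * (g d c / g c d) else 1)" for i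
  have \<mu>: "\<mu> a = 1" "\<mu> b = g b a / g a b" "\<mu> c = g b a / g a b * (g c b / g b c)"
   "\<mu> d = g b a / g a b * (g c b / g b c) * (g d c / g c d)" using d by (auto simp: \<mu>_def)
  have "\<mu> i \<noteq> 0" for i using n n' by (auto simp: \<mu>_def)
  moreover have "\<forall>i\<in>{a, b, c, d}. \<forall>j\<in>{a, b, c, d}. g i j * \<mu> j = g j i * \<mu> i"
   using n n' by (simp add: \<mu>)
  ultimately show ?thesis by blast
 qed
 then show ?thesis using that d by blast
qed

lemma basis_ext:
 assumes "distinct [i, j, k]" "L i \<bullet> x = L i \<bullet> y" "L j \<bullet> x = L j \<bullet> y" "L k \<bullet> x = L k \<bullet> y" shows "x = y"
 using lines_zero[OF assms(1), of "x - y"] assms by (simp add: inner_diff_right)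

text \<open>The inverse of the invariant form: the symmetric matrix that takes the lines to the centres.\<close>

lemma polarity:
 obtains A \<mu> a b c d where "distinct [a, b, c, d]" "transpose A = A" "invertible A"
  "\<And>i. i \<in> {a, b, c, d} \<Longrightarrow> \<mu> i \<noteq> 0 \<and> A *v L i = \<mu> i *\<^sub>R cen i"
proof -
 obtain a b c d \<mu> where d: "distinct [a, b, c, d]" and \<mu>: "\<And>i. \<mu> i \<noteq> 0"
  and sym: "\<And>i j. i \<in> {a, b, c, d} \<Longrightarrow> j \<in> {a, b, c, d} \<Longrightarrow> g i j * \<mu> j = g j i * \<mu> i"
  using symmetrizer by metis
 have abc: "distinct [a, b, c]" using d by simp
 define D where "D = L a \<bullet> cross3 (L b) (L c)"
 have D: "D \<noteq> 0" unfolding D_def by (rule lines[OF abc])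
 define A where "A = (1 / D) *\<^sub>R (\<mu> a *\<^sub>R outer (cen a) (cross3 (L b) (L c)) + \<mu> b *\<^sub>R outer (cen b) (cross3 (L c) (L a))
   + \<mu> c *\<^sub>R outer (cen c) (cross3 (L a) (L b)))"
 have A: "A *v x = (1 / D) *\<^sub>R ((\<mu> a * (cross3 (L b) (L c) \<bullet> x)) *\<^sub>R cen a + (\<mu> b * (cross3 (L c) (L a) \<bullet> x)) *\<^sub>R cen b
   + (\<mu> c * (cross3 (L a) (L b) \<bullet> x)) *\<^sub>R cen c)" for x
  by (simp add: A_def scaleR_matrix_vector_assoc[symmetric] matrix_vector_mult_add_rdistrib outer_mult_vec)
 have det: "cross3 (L b) (L c) \<bullet> L a = D" "cross3 (L c) (L a) \<bullet> L b = D" "cross3 (L a) (L b) \<bullet> L c = D"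
  unfolding D_def by (simp_all add: cross3_def inner_vec_def sum_3 algebra_simps)
 have AL: "A *v L i = \<mu> i *\<^sub>R cen i" if "i \<in> {a, b, c}" for i
  using that D det by (auto simp: A dot_cross_self)
 have bil: "x \<bullet> (A *v y) = (A *v x) \<bullet> y" for x y
 proof -
  define W where "W x y = x \<bullet> (A *v y) - (A *v x) \<bullet> y" for x y
  have lin: "W (x + x') y = W x y + W x' y" "W x (y + y') = W x y + W x y'" "W (t *\<^sub>R x) y = t * W x y" "W x (t *\<^sub>R y) = t * W x y"
   for x x' y y' t
   by (simp_all add: W_def matrix_vector_right_distrib matrix_vector_mult_scaleR inner_add_left inner_add_right algebra_simps)
  have base: "W (L i) (L j) = 0" if "i \<in> {a, b, c}" "j \<in> {a, b, c}" for i j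
   using sym[of i j] that AL[of i] AL[of j] by (auto simp: W_def g_def inner_commute[of "cen i"] mult.commute)
  have expand: "\<exists>r s t. x = r *\<^sub>R L a + s *\<^sub>R L b + t *\<^sub>R L c" for x
  proof -
   let ?r = "(cross3 (L b) (L c) \<bullet> x) / D" and ?s = "(cross3 (L c) (L a) \<bullet> x) / D" and ?t = "(cross3 (L a) (L b) \<bullet> x) / D"
   have "D *\<^sub>R x = (cross3 (L b) (L c) \<bullet> x) *\<^sub>R L a + (cross3 (L c) (L a) \<bullet> x) *\<^sub>R L b + (cross3 (L a) (L b) \<bullet> x) *\<^sub>R L c"
    unfolding D_def by (simp add: vec_eq_iff forall_3 cross3_def inner_vec_def sum_3 algebra_simps)
   then have "(1 / D) *\<^sub>R (D *\<^sub>R x) = ?r *\<^sub>R L a + ?s *\<^sub>R L b + ?t *\<^sub>R L c" by (simp add: scaleR_add_right)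
   then show ?thesis using D by (intro exI[of _ ?r] exI[of _ ?s] exI[of _ ?t]) simp
  qed
  obtain r s t where x: "x = r *\<^sub>R L a + s *\<^sub>R L b + t *\<^sub>R L c" using expand by blast
  obtain r' s' t' where y: "y = r' *\<^sub>R L a + s' *\<^sub>R L b + t' *\<^sub>R L c" using expand by blast
  have "W x y = 0" unfolding x y by (simp add: lin base)
  then show ?thesis by (simp add: W_def)
 qed
 have tr: "transpose A = A"
 proof -
  have "transpose A *v y = A *v y" for y
  proof -
   have "x \<bullet> (transpose A *v y) = x \<bullet> (A *v y)" for x
    by (simp only: bil) (simp only: dot_lmul_matrix[symmetric] vector_transpose_matrix)
   then show ?thesis using vector_eq_ldot by blast
  qed
  then show ?thesis by (simp add: matrix_eq)
 qed
 have Ad: "A *v L d = \<mu> d *\<^sub>R cen d"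
 proof (rule basis_ext[OF abc])
  have "L i \<bullet> (A *v L d) = L i \<bullet> (\<mu> d *\<^sub>R cen d)" if i: "i \<in> {a, b, c}" for i
  proof -
   have "L i \<bullet> (A *v L d) = \<mu> i * (L d \<bullet> cen i)" by (simp add: bil AL[OF i] inner_commute)
   also have "\<dots> = \<mu> d * (L i \<bullet> cen d)" using sym[of i d] i by (auto simp: g_def mult.commute)
   finally show ?thesis by simp
  qed
  then show "L a \<bullet> (A *v L d) = L a \<bullet> (\<mu> d *\<^sub>R cen d)" "L b \<bullet> (A *v L d) = L b \<bullet> (\<mu> d *\<^sub>R cen d)"
   "L c \<bullet> (A *v L d) = L c \<bullet> (\<mu> d *\<^sub>R cen d)" by auto
 qed
 have all: "\<mu> i \<noteq> 0 \<and> A *v L i = \<mu> i *\<^sub>R cen i" if "i \<in> {a, b, c, d}" for i using that AL Ad \<mu> by auto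
 have "x = 0" if z: "A *v x = 0" for x
 proof (rule centres)
  show "card {a, b, c, d} = 4" using d by simp
  fix i assume i: "i \<in> {a, b, c, d}"
  have "\<mu> i * (x \<bullet> cen i) = x \<bullet> (A *v L i)" using all[OF i] by simp
  also have "\<dots> = 0" by (simp add: bil z)
  finally show "x \<bullet> cen i = 0" using all[OF i] by simp
 qed
 then have "invertible A" by (metis invertible_left_inverse matrix_left_invertible_ker)
 then show ?thesis using that[OF d tr _ all] by blast
qed

theorem invariant_form_exists:
 obtains Q where "nondegenerate_form Q" "\<And>i. \<exists>k. k \<noteq> 0 \<and> Q *v cen i = k *\<^sub>R L i"
proof -
 obtain A \<mu> a b c d where d: "distinct [a, b, c, d]" and tr: "transpose A = A" and inv: "invertible A"
  and A: "\<And>i. i \<in> {a, b, c, d} \<Longrightarrow> \<mu> i \<noteq> 0 \<and> A *v L i = \<mu> i *\<^sub>R cen i"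
  using polarity by metis
 define Q where "Q = matrix_inv A"
 have QA: "Q ** A = mat 1" "A ** Q = mat 1"
  using inv by (simp_all add: Q_def matrix_inv_mult)
 have "transpose Q ** A = mat 1" using arg_cong[OF QA(2), of transpose] by (simp add: matrix_transpose_mul tr)
 then have "transpose Q = Q" using QA by (metis matrix_mul_assoc matrix_mul_lid matrix_mul_rid)
 moreover have "invertible Q" using QA unfolding invertible_def by blast
 ultimately have Q: "nondegenerate_form Q" by (simp add: nondegenerate_form_def invertible_det_nz)
 interpret form Q by (unfold_locales) (rule Q)
 have QL: "Q *v cen i = (1 / \<mu> i) *\<^sub>R L i" if i: "i \<in> {a, b, c, d}" for i
 proof -
  have "L i = Q *v (A *v L i)" using QA by (simp add: matrix_vector_mul_assoc)
  then show ?thesis using A[OF i] by (simp add: matrix_vector_mult_scaleR)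
 qed
 have HR: "H i = R (cen i)" "aniso (cen i)" if k: "k \<noteq> 0" "Q *v cen i = k *\<^sub>R L i" for i k
 proof -
  have pi: "p (cen i) x = k * (L i \<bullet> x)" for x by (subst p_commute) (simp add: p_def k inner_commute)
  then show "aniso (cen i)" using k by (simp add: aniso_def unit)
  show "H i = R (cen i)" using k by (simp add: matrix_eq H_apply R_apply pi unit)
 qed
 have HO: "H i \<in> orthogonal_group Q" if "i \<in> {a, b, c, d}" for i
  using HR[OF _ QL[OF that]] A[OF that] R_orthogonal by simp
 have "\<exists>k. k \<noteq> 0 \<and> Q *v cen i = k *\<^sub>R L i" for i
 proof (cases "i \<in> {a, b, c, d}")
  case True
  then show ?thesis using QL A by (intro exI[of _ "1 / \<mu> i"]) auto
 next
  case False
  have "card {i, a, b, c, d} = CARD(5)" using d False by simp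
  then have "{i, a, b, c, d} = UNIV" by (intro card_subset_eq) auto
  then have other: "H j \<in> orthogonal_group Q" if "j \<noteq> i" for j using that HO by blast
  have neg: "- x \<in> orthogonal_group Q" if "x \<in> orthogonal_group Q" for x
   using that by (simp add: orthogonal_group_iff uminus_matrix_vec)
  have last: "H i \<in> orthogonal_group Q"
   if "H j ** H k ** H l ** H m ** H i = - mat 1" "i \<notin> {j, k, l, m}" for j k l m
  proof -
   have "H j ** H k ** H l ** H m = (H j ** H k ** H l ** H m ** H i) ** H i"
    using H_involution by (simp add: matrix_mul_assoc[symmetric])
   then have "H i = - (H j ** H k ** H l ** H m)" by (simp add: that(1) uminus_matrix_mult)
   moreover have "H j ** H k ** H l ** H m \<in> orthogonal_group Q"
    using that(2) other by (intro orthogonal_group_mult) auto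
   ultimately show ?thesis using neg by simp
  qed
  have "H i \<in> orthogonal_group Q"
  proof -
   have "i = 0 \<or> i = 1 \<or> i = 2 \<or> i = 3 \<or> i = 4"
    using all_5[of "\<lambda>i. i = 0 \<or> i = 1 \<or> i = 2 \<or> i = 3 \<or> i = 4"] by auto
   then show ?thesis
    using last[of 4 3 2 1] last[of 0 4 3 2] last[of 1 0 4 3] last[of 2 1 0 4] last[of 3 2 1 0] relations by auto
  qed
  then have orth: "p (H i *v cen i) (H i *v y) = p (cen i) y" for y by (rule orthogonal_groupD)
  have "H i *v cen i = - cen i" by (simp add: H_apply unit scaleR_2)
  then have "p (- cen i) (H i *v y) = p (cen i) y" for y using orth[of y] by (simp only:)
  then have pi: "p (cen i) y = p (cen i) (cen i) * (L i \<bullet> y)" for y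
   using \<open>\<And>y. p (- cen i) (H i *v y) = p (cen i) y\<close>[of y] by (simp add: H_apply mult.commute)
  have "y \<bullet> (Q *v cen i) = y \<bullet> (p (cen i) (cen i) *\<^sub>R L i)" for y
   using pi[of y] by (subst (asm) p_commute) (simp add: p_def inner_commute)
  then have eq: "Q *v cen i = p (cen i) (cen i) *\<^sub>R L i" using vector_eq_ldot by blast
  have "cen i \<noteq> 0" using unit[of i] by auto
  then have "p (cen i) (cen i) \<noteq> 0" using eq Q_eq_0[of "cen i"] by auto
  then show ?thesis using eq by blast
 qed
 then show ?thesis using that Q by blast
qed

end

section \<open>Convex pentagons\<close>

lemma num5: "(5::5) = 0" "(6::5) = 1" "(7::5) = 2" "(8::5) = 3" "(9::5) = 4"
proof -
 show 5: "(5::5) = 0" by (simp add: iszero_def[symmetric])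
 have "(6::5) = 5 + 1" "(7::5) = 5 + 2" "(8::5) = 5 + 3" "(9::5) = 5 + 4" by simp_all
 then show "(6::5) = 1" "(7::5) = 2" "(8::5) = 3" "(9::5) = 4" unfolding 5 by simp_all
qed

lemma shift5: "i \<noteq> i + (1::5)" "i \<noteq> i + (2::5)" "i \<noteq> i + (3::5)" "i \<noteq> i + (4::5)" "i + 4 + 1 = i"
 by (simp_all add: num5 add.assoc)

lemma chart_simps [simp]: "chart x $ 1 = x $ 1" "chart x $ 2 = x $ 2" "chart x $ 3 = 1"
 by (simp_all add: chart_def)

lemma chart_convex: "chart ((1 - t) *\<^sub>R x + t *\<^sub>R y) = (1 - t) *\<^sub>R chart x + t *\<^sub>R chart y"
 by (simp add: vec_eq_iff forall_3)

lemma chart_inj: "chart x = chart y \<longleftrightarrow> x = y"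
 by (auto simp: vec_eq_iff forall_3 forall_2)

lemma chart_nonzero [simp]: "chart x \<noteq> 0"
 by (metis chart_simps(3) zero_index zero_neq_one)

lemma barycentric:
 "(a \<bullet> cross3 b c) *\<^sub>R x = (x \<bullet> cross3 b c) *\<^sub>R a + (x \<bullet> cross3 c a) *\<^sub>R b + (x \<bullet> cross3 a b) *\<^sub>R c"
 by (simp add: vec_eq_iff forall_3 cross3_def inner_vec_def sum_3 algebra_simps)

lemma det_rotate: "a \<bullet> cross3 b c = b \<bullet> cross3 c a" "a \<bullet> cross3 b c = c \<bullet> cross3 a b"
 "a \<bullet> cross3 c b = - (a \<bullet> cross3 b c)"
 by (simp_all add: cross3_def inner_vec_def sum_3 algebra_simps)

lemma chart_barycentric_hull:
 assumes D: "chart a \<bullet> cross3 (chart b) (chart c) = D" "\<sigma> * D > 0"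
  and nn: "\<sigma> * (chart x \<bullet> cross3 (chart b) (chart c)) \<ge> 0" "\<sigma> * (chart x \<bullet> cross3 (chart c) (chart a)) \<ge> 0"
   "\<sigma> * (chart x \<bullet> cross3 (chart a) (chart b)) \<ge> 0"
 shows "x \<in> convex hull {a, b, c}"
proof -
 define u v w where d: "u = (chart x \<bullet> cross3 (chart b) (chart c)) / D" "v = (chart x \<bullet> cross3 (chart c) (chart a)) / D"
  "w = (chart x \<bullet> cross3 (chart a) (chart b)) / D"
 have D0: "D \<noteq> 0" using D(2) by auto
 have "r / D \<ge> 0" if "\<sigma> * r \<ge> 0" for r
  using that D(2) by (auto simp: zero_le_divide_iff zero_le_mult_iff zero_less_mult_iff)
 then have pos: "u \<ge> 0" "v \<ge> 0" "w \<ge> 0" using nn by (simp_all add: d)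
 have "D *\<^sub>R chart x = D *\<^sub>R (u *\<^sub>R chart a + v *\<^sub>R chart b + w *\<^sub>R chart c)"
  using barycentric[of "chart a" "chart b" "chart c" "chart x"] D(1) D0 by (simp add: d scaleR_add_right)
 then have x: "chart x = u *\<^sub>R chart a + v *\<^sub>R chart b + w *\<^sub>R chart c" using D0 by simp
 have "u + v + w = 1" using x by (simp add: vec_eq_iff forall_3)
 moreover have "x = u *\<^sub>R a + v *\<^sub>R b + w *\<^sub>R c"
  using arg_cong[OF x, of "\<lambda>z. z $ 1"] arg_cong[OF x, of "\<lambda>z. z $ 2"] by (simp add: vec_eq_iff forall_2)
 ultimately show ?thesis using pos by (auto simp: convex_hull_3)
qed

text \<open>The sign \<open>\<sigma>\<close> is the orientation; \<open>f i\<close> is positive inside the side \<open>i\<close>.\<close>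

locale pentagon =
 fixes v :: "5 \<Rightarrow> real^2" and \<sigma> :: real
 assumes pos: "k \<noteq> i \<Longrightarrow> k \<noteq> i + 1 \<Longrightarrow> \<sigma> * (side_line v i \<bullet> chart (v k)) > 0"
begin

definition f :: "5 \<Rightarrow> real^2 \<Rightarrow> real" where "f i x = \<sigma> * (side_line v i \<bullet> chart x)"

abbreviation body where "body \<equiv> convex hull (range v)"

lemma f_pos: "k \<noteq> i \<Longrightarrow> k \<noteq> i + 1 \<Longrightarrow> f i (v k) > 0"
 by (simp add: f_def pos)

lemma f_zero [simp]: "f i (v i) = 0" "f i (v (i + 1)) = 0"
 by (simp_all add: f_def side_line_def dot_cross_self)

lemma f_nonneg: "f i (v k) \<ge> 0"
 using f_pos[of k i] by (cases "k = i \<or> k = i + 1") auto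

lemma sigma_nonzero: "\<sigma> \<noteq> 0"
 using pos[of 2 0] by auto

lemma f_affine: "f i ((1 - t) *\<^sub>R x + t *\<^sub>R y) = (1 - t) * f i x + t * f i y"
 by (simp only: f_def chart_convex inner_add_right inner_scaleR_right) (simp add: algebra_simps)

lemma f_halfplane:
 obtains a b where "\<And>x. f i x = a \<bullet> x - b"
proof -
 have "f i x = (\<sigma> *\<^sub>R vector [side_line v i $ 1, side_line v i $ 2]) \<bullet> x - (- \<sigma> * side_line v i $ 3)" for x
  by (simp add: f_def inner_vec_def sum_2 sum_3 algebra_simps)
 then show ?thesis using that by blast
qed

lemma hull_nonneg: "x \<in> body \<Longrightarrow> f i x \<ge> 0"
proof -
 obtain a b where ab: "\<And>x. f i x = a \<bullet> x - b" using f_halfplane[of i] by metis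
 have "body \<subseteq> {x. a \<bullet> x \<ge> b}"
  using f_nonneg[of i] by (intro hull_minimal convex_halfspace_ge) (auto simp: ab)
 then show "x \<in> body \<Longrightarrow> f i x \<ge> 0" by (auto simp: ab)
qed

lemma hullI:
 assumes nn: "\<And>i. f i x \<ge> 0" shows "x \<in> body"
proof -
 have sub: "convex hull {v i, v j, v k} \<subseteq> body" for i j k by (intro hull_mono) auto
 have f: "f i y = \<sigma> * (chart y \<bullet> cross3 (chart (v i)) (chart (v (i + 1))))" for i y
  by (simp add: f_def side_line_def inner_commute)
 have nn': "\<sigma> * (chart x \<bullet> cross3 (chart (v 0)) (chart (v 1))) \<ge> 0" "\<sigma> * (chart x \<bullet> cross3 (chart (v 1)) (chart (v 2))) \<ge> 0"
  "\<sigma> * (chart x \<bullet> cross3 (chart (v 2)) (chart (v 3))) \<ge> 0" "\<sigma> * (chart x \<bullet> cross3 (chart (v 3)) (chart (v 4))) \<ge> 0"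
  "\<sigma> * (chart x \<bullet> cross3 (chart (v 4)) (chart (v 0))) \<ge> 0"
  using nn[of 0] nn[of 1] nn[of 2] nn[of 3] nn[of 4] by (simp_all add: f num5)
 have ps: "\<sigma> * (chart (v 0) \<bullet> cross3 (chart (v 1)) (chart (v 2))) > 0" "\<sigma> * (chart (v 0) \<bullet> cross3 (chart (v 2)) (chart (v 3))) > 0"
  "\<sigma> * (chart (v 0) \<bullet> cross3 (chart (v 3)) (chart (v 4))) > 0"
  using f_pos[of 0 1] f_pos[of 0 2] f_pos[of 0 3] by (simp_all add: f num5)
 define d where "d k = \<sigma> * (chart x \<bullet> cross3 (chart (v 0)) (chart (v k)))" for k
 have neg: "\<sigma> * (chart x \<bullet> cross3 (chart (v k)) (chart (v 0))) = - d k" for k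
  by (simp add: d_def det_rotate(3)[of _ "chart (v 0)" "chart (v k)"])
 consider "d 2 \<le> 0" | "d 2 \<ge> 0" "d 3 \<le> 0" | "d 3 \<ge> 0" by linarith
 then show ?thesis
 proof cases
  case 1
  then have "x \<in> convex hull {v 0, v 1, v 2}"
   using chart_barycentric_hull[OF refl ps(1), of x] nn' neg[of 2] by simp
  then show ?thesis using sub by blast
 next
  case 2
  then have "x \<in> convex hull {v 0, v 2, v 3}"
   using chart_barycentric_hull[OF refl ps(2), of x] nn' neg[of 3] by (simp add: d_def)
  then show ?thesis using sub by blast
 next
  case 3
  then have "x \<in> convex hull {v 0, v 3, v 4}"
   using chart_barycentric_hull[OF refl ps(3), of x] nn' by (simp add: d_def)
  then show ?thesis using sub by blast
 qed
qed

lemma interior_iff: "x \<in> interior body \<longleftrightarrow> (\<forall>i. f i x > 0)"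
proof
 assume x: "x \<in> interior body"
 then obtain e where e: "e > 0" "ball x e \<subseteq> body" by (auto simp: mem_interior)
 show "\<forall>i. f i x > 0"
 proof
  fix i
  define w where "w = v (i + 2)"
  have fw: "f i w > 0" unfolding w_def by (intro f_pos) (simp_all add: num5)
  define s where "s = e / (2 * (norm (w - x) + 1))"
  have s: "s > 0" using e by (simp add: s_def add_nonneg_pos)
  have "norm (s *\<^sub>R (w - x)) \<le> s * (norm (w - x) + 1)" using s by (simp add: mult_left_mono)
  also have "\<dots> = e / 2" using norm_ge_zero[of "w - x"] by (simp add: s_def field_simps add_nonneg_eq_0_iff)
  also have "\<dots> < e" using e by simp
  finally have "(1 - (- s)) *\<^sub>R x + (- s) *\<^sub>R w \<in> ball x e" by (simp add: dist_norm algebra_simps norm_minus_commute)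
  then have "f i ((1 - (- s)) *\<^sub>R x + (- s) *\<^sub>R w) \<ge> 0" using e hull_nonneg by blast
  then have "s * f i w \<le> (1 + s) * f i x" by (simp only: f_affine) simp
  moreover have "s * f i w > 0" using s fw by simp
  ultimately have "(1 + s) * f i x > 0" by linarith
  then show "f i x > 0" using s by (simp add: zero_less_mult_iff)
 qed
next
 assume x: "\<forall>i. f i x > 0"
 have "open {x. f i x > 0}" for i
 proof -
  obtain a b where ab: "\<And>x. f i x = a \<bullet> x - b" using f_halfplane[of i] by metis
  show ?thesis using open_halfspace_gt[of b a] by (simp add: ab)
 qed
 then have "open (\<Inter>i. {x. f i x > 0})" by (intro open_INT) auto
 moreover have "(\<Inter>i. {x. f i x > 0}) \<subseteq> body" using hullI by (auto intro: less_imp_le)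
 ultimately show "x \<in> interior body" using x by (intro interiorI[of "\<Inter>i. {x. f i x > 0}"]) auto
qed

lemma hull_closed: "closed body"
 by (intro compact_imp_closed compact_convex_hull finite_imp_compact) simp

lemma frontier_iff: "x \<in> frontier body \<longleftrightarrow> x \<in> body \<and> \<not> (\<forall>i. f i x > 0)"
 using hull_closed by (auto simp: frontier_def interior_iff)

lemma side_coordinates:
 assumes z: "f i x = 0"
 obtains s t where "s + t = 1" "x = s *\<^sub>R v i + t *\<^sub>R v (i + 1)"
  "f (i + 1) x = s * f (i + 1) (v i)" "f (i + 4) x = t * f (i + 4) (v (i + 1))"
proof -
 define D where "D = chart (v i) \<bullet> cross3 (chart (v (i + 1))) (chart (v (i + 2)))"
 have "f i (v (i + 2)) > 0" by (intro f_pos) (simp_all add: num5)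
 then have D: "D \<noteq> 0"
  unfolding D_def by (subst det_rotate(2)) (auto simp: f_def side_line_def inner_commute)
 have "chart x \<bullet> cross3 (chart (v i)) (chart (v (i + 1))) = 0"
  using z sigma_nonzero by (simp add: f_def side_line_def inner_commute)
 then have eq: "D *\<^sub>R chart x = (chart x \<bullet> cross3 (chart (v (i + 1))) (chart (v (i + 2)))) *\<^sub>R chart (v i)
   + (chart x \<bullet> cross3 (chart (v (i + 2))) (chart (v i))) *\<^sub>R chart (v (i + 1))"
  using barycentric[of "chart (v i)" "chart (v (i + 1))" "chart (v (i + 2))" "chart x"] by (simp add: D_def)
 define s t where st: "s = (chart x \<bullet> cross3 (chart (v (i + 1))) (chart (v (i + 2)))) / D"
  "t = (chart x \<bullet> cross3 (chart (v (i + 2))) (chart (v i))) / D"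
 have "D *\<^sub>R chart x = D *\<^sub>R (s *\<^sub>R chart (v i) + t *\<^sub>R chart (v (i + 1)))"
  using D by (simp add: eq st scaleR_add_right)
 then have x: "chart x = s *\<^sub>R chart (v i) + t *\<^sub>R chart (v (i + 1))" using D by simp
 have sum: "s + t = 1" using arg_cong[OF x, of "\<lambda>z. z $ 3"] by simp
 have x': "x = s *\<^sub>R v i + t *\<^sub>R v (i + 1)"
  using arg_cong[OF x, of "\<lambda>z. z $ 1"] arg_cong[OF x, of "\<lambda>z. z $ 2"] by (simp add: vec_eq_iff forall_2)
 have "s = 1 - t" using sum by simp
 then have aff: "f j x = s * f j (v i) + t * f j (v (i + 1))" for j using f_affine[of j t] x' by simp
 have "f (i + 4) (v i) = 0" using f_zero(2)[of "i + 4"] by (simp only: shift5)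
 then have "f (i + 1) x = s * f (i + 1) (v i)" "f (i + 4) x = t * f (i + 4) (v (i + 1))"
  using aff[of "i + 1"] aff[of "i + 4"] by simp_all
 then show ?thesis using that sum x' by blast
qed

lemma side_signs: "f (i + 1) (v i) > 0" "f (i + 4) (v (i + 1)) > 0"
 by (intro f_pos; simp add: num5 add.assoc)+

lemma open_side_iff: "x \<in> open_segment (v i) (v (i + 1)) \<longleftrightarrow> f i x = 0 \<and> (\<forall>k. k \<noteq> i \<longrightarrow> f k x > 0)"
proof
 assume "x \<in> open_segment (v i) (v (i + 1))"
 then obtain t where t: "0 < t" "t < 1" "x = (1 - t) *\<^sub>R v i + t *\<^sub>R v (i + 1)" by (auto simp: in_segment)
 have "f k x > 0" if k: "k \<noteq> i" for k
 proof -
  have "f k (v i) > 0 \<or> f k (v (i + 1)) > 0"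
  proof (cases "i = k + 1")
   case True
   then show ?thesis using f_pos[of "i + 1" k] by (auto simp: add.assoc)
  next
   case False
   then show ?thesis using f_pos[of i k] k by auto
  qed
  then show ?thesis using t f_nonneg[of k i] f_nonneg[of k "i + 1"]
   unfolding t(3) f_affine by (auto intro: add_pos_nonneg add_nonneg_pos)
 qed
 moreover have "f i x = 0" unfolding t(3) f_affine by simp
 ultimately show "f i x = 0 \<and> (\<forall>k. k \<noteq> i \<longrightarrow> f k x > 0)" by blast
next
 assume x: "f i x = 0 \<and> (\<forall>k. k \<noteq> i \<longrightarrow> f k x > 0)"
 then obtain s t where st: "s + t = 1" "x = s *\<^sub>R v i + t *\<^sub>R v (i + 1)"
  "f (i + 1) x = s * f (i + 1) (v i)" "f (i + 4) x = t * f (i + 4) (v (i + 1))" using side_coordinates by blast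
 have "f (i + 1) x > 0" "f (i + 4) x > 0" using x by simp_all
 then have "s > 0" "t > 0" using st(3,4) side_signs[of i] by (simp_all add: zero_less_mult_iff)
 moreover have "s = 1 - t" using st(1) by simp
 moreover have "v i \<noteq> v (i + 1)" using side_signs(1)[of i] by (metis f_zero(1) less_irrefl)
 ultimately show "x \<in> open_segment (v i) (v (i + 1))" using st(2) by (auto simp: in_segment)
qed

lemma side_hull: "f i x = 0 \<Longrightarrow> x \<in> body \<Longrightarrow> x \<in> closed_segment (v i) (v (i + 1))"
proof -
 assume x: "f i x = 0" "x \<in> body"
 then obtain s t where st: "s + t = 1" "x = s *\<^sub>R v i + t *\<^sub>R v (i + 1)"
  "f (i + 1) x = s * f (i + 1) (v i)" "f (i + 4) x = t * f (i + 4) (v (i + 1))" using side_coordinates by blast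
 have "f (i + 1) x \<ge> 0" "f (i + 4) x \<ge> 0" using x hull_nonneg by blast+
 then have "s \<ge> 0" "t \<ge> 0" using st(3,4) side_signs[of i] by (simp_all add: zero_le_mult_iff)
 moreover have "s = 1 - t" using st(1) by simp
 ultimately show "x \<in> closed_segment (v i) (v (i + 1))" using st(2) by (auto simp: in_segment)
qed

lemma open_side_frontier:
 assumes "x \<in> open_segment (v i) (v (i + 1))" shows "x \<in> frontier body"
proof -
 have "f i x = 0" "\<And>k. f k x \<ge> 0" using assms unfolding open_side_iff by (metis less_imp_le order_refl)+
 moreover have "\<not> f i x > 0" using calculation(1) by simp
 ultimately show ?thesis using hullI unfolding frontier_iff by blast
qed

lemma frontier_open_side:
 assumes "x \<in> frontier body" "\<And>k. k \<noteq> i \<Longrightarrow> f k x > 0" shows "x \<in> open_segment (v i) (v (i + 1))"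
 using assms hull_nonneg[of x i] unfolding frontier_iff open_side_iff by force

lemma open_side_unique: "x \<in> open_segment (v i) (v (i + 1)) \<Longrightarrow> x \<in> open_segment (v j) (v (j + 1)) \<Longrightarrow> i = j"
 unfolding open_side_iff by (metis less_irrefl)

lemma chord_interior:
 assumes x: "x \<in> open_segment (v i) (v (i + 1))" and y: "y \<in> open_segment (v j) (v (j + 1))" and ij: "i \<noteq> j"
 shows "open_segment x y \<subseteq> interior body"
proof
 fix z assume "z \<in> open_segment x y"
 then obtain t where t: "0 < t" "t < 1" "z = (1 - t) *\<^sub>R x + t *\<^sub>R y" by (auto simp: in_segment)
 have "f k z > 0" for k
 proof -
  have "f k x \<ge> 0" "f k y \<ge> 0" "f k x > 0 \<or> f k y > 0"
   using x y ij unfolding open_side_iff by (metis less_imp_le order_refl)+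
  then show ?thesis using t unfolding t(3) f_affine by (auto intro: add_pos_nonneg add_nonneg_pos)
 qed
 then show "z \<in> interior body" by (simp add: interior_iff)
qed

lemma convex_pentagon: "convex_pentagon v"
 unfolding convex_pentagon_def
proof (intro conjI allI)
 show inj: "inj v"
 proof (rule injI, rule ccontr)
  fix i k assume h: "v i = v k" "i \<noteq> k"
  show False
  proof (cases "k = i + 1")
   case True
   then show False using h side_signs(1)[of i] by (metis f_zero(1) less_irrefl)
  next
   case False
   then show False using h f_pos[of k i] by (metis f_zero(1) less_irrefl)
  qed
 qed
 fix i
 obtain a b where ab: "\<And>x. f i x = a \<bullet> x - b" using f_halfplane[of i] by metis
 have "body \<inter> {x. a \<bullet> x = b} face_of body"
  using hull_nonneg[of _ i] by (intro face_of_Int_supporting_hyperplane_ge) (auto simp: ab)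
 moreover have "body \<inter> {x. a \<bullet> x = b} = closed_segment (v i) (v (i + 1))"
 proof (intro equalityI subsetI)
  fix x assume "x \<in> closed_segment (v i) (v (i + 1))"
  then obtain t where t: "0 \<le> t" "t \<le> 1" "x = (1 - t) *\<^sub>R v i + t *\<^sub>R v (i + 1)" by (auto simp: in_segment)
  have "x \<in> body" unfolding t(3) using t(1,2) by (intro convexD_alt[OF convex_convex_hull] hull_inc) auto
  moreover have "f i x = 0" unfolding t(3) f_affine by simp
  ultimately show "x \<in> body \<inter> {x. a \<bullet> x = b}" by (simp add: ab)
 qed (use side_hull in \<open>auto simp: ab\<close>)
 moreover have "v i \<noteq> v (i + 1)" using inj by (simp add: inj_eq)
 ultimately show "closed_segment (v i) (v (i + 1)) edge_of body"
  by (simp add: edge_of_def segment_convex_hull aff_dim_convex_hull aff_dim_2)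
qed

text \<open>Among any three sides two are consecutive; they meet in a vertex, which lies on no third line.\<close>

lemma lines_independent:
 assumes "distinct [i, j, k]" shows "side_line v i \<bullet> cross3 (side_line v j) (side_line v k) \<noteq> 0"
proof -
 define T where "T i j k = side_line v i \<bullet> cross3 (side_line v j) (side_line v k)" for i j k
 have adj: "T i j (j + 1) \<noteq> 0" if "i \<noteq> j" "i \<noteq> j + 1" for i j
 proof -
  have c: "cross3 (side_line v j) (side_line v (j + 1))
    = (chart (v j) \<bullet> cross3 (chart (v (j + 1))) (chart (v (j + 1 + 1)))) *\<^sub>R chart (v (j + 1))"
   unfolding side_line_def by (simp add: cross3_def inner_vec_def sum_3 vec_eq_iff forall_3 algebra_simps)
  have "\<sigma> * (side_line v j \<bullet> chart (v (j + 1 + 1))) > 0" by (intro pos) (simp_all add: num5 add.assoc)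
  then have "chart (v j) \<bullet> cross3 (chart (v (j + 1))) (chart (v (j + 1 + 1))) \<noteq> 0"
   by (subst det_rotate(2)) (auto simp: side_line_def inner_commute)
  moreover have "\<sigma> * (side_line v i \<bullet> chart (v (j + 1))) > 0" using that by (intro pos) auto
  then have "side_line v i \<bullet> chart (v (j + 1)) \<noteq> 0" by auto
  ultimately show ?thesis by (simp add: T_def c)
 qed
 have rot: "T i j k = T j k i" "T i k j = - T i j k" for i j k
  unfolding T_def by (rule det_rotate)+
 have nz: "T j k i \<noteq> 0 \<and> T k i j \<noteq> 0 \<and> T i k j \<noteq> 0 \<and> T j i k \<noteq> 0 \<and> T k j i \<noteq> 0 \<and> T i j k \<noteq> 0" if "T i j k \<noteq> 0" for i j k
  using that rot by (metis neg_equal_0_iff_equal)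
 note a = adj[of 2 0] adj[of 3 0] adj[of 4 0] adj[of 0 1] adj[of 3 1] adj[of 4 1] adj[of 0 2] adj[of 1 2] adj[of 4 2]
  adj[of 0 3] adj[of 1 3] adj[of 2 3] adj[of 1 4] adj[of 2 4] adj[of 3 4]
 have b: "T 2 0 1 \<noteq> 0" "T 3 0 1 \<noteq> 0" "T 4 0 1 \<noteq> 0" "T 3 1 2 \<noteq> 0" "T 4 1 2 \<noteq> 0" "T 0 2 3 \<noteq> 0" "T 4 2 3 \<noteq> 0" "T 0 3 4 \<noteq> 0"
  "T 1 3 4 \<noteq> 0" "T 2 4 0 \<noteq> 0" using a by (simp_all add: num5)
 have "\<forall>i j k. distinct [i, j, k] \<longrightarrow> T i j k \<noteq> 0"
  unfolding all_5 using nz[OF b(1)] nz[OF b(2)] nz[OF b(3)] nz[OF b(4)] nz[OF b(5)] nz[OF b(6)] nz[OF b(7)] nz[OF b(8)] nz[OF b(9)]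
   nz[OF b(10)] by simp
 then show ?thesis using assms unfolding T_def by blast
qed

end

text \<open>Conversely, an edge is a face, so it cannot be crossed by a segment between two other vertices;
 the two orientations at neighbouring edges agree because they are given by the same determinant.\<close>

lemma convex_pentagon_orientation:
 assumes v: "convex_pentagon v" obtains \<sigma> where "pentagon v \<sigma>"
proof -
 let ?K = "convex hull (range v)"
 define l where "l i x = side_line v i \<bullet> chart x" for i x
 have inj: "v i \<noteq> v k" if "i \<noteq> k" for i k using v that by (auto simp: convex_pentagon_def inj_eq)
 have face: "closed_segment (v i) (v (i + 1)) face_of ?K" for i using v by (auto simp: convex_pentagon_def edge_of_def)
 have ext: "v i extreme_point_of ?K" for i
 proof -
  have "v i extreme_point_of closed_segment (v i) (v (i + 1))" by (simp add: extreme_point_of_segment)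
  then show ?thesis using extreme_point_of_face[OF face] by blast
 qed
 have online: "x \<in> closed_segment (v i) (v (i + 1))" if x: "x \<in> ?K" "l i x = 0" for i x
 proof -
  let ?a = "chart (v i)" and ?b = "chart (v (i + 1))"
  let ?n = "cross3 ?a ?b"
  have "?n \<noteq> 0"
  proof
   assume z: "?n = 0"
   have "?n $ 1 = v i $ 2 - v (i + 1) $ 2" "?n $ 2 = v (i + 1) $ 1 - v i $ 1" by (simp_all add: cross3_def)
   then have "v i = v (i + 1)" using z by (simp add: vec_eq_iff forall_2)
   then show False using inj[of i "i + 1"] by simp
  qed
  define D where "D = ?n \<bullet> ?n"
  have D: "D \<noteq> 0" using \<open>?n \<noteq> 0\<close> by (simp add: D_def)
  define s t where st: "s = (chart x \<bullet> cross3 ?b ?n) / D" "t = (chart x \<bullet> cross3 ?n ?a) / D"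
  have "?a \<bullet> cross3 ?b ?n = D" unfolding D_def by (subst det_rotate(2)) simp
  then have "D *\<^sub>R chart x = D *\<^sub>R (s *\<^sub>R ?a + t *\<^sub>R ?b)"
   using barycentric[of ?a ?b ?n "chart x"] x(2) D by (simp add: st scaleR_add_right l_def side_line_def inner_commute)
  then have c: "chart x = s *\<^sub>R ?a + t *\<^sub>R ?b" using D by simp
  have "s + t = 1" using arg_cong[OF c, of "\<lambda>z. z $ 3"] by simp
  moreover have "x = s *\<^sub>R v i + t *\<^sub>R v (i + 1)"
   using arg_cong[OF c, of "\<lambda>z. z $ 1"] arg_cong[OF c, of "\<lambda>z. z $ 2"] by (simp add: vec_eq_iff forall_2)
  ultimately have "x \<in> affine hull {v i, v (i + 1)}" by (auto simp: affine_hull_2)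
  then have "x \<in> affine hull closed_segment (v i) (v (i + 1))" by (simp add: segment_convex_hull affine_hull_convex_hull)
  then show ?thesis using x(1) face_of_imp_eq_affine_Int[OF convex_convex_hull face] by blast
 qed
 have other: "v k \<notin> closed_segment (v i) (v (i + 1))" if "k \<noteq> i" "k \<noteq> i + 1" for i k
 proof
  assume k: "v k \<in> closed_segment (v i) (v (i + 1))"
  then have "v k extreme_point_of closed_segment (v i) (v (i + 1))"
   using ext extreme_point_of_face[OF face] by blast
  then show False using inj that by (auto simp: extreme_point_of_segment)
 qed
 have vK: "v k \<in> ?K" for k by (simp add: hull_inc)
 have nz: "l i (v k) \<noteq> 0" if "k \<noteq> i" "k \<noteq> i + 1" for i k using online[OF vK] other that by blast
 have same: "l i (v k) * l i (v m) > 0" if k: "k \<noteq> i" "k \<noteq> i + 1" and m: "m \<noteq> i" "m \<noteq> i + 1" for i k m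
 proof (rule ccontr)
  assume "\<not> ?thesis"
  then have neg: "l i (v k) * l i (v m) < 0" using nz[OF k] nz[OF m] by (simp add: not_less less_le)
  then have ne: "l i (v k) - l i (v m) \<noteq> 0" by (auto simp: mult_less_0_iff)
  define t where "t = l i (v k) / (l i (v k) - l i (v m))"
  have t: "0 < t" "t < 1" using neg by (auto simp: t_def mult_less_0_iff field_simps divide_simps split: if_splits)
  define z where "z = (1 - t) *\<^sub>R v k + t *\<^sub>R v m"
  have "l i z = (1 - t) * l i (v k) + t * l i (v m)"
   by (simp add: z_def l_def chart_convex inner_add_right)
  then have "l i z = 0" using ne by (simp add: t_def field_simps)
  moreover have km: "v k \<noteq> v m" using neg by (auto simp: mult_less_0_iff)
  then have zs: "z \<in> open_segment (v k) (v m)" using t by (auto simp: in_segment z_def)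
  then have "z \<in> ?K" using vK[of k] vK[of m] convex_contains_open_segment[of ?K] convex_convex_hull by blast
  ultimately have "z \<in> closed_segment (v i) (v (i + 1))" by (intro online)
  then have "v k \<in> closed_segment (v i) (v (i + 1))" using face_ofD[OF face zs] vK by blast
  then show False using other[OF k] by blast
 qed
 define D where "D i = l i (v (i + 2))" for i
 have D': "D i = l (i + 1) (v i)" for i
  unfolding D_def l_def side_line_def by (simp add: add.assoc inner_commute det_rotate(2)[of "chart (v i)", symmetric])
 have step: "D i * D (i + 1) > 0" for i
  using same[of i "i + 1" "i + 1 + 2"] unfolding D'[of i] by (simp add: D_def num5 add.assoc)
 have all: "D 0 * D i > 0" for i
 proof -
  have "D 0 * D 0 > 0 \<and> D 0 * D 1 > 0 \<and> D 0 * D 2 > 0 \<and> D 0 * D 3 > 0 \<and> D 0 * D 4 > 0"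
   using step[of 0] step[of 1] step[of 2] step[of 3] by (auto simp: zero_less_mult_iff)
  then show ?thesis using all_5[of "\<lambda>i. D 0 * D i > 0"] by blast
 qed
 have "pentagon v (D 0)"
 proof
  fix k i :: 5 assume k: "k \<noteq> i" "k \<noteq> i + 1"
  have "l i (v (i + 2)) * l i (v k) > 0" using k by (intro same) (simp_all add: num5)
  then have "D i * l i (v k) > 0" by (simp add: D_def)
  then show "D 0 * (side_line v i \<bullet> chart (v k)) > 0" using all[of i] by (auto simp: l_def zero_less_mult_iff)
 qed
 then show ?thesis using that by blast
qed

section \<open>Orbits in a pentagon\<close>

definition reflect :: "real^3 \<Rightarrow> real^3 \<Rightarrow> real^3 \<Rightarrow> real^3" where
 "reflect a m z = z - (2 * (m \<bullet> z) / (m \<bullet> a)) *\<^sub>R a"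

text \<open>The point where the ray from \<open>x\<close>, reflected at \<open>y\<close> by the homology with centre \<open>a\<close> and axis \<open>m\<close>,
 meets the line \<open>l\<close>.\<close>

definition hit :: "real^3 \<Rightarrow> real^3 \<Rightarrow> real^3 \<Rightarrow> real^2 \<Rightarrow> real^2 \<Rightarrow> real^3" where
 "hit l m a x y = (l \<bullet> reflect a m (chart x)) *\<^sub>R chart y - (l \<bullet> chart y) *\<^sub>R reflect a m (chart x)"

definition unchart :: "real^3 \<Rightarrow> real^2" where
 "unchart z = vector [z $ 1 / z $ 3, z $ 2 / z $ 3]"

lemma homology_reflect: "homology a m *v z = reflect a m z"
 by (simp add: homology_apply reflect_def)

lemma chart_unchart: "z $ 3 \<noteq> 0 \<Longrightarrow> chart (unchart z) = (1 / z $ 3) *\<^sub>R z"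
 by (simp add: vec_eq_iff forall_3 unchart_def)

lemma unchart_scale: "t \<noteq> 0 \<Longrightarrow> unchart (t *\<^sub>R chart x) = x"
 by (simp add: vec_eq_iff forall_2 unchart_def)

lemma span_pair: "z \<in> span {a, b} \<longleftrightarrow> (\<exists>s t. z = s *\<^sub>R a + t *\<^sub>R b)"
 for z :: "'a::real_vector"
proof
 assume "z \<in> span {a, b}"
 then obtain s where "z - s *\<^sub>R a \<in> span {b}" by (auto simp: span_insert)
 then obtain t where "z - s *\<^sub>R a = t *\<^sub>R b" by (auto simp: span_singleton)
 then have "z = s *\<^sub>R a + t *\<^sub>R b" by (simp add: algebra_simps)
 then show "\<exists>s t. z = s *\<^sub>R a + t *\<^sub>R b" by blast
next
 assume "\<exists>s t. z = s *\<^sub>R a + t *\<^sub>R b"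
 then obtain s t where "z = s *\<^sub>R a + t *\<^sub>R b" by blast
 then show "z \<in> span {a, b}" by (simp add: span_add span_scale span_base)
qed

lemma hit_line: "l \<bullet> hit l m a x y = 0"
 by (simp add: hit_def inner_diff_right)

lemma hit_span: "hit l m a x y \<in> span {chart y, reflect a m (chart x)}"
 unfolding span_pair hit_def by (intro exI[of _ "l \<bullet> reflect a m (chart x)"] exI[of _ "- (l \<bullet> chart y)"]) simp

lemma hit_eq:
 assumes z: "chart z \<in> span {chart y, reflect a m (chart x)}" and lz: "l \<bullet> chart z = 0" and ly: "l \<bullet> chart y \<noteq> 0"
 obtains t where "t \<noteq> 0" "hit l m a x y = t *\<^sub>R chart z"
proof -
 let ?h = "reflect a m (chart x)"
 obtain s t where st: "chart z = s *\<^sub>R chart y + t *\<^sub>R ?h" using z unfolding span_pair by blast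
 have s: "s * (l \<bullet> chart y) = - t * (l \<bullet> ?h)" using lz by (simp add: st inner_add_right)
 have t: "t \<noteq> 0"
 proof
  assume "t = 0"
  then have "s = 0" using s ly by simp
  then show False using st \<open>t = 0\<close> by simp
 qed
 have "t *\<^sub>R hit l m a x y = - (l \<bullet> chart y) *\<^sub>R chart z"
  unfolding hit_def st by (simp add: scaleR_add_right scaleR_diff_right) (metis (no_types, lifting) s mult.commute mult_minus_right add.inverse_inverse minus_mult_right scaleR_minus_left diff_conv_add_uminus add.commute)
 then have "(1 / t) *\<^sub>R (t *\<^sub>R hit l m a x y) = (1 / t) *\<^sub>R (- (l \<bullet> chart y) *\<^sub>R chart z)" by simp
 then have "hit l m a x y = (- (l \<bullet> chart y) / t) *\<^sub>R chart z" using t by simp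
 then show ?thesis using that[of "- (l \<bullet> chart y) / t"] t ly by simp
qed

lemma tendsto_chart [tendsto_intros]: "(x \<longlongrightarrow> x0) F \<Longrightarrow> ((\<lambda>t. chart (x t)) \<longlongrightarrow> chart x0) F"
proof (rule vec_tendstoI)
 fix i :: 3
 assume x: "(x \<longlongrightarrow> x0) F"
 have "\<forall>i::3. ((\<lambda>t. chart (x t) $ i) \<longlongrightarrow> chart x0 $ i) F"
  unfolding forall_3 by (auto intro!: tendsto_intros x)
 then show "((\<lambda>t. chart (x t) $ i) \<longlongrightarrow> chart x0 $ i) F" by blast
qed

lemma tendsto_cross3 [tendsto_intros]:
 assumes "(x \<longlongrightarrow> x0) F" "(y \<longlongrightarrow> y0) F" shows "((\<lambda>t. cross3 (x t) (y t)) \<longlongrightarrow> cross3 x0 y0) F"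
proof (rule vec_tendstoI)
 fix i :: 3
 have "\<forall>i::3. ((\<lambda>t. cross3 (x t) (y t) $ i) \<longlongrightarrow> cross3 x0 y0 $ i) F"
  unfolding forall_3 by (auto simp: cross3_def intro!: tendsto_intros assms)
 then show "((\<lambda>t. cross3 (x t) (y t) $ i) \<longlongrightarrow> cross3 x0 y0 $ i) F" by blast
qed

lemma tendsto_unchart [tendsto_intros]:
 assumes z: "(z \<longlongrightarrow> z0) F" "z0 $ 3 \<noteq> 0" shows "((\<lambda>t. unchart (z t)) \<longlongrightarrow> unchart z0) F"
proof (rule vec_tendstoI)
 fix i :: 2
 have "\<forall>i::2. ((\<lambda>t. unchart (z t) $ i) \<longlongrightarrow> unchart z0 $ i) F"
  unfolding forall_2 by (auto simp: unchart_def intro!: tendsto_intros z)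
 then show "((\<lambda>t. unchart (z t) $ i) \<longlongrightarrow> unchart z0 $ i) F" by blast
qed

lemma tendsto_reflect [tendsto_intros]:
 assumes "(a \<longlongrightarrow> a0) F" "(m \<longlongrightarrow> m0) F" "(z \<longlongrightarrow> z0) F" "m0 \<bullet> a0 \<noteq> 0"
 shows "((\<lambda>t. reflect (a t) (m t) (z t)) \<longlongrightarrow> reflect a0 m0 z0) F"
 unfolding reflect_def by (intro tendsto_intros assms)

lemma tendsto_hit [tendsto_intros]:
 assumes "(l \<longlongrightarrow> l0) F" "(m \<longlongrightarrow> m0) F" "(a \<longlongrightarrow> a0) F" "(x \<longlongrightarrow> x0) F" "(y \<longlongrightarrow> y0) F" "m0 \<bullet> a0 \<noteq> 0"
 shows "((\<lambda>t. hit (l t) (m t) (a t) (x t) (y t)) \<longlongrightarrow> hit l0 m0 a0 x0 y0) F"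
 unfolding hit_def by (intro tendsto_intros assms)

lemma eventually_pentagon:
 assumes v: "\<And>i. ((\<lambda>t. v t i) \<longlongrightarrow> v0 i) F" and p: "pentagon v0 \<sigma>"
 shows "eventually (\<lambda>t. pentagon (v t) \<sigma>) F"
proof -
 have "eventually (\<lambda>t. \<sigma> * (side_line (v t) i \<bullet> chart (v t k)) > 0) F" if "k \<noteq> i" "k \<noteq> i + 1" for i k
 proof (rule order_tendstoD)
  show "((\<lambda>t. \<sigma> * (side_line (v t) i \<bullet> chart (v t k))) \<longlongrightarrow> \<sigma> * (side_line v0 i \<bullet> chart (v0 k))) F"
   unfolding side_line_def by (intro tendsto_intros v)
 qed (rule pentagon.pos[OF p that])
 then have "eventually (\<lambda>t. \<forall>i k. k \<noteq> i \<longrightarrow> k \<noteq> i + 1 \<longrightarrow> \<sigma> * (side_line (v t) i \<bullet> chart (v t k)) > 0) F"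
  by (intro eventually_all_finite) auto
 then show ?thesis by (rule eventually_mono) (unfold_locales, blast)
qed

lemma eventually_open_side:
 assumes v: "\<And>i. ((\<lambda>t. v t i) \<longlongrightarrow> v0 i) F" and p: "pentagon v0 \<sigma>"
  and z: "(z \<longlongrightarrow> z0) F" "z0 \<in> open_segment (v0 i) (v0 (i + 1))"
  and line: "eventually (\<lambda>t. side_line (v t) i \<bullet> chart (z t) = 0) F"
 shows "eventually (\<lambda>t. z t \<in> open_segment (v t i) (v t (i + 1))) F"
proof -
 have "eventually (\<lambda>t. \<sigma> * (side_line (v t) k \<bullet> chart (z t)) > 0) F" if k: "k \<noteq> i" for k
 proof (rule order_tendstoD)
  show "((\<lambda>t. \<sigma> * (side_line (v t) k \<bullet> chart (z t))) \<longlongrightarrow> \<sigma> * (side_line v0 k \<bullet> chart z0)) F"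
   unfolding side_line_def by (intro tendsto_intros v z)
  show "0 < \<sigma> * (side_line v0 k \<bullet> chart z0)"
   using z(2) k unfolding pentagon.open_side_iff[OF p] pentagon.f_def[OF p] by blast
 qed
 then have "eventually (\<lambda>t. \<forall>k. k \<noteq> i \<longrightarrow> \<sigma> * (side_line (v t) k \<bullet> chart (z t)) > 0) F"
  by (intro eventually_all_finite) auto
 with line eventually_pentagon[OF v p] show ?thesis
 proof eventually_elim
  case (elim t)
  then show ?case unfolding pentagon.open_side_iff[OF elim(2)] pentagon.f_def[OF elim(2)] by simp
 qed
qed

text \<open>The points after the first two of an orbit that runs through the sides in their cyclic order.\<close>

definition third :: "(5 \<Rightarrow> real^2) \<Rightarrow> (5 \<Rightarrow> real^3) \<Rightarrow> real^2 \<Rightarrow> real^2 \<Rightarrow> real^2" where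
 "third v a x y = unchart (hit (side_line v 2) (side_line v 1) (a 1) x y)"

definition fourth :: "(5 \<Rightarrow> real^2) \<Rightarrow> (5 \<Rightarrow> real^3) \<Rightarrow> real^2 \<Rightarrow> real^2 \<Rightarrow> real^2" where
 "fourth v a x y = unchart (hit (side_line v 3) (side_line v 2) (a 2) y (third v a x y))"

definition fifth :: "(5 \<Rightarrow> real^2) \<Rightarrow> (5 \<Rightarrow> real^3) \<Rightarrow> real^2 \<Rightarrow> real^2 \<Rightarrow> real^2" where
 "fifth v a x y = unchart (hit (side_line v 4) (side_line v 3) (a 3) (third v a x y) (fourth v a x y))"

abbreviation on_side :: "(5 \<Rightarrow> real^2) \<Rightarrow> 5 \<Rightarrow> real^2 \<Rightarrow> bool" where
 "on_side v i x \<equiv> x \<in> open_segment (v i) (v (i + 1))"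

definition good_start :: "(5 \<Rightarrow> real^2) \<Rightarrow> (5 \<Rightarrow> real^3) \<Rightarrow> real^2 \<Rightarrow> real^2 \<Rightarrow> bool" where
 "good_start v a x y \<longleftrightarrow> on_side v 0 x \<and> on_side v 1 y \<and> on_side v 2 (third v a x y) \<and> on_side v 3 (fourth v a x y) \<and>
   on_side v 4 (fifth v a x y) \<and> hit (side_line v 2) (side_line v 1) (a 1) x y $ 3 \<noteq> 0 \<and>
   hit (side_line v 3) (side_line v 2) (a 2) y (third v a x y) $ 3 \<noteq> 0 \<and>
   hit (side_line v 4) (side_line v 3) (a 3) (third v a x y) (fourth v a x y) $ 3 \<noteq> 0"

text \<open>Each point of the orbit depends continuously on the two before it, and on the line of a side the open side is defined by
 strict inequalities.\<close>

lemma eventually_good_start: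
 assumes v: "\<And>i. ((\<lambda>t. v t i) \<longlongrightarrow> v0 i) F" and p: "pentagon v0 \<sigma>"
  and a: "\<And>i. ((\<lambda>t. a t i) \<longlongrightarrow> a0 i) F" and nz: "\<And>i. side_line v0 i \<bullet> a0 i \<noteq> 0"
  and x: "(x \<longlongrightarrow> x0) F" and y: "(y \<longlongrightarrow> y0) F"
  and sides: "eventually (\<lambda>t. on_side (v t) 0 (x t) \<and> on_side (v t) 1 (y t)) F"
  and good: "good_start v0 a0 x0 y0"
 shows "eventually (\<lambda>t. good_start (v t) (a t) (x t) (y t)) F"
proof -
 note g = good[unfolded good_start_def]
 have L: "((\<lambda>t. side_line (v t) i) \<longlongrightarrow> side_line v0 i) F" for i
  unfolding side_line_def by (intro tendsto_intros v)
 have step: "((\<lambda>t. unchart (hit (side_line (v t) j) (side_line (v t) i) (a t i) (w t) (z t))) \<longlongrightarrow>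
    unchart (hit (side_line v0 j) (side_line v0 i) (a0 i) w0 z0)) F"
   "eventually (\<lambda>t. hit (side_line (v t) j) (side_line (v t) i) (a t i) (w t) (z t) $ 3 \<noteq> 0) F"
   "eventually (\<lambda>t. on_side (v t) j (unchart (hit (side_line (v t) j) (side_line (v t) i) (a t i) (w t) (z t)))) F"
  if w: "(w \<longlongrightarrow> w0) F" and z: "(z \<longlongrightarrow> z0) F"
   and n3: "hit (side_line v0 j) (side_line v0 i) (a0 i) w0 z0 $ 3 \<noteq> 0"
   and on: "on_side v0 j (unchart (hit (side_line v0 j) (side_line v0 i) (a0 i) w0 z0))" for w z w0 z0 i j
 proof -
  have h: "((\<lambda>t. hit (side_line (v t) j) (side_line (v t) i) (a t i) (w t) (z t)) \<longlongrightarrow>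
    hit (side_line v0 j) (side_line v0 i) (a0 i) w0 z0) F" by (intro tendsto_intros L a w z nz)
  show t: "((\<lambda>t. unchart (hit (side_line (v t) j) (side_line (v t) i) (a t i) (w t) (z t))) \<longlongrightarrow>
    unchart (hit (side_line v0 j) (side_line v0 i) (a0 i) w0 z0)) F" by (intro tendsto_unchart h n3)
  have "((\<lambda>t. hit (side_line (v t) j) (side_line (v t) i) (a t i) (w t) (z t) $ 3) \<longlongrightarrow>
    hit (side_line v0 j) (side_line v0 i) (a0 i) w0 z0 $ 3) F" by (intro tendsto_vec_nth h)
  then show ev: "eventually (\<lambda>t. hit (side_line (v t) j) (side_line (v t) i) (a t i) (w t) (z t) $ 3 \<noteq> 0) F"
   using n3 by (rule tendsto_imp_eventually_ne)
  have "eventually (\<lambda>t. side_line (v t) j \<bullet> chart (unchart (hit (side_line (v t) j) (side_line (v t) i) (a t i) (w t) (z t))) = 0) F"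
   using ev by eventually_elim (simp add: chart_unchart hit_line)
  then show "eventually (\<lambda>t. on_side (v t) j (unchart (hit (side_line (v t) j) (side_line (v t) i) (a t i) (w t) (z t)))) F"
   by (rule eventually_open_side[OF v p t on])
 qed
 have n3: "hit (side_line v0 2) (side_line v0 1) (a0 1) x0 y0 $ 3 \<noteq> 0"
   "on_side v0 2 (unchart (hit (side_line v0 2) (side_line v0 1) (a0 1) x0 y0))"
  using g by (simp_all add: third_def)
 note s3 = step[OF x y n3, folded third_def]
 have n4: "hit (side_line v0 3) (side_line v0 2) (a0 2) y0 (third v0 a0 x0 y0) $ 3 \<noteq> 0"
   "on_side v0 3 (unchart (hit (side_line v0 3) (side_line v0 2) (a0 2) y0 (third v0 a0 x0 y0)))"
  using g by (simp_all add: fourth_def)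
 note s4 = step[OF y s3(1) n4, folded fourth_def]
 have n5: "hit (side_line v0 4) (side_line v0 3) (a0 3) (third v0 a0 x0 y0) (fourth v0 a0 x0 y0) $ 3 \<noteq> 0"
   "on_side v0 4 (unchart (hit (side_line v0 4) (side_line v0 3) (a0 3) (third v0 a0 x0 y0) (fourth v0 a0 x0 y0)))"
  using g by (simp_all add: fifth_def)
 note s5 = step(2,3)[OF s3(1) s4(1) n5, folded fifth_def]
 from sides s3(2,3) s4(2,3) s5 show ?thesis
  by eventually_elim (simp add: good_start_def)
qed

lemma homology_fixes: "m \<bullet> z = 0 \<Longrightarrow> homology a m *v z = z"
 by (simp add: homology_apply)

lemma homology_involution: "m \<bullet> a \<noteq> 0 \<Longrightarrow> homology a m ** homology a m = mat 1"
 by (simp add: matrix_eq matrix_vector_mul_assoc[symmetric] homology_apply inner_diff_right)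

lemma det_homology: "m \<bullet> a \<noteq> 0 \<Longrightarrow> det (homology a m) = - 1"
proof -
 assume ne: "m \<bullet> a \<noteq> 0"
 define t where "t = 2 / (m \<bullet> a)"
 have "det (homology a m) = 1 - t * (m \<bullet> a)"
  unfolding homology_def t_def[symmetric]
  by (simp add: det_3 outer_def mat_def inner_vec_def sum_3 algebra_simps)
 then show ?thesis using ne by (simp add: t_def)
qed

lemma chart_pair_independent:
 assumes "y \<noteq> z" "s *\<^sub>R chart y = t *\<^sub>R chart z" shows "s = 0 \<and> t = 0"
proof -
 have "s = t" using arg_cong[OF assms(2), of "\<lambda>w. w $ 3"] by simp
 then have "s *\<^sub>R chart y = s *\<^sub>R chart z" using assms(2) by simp
 then have "s = 0 \<or> y = z" by (auto simp: chart_inj)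
 then show ?thesis using \<open>s = t\<close> assms(1) by simp
qed

lemma in_span_exchange:
 assumes "chart z \<in> span {chart y, h}" "z \<noteq> y" shows "h \<in> span {chart y, chart z}"
proof -
 obtain s t where st: "chart z = s *\<^sub>R chart y + t *\<^sub>R h" using assms(1) unfolding span_pair by blast
 have t: "t \<noteq> 0"
 proof
  assume "t = 0"
  then have "1 *\<^sub>R chart z = s *\<^sub>R chart y" using st by simp
  then show False using chart_pair_independent assms(2) by fastforce
 qed
 have "h = (1 / t) *\<^sub>R (chart z - s *\<^sub>R chart y)" using t by (simp add: st)
 then have "h = (- s / t) *\<^sub>R chart y + (1 / t) *\<^sub>R chart z" by (simp add: scaleR_diff_right)
 then show ?thesis unfolding span_pair by blast
qed

lemma span_image_pair:
 fixes M :: "real^3^3"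
 assumes "x \<in> span {a, b}" "M *v a \<in> span S" "M *v b \<in> span S" shows "M *v x \<in> span S"
proof -
 obtain s t where "x = s *\<^sub>R a + t *\<^sub>R b" using assms(1) unfolding span_pair by blast
 then show ?thesis using assms(2,3)
  by (simp add: matrix_vector_right_distrib matrix_vector_mult_scaleR span_add span_scale)
qed

text \<open>A chord leaves a pentagon through exactly one other point: of the points of the line through
 \<open>y\<close> and \<open>z\<close> on different sides, those that are strictly between \<open>y\<close> and \<open>z\<close> are interior and those
 outside the segment are outside the pentagon.\<close>

lemma (in pentagon) next_point_unique:
 assumes y: "on_side v j y" and z: "on_side v k z" and jk: "j \<noteq> k"
  and w: "on_side v m w" "w \<noteq> y" and wy: "chart w \<in> span {chart y, chart z}"
 shows "w = z"
proof -
 obtain s t where st: "chart w = s *\<^sub>R chart y + t *\<^sub>R chart z" using wy unfolding span_pair by blast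
 have s: "s = 1 - t" using arg_cong[OF st, of "\<lambda>w. w $ 3"] by simp
 then have "chart w = chart ((1 - t) *\<^sub>R y + t *\<^sub>R z)" by (simp add: st chart_convex)
 then have wt: "w = (1 - t) *\<^sub>R y + t *\<^sub>R z" by (simp add: chart_inj)
 have nn: "f i w \<ge> 0" for i using w(1) unfolding open_side_iff by (metis less_imp_le order_refl)
 have "f j y = 0" "f j z > 0" "f k z = 0" "f k y > 0" using y z jk unfolding open_side_iff by metis+
 then have "t * f j z \<ge> 0" "(1 - t) * f k y \<ge> 0" using nn[of j] nn[of k] unfolding wt f_affine by simp_all
 then have t: "0 \<le> t" "t \<le> 1" using \<open>f j z > 0\<close> \<open>f k y > 0\<close> by (simp_all add: zero_le_mult_iff)
 have "t \<noteq> 0" using w(2) wt by auto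
 moreover have "\<not> t < 1"
 proof
  assume "t < 1"
  have "y \<noteq> z" using \<open>f j y = 0\<close> \<open>f j z > 0\<close> by auto
  then have "w \<in> open_segment y z"
   using \<open>t \<noteq> 0\<close> t \<open>t < 1\<close> wt unfolding in_segment by (intro conjI exI[of _ t]) auto
  then have "f m w > 0" using chord_interior[OF y z jk] by (auto simp: interior_iff)
  then show False using w(1) unfolding open_side_iff by simp
 qed
 ultimately show ?thesis using t wt by simp
qed

locale billiard = pentagon +
 fixes c :: "5 \<Rightarrow> rp2"
 assumes centre_off: "side_line v i \<bullet> rep_rp2 (c i) \<noteq> 0"
begin

abbreviation "cen i \<equiv> rep_rp2 (c i)"

abbreviation H where "H i \<equiv> side_reflection v c i"

abbreviation "Z3 \<equiv> third v (\<lambda>i. cen i)"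
abbreviation "Z4 \<equiv> fourth v (\<lambda>i. cen i)"
abbreviation "Z5 \<equiv> fifth v (\<lambda>i. cen i)"

abbreviation "good x y \<equiv> good_start v (\<lambda>i. cen i) x y"

lemma H_reflect: "H i *v x = reflect (cen i) (side_line v i) x"
 by (simp add: side_reflection_def homology_reflect)

lemma side_line_zero: "on_side v i x \<Longrightarrow> side_line v i \<bullet> chart x = 0"
 using sigma_nonzero unfolding open_side_iff f_def by simp

lemma side_line_nonzero: "on_side v i x \<Longrightarrow> k \<noteq> i \<Longrightarrow> side_line v k \<bullet> chart x \<noteq> 0"
 unfolding open_side_iff f_def by fastforce

lemma H_fixes: "on_side v i x \<Longrightarrow> H i *v chart x = chart x"
 by (simp add: side_reflection_def homology_fixes side_line_zero)

lemma H_involution: "H i ** H i = mat 1"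
 by (simp add: side_reflection_def homology_involution centre_off)

lemma H_cancel: "H i *v (H i *v x) = x"
 by (simp add: matrix_vector_mul_assoc H_involution)

lemma on_side_ne: "on_side v i x \<Longrightarrow> on_side v j y \<Longrightarrow> i \<noteq> j \<Longrightarrow> x \<noteq> y"
 using open_side_unique by blast

lemma orbit_plane:
 assumes "chart w \<in> span {chart z, H i *v chart y}" "w \<noteq> z" "on_side v i z" "u \<in> span {chart y, chart z}"
 shows "H i *v u \<in> span {chart z, chart w}"
 by (rule span_image_pair[OF assms(4)]) (simp_all add: in_span_exchange[OF assms(1,2)] H_fixes[OF assms(3)] span_base)

lemma hit_in_span:
 assumes "hit (side_line v j) (side_line v i) (cen i) x y $ 3 \<noteq> 0"
 shows "chart (unchart (hit (side_line v j) (side_line v i) (cen i) x y)) \<in> span {chart y, H i *v chart x}"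
 unfolding chart_unchart[OF assms] H_reflect by (intro span_scale hit_span)

lemma good_spans:
 assumes "good x y"
 shows "chart (Z3 x y) \<in> span {chart y, H 1 *v chart x}"
  "chart (Z4 x y) \<in> span {chart (Z3 x y), H 2 *v chart y}"
  "chart (Z5 x y) \<in> span {chart (Z4 x y), H 3 *v chart (Z3 x y)}"
proof -
 note h = assms[unfolded good_start_def]
 have "hit (side_line v 2) (side_line v 1) (cen 1) x y $ 3 \<noteq> 0" using h by blast
 from hit_in_span[OF this] show "chart (Z3 x y) \<in> span {chart y, H 1 *v chart x}" unfolding third_def .
 have "hit (side_line v 3) (side_line v 2) (cen 2) y (Z3 x y) $ 3 \<noteq> 0" using h by blast
 from hit_in_span[OF this] show "chart (Z4 x y) \<in> span {chart (Z3 x y), H 2 *v chart y}" unfolding fourth_def .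
 have "hit (side_line v 4) (side_line v 3) (cen 3) (Z3 x y) (Z4 x y) $ 3 \<noteq> 0" using h by blast
 from hit_in_span[OF this] show "chart (Z5 x y) \<in> span {chart (Z4 x y), H 3 *v chart (Z3 x y)}" unfolding fifth_def .
qed

lemma good_sides:
 assumes "good x y"
 shows "on_side v 0 x" "on_side v 1 y" "on_side v 2 (Z3 x y)" "on_side v 3 (Z4 x y)" "on_side v 4 (Z5 x y)"
 using assms unfolding good_start_def by blast+

lemma next_point:
 assumes q: "billiard_orbit v c q" and y: "on_side v j (q (Suc n))" and z: "on_side v k z" and jk: "j \<noteq> k"
  and zs: "chart z \<in> span {chart (q (Suc n)), H j *v chart (q n)}"
 shows "q (Suc (Suc n)) = z"
proof -
 have "chart (q (Suc (Suc n))) \<in> span {chart (q (Suc n)), H j *v chart (q n)}"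
  using q y unfolding billiard_orbit_def reflected_def by blast
 moreover have "H j *v chart (q n) \<in> span {chart (q (Suc n)), chart z}"
  using zs on_side_ne[OF y z jk] by (intro in_span_exchange) auto
 ultimately have "chart (q (Suc (Suc n))) \<in> span {chart (q (Suc n)), chart z}"
  using span_minimal[of "{chart (q (Suc n)), H j *v chart (q n)}" "span {chart (q (Suc n)), chart z}"]
  by (auto simp: span_base)
 moreover obtain m where "on_side v m (q (Suc (Suc n)))" using q unfolding billiard_orbit_def by blast
 moreover have "q (Suc (Suc n)) \<noteq> q (Suc n)" using q unfolding billiard_orbit_def by metis
 ultimately show ?thesis using next_point_unique[OF y z jk] by blast
qed

text \<open>The reflected ray and the position of the sides determine the orbit.\<close>

lemma good_orbit:
 assumes q: "billiard_orbit v c q" and g: "good (q 0) (q 1)"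
 shows "q 2 = Z3 (q 0) (q 1)" "q 3 = Z4 (q 0) (q 1)" "q 4 = Z5 (q 0) (q 1)"
proof -
 note s = good_sides[OF g] and sp = good_spans[OF g]
 show 2: "q 2 = Z3 (q 0) (q 1)"
  using next_point[OF q, where j = 1 and n = 0 and k = 2] s(2,3) sp(1) by (simp add: numeral_2_eq_2)
 show 3: "q 3 = Z4 (q 0) (q 1)"
  using next_point[OF q, where j = 2 and n = 1 and k = 3] s(3,4) sp(2) 2 by (simp add: numeral_2_eq_2 numeral_3_eq_3)
 show "q 4 = Z5 (q 0) (q 1)"
  using next_point[OF q, where j = 3 and n = 2 and k = 4] s(4,5) sp(3) 2 3 by (simp add: numeral_eq_Suc)
qed

lemma hit_orbit:
 assumes q: "billiard_orbit v c q" and s: "on_side v i (q (Suc n))" "on_side v j (q (Suc (Suc n)))" "i \<noteq> j"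
 shows "hit (side_line v j) (side_line v i) (cen i) (q n) (q (Suc n)) $ 3 \<noteq> 0 \<and>
  unchart (hit (side_line v j) (side_line v i) (cen i) (q n) (q (Suc n))) = q (Suc (Suc n))"
proof -
 have "chart (q (Suc (Suc n))) \<in> span {chart (q (Suc n)), reflect (cen i) (side_line v i) (chart (q n))}"
  using q s(1) unfolding billiard_orbit_def reflected_def H_reflect by blast
 moreover have "side_line v j \<bullet> chart (q (Suc (Suc n))) = 0" "side_line v j \<bullet> chart (q (Suc n)) \<noteq> 0"
  using side_line_zero[OF s(2)] side_line_nonzero[OF s(1)] s(3) by auto
 ultimately obtain t where "t \<noteq> 0" "hit (side_line v j) (side_line v i) (cen i) (q n) (q (Suc n)) = t *\<^sub>R chart (q (Suc (Suc n)))"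
  by (rule hit_eq)
 then show ?thesis by (simp add: unchart_scale)
qed

lemma orbit_good:
 assumes q: "billiard_orbit v c q" and s: "on_side v 0 (q 0)" "on_side v 1 (q 1)" "on_side v 2 (q 2)" "on_side v 3 (q 3)" "on_side v 4 (q 4)"
 shows "good (q 0) (q 1)"
proof -
 have h1: "hit (side_line v 2) (side_line v 1) (cen 1) (q 0) (q 1) $ 3 \<noteq> 0 \<and>
  unchart (hit (side_line v 2) (side_line v 1) (cen 1) (q 0) (q 1)) = q 2"
  using hit_orbit[OF q, where i = 1 and n = 0 and j = 2] s by (simp add: numeral_2_eq_2)
 then have t: "Z3 (q 0) (q 1) = q 2" by (simp add: third_def)
 have h2: "hit (side_line v 3) (side_line v 2) (cen 2) (q 1) (q 2) $ 3 \<noteq> 0 \<and>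
  unchart (hit (side_line v 3) (side_line v 2) (cen 2) (q 1) (q 2)) = q 3"
  using hit_orbit[OF q, where i = 2 and n = 1 and j = 3] s by (simp add: numeral_eq_Suc)
 then have f: "Z4 (q 0) (q 1) = q 3" unfolding fourth_def t by (rule conjunct2)
 have h3: "hit (side_line v 4) (side_line v 3) (cen 3) (q 2) (q 3) $ 3 \<noteq> 0 \<and>
  unchart (hit (side_line v 4) (side_line v 3) (cen 3) (q 2) (q 3)) = q 4"
  using hit_orbit[OF q, where i = 3 and n = 2 and j = 4] s by (simp add: numeral_eq_Suc)
 then have "Z5 (q 0) (q 1) = q 4" unfolding fifth_def t f by (rule conjunct2)
 then show ?thesis using h1 h2 h3 s t f by (simp add: good_start_def)
qed

definition M :: "real^3^3" where "M = H 0 ** H 4 ** H 3 ** H 2 ** H 1"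

lemma M_apply: "M *v x = H 0 *v (H 4 *v (H 3 *v (H 2 *v (H 1 *v x))))"
 unfolding M_def by (simp add: matrix_vector_mul_assoc matrix_mul_assoc)

lemma Suc_5: "Suc 5 = 6"
 by simp

lemma periodic_plane:
 assumes q: "periodic_orbit v c 5 q" and g: "good (q 0) (q 1)" and u: "u \<in> span {chart (q 0), chart (q 1)}"
 shows "M *v u \<in> span {chart (q 0), chart (q 1)}"
proof -
 have o: "billiard_orbit v c q" and q5: "q 5 = q 0" using q by (simp_all add: periodic_orbit_def)
 have "\<exists>t. q 6 - q 5 = t *\<^sub>R (q 1 - q 0)"
  using q unfolding periodic_orbit_def Suc_5 One_nat_def by blast
 then obtain t where t: "q 6 - q 5 = t *\<^sub>R (q 1 - q 0)" by blast
 note s = good_sides[OF g, folded good_orbit[OF o g]]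
 have r: "chart (q (Suc (Suc n))) \<in> span {chart (q (Suc n)), H i *v chart (q n)}" if "on_side v i (q (Suc n))" for i n
  using o that unfolding billiard_orbit_def reflected_def by blast
 have ne: "q (Suc (Suc n)) \<noteq> q (Suc n)" for n using o unfolding billiard_orbit_def by metis
 have pl: "H i *v u \<in> span {chart (q (Suc n)), chart (q (Suc (Suc n)))}"
  if "on_side v i (q (Suc n))" "u \<in> span {chart (q n), chart (q (Suc n))}" for i n u
  by (rule orbit_plane[OF r[OF that(1)] ne that])
 have "H 1 *v u \<in> span {chart (q 1), chart (q 2)}"
  using pl[where i = 1 and n = 0] s u by (simp add: numeral_eq_Suc)
 then have "H 2 *v (H 1 *v u) \<in> span {chart (q 2), chart (q 3)}"
  using pl[where i = 2 and n = 1] s by (simp add: numeral_eq_Suc)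
 then have "H 3 *v (H 2 *v (H 1 *v u)) \<in> span {chart (q 3), chart (q 4)}"
  using pl[where i = 3 and n = 2] s by (simp add: numeral_eq_Suc)
 then have "H 4 *v (H 3 *v (H 2 *v (H 1 *v u))) \<in> span {chart (q 4), chart (q 5)}"
  using pl[where i = 4 and n = 3] s by (simp add: numeral_eq_Suc)
 moreover have "on_side v 0 (q 5)" using s q5 by simp
 ultimately have "M *v u \<in> span {chart (q 5), chart (q 6)}"
  using pl[where i = 0 and n = 4] unfolding M_apply by (simp add: numeral_eq_Suc)
 moreover have "q 6 = (1 - t) *\<^sub>R q 0 + t *\<^sub>R q 1" using t by (simp add: q5 algebra_simps)
 then have "chart (q 6) \<in> span {chart (q 0), chart (q 1)}"
  by (simp add: chart_convex span_add span_scale span_base)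
 ultimately show ?thesis
  using span_minimal[of "{chart (q 5), chart (q 6)}" "span {chart (q 0), chart (q 1)}"] by (auto simp: q5 span_base)
qed

text \<open>Two lines through \<open>x\<close> are mapped to themselves, and so is their point of intersection.\<close>

lemma M_eigenvector:
 assumes st: "M *v chart x \<in> span {chart x, chart y}" "M *v chart x \<in> span {chart x, chart z}"
  and s: "on_side v i y" "on_side v i z" "y \<noteq> z" "\<not> side_line v i \<bullet> chart x = 0"
 obtains l where "M *v chart x = l *\<^sub>R chart x"
proof -
 obtain a b where ab: "M *v chart x = a *\<^sub>R chart x + b *\<^sub>R chart y" using st(1) unfolding span_pair by blast
 obtain a' b' where ab': "M *v chart x = a' *\<^sub>R chart x + b' *\<^sub>R chart z" using st(2) unfolding span_pair by blast
 have e: "(a - a') *\<^sub>R chart x + b *\<^sub>R chart y = b' *\<^sub>R chart z"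
  using ab ab' by (simp add: algebra_simps)
 have "(a - a') * (side_line v i \<bullet> chart x) = 0"
  using arg_cong[OF e, of "inner (side_line v i)"] side_line_zero[OF s(1)] side_line_zero[OF s(2)]
  by (simp add: inner_add_right)
 then have "a = a'" using s(4) by simp
 then have "b *\<^sub>R chart y = b' *\<^sub>R chart z" using e by simp
 then have "b = 0" using chart_pair_independent s(3) by blast
 then show ?thesis using ab that by simp
qed

lemma M_scalar_on_line:
 assumes ne: "x \<noteq> y" and z: "2 *\<^sub>R chart z = chart x + chart y"
  and e: "M *v chart x = a *\<^sub>R chart x" "M *v chart y = b *\<^sub>R chart y" "M *v chart z = k *\<^sub>R chart z"
 shows "a = b"
proof -
 have "k *\<^sub>R (2 *\<^sub>R chart z) = 2 *\<^sub>R (M *v chart z)" by (simp add: e mult.commute)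
 also have "\<dots> = M *v (2 *\<^sub>R chart z)" by (simp add: matrix_vector_mult_scaleR)
 also have "\<dots> = a *\<^sub>R chart x + b *\<^sub>R chart y" unfolding z by (simp add: matrix_vector_right_distrib e)
 finally have "(k - a) *\<^sub>R chart x = (b - k) *\<^sub>R chart y" unfolding z by (simp add: algebra_simps)
 then show ?thesis using chart_pair_independent[OF ne] by force
qed

text \<open>The eigenlines of \<open>M\<close> include all points of the sides \<open>0\<close> and \<open>1\<close> near the two starting points, hence
 \<open>M\<close> is a multiple of the identity on both lines; they share a vertex. The multiple is \<open>-1\<close> since
 each of the five homologies has determinant \<open>-1\<close>.\<close>

lemma reflective_relation:
 assumes r: "reflective_along v c 5 of_nat"
 obtains x y where "good x y" "M = - mat 1"
proof -
 obtain p U1 U2 where p: "periodic_orbit v c 5 p" and sides: "\<forall>j<5. on_side v (of_nat j) (p j)"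
  and U: "openin (top_of_set (frontier body)) U1" "openin (top_of_set (frontier body)) U2" "p 0 \<in> U1" "p 1 \<in> U2"
  and orb: "\<forall>x\<in>U1. \<forall>y\<in>U2. \<exists>q. periodic_orbit v c 5 q \<and> q 0 = x \<and> q 1 = y"
  using r unfolding reflective_along_def One_nat_def by blast
 have s: "on_side v 0 (p 0)" "on_side v 1 (p 1)" "on_side v 2 (p 2)" "on_side v 3 (p 3)" "on_side v 4 (p 4)"
  using sides[rule_format, of 0] sides[rule_format, of 1] sides[rule_format, of 2] sides[rule_format, of 3]
   sides[rule_format, of 4] by simp_all
 have good0: "good (p 0) (p 1)" by (rule orbit_good[OF _ s]) (use p in \<open>simp add: periodic_orbit_def\<close>)
 define X where "X t = p 0 + t *\<^sub>R (v 1 - v 0)" for t :: real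
 define Y where "Y t = p 1 + t *\<^sub>R (v 2 - v 1)" for t :: real
 let ?F = "nhds (0 :: real \<times> real)"
 have "((\<lambda>t. X (fst t)) \<longlongrightarrow> p 0 + fst (0 :: real \<times> real) *\<^sub>R (v 1 - v 0)) ?F"
  "((\<lambda>t. Y (snd t)) \<longlongrightarrow> p 1 + snd (0 :: real \<times> real) *\<^sub>R (v 2 - v 1)) ?F"
  unfolding X_def Y_def by (intro tendsto_intros filterlim_ident)+
 then have tend: "((\<lambda>t. X (fst t)) \<longlongrightarrow> p 0) ?F" "((\<lambda>t. Y (snd t)) \<longlongrightarrow> p 1) ?F" by simp_all
 have chart_add: "chart (a + t *\<^sub>R (b - d)) = chart a + t *\<^sub>R (chart b - chart d)" for a b d t
  by (simp add: vec_eq_iff forall_3)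
 have z: "side_line v 0 \<bullet> chart (v 0) = 0" "side_line v 0 \<bullet> chart (v 1) = 0"
   "side_line v 1 \<bullet> chart (v 1) = 0" "side_line v 1 \<bullet> chart (v 2) = 0"
  by (simp_all add: side_line_def dot_cross_self)
 have line: "side_line v 0 \<bullet> chart (X t) = 0" "side_line v 1 \<bullet> chart (Y t) = 0" for t
  using side_line_zero[OF s(1)] side_line_zero[OF s(2)] z
  unfolding X_def Y_def chart_add by (simp_all add: inner_add_right inner_diff_right)
 have pent: "pentagon v \<sigma>" by unfold_locales
 have on: "eventually (\<lambda>t. on_side v 0 (X (fst t))) ?F" "eventually (\<lambda>t. on_side v 1 (Y (snd t))) ?F"
  by (rule eventually_open_side[OF tendsto_const pent tend(1) s(1)], simp add: line)
   (rule eventually_open_side[OF tendsto_const pent tend(2) s(2)], simp add: line)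
 have g: "eventually (\<lambda>t. good (X (fst t)) (Y (snd t))) ?F"
  by (rule eventually_good_start[OF tendsto_const pent tendsto_const centre_off tend eventually_conj[OF on] good0])
 obtain V1 V2 where V: "open V1" "open V2" "U1 = frontier body \<inter> V1" "U2 = frontier body \<inter> V2"
  using U(1,2) unfolding openin_open by blast
 have "eventually (\<lambda>t. X (fst t) \<in> V1) ?F" "eventually (\<lambda>t. Y (snd t) \<in> V2) ?F"
  using tend U(3,4) V by (auto intro!: topological_tendstoD)
 with on g have "eventually (\<lambda>t. good (X (fst t)) (Y (snd t)) \<and> X (fst t) \<in> U1 \<and> Y (snd t) \<in> U2) ?F"
 proof eventually_elim
  case (elim t)
  then show ?case using open_side_frontier[OF elim(1)] open_side_frontier[of _ 1] V by simp
 qed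
 then obtain W where W: "open W" "0 \<in> W" "\<And>t. t \<in> W \<Longrightarrow> good (X (fst t)) (Y (snd t)) \<and> X (fst t) \<in> U1 \<and> Y (snd t) \<in> U2"
  unfolding eventually_nhds by blast
 obtain e where e: "e > 0" "ball 0 e \<subseteq> W" using W(1,2) by (auto simp: open_contains_ball)
 define d where "d = e / 3"
 have d: "d > 0" using e by (simp add: d_def)
 have small: "(a, b) \<in> W" if "\<bar>a\<bar> \<le> d" "\<bar>b\<bar> \<le> d" for a b
 proof -
  have "norm (a, b) \<le> norm a + norm b" by (rule norm_Pair_le)
  also have "\<dots> < e" using that e by (simp add: d_def)
  finally show ?thesis using e(2) by (auto simp: dist_norm)
 qed
 have plane: "M *v u \<in> span {chart (X a), chart (Y b)}"
  if "\<bar>a\<bar> \<le> d" "\<bar>b\<bar> \<le> d" "u \<in> span {chart (X a), chart (Y b)}" for a b u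
 proof -
  have w: "good (X a) (Y b)" "X a \<in> U1" "Y b \<in> U2" using W(3)[OF small[OF that(1,2)]] by simp_all
  obtain q where "periodic_orbit v c 5 q" "q 0 = X a" "q 1 = Y b" using orb w(2,3) by blast
  then show ?thesis using periodic_plane[of q u] w(1) that(3) by simp
 qed
 have side: "on_side v 0 (X a)" "on_side v 1 (Y a)" if "\<bar>a\<bar> \<le> d" for a
  using good_sides(1)[of "X a" "Y 0"] good_sides(2)[of "X 0" "Y a"] W(3)[OF small[OF that, of 0]] W(3)[OF small[OF _ that, of 0]] d
  by simp_all
 have vne: "v 0 \<noteq> v 1" "v 1 \<noteq> v 2" using side_signs(1)[of 0] side_signs(1)[of 1] f_zero(1)[of 1] f_zero(1)[of 2]
  by (metis less_irrefl add_0 one_add_one)+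
 have Xne: "X a \<noteq> X b" "Y a \<noteq> Y b" if "a \<noteq> b" for a b using that vne by (simp_all add: X_def Y_def)
 have eX: "\<exists>l. M *v chart (X a) = l *\<^sub>R chart (X a)" if a: "\<bar>a\<bar> \<le> d" for a
 proof -
  have "M *v chart (X a) \<in> span {chart (X a), chart (Y 0)}" "M *v chart (X a) \<in> span {chart (X a), chart (Y d)}"
   using a d by (simp_all add: plane span_base)
  then show ?thesis
   by (rule M_eigenvector[OF _ _ side(2) side(2) Xne(2)]) (use d side_line_nonzero[OF side(1)[OF a], of 1] in auto)
 qed
 have eY: "\<exists>l. M *v chart (Y a) = l *\<^sub>R chart (Y a)" if a: "\<bar>a\<bar> \<le> d" for a
 proof -
  have "M *v chart (Y a) \<in> span {chart (Y a), chart (X 0)}" "M *v chart (Y a) \<in> span {chart (Y a), chart (X d)}"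
   using a d by (simp_all add: plane span_base insert_commute)
  then show ?thesis
   by (rule M_eigenvector[OF _ _ side(1) side(1) Xne(1)]) (use d side_line_nonzero[OF side(2)[OF a], of 0] in auto)
 qed
 \<comment> \<open>Three points on a line that are eigenvectors have the same eigenvalue.\<close>
 obtain a b a' b' k k' where E: "M *v chart (X d) = a *\<^sub>R chart (X d)" "M *v chart (X (- d)) = b *\<^sub>R chart (X (- d))"
   "M *v chart (X 0) = k *\<^sub>R chart (X 0)" "M *v chart (Y d) = a' *\<^sub>R chart (Y d)"
   "M *v chart (Y (- d)) = b' *\<^sub>R chart (Y (- d))" "M *v chart (Y 0) = k' *\<^sub>R chart (Y 0)"
  using eX[of d] eX[of "- d"] eX[of 0] eY[of d] eY[of "- d"] eY[of 0] d by auto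
 have mid: "2 *\<^sub>R chart (X 0) = chart (X d) + chart (X (- d))" "2 *\<^sub>R chart (Y 0) = chart (Y d) + chart (Y (- d))"
  by (simp_all add: vec_eq_iff forall_3 X_def Y_def)
 have ab: "a = b" "a' = b'"
  using M_scalar_on_line[OF Xne(1) mid(1) E(1,2,3)] M_scalar_on_line[OF Xne(2) mid(2) E(4,5,6)] d by auto
 have scalar: "M *v chart w = l *\<^sub>R chart w"
  if e: "M *v chart x = l *\<^sub>R chart x" "M *v chart y = l *\<^sub>R chart y" and w: "w = (1 - t) *\<^sub>R x + t *\<^sub>R y" for x y w l t
  unfolding w chart_convex by (simp add: matrix_vector_right_distrib matrix_vector_mult_scaleR e algebra_simps)
 have line: "M *v chart w = l *\<^sub>R chart w"
  if e: "M *v chart (x + d *\<^sub>R (z' - z)) = l *\<^sub>R chart (x + d *\<^sub>R (z' - z))"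
   "M *v chart (x + (- d) *\<^sub>R (z' - z)) = l *\<^sub>R chart (x + (- d) *\<^sub>R (z' - z))"
   and w: "w = z \<or> w = z'" and x: "x \<in> open_segment z z'" for w x z z' l
 proof -
  obtain t where t: "x = (1 - t) *\<^sub>R z + t *\<^sub>R z'" using x by (auto simp: in_segment)
  have "\<exists>r. w = x + r *\<^sub>R (z' - z)" unfolding t
   using w by (auto intro: exI[of _ "- t"] exI[of _ "1 - t"] simp: algebra_simps)
  then obtain r where r: "w = x + r *\<^sub>R (z' - z)" by blast
  have "w = (1 - (d - r) / (2 * d)) *\<^sub>R (x + d *\<^sub>R (z' - z)) + ((d - r) / (2 * d)) *\<^sub>R (x + (- d) *\<^sub>R (z' - z))"
   using d unfolding r by (simp add: vec_eq_iff field_simps)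
  then show ?thesis using scalar[OF e] by blast
 qed
 note lineX = line[OF E(1,2)[unfolded ab X_def]] and lineY = line[OF E(4,5)[unfolded ab Y_def]]
 have m: "M *v chart (v 0) = b *\<^sub>R chart (v 0)" "M *v chart (v 1) = b *\<^sub>R chart (v 1)" "M *v chart (v 1) = b' *\<^sub>R chart (v 1)"
   "M *v chart (v 2) = b' *\<^sub>R chart (v 2)"
  using lineX[of "v 0"] lineX[of "v 1"] lineY[of "v 1"] lineY[of "v 2"] s(1,2) by simp_all
 have "b *\<^sub>R chart (v 1) = b' *\<^sub>R chart (v 1)" unfolding m(2)[symmetric] by (rule m(3))
 then have bb: "b' = b" by simp
 let ?D = "chart (v 0) \<bullet> cross3 (chart (v 1)) (chart (v 2))"
 have "f 0 (v 2) > 0" using f_pos[of 2 0] by simp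
 then have D: "?D \<noteq> 0" by (subst det_rotate(2)) (auto simp: f_def side_line_def inner_commute)
 have "M *v z = b *\<^sub>R z" for z
 proof -
  have "?D *\<^sub>R (M *v z) = M *v (?D *\<^sub>R z)" by (simp add: matrix_vector_mult_scaleR)
  also have "\<dots> = b *\<^sub>R (?D *\<^sub>R z)"
   unfolding barycentric[of _ _ _ z]
   by (simp add: matrix_vector_right_distrib matrix_vector_mult_scaleR m bb[symmetric] scaleR_add_right mult.commute)
  also have "\<dots> = ?D *\<^sub>R (b *\<^sub>R z)" by (rule scaleR_left_commute)
  finally have "?D *\<^sub>R (M *v z) = ?D *\<^sub>R (b *\<^sub>R z)" .
  then show ?thesis using D unfolding scaleR_cancel_left by blast
 qed
 then have Mb: "M = b *\<^sub>R mat 1" by (simp add: matrix_eq scaleR_matrix_vector_assoc[symmetric])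
 have "det M = - 1"
  unfolding M_def side_reflection_def by (simp add: det_mul det_homology centre_off)
 moreover have "det (b *\<^sub>R mat 1 :: real^3^3) = b ^ 3" by (simp add: det_3 mat_def power3_eq_cube)
 ultimately have "(b + 1) * ((b - 1 / 2)\<^sup>2 + 3 / 4) = 0" using Mb by (simp add: power3_eq_cube power2_eq_square algebra_simps)
 moreover have "(b - 1 / 2)\<^sup>2 + 3 / 4 \<noteq> 0" using zero_le_power2[of "b - 1 / 2"] by linarith
 ultimately have "b = - 1" by auto
 then show ?thesis using that good0 Mb by simp
qed

text \<open>Conversely, the relation \<open>M = -1\<close> makes the plane of the starting ray return to itself, so the
 reflections at the fifth and at the first point close up the orbit.\<close>

lemma closing:
 assumes M: "M = - mat 1" and g: "good x y"
 shows "chart x \<in> span {chart (Z5 x y), H 4 *v chart (Z4 x y)}" "chart y \<in> span {chart x, H 0 *v chart (Z5 x y)}"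
proof -
 note s = good_sides[OF g] and sp = good_spans[OF g]
 let ?P = "span {chart (Z5 x y), H 4 *v chart (Z4 x y)}"
 have returns: "H 0 *v u \<in> ?P" if "u \<in> span {chart x, chart y}" for u
 proof -
  have 1: "H 1 *v u \<in> span {chart y, chart (Z3 x y)}"
   using that by (intro orbit_plane[OF sp(1)] on_side_ne[OF s(3,2)] s) simp_all
  have 2: "H 2 *v (H 1 *v u) \<in> span {chart (Z3 x y), chart (Z4 x y)}"
   using 1 by (intro orbit_plane[OF sp(2)] on_side_ne[OF s(4,3)] s) simp_all
  have 3: "H 3 *v (H 2 *v (H 1 *v u)) \<in> span {chart (Z4 x y), chart (Z5 x y)}"
   using 2 by (intro orbit_plane[OF sp(3)] on_side_ne[OF s(5,4)] s) simp_all
  have "H 4 *v (H 3 *v (H 2 *v (H 1 *v u))) \<in> ?P"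
   by (rule span_image_pair[OF 3]) (simp_all add: span_base H_fixes[OF s(5)])
  moreover have "H 0 *v (M *v u) = H 4 *v (H 3 *v (H 2 *v (H 1 *v u)))" by (simp add: M_apply H_cancel)
  ultimately have "- (H 0 *v u) \<in> ?P" by (simp add: M uminus_matrix_vec)
  then show ?thesis using span_neg by fastforce
 qed
 show x: "chart x \<in> ?P" using returns[of "chart x"] by (simp add: span_base H_fixes[OF s(1)])
 have "H 4 *v chart (Z4 x y) \<in> span {chart (Z5 x y), chart x}"
  using x by (intro in_span_exchange on_side_ne[OF s(1,5)]) simp_all
 then have "?P \<subseteq> span {chart (Z5 x y), chart x}"
  by (intro span_minimal) (simp_all add: span_base)
 then have "H 0 *v chart y \<in> span {chart (Z5 x y), chart x}" using returns[of "chart y"] by (auto simp: span_base)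
 then have "H 0 *v (H 0 *v chart y) \<in> span {chart x, H 0 *v chart (Z5 x y)}"
  by (rule span_image_pair) (simp_all add: span_base H_fixes[OF s(1)])
 then show "chart y \<in> span {chart x, H 0 *v chart (Z5 x y)}" by (simp add: H_cancel)
qed

definition closed_orbit :: "real^2 \<Rightarrow> real^2 \<Rightarrow> nat \<Rightarrow> real^2" where
 "closed_orbit x y n = [x, y, Z3 x y, Z4 x y, Z5 x y] ! (n mod 5)"

lemma closed_orbit_values:
 "closed_orbit x y 0 = x" "closed_orbit x y 1 = y" "closed_orbit x y 2 = Z3 x y" "closed_orbit x y 3 = Z4 x y"
 "closed_orbit x y 4 = Z5 x y" "closed_orbit x y 5 = x" "closed_orbit x y 6 = y"
 by (simp_all add: closed_orbit_def)

lemma closed_orbit_mod: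
 "closed_orbit x y n = closed_orbit x y (n mod 5)"
 "closed_orbit x y (Suc n) = closed_orbit x y (Suc (n mod 5))"
 "closed_orbit x y (Suc (Suc n)) = closed_orbit x y (Suc (Suc (n mod 5)))"
 unfolding closed_orbit_def by (simp, metis mod_Suc_eq, metis mod_Suc_eq)

lemma of_nat_mod5: "(of_nat (n mod 5) :: 5) = of_nat n"
proof -
 have "(of_nat n :: 5) = of_nat (5 * (n div 5) + n mod 5)" by simp
 also have "\<dots> = of_nat (n mod 5)" by (simp only: of_nat_add of_nat_mult of_nat_numeral num5) simp
 finally show ?thesis by simp
qed

lemma closed_periodic:
 assumes M: "M = - mat 1" and g: "good x y"
 shows "periodic_orbit v c 5 (closed_orbit x y)" "on_side v (of_nat n) (closed_orbit x y n)"
proof -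
 let ?q = "closed_orbit x y"
 note s = good_sides[OF g] and sp = good_spans[OF g] closing[OF M g]
 have five: "k = 0 \<or> k = 1 \<or> k = 2 \<or> k = 3 \<or> k = 4" if "k < 5" for k :: nat using that by presburger
 have suc: "Suc 0 = 1" "Suc 1 = 2" "Suc 2 = 3" "Suc 3 = 4" "Suc 4 = 5" "Suc 5 = 6" by simp_all
 have nats: "of_nat 0 = (0 :: 5)" "of_nat 1 = (1 :: 5)" "of_nat 2 = (2 :: 5)" "of_nat 3 = (3 :: 5)" "of_nat 4 = (4 :: 5)"
  "of_nat 5 = (0 :: 5)" by (simp_all add: num5)
 have "on_side v (of_nat k) (?q k)" if "k < 5" for k
  using five[OF that] s by (elim disjE) (simp_all only: closed_orbit_values nats add_0)
 then have on: "on_side v (of_nat n) (?q n)" for n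
  unfolding of_nat_mod5[of n, symmetric] closed_orbit_mod(1)[of x y n] by simp
 then show "on_side v (of_nat n) (?q n)" .
 have "of_nat n \<noteq> (of_nat (Suc n) :: 5)" for n using shift5(1)[of "of_nat n"] by (simp add: add.commute)
 then have ne: "?q n \<noteq> ?q (Suc n)" "open_segment (?q n) (?q (Suc n)) \<subseteq> interior body" for n
  using on_side_ne[OF on on] chord_interior[OF on on] by blast+
 have refl: "chart (?q (Suc (Suc n))) \<in> span {chart (?q (Suc n)), H (of_nat (Suc n)) *v chart (?q n)}" for n
 proof -
  have "chart (?q (Suc (Suc k))) \<in> span {chart (?q (Suc k)), H (of_nat (Suc k)) *v chart (?q k)}" if "k < 5" for k
   using five[OF that] sp by (elim disjE) (simp_all only: suc closed_orbit_values nats)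
  from this[of "n mod 5"] have "chart (?q (Suc (Suc (n mod 5)))) \<in>
    span {chart (?q (Suc (n mod 5))), H (of_nat (Suc (n mod 5))) *v chart (?q (n mod 5))}" by simp
  moreover have "of_nat (Suc (n mod 5)) = (of_nat (Suc n) :: 5)" by (simp add: of_nat_mod5)
  ultimately show ?thesis by (simp only: closed_orbit_mod[of x y n])
 qed
 have "reflected v c i (?q n) (?q (Suc n)) (?q (Suc (Suc n)))" if "on_side v i (?q (Suc n))" for n i
 proof -
  have "i = of_nat (Suc n)" using open_side_unique[OF that on] .
  then show ?thesis using refl[of n] unfolding reflected_def by simp
 qed
 then have "billiard_orbit v c ?q" unfolding billiard_orbit_def using on ne by blast
 moreover have "?q 5 = ?q 0" "?q (Suc 5) = ?q (Suc 0)" by (simp_all only: suc closed_orbit_values)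
 ultimately show "periodic_orbit v c 5 ?q"
  unfolding periodic_orbit_def by (auto intro: exI[of _ 1])
qed

text \<open>By continuity, the rays from all points of the boundary near the two starting points run through the sides in the same order.\<close>

lemma reflectiveI:
 assumes M: "M = - mat 1" and g: "good x y"
 shows "reflective_along v c 5 of_nat"
proof -
 let ?Fr = "frontier body"
 let ?F = "inf (nhds (x, y)) (principal (?Fr \<times> ?Fr))"
 have pent: "pentagon v \<sigma>" by unfold_locales
 have "(fst \<longlongrightarrow> fst (x, y)) (nhds (x, y))" "(snd \<longlongrightarrow> snd (x, y)) (nhds (x, y))"
  by (intro tendsto_intros filterlim_ident)+
 then have tend: "(fst \<longlongrightarrow> x) ?F" "(snd \<longlongrightarrow> y) ?F" by (auto intro: tendsto_mono[OF inf_le1])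
 have on: "eventually (\<lambda>t. on_side v i (w t)) ?F"
  if w: "(w \<longlongrightarrow> w0) ?F" "on_side v i w0" and fr: "\<And>t. t \<in> ?Fr \<times> ?Fr \<Longrightarrow> w t \<in> ?Fr" for w w0 i
 proof -
  have "eventually (\<lambda>t. f k (w t) > 0) ?F" if "k \<noteq> i" for k
  proof (rule order_tendstoD)
   show "((\<lambda>t. f k (w t)) \<longlongrightarrow> f k w0) ?F" unfolding f_def by (intro tendsto_intros w)
  qed (use w(2) that in \<open>simp add: open_side_iff\<close>)
  then have "eventually (\<lambda>t. \<forall>k. k \<noteq> i \<longrightarrow> f k (w t) > 0) ?F" by (intro eventually_all_finite) auto
  moreover have "eventually (\<lambda>t. w t \<in> ?Fr) ?F"
   unfolding eventually_inf_principal by (intro always_eventually allI impI fr)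
  ultimately show ?thesis by eventually_elim (blast intro: frontier_open_side)
 qed
 have "eventually (\<lambda>t. good (fst t) (snd t)) ?F"
  by (rule eventually_good_start[OF tendsto_const pent tendsto_const centre_off tend _ g])
   (intro eventually_conj on[OF tend(1)] on[OF tend(2)] good_sides[OF g]; auto)
 then obtain W where W: "open W" "(x, y) \<in> W" "\<forall>t\<in>W. t \<in> ?Fr \<times> ?Fr \<longrightarrow> good (fst t) (snd t)"
  unfolding eventually_inf_principal eventually_nhds by blast
 obtain A B where AB: "open A" "open B" "(x, y) \<in> A \<times> B" "A \<times> B \<subseteq> W" using open_prod_elim[OF W(1,2)] by blast
 have fr: "x \<in> ?Fr" "y \<in> ?Fr" using open_side_frontier good_sides[OF g] by blast+
 show ?thesis unfolding reflective_along_def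
 proof (intro exI conjI ballI)
  show "periodic_orbit v c 5 (closed_orbit x y)" by (rule closed_periodic[OF M g])
  show "\<forall>j<5. on_side v (of_nat j) (closed_orbit x y j)" using closed_periodic(2)[OF M g] by blast
  show "openin (top_of_set ?Fr) (?Fr \<inter> A)" "openin (top_of_set ?Fr) (?Fr \<inter> B)" using AB by (auto simp: openin_open)
  show "closed_orbit x y 0 \<in> ?Fr \<inter> A" "closed_orbit x y (Suc 0) \<in> ?Fr \<inter> B" using AB fr by (simp_all add: closed_orbit_def)
  fix x' y' assume "x' \<in> ?Fr \<inter> A" "y' \<in> ?Fr \<inter> B"
  then have "good x' y'" using W(3) AB(4) by fastforce
  then show "periodic_orbit v c 5 (closed_orbit x' y')" by (rule closed_periodic[OF M])
  show "closed_orbit x' y' 0 = x'" "closed_orbit x' y' (Suc 0) = y'" by (simp_all add: closed_orbit_def)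
 qed
qed

end

section \<open>Every reflective billiard arises from the construction\<close>

lemma (in billiard) relation:
 assumes "M = - mat 1" shows "H 4 ** H 3 ** H 2 ** H 1 ** H 0 = - mat 1"
proof -
 have "H 0 ** (H 4 ** H 3 ** H 2 ** H 1) = - mat 1" using assms by (simp add: M_def matrix_mul_assoc)
 then have "H 0 ** (H 0 ** (H 4 ** H 3 ** H 2 ** H 1)) = - H 0" by (simp add: uminus_matrix_mult)
 then have "H 4 ** H 3 ** H 2 ** H 1 = - H 0" by (simp add: matrix_mul_assoc H_involution)
 then show ?thesis by (simp add: uminus_matrix_mult H_involution)
qed

lemma convex_billiard_iff: "convex_billiard v c \<longleftrightarrow> (\<exists>\<sigma>. billiard v \<sigma> c)"
proof
 assume c: "convex_billiard v c"
 obtain \<sigma> where "pentagon v \<sigma>" using c convex_pentagon_orientation unfolding convex_billiard_def by blast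
 then have "billiard v \<sigma> c"
  using c by (intro billiard.intro billiard_axioms.intro) (simp_all add: convex_billiard_def)
 then show "\<exists>\<sigma>. billiard v \<sigma> c" by blast
next
 assume "\<exists>\<sigma>. billiard v \<sigma> c"
 then obtain \<sigma> where b: "billiard v \<sigma> c" by blast
 then show "convex_billiard v c"
  using pentagon.convex_pentagon[OF billiard.axioms(1)[OF b]] billiard.centre_off[OF b] by (simp add: convex_billiard_def)
qed

lemma reflective_invariant_form:
 assumes "convex_5_reflective v c"
 obtains \<sigma> Q k where "billiard v \<sigma> c" "nondegenerate_form Q" "\<And>i. k i \<noteq> 0" "\<And>i. Q *v rep_rp2 (c i) = k i *\<^sub>R side_line v i"
  "side_reflection v c 4 ** side_reflection v c 3 ** side_reflection v c 2 ** side_reflection v c 1 ** side_reflection v c 0 = - mat 1"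
proof -
 obtain \<sigma> where b: "billiard v \<sigma> c" using assms convex_billiard_iff unfolding convex_5_reflective_def by blast
 interpret billiard v \<sigma> c by (rule b)
 have "M = - mat 1" using assms reflective_relation unfolding convex_5_reflective_def by metis
 then have rel: "H 4 ** H 3 ** H 2 ** H 1 ** H 0 = - mat 1" using relation by blast
 define a where "a i = (1 / (side_line v i \<bullet> cen i)) *\<^sub>R cen i" for i
 have H: "homology (a i) (side_line v i) = H i" for i
  using homology_scale[of "1 / (side_line v i \<bullet> cen i)" 1 "cen i" "side_line v i"] centre_off[of i]
  by (simp add: a_def side_reflection_def)
 have five: "five_homologies (side_line v) a"
 proof
  show "side_line v i \<bullet> a i = 1" for i using centre_off by (simp add: a_def)
  show "homology (a 4) (side_line v 4) ** homology (a 3) (side_line v 3) ** homology (a 2) (side_line v 2) **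
    homology (a 1) (side_line v 1) ** homology (a 0) (side_line v 0) = - mat 1"
   unfolding H by (rule rel)
  show "distinct [i, j, k] \<Longrightarrow> side_line v i \<bullet> cross3 (side_line v j) (side_line v k) \<noteq> 0" for i j k
   by (rule lines_independent)
  fix S :: "5 set" and l :: "real^3"
  assume S: "card S = 4" "\<And>i. i \<in> S \<Longrightarrow> l \<bullet> a i = 0"
  have "l \<bullet> cen i = 0" if "i \<in> S" for i using S(2)[OF that] centre_off[of i] by (simp add: a_def)
  then show "l = 0" using S(1) assms unfolding convex_5_reflective_def no_four_collinear_def by blast
 qed
 obtain Q where Q: "nondegenerate_form Q" "\<forall>i. \<exists>k. k \<noteq> 0 \<and> Q *v a i = k *\<^sub>R side_line v i"
  using five_homologies.invariant_form_exists[OF five] by metis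
 then obtain k where k: "\<And>i. k i \<noteq> 0" "\<And>i. Q *v a i = k i *\<^sub>R side_line v i" by metis
 have "Q *v cen i = (k i * (side_line v i \<bullet> cen i)) *\<^sub>R side_line v i" for i
 proof -
  have "cen i = (side_line v i \<bullet> cen i) *\<^sub>R a i" using centre_off[of i] by (simp add: a_def)
  then have "Q *v cen i = (side_line v i \<bullet> cen i) *\<^sub>R (Q *v a i)" by (metis matrix_vector_mult_scaleR)
  then show ?thesis by (simp add: k(2) mult.commute)
 qed
 then show ?thesis using that[OF b Q(1), of "\<lambda>i. k i * (side_line v i \<bullet> cen i)"] k(1) centre_off rel by simp
qed

lemma form_reflection_homology:
 assumes Q: "nondegenerate_form Q" and n: "Q *v n = k *\<^sub>R l" "k \<noteq> 0"
 shows "form_reflection Q n = homology n l"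
proof -
 have "outer n n ** Q = k *\<^sub>R outer n l"
 proof -
  have "n \<bullet> (Q *v x) = (Q *v n) \<bullet> x" for x
   using Q dot_lmul_matrix[of n Q x] vector_transpose_matrix[of n Q] by (simp add: nondegenerate_form_def)
  then show ?thesis
   by (simp add: matrix_eq matrix_vector_mul_assoc[symmetric] outer_mult_vec scaleR_matrix_vector_assoc[symmetric] n)
 qed
 then show ?thesis using n by (simp add: form_reflection_def homology_def inner_commute)
qed

lemma reflective_construction:
 assumes "convex_5_reflective v c"
 shows "\<exists>Q n\<^sub>0 n\<^sub>1 n\<^sub>2 w n\<^sub>4 R. nondegenerate_form Q \<and> construction Q n\<^sub>0 n\<^sub>1 n\<^sub>2 w n\<^sub>4 R \<and> (\<forall>i. side_reflection v c i = R i)"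
proof -
 obtain \<sigma> Q k where b: "billiard v \<sigma> c" and Q: "nondegenerate_form Q" and k: "\<And>i. k i \<noteq> 0" "\<And>i. Q *v rep_rp2 (c i) = k i *\<^sub>R side_line v i"
  and rel: "side_reflection v c 4 ** side_reflection v c 3 ** side_reflection v c 2 ** side_reflection v c 1 ** side_reflection v c 0 = - mat 1"
  using reflective_invariant_form[OF assms] by metis
 interpret billiard v \<sigma> c by (rule b)
 have R: "H i = form_reflection Q (cen i)" for i
  using form_reflection_homology[OF Q k(2) k(1)] by (simp add: side_reflection_def)
 have iso: "cen i \<bullet> (Q *v cen i) \<noteq> 0" for i using centre_off[of i] k(1)[of i] by (simp add: k(2) inner_commute)
 define w where "w = cross3 (side_line v 3) (side_line v 4)"
 have "side_line v 0 \<bullet> w \<noteq> 0" unfolding w_def by (rule lines_independent) simp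
 then have w: "w \<noteq> 0" by auto
 have "side_line v 3 \<bullet> w = 0" "side_line v 4 \<bullet> w = 0" by (simp_all add: w_def dot_cross_self)
 then have fixw: "H 3 *v w = w" "H 4 *v w = w" and n4: "(Q *v cen 4) \<bullet> w = 0"
  by (simp_all add: side_reflection_def homology_fixes k(2))
 have n4': "cen 4 \<bullet> (Q *v w) = 0"
  using n4 Q dot_lmul_matrix[of "cen 4" Q w] vector_transpose_matrix[of "cen 4" Q] by (simp add: nondegenerate_form_def)
 define B where "B = - (H 2 ** H 1 ** H 0)"
 have "H 4 ** (H 3 ** (H 2 ** H 1 ** H 0)) = - mat 1" using rel by (simp add: matrix_mul_assoc)
 then have "H 3 ** (H 4 ** (H 4 ** (H 3 ** (H 2 ** H 1 ** H 0)))) = - (H 3 ** H 4)" by (simp add: uminus_matrix_mult)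
 moreover have cancel: "H i ** (H i ** X) = X" for i X by (simp add: matrix_mul_assoc H_involution)
 ultimately have B: "B = H 3 ** H 4" unfolding B_def cancel by simp
 have "construction Q (cen 0) (cen 1) (cen 2) w (cen 4) H"
  unfolding construction_def Let_def B_def[symmetric]
  using iso w n4' by (simp add: B matrix_vector_mul_assoc[symmetric] fixw R[of 0, symmetric] R[of 1, symmetric]
   R[of 2, symmetric] R[of 4, symmetric]) (simp add: matrix_mul_assoc[symmetric] H_involution)
 then show ?thesis using Q by blast
qed

section \<open>The standard family of configurations\<close>

text \<open>A symmetric matrix \<open>A\<close> assigns to each line \<open>l\<close> a centre \<open>A l\<close>. The vector below spans the axis of the
 product of the three homologies with the given lines.\<close>

definition triple_axis :: "real^3^3 \<Rightarrow> real^3 \<Rightarrow> real^3 \<Rightarrow> real^3 \<Rightarrow> real^3" where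
 "triple_axis A l m n = (m \<bullet> (A *v n)) *\<^sub>R (A *v l) - (l \<bullet> (A *v n)) *\<^sub>R (A *v m) + (l \<bullet> (A *v m)) *\<^sub>R (A *v n)"

locale symmetric_matrix =
 fixes A :: "real^3^3"
 assumes sym: "transpose A = A"
begin

abbreviation h where "h l \<equiv> homology (A *v l) l"
abbreviation ax where "ax \<equiv> triple_axis A"

lemma g_commute: "l \<bullet> (A *v m) = m \<bullet> (A *v l)"
 using dot_lmul_matrix[of l A m] vector_transpose_matrix[of l A] sym by (simp add: inner_commute)

lemma h_apply: "h l *v x = x - (2 * (l \<bullet> x) / (l \<bullet> (A *v l))) *\<^sub>R (A *v l)"
 by (rule homology_apply)

lemma inner_ax: "x \<bullet> ax l m n = (m \<bullet> (A *v n)) * (x \<bullet> (A *v l)) - (l \<bullet> (A *v n)) * (x \<bullet> (A *v m)) + (l \<bullet> (A *v m)) * (x \<bullet> (A *v n))"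
 by (simp add: triple_axis_def inner_add_right inner_diff_right)

lemma h_ax:
 assumes "l \<bullet> (A *v l) \<noteq> 0" "m \<bullet> (A *v m) \<noteq> 0" "n \<bullet> (A *v n) \<noteq> 0"
 shows "h n *v (h m *v (h l *v ax l m n)) = - ax l m n"
proof -
 define a b c where abc: "a = m \<bullet> (A *v n)" "b = l \<bullet> (A *v n)" "c = l \<bullet> (A *v m)"
 have com: "m \<bullet> (A *v l) = c" "n \<bullet> (A *v l) = b" "n \<bullet> (A *v m) = a" using g_commute by (simp_all add: abc)
 have self: "h u *v (A *v u) = - (A *v u)" if "u \<bullet> (A *v u) \<noteq> 0" for u
  using that by (simp add: h_apply) (simp add: scaleR_2)
 have on: "h u *v (x *\<^sub>R (A *v l) + y *\<^sub>R (A *v m) + z *\<^sub>R (A *v n)) = x *\<^sub>R (A *v l) + y *\<^sub>R (A *v m) + z *\<^sub>R (A *v n)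
   - (2 * (x * (u \<bullet> (A *v l)) + y * (u \<bullet> (A *v m)) + z * (u \<bullet> (A *v n))) / (u \<bullet> (A *v u))) *\<^sub>R (A *v u)" for u x y z
  by (simp add: h_apply inner_add_right)
 have "ax l m n = a *\<^sub>R (A *v l) + (- b) *\<^sub>R (A *v m) + c *\<^sub>R (A *v n)" by (simp add: triple_axis_def abc)
 then have "h l *v ax l m n = (- a) *\<^sub>R (A *v l) + (- b) *\<^sub>R (A *v m) + c *\<^sub>R (A *v n)"
  using assms(1) by (simp add: on[of l a "- b" c, simplified] abc[symmetric] mult.commute) (simp add: vec_eq_iff)
 then have "h m *v (h l *v ax l m n) = (- a) *\<^sub>R (A *v l) + b *\<^sub>R (A *v m) + c *\<^sub>R (A *v n)"
  using assms(2) by (simp add: on[of m "- a" "- b" c, simplified] abc[symmetric] com mult.commute) (simp add: vec_eq_iff)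
 then have "h n *v (h m *v (h l *v ax l m n)) = (- a) *\<^sub>R (A *v l) + b *\<^sub>R (A *v m) + (- c) *\<^sub>R (A *v n)"
  using assms(3) by (simp add: on[of n "- a" b c, simplified] abc[symmetric] com mult.commute) (simp add: vec_eq_iff)
 then show ?thesis by (simp add: triple_axis_def abc algebra_simps)
qed

lemma h_preserves: "l \<bullet> (A *v l) \<noteq> 0 \<Longrightarrow> h l ** A ** transpose (h l) = A"
proof -
 assume l: "l \<bullet> (A *v l) \<noteq> 0"
 have t: "transpose (h l) *v y = y - (2 * (y \<bullet> (A *v l)) / (l \<bullet> (A *v l))) *\<^sub>R l" for y
 proof -
  have "(transpose (h l) *v y) \<bullet> x = (y - (2 * (y \<bullet> (A *v l)) / (l \<bullet> (A *v l))) *\<^sub>R l) \<bullet> x" for x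
   using dot_lmul_matrix[of y "h l" x] vector_transpose_matrix[of y "transpose (h l)"]
   by (simp add: h_apply inner_diff_right inner_diff_left)
  then show ?thesis using vector_eq_rdot by blast
 qed
 have "(h l ** A ** transpose (h l)) *v y = A *v y" for y
  using l unfolding matrix_vector_mul_assoc[symmetric] t h_apply
  by (simp add: matrix_vector_mult_diff_distrib matrix_vector_mult_scaleR inner_diff_right g_commute[of l y])
 then show ?thesis by (simp add: matrix_eq)
qed

lemma h_involution: "l \<bullet> (A *v l) \<noteq> 0 \<Longrightarrow> h l ** h l = mat 1"
 by (rule homology_involution)

lemma axis_on_last_line: "l \<bullet> ax m n k = k \<bullet> ax l m n"
 unfolding inner_ax g_commute[of k l] g_commute[of k m] g_commute[of k n] by (simp add: algebra_simps)

lemma axes_independent: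
 assumes nz: "l \<bullet> (A *v l) \<noteq> 0" "k \<bullet> (A *v k) \<noteq> 0" and mn: "m \<bullet> (A *v n) \<noteq> 0" and pf: "k \<bullet> ax l m n = 0"
 shows "cross3 (ax l m n) (ax m n k) \<noteq> 0"
proof
 assume z: "cross3 (ax l m n) (ax m n k) = 0"
 have "l \<bullet> ax l m n = (m \<bullet> (A *v n)) * (l \<bullet> (A *v l))" unfolding inner_ax by (simp add: mult.commute)
 then have w0: "l \<bullet> ax l m n \<noteq> 0" using mn nz by simp
 have "k \<bullet> ax m n k = (m \<bullet> (A *v n)) * (k \<bullet> (A *v k))" unfolding inner_ax
  unfolding g_commute[of k m] g_commute[of k n] by simp
 then have w3: "k \<bullet> ax m n k \<noteq> 0" using mn nz by simp
 have "cross3 l (cross3 (ax l m n) (ax m n k)) = 0" using z by simp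
 then have "(l \<bullet> ax m n k) *\<^sub>R ax l m n = (l \<bullet> ax l m n) *\<^sub>R ax m n k" by (simp add: Lagrange)
 then have "ax m n k = 0" using pf w0 unfolding axis_on_last_line[of l] by simp
 then show False using w3 by simp
qed

text \<open>The product of four homologies fixes the axes of the two products of three consecutive ones. It preserves \<open>A\<close> and has
 determinant \<open>-1\<close> up to sign, so it is the homology whose line is spanned by the two axes.\<close>

lemma five_relation:
 assumes nz: "\<And>i::5. L i \<bullet> (A *v L i) \<noteq> 0" and a12: "L 1 \<bullet> (A *v L 2) \<noteq> 0"
  and pf: "L 3 \<bullet> ax (L 0) (L 1) (L 2) = 0" and L4: "L 4 \<bullet> ax (L 0) (L 1) (L 2) = 0" "L 4 \<bullet> ax (L 1) (L 2) (L 3) = 0"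
 shows "h (L 4) ** h (L 3) ** h (L 2) ** h (L 1) ** h (L 0) = - mat 1"
proof -
 define w where "w = ax (L 0) (L 1) (L 2)"
 define w' where "w' = ax (L 1) (L 2) (L 3)"
 define G where "G = - (h (L 3) ** h (L 2) ** h (L 1) ** h (L 0))"
 have Gx: "G *v x = - (h (L 3) *v (h (L 2) *v (h (L 1) *v (h (L 0) *v x))))" for x
  by (simp add: G_def uminus_matrix_vec matrix_vector_mul_assoc matrix_mul_assoc)
 have fixed: "h l *v x = x" if "l \<bullet> x = 0" for l x using that by (rule homology_fixes)
 have pf': "L 0 \<bullet> w' = 0" using pf unfolding w'_def axis_on_last_line[of "L 0"] .
 have Gw: "G *v w = w" using h_ax[OF nz[of 0] nz[of 1] nz[of 2]] fixed[of "L 3" w] pf by (simp add: Gx w_def uminus_matrix_vec)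
 have Gw': "G *v w' = w'" using h_ax[OF nz[of 1] nz[of 2] nz[of 3]] fixed[of "L 0" w'] pf' by (simp add: Gx w'_def[symmetric])
 have ne: "cross3 w w' \<noteq> 0" unfolding w_def w'_def by (rule axes_independent[OF nz nz a12 pf])
 obtain k where k: "L 4 = k *\<^sub>R cross3 w w'"
  by (rule cross3_orthogonal_span[OF _ _ ne, of "L 4"]) (use L4 in \<open>auto simp: w_def w'_def\<close>)
 have "det G = - 1"
 proof -
  have "det (- X) = - det X" for X :: "real^3^3" by (simp add: det_3 algebra_simps)
  then show ?thesis unfolding G_def by (simp add: det_mul det_homology nz)
 qed
 then have "transpose G *v cross3 w w' = - cross3 w w'" using cross_matrix_mult[of G w w'] by (simp add: Gw Gw')
 then have GL: "transpose G *v L 4 = - L 4" by (simp add: k matrix_vector_mult_scaleR)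
 have pres: "G ** A ** transpose G = A"
 proof -
  have step: "h l ** X ** A ** transpose (h l ** X) = A" if "l \<bullet> (A *v l) \<noteq> 0" "X ** A ** transpose X = A" for l X
  proof -
   have "h l ** X ** A ** transpose (h l ** X) = h l ** (X ** A ** transpose X) ** transpose (h l)"
    by (simp add: matrix_transpose_mul matrix_mul_assoc)
   then show ?thesis using that h_preserves by simp
  qed
  define X where "X = h (L 3) ** (h (L 2) ** (h (L 1) ** h (L 0)))"
  have "X ** A ** transpose X = A" unfolding X_def by (intro step nz h_preserves)
  moreover have "G = - X" "transpose (- X) = - transpose X" by (simp_all add: G_def X_def matrix_mul_assoc transpose_def vec_eq_iff)
  ultimately show ?thesis by (simp add: uminus_matrix_mult)
 qed
 have "G *v (A *v (transpose G *v L 4)) = A *v L 4"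
  using arg_cong[OF pres, of "\<lambda>X. X *v L 4"] by (simp only: matrix_vector_mul_assoc matrix_mul_assoc)
 then have "- (G *v (A *v L 4)) = A *v L 4" by (simp only: GL uminus_matrix_vec)
 then have GO: "G *v (A *v L 4) = - (A *v L 4)" by (metis minus_minus)
 let ?O = "A *v L 4"
 have D: "?O \<bullet> cross3 w w' \<noteq> 0" using nz[of 4] by (auto simp: k inner_commute)
 have "G *v x = h (L 4) *v x" for x
 proof -
  have eq: "X *v x = Y *v x" if "X *v ?O = Y *v ?O" "X *v w = Y *v w" "X *v w' = Y *v w'" for X Y :: "real^3^3"
  proof -
   have "X *v ((?O \<bullet> cross3 w w') *\<^sub>R x) = Y *v ((?O \<bullet> cross3 w w') *\<^sub>R x)"
    unfolding barycentric[of ?O w w' x] by (simp add: matrix_vector_right_distrib matrix_vector_mult_scaleR that)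
   then show ?thesis using D by (simp add: matrix_vector_mult_scaleR)
  qed
  have "h (L 4) *v ?O = - ?O" using nz[of 4] by (simp add: h_apply) (simp add: scaleR_2)
  then show ?thesis using L4 fixed by (intro eq) (simp_all add: Gw Gw' GO w_def[symmetric] w'_def[symmetric])
 qed
 then have GH: "G = h (L 4)" by (simp add: matrix_eq)
 have "h (L 4) ** h (L 3) ** h (L 2) ** h (L 1) ** h (L 0) = - (h (L 4) ** G)"
  by (simp add: G_def uminus_matrix_mult matrix_mul_assoc)
 then show ?thesis by (simp add: GH h_involution nz)
qed

end

text \<open>Four lines in general position have the covectors \<open>e\<^sub>1\<close>, \<open>e\<^sub>2\<close>, \<open>e\<^sub>3\<close>, \<open>e\<^sub>1 + e\<^sub>2 + e\<^sub>3\<close> in a suitable frame, and the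
 matrix is scaled by its entry for the lines \<open>1\<close> and \<open>2\<close>. The first diagonal entry is then determined by the
 condition that the line \<open>3\<close> passes through the axis of the first three homologies.\<close>

type_synonym params = "real \<times> real \<times> real \<times> real"

definition param_matrix :: "params \<Rightarrow> real^3^3" where
 "param_matrix = (\<lambda>(a, b, c, d). vector [vector [d * a - c * b - 2 * c, c, d], vector [c, a, 1], vector [d, 1, b]])"

definition frame :: "5 \<Rightarrow> real^3" where
 "frame i = (if i = 0 then vector [1, 0, 0] else if i = 1 then vector [0, 1, 0] else if i = 2 then vector [0, 0, 1]
   else vector [1, 1, 1])"

definition param_line :: "params \<Rightarrow> 5 \<Rightarrow> real^3" where
 "param_line u i = (if i = 4 then cross3 (triple_axis (param_matrix u) (frame 0) (frame 1) (frame 2))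
    (triple_axis (param_matrix u) (frame 1) (frame 2) (frame 3)) else frame i)"

definition param_config :: "5 + 5 \<Rightarrow> params \<Rightarrow> real^3" where
 "param_config k u = (case k of Inl i \<Rightarrow> param_matrix u *v param_line u i | Inr i \<Rightarrow> param_line u i)"

lemma polynomial_vec3:
 fixes f g h :: "'a::euclidean_space \<Rightarrow> real"
 assumes "poly_map f" "poly_map g" "poly_map h"
 shows "poly_map (\<lambda>u. vector [f u, g u, h u] :: real^3)"
proof (rule polynomial_vecI)
 have "\<forall>i::3. poly_map (\<lambda>u. (vector [f u, g u, h u] :: real^3) $ i)" unfolding forall_3 using assms by simp
 then show "poly_map (\<lambda>u. (vector [f u, g u, h u] :: real^3) $ i)" for i by blast
qed

lemma polynomial_coord4:
 "poly_map (\<lambda>u :: params. fst u)" "poly_map (\<lambda>u :: params. fst (snd u))"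
 "poly_map (\<lambda>u :: params. fst (snd (snd u)))" "poly_map (\<lambda>u :: params. snd (snd (snd u)))"
 by (intro polynomial_function_bounded_linear bounded_linear_intros)+

lemma polynomial_times:
 fixes f g :: "'a::euclidean_space \<Rightarrow> real"
 assumes "poly_map f" "poly_map g" shows "poly_map (\<lambda>u. f u * g u)"
 using polynomial_function_mult[OF assms] by simp

lemma polynomial_entry:
 fixes f :: "'a::euclidean_space \<Rightarrow> 'b::euclidean_space^'n::finite"
 assumes "poly_map f" shows "poly_map (\<lambda>u. f u $ i)"
 using polynomial_function_compose[OF assms polynomial_nth[of i]] by (simp add: o_def)

lemma polynomial_matrix_vec:
 fixes f :: "'a::euclidean_space \<Rightarrow> real^3^3" and g :: "'a \<Rightarrow> real^3"
 assumes f: "poly_map f" and g: "poly_map g"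
 shows "poly_map (\<lambda>u. f u *v g u)"
proof (rule polynomial_vecI)
 fix i
 have "poly_map (\<lambda>u. \<Sum>j\<in>UNIV. f u $ i $ j * g u $ j)"
  by (intro polynomial_function_sum polynomial_times polynomial_entry f g) simp
 then show "poly_map (\<lambda>u. (f u *v g u) $ i)" by (simp add: matrix_vector_mult_def)
qed

lemma polynomial_param_matrix: "poly_map param_matrix"
proof -
 have row: "poly_map (\<lambda>u. (vector [f u, g u, h u] :: real^3^3))"
  if "poly_map f" "poly_map g" "poly_map h" for f g h :: "params \<Rightarrow> real^3"
 proof (rule polynomial_vecI)
  have "\<forall>i::3. poly_map (\<lambda>u. (vector [f u, g u, h u] :: real^3^3) $ i)" unfolding forall_3 using that by simp
  then show "poly_map (\<lambda>u. (vector [f u, g u, h u] :: real^3^3) $ i)" for i by blast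
 qed
 show ?thesis unfolding param_matrix_def case_prod_beta
  by (intro row polynomial_vec3 polynomial_function_diff polynomial_times polynomial_function_const polynomial_coord4)
qed

lemma polynomial_param_config: "poly_map (param_config k)"
proof -
 have inner: "poly_map (\<lambda>u. l \<bullet> f u)" if "poly_map f" for l :: "real^3" and f :: "params \<Rightarrow> real^3"
  using real_polynomial_function_component[OF that, of l] by (simp add: real_polynomial_function_eq inner_commute)
 have ax: "poly_map (\<lambda>u. triple_axis (param_matrix u) l m n)" for l m n
  unfolding triple_axis_def
  by (intro polynomial_function_add polynomial_function_diff polynomial_function_mult inner polynomial_matrix_vec
    polynomial_param_matrix polynomial_function_const)
 have line: "poly_map (\<lambda>u. param_line u i)" for i
  unfolding param_line_def by (cases "i = 4") (auto intro!: polynomial_cross3 ax)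
 show ?thesis
  by (cases k) (simp_all add: param_config_def[abs_def] line polynomial_matrix_vec polynomial_param_matrix)
qed

section \<open>Normal forms of billiards under projective equivalence\<close>

lemma matrix_inv_eqI:
 fixes g h :: "real^'n^'n" assumes "g ** h = mat 1" shows "matrix_inv g = h" "invertible g"
proof -
 have hg: "h ** g = mat 1" using assms by (simp add: matrix_left_right_inverse)
 then show "invertible g" using assms by (auto simp: invertible_def)
 then have "matrix_inv g ** g = mat 1" by (rule matrix_inv_mult)
 then have "matrix_inv g ** g ** h = h" by simp
 then show "matrix_inv g = h" using assms by (simp add: matrix_mul_assoc[symmetric])
qed

lemma invertible_transpose_inv: "invertible g \<Longrightarrow> invertible (transpose (matrix_inv g))" for g :: "real^'n^'n"
proof -
 assume "invertible g"
 then have "transpose (matrix_inv g) ** transpose g = mat 1"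
  using matrix_inv_mult[of g] by (metis matrix_transpose_mul transpose_mat)
 then show ?thesis by (rule matrix_inv_eqI)
qed

lemma transpose_inv_cancel:
 fixes g :: "real^'n^'n" assumes "invertible g" shows "transpose (matrix_inv g) *v (transpose g *v x) = x"
proof -
 have "transpose (matrix_inv g) ** transpose g = mat 1"
  using matrix_inv_mult[OF assms] by (metis matrix_transpose_mul transpose_mat)
 then show ?thesis by (simp only: matrix_vector_mul_assoc matrix_vector_mul_lid)
qed

lemma pgl_action_mult:
 assumes g: "invertible g" and h: "invertible h" shows "pgl_action (g ** h) x = pgl_action g (pgl_action h x)"
proof -
 have "g ** h ** (matrix_inv h ** matrix_inv g) = g ** (h ** matrix_inv h) ** matrix_inv g" by (simp add: matrix_mul_assoc)
 then have "g ** h ** (matrix_inv h ** matrix_inv g) = mat 1" using matrix_inv_mult[OF g] matrix_inv_mult[OF h] by simp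
 then have "transpose (matrix_inv (g ** h)) = transpose (matrix_inv g) ** transpose (matrix_inv h)"
  by (simp add: matrix_inv_eqI matrix_transpose_mul)
 then show ?thesis using g h
  by (auto simp: pgl_action_def fun_eq_iff rp2_map_mult invertible_transpose_inv split: sum.split)
qed

lemma pgl_action_one: "pgl_action (mat 1) x = x"
 using matrix_inv_eqI(1)[of "mat 1 :: real^3^3" "mat 1"]
 by (auto simp: pgl_action_def fun_eq_iff transpose_mat split: sum.split)

lemma pgl_orbit_action:
 assumes g: "invertible g" shows "pgl_orbit (pgl_action g x) = pgl_orbit x"
proof -
 have sub: "pgl_orbit (pgl_action g x) \<subseteq> pgl_orbit x" if "invertible g" for g x
  using that by (auto simp: pgl_orbit_def pgl_action_mult[symmetric] intro: invertible_mult)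
 have gi: "invertible (matrix_inv g)" using matrix_inv_mult[OF g] by (auto simp: invertible_def)
 have "pgl_action (matrix_inv g) (pgl_action g x) = x"
  using matrix_inv_mult[OF g] by (simp add: pgl_action_mult[OF gi g, symmetric] pgl_action_one)
 then show ?thesis using sub[OF g, of x] sub[OF gi, of "pgl_action g x"] by simp
qed

lemma pgl_orbit_self: "x \<in> pgl_orbit x"
proof -
 have "invertible (mat 1 :: real^3^3)" by (rule matrix_inv_eqI[of _ "mat 1"]) simp
 then show ?thesis unfolding pgl_orbit_def using pgl_action_one[of x, symmetric] by blast
qed

lemma congruence_entry: "(P ** A ** transpose P) $ i $ j = P $ i \<bullet> (A *v P $ j)" for P A :: "real^3^3"
 by (simp add: matrix_matrix_mult_def matrix_vector_mult_def transpose_def inner_vec_def sum_3 algebra_simps)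

lemma inner_matrix_transpose: "l \<bullet> (P *v x) = (transpose P *v l) \<bullet> x" for P :: "real^'n^'n"
 by (simp add: dot_lmul_matrix[symmetric] vector_transpose_matrix[of l "transpose P", symmetric])

lemma triple_axis_congruence:
 "triple_axis (t *\<^sub>R (P ** A ** transpose P)) l m n =
   (t * t) *\<^sub>R (P *v triple_axis A (transpose P *v l) (transpose P *v m) (transpose P *v n))"
proof -
 have "(t *\<^sub>R (P ** A ** transpose P)) *v x = t *\<^sub>R (P *v (A *v (transpose P *v x)))" for x
  by (simp only: scaleR_matrix_vector_assoc[symmetric] matrix_vector_mul_assoc matrix_mul_assoc)
 then show ?thesis
  by (simp add: triple_axis_def inner_matrix_transpose matrix_vector_right_distrib matrix_vector_mult_diff_distrib
    matrix_vector_mult_scaleR scaleR_add_right scaleR_diff_right mult_ac)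
qed

lemma inner_three_zero:
 assumes "a \<bullet> cross3 b c \<noteq> 0" "a \<bullet> x = 0" "b \<bullet> x = 0" "c \<bullet> x = 0" shows "x = 0"
proof -
 have ne: "cross3 b c \<noteq> 0" using assms(1) by auto
 obtain k where k: "x = k *\<^sub>R cross3 b c"
  by (rule cross3_orthogonal_span[OF _ _ ne, of x]) (use assms in \<open>auto simp: inner_commute\<close>)
 then show ?thesis using assms by simp
qed

lemma det_scaleR3: "det (c *\<^sub>R X) = c ^ 3 * det X" for X :: "real^3^3"
 by (simp add: det_3 power3_eq_cube algebra_simps)

text \<open>In a projective frame adapted to the first four sides, the inverse of the invariant form is, up to a
 factor, one of the matrices of the standard family. The entry that is used for the scaling cannot vanish: otherwise
 the lines \<open>0\<close>, \<open>3\<close> and \<open>4\<close> are concurrent at the axis of the first three homologies, or these three commute.\<close>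

lemma reflective_normal_form:
 assumes refl: "convex_5_reflective v c"
 obtains u where "det (param_matrix u) \<noteq> 0" "\<And>k. param_config k u \<noteq> 0"
  "pgl_orbit (billiard_configuration v c) = pgl_orbit (\<lambda>k. abs_rp2 (param_config k u))"
proof -
 obtain \<sigma> Q k where b: "billiard v \<sigma> c" and Q: "nondegenerate_form Q" and k: "\<And>i. k i \<noteq> 0" "\<And>i. Q *v rep_rp2 (c i) = k i *\<^sub>R side_line v i"
  and rel: "side_reflection v c 4 ** side_reflection v c 3 ** side_reflection v c 2 ** side_reflection v c 1 ** side_reflection v c 0 = - mat 1"
  using reflective_invariant_form[OF refl] by metis
 interpret billiard v \<sigma> c by (rule b)
 define l where "l = side_line v"
 define A where "A = matrix_inv Q"
 have iQ: "invertible Q" using Q by (simp add: nondegenerate_form_def invertible_det_nz)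
 have AQ: "A ** Q = mat 1" "Q ** A = mat 1" using matrix_inv_mult[OF iQ] by (simp_all add: A_def)
 have "transpose A ** Q = mat 1"
  using arg_cong[OF AQ(2), of transpose] Q by (simp add: matrix_transpose_mul nondegenerate_form_def)
 then have "transpose A ** Q ** A = A" by simp
 then have "transpose A = A" using AQ(2) by (simp add: matrix_mul_assoc[symmetric])
 then interpret S: symmetric_matrix A by unfold_locales
 have Al: "A *v l i = (1 / k i) *\<^sub>R cen i" for i
 proof -
  have "A *v (Q *v cen i) = k i *\<^sub>R (A *v l i)" by (simp add: k(2) l_def matrix_vector_mult_scaleR)
  then have "cen i = k i *\<^sub>R (A *v l i)" by (simp add: matrix_vector_mul_assoc AQ)
  then show ?thesis using k(1)[of i] by simp
 qed
 define T where "T i j m = l i \<bullet> cross3 (l j) (l m)" for i j m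
 have T: "T i j m \<noteq> 0" if "distinct [i, j, m]" for i j m unfolding T_def l_def by (rule lines_independent[OF that])
 define e where "e i = (if i = 0 then T 3 1 2 / T 0 1 2 else if i = 1 then T 3 2 0 / T 0 1 2 else
   if i = 2 then T 3 0 1 / T 0 1 2 else 1)" for i :: 5
 have e: "e i \<noteq> 0" for i using T by (simp add: e_def)
 define \<Lambda> where "\<Lambda> i = e i *\<^sub>R l i" for i
 have "T 0 1 2 *\<^sub>R l 3 = T 3 1 2 *\<^sub>R l 0 + T 3 2 0 *\<^sub>R l 1 + T 3 0 1 *\<^sub>R l 2" unfolding T_def by (rule barycentric)
 also have "\<dots> = T 0 1 2 *\<^sub>R (\<Lambda> 0 + \<Lambda> 1 + \<Lambda> 2)" using T[of 0 1 2] by (simp add: \<Lambda>_def e_def scaleR_add_right)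
 finally have "T 0 1 2 *\<^sub>R l 3 = T 0 1 2 *\<^sub>R (\<Lambda> 0 + \<Lambda> 1 + \<Lambda> 2)" .
 then have L3: "\<Lambda> 3 = \<Lambda> 0 + \<Lambda> 1 + \<Lambda> 2" using T[of 0 1 2] unfolding scaleR_cancel_left by (simp add: \<Lambda>_def e_def)
 define r where "r i = e i / k i" for i
 have r: "r i \<noteq> 0" "A *v \<Lambda> i = r i *\<^sub>R cen i" for i
  using e k(1) by (simp_all add: r_def \<Lambda>_def matrix_vector_mult_scaleR Al)
 have hH: "S.h (\<Lambda> i) = H i" for i
 proof -
  have "S.h (\<Lambda> i) = homology (r i *\<^sub>R cen i) (e i *\<^sub>R side_line v i)" unfolding r(2) unfolding \<Lambda>_def l_def ..
  then show ?thesis using homology_scale[OF r(1)[of i] e[of i]] by (simp add: side_reflection_def)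
 qed
 have nz: "\<Lambda> i \<bullet> (A *v \<Lambda> i) \<noteq> 0" for i
  using centre_off[of i] e[of i] r(1)[of i] unfolding r(2) by (simp add: \<Lambda>_def l_def)
 have indep: "s = 0 \<and> t = 0" if "s *\<^sub>R (A *v \<Lambda> i) = t *\<^sub>R (A *v \<Lambda> j)" "i \<noteq> j" for i j s t
 proof -
  have eq: "(s * r i) *\<^sub>R cen i = (t * r j) *\<^sub>R cen j" using that(1) by (simp add: r(2))
  have "s = 0"
  proof (rule ccontr)
   assume s: "s \<noteq> 0"
   then have "t \<noteq> 0" using eq r(1)[of i] by auto
   then have "abs_rp2 (cen i) = abs_rp2 (cen j)" using arg_cong[OF eq, of abs_rp2] s r(1) by simp
   then have "c i = c j" by simp
   then show False using refl that(2) by (simp add: convex_5_reflective_def inj_eq)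
  qed
  then show ?thesis using eq r(1)[of j] by simp
 qed
 have rel': "H 4 *v (H 3 *v (H 2 *v (H 1 *v (H 0 *v x)))) = - x" for x
  using arg_cong[OF rel, of "\<lambda>X. X *v x"] by (simp add: matrix_vector_mul_assoc matrix_mul_assoc uminus_matrix_vec)
 have same_axis: "\<Lambda> i \<bullet> x = 0 \<and> \<Lambda> j \<bullet> x = 0" if "H i *v x = H j *v x" "i \<noteq> j" for i j x
 proof -
  have "(2 * (\<Lambda> i \<bullet> x) / (\<Lambda> i \<bullet> (A *v \<Lambda> i))) *\<^sub>R (A *v \<Lambda> i) = (2 * (\<Lambda> j \<bullet> x) / (\<Lambda> j \<bullet> (A *v \<Lambda> j))) *\<^sub>R (A *v \<Lambda> j)"
   using that(1) unfolding hH[symmetric] S.h_apply by simp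
  from indep[OF this that(2)] show ?thesis using nz by simp
 qed
 define w where "w = S.ax (\<Lambda> 0) (\<Lambda> 1) (\<Lambda> 2)"
 define w' where "w' = S.ax (\<Lambda> 1) (\<Lambda> 2) (\<Lambda> 3)"
 have "H 2 *v (H 1 *v (H 0 *v w)) = - w"
  using S.h_ax[OF nz[of 0] nz[of 1] nz[of 2]] by (simp add: hH w_def)
 then have "H 4 *v (H 3 *v w) = w" using rel'[of w] by (simp add: uminus_matrix_vec)
 then have "H 3 *v w = H 4 *v w" by (metis H_cancel)
 then have w: "\<Lambda> 3 \<bullet> w = 0" "\<Lambda> 4 \<bullet> w = 0" using same_axis[of 3 w 4] by simp_all
 have "H 3 *v (H 2 *v (H 1 *v w')) = - w'"
  using S.h_ax[OF nz[of 1] nz[of 2] nz[of 3]] by (simp add: hH w'_def)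
 then have "H 4 *v w' = H 0 *v w'" using rel'[of "H 0 *v w'"] by (simp add: uminus_matrix_vec H_cancel)
 then have w': "\<Lambda> 4 \<bullet> w' = 0" using same_axis[of 4 w' 0] by simp
 define a where "a i j = \<Lambda> i \<bullet> (A *v \<Lambda> j)" for i j
 have a_sym: "a i j = a j i" for i j unfolding a_def by (rule S.g_commute)
 have a12: "a 1 2 \<noteq> 0"
 proof
  assume z: "a 1 2 = 0"
  have "\<Lambda> 0 \<bullet> w = 0" using z unfolding w_def S.inner_ax a_def[symmetric] by (simp add: mult.commute)
  then have "w = 0"
   using w T[of 0 3 4] e by (intro inner_three_zero[of "l 0" "l 3" "l 4"]) (simp_all add: T_def \<Lambda>_def)
  then have "(a 0 2) *\<^sub>R (A *v \<Lambda> 1) = (a 0 1) *\<^sub>R (A *v \<Lambda> 2)"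
   using z unfolding w_def triple_axis_def a_def[symmetric] by simp
  then have z': "a 0 2 = 0" "a 0 1 = 0" using indep[of "a 0 2" 1 "a 0 1" 2] by simp_all
  have H: "H i *v (A *v \<Lambda> j) = A *v \<Lambda> j - (2 * a i j / a i i) *\<^sub>R (A *v \<Lambda> i)" for i j
   unfolding hH[symmetric] S.h_apply a_def ..
  have neg: "H i *v (A *v \<Lambda> i) = - (A *v \<Lambda> i)" for i
   using nz[of i] unfolding H a_def[symmetric] by simp (simp add: scaleR_2)
  have keep: "H 0 *v (A *v \<Lambda> 1) = A *v \<Lambda> 1" "H 0 *v (A *v \<Lambda> 2) = A *v \<Lambda> 2" "H 1 *v (A *v \<Lambda> 0) = A *v \<Lambda> 0"
   "H 1 *v (A *v \<Lambda> 2) = A *v \<Lambda> 2" "H 2 *v (A *v \<Lambda> 0) = A *v \<Lambda> 0" "H 2 *v (A *v \<Lambda> 1) = A *v \<Lambda> 1"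
   unfolding H using z z' a_sym[of 1 0] a_sym[of 2 0] a_sym[of 2 1] by simp_all
  have "H 2 *v (H 1 *v (H 0 *v (A *v \<Lambda> 3))) = - (A *v \<Lambda> 3)"
   unfolding L3 by (simp add: matrix_vector_right_distrib matrix_vector_mult_diff_distrib neg keep uminus_matrix_vec)
  then have "H 4 *v (A *v \<Lambda> 3) = - (A *v \<Lambda> 3)" using rel'[of "A *v \<Lambda> 3"] by (simp add: uminus_matrix_vec neg)
  then have "(2 * a 4 3 / a 4 4) *\<^sub>R (A *v \<Lambda> 4) = A *v \<Lambda> 3 + A *v \<Lambda> 3" unfolding H by (simp add: algebra_simps)
  then have "2 *\<^sub>R (A *v \<Lambda> 3) = (2 * a 4 3 / a 4 4) *\<^sub>R (A *v \<Lambda> 4)" by (simp add: scaleR_2)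
  then show False using indep[of 2 3 _ 4] by fastforce
 qed
 define P :: "real^3^3" where "P = vector [\<Lambda> 0, \<Lambda> 1, \<Lambda> 2]"
 have P: "P $ 1 = \<Lambda> 0" "P $ 2 = \<Lambda> 1" "P $ 3 = \<Lambda> 2" by (simp_all add: P_def)
 have "\<Lambda> 0 \<bullet> cross3 (\<Lambda> 1) (\<Lambda> 2) = e 0 * e 1 * e 2 * T 0 1 2" by (simp add: \<Lambda>_def T_def cross_mult_left cross_mult_right)
 then have "det P \<noteq> 0" unfolding P_def dot_cross_det[symmetric] using e T[of 0 1 2] by simp
 then have iP: "invertible P" by (simp add: invertible_det_nz)
 have Pt: "transpose P *v x = (x $ 1) *\<^sub>R \<Lambda> 0 + (x $ 2) *\<^sub>R \<Lambda> 1 + (x $ 3) *\<^sub>R \<Lambda> 2" for x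
  by (simp add: vec_eq_iff matrix_vector_mult_def transpose_def sum_3 P mult.commute)
 have frame: "transpose P *v frame 0 = \<Lambda> 0" "transpose P *v frame 1 = \<Lambda> 1" "transpose P *v frame 2 = \<Lambda> 2"
  "transpose P *v frame 3 = \<Lambda> 3" unfolding Pt L3 by (simp_all add: frame_def)
 define u :: params where "u = (a 1 1 / a 1 2, a 2 2 / a 1 2, a 0 1 / a 1 2, a 0 2 / a 1 2)"
 have "a 1 2 * a 0 0 = a 0 2 * a 1 1 - a 0 1 * a 2 2 - 2 * (a 1 2 * a 0 1)"
  using w(1) unfolding w_def S.inner_ax L3 inner_add_left a_def[symmetric]
  by (simp add: a_sym[of 1 0] a_sym[of 2 0] a_sym[of 2 1] algebra_simps)
 then have "a 1 2 * (a 1 2 * a 0 0) = a 1 2 * (a 0 2 * a 1 1 - a 0 1 * a 2 2 - 2 * (a 1 2 * a 0 1))" by simp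
 then have a00: "a 0 0 / a 1 2 = a 0 2 / a 1 2 * (a 1 1 / a 1 2) - a 0 1 / a 1 2 * (a 2 2 / a 1 2) - 2 * (a 0 1 / a 1 2)"
  using a12 by (simp add: field_simps)
 have M: "param_matrix u = (1 / a 1 2) *\<^sub>R (P ** A ** transpose P)"
  unfolding vec_eq_iff forall_3 vector_scaleR_component congruence_entry P a_def[symmetric]
  using a00 a12 by (simp add: param_matrix_def u_def a_sym[of 1 0] a_sym[of 2 0] a_sym[of 2 1])
 have Mx: "param_matrix u *v x = (1 / a 1 2) *\<^sub>R (P *v (A *v (transpose P *v x)))" for x
  unfolding M by (simp only: scaleR_matrix_vector_assoc[symmetric] matrix_vector_mul_assoc matrix_mul_assoc)
 have ne: "cross3 w w' \<noteq> 0"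
  unfolding w_def w'_def using nz a12 w(1) by (intro S.axes_independent) (simp_all add: a_def w_def)
 obtain q where q: "\<Lambda> 4 = q *\<^sub>R cross3 w w'"
  by (rule cross3_orthogonal_span[OF _ _ ne, of "\<Lambda> 4"]) (use w w' in auto)
 have q0: "q \<noteq> 0" using q nz[of 4] by auto
 have "\<exists>t. t \<noteq> 0 \<and> transpose P *v param_line u i = t *\<^sub>R l i" for i
 proof (cases "i = 4")
  case True
  define s where "s = (1 / a 1 2) * (1 / a 1 2)"
  have s: "s \<noteq> 0" using a12 by (simp add: s_def)
  have "param_line u 4 = cross3 (s *\<^sub>R (P *v w)) (s *\<^sub>R (P *v w'))"
   unfolding param_line_def M triple_axis_congruence frame s_def w_def w'_def by simp
  then have "transpose P *v param_line u 4 = (s * s * det P) *\<^sub>R cross3 w w'"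
   by (simp only: cross_mult_left cross_mult_right matrix_vector_mult_scaleR cross_matrix_mult scaleR_scaleR mult.assoc)
  also have "cross3 w w' = (1 / q) *\<^sub>R \<Lambda> 4" using q q0 by simp
  also have "(s * s * det P) *\<^sub>R (1 / q) *\<^sub>R \<Lambda> 4 = (s * s * det P / q * e 4) *\<^sub>R l 4" by (simp add: \<Lambda>_def)
  finally show ?thesis using True s \<open>det P \<noteq> 0\<close> q0 e[of 4] by (intro exI[of _ "s * s * det P / q * e 4"]) simp
 next
  case False
  then have "\<forall>i. i \<noteq> 4 \<longrightarrow> transpose P *v param_line u i = e i *\<^sub>R l i"
   unfolding all_5 using frame by (simp add: param_line_def \<Lambda>_def)
  then show ?thesis using False e by blast
 qed
 then obtain t where t: "\<And>i. t i \<noteq> 0" "\<And>i. transpose P *v param_line u i = t i *\<^sub>R l i" by metis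
 have l0: "l i \<noteq> 0" for i using nz[of i] by (auto simp: \<Lambda>_def)
 have line0: "param_line u i \<noteq> 0" for i using t[of i] l0[of i] by auto
 have lineL: "transpose (matrix_inv P) *v l i = (1 / t i) *\<^sub>R param_line u i" for i
 proof -
  have "l i = (1 / t i) *\<^sub>R (transpose P *v param_line u i)" using t by simp
  then show ?thesis by (metis matrix_vector_mult_scaleR transpose_inv_cancel[OF iP])
 qed
 have cenL: "param_matrix u *v param_line u i = (t i / (a 1 2 * k i)) *\<^sub>R (P *v cen i)" for i
  unfolding Mx t by (simp add: matrix_vector_mult_scaleR Al)
 have cen0: "param_matrix u *v param_line u i \<noteq> 0" for i
  using t(1) a12 k(1) by (simp add: cenL matrix_vector_mult_eq_0_invertible[OF iP])
 have "pgl_action P (billiard_configuration v c) j = abs_rp2 (param_config j u)" for j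
 proof (cases j)
  case (Inl i)
  have "rp2_map P (c i) = abs_rp2 (P *v cen i)" using rp2_map_abs[OF iP, of "cen i"] by simp
  then show ?thesis using t(1) a12 k(1)
   by (simp add: Inl pgl_action_def billiard_configuration_def param_config_def cenL)
 next
  case (Inr i)
  have "rp2_map (transpose (matrix_inv P)) (abs_rp2 (l i)) = abs_rp2 ((1 / t i) *\<^sub>R param_line u i)"
   unfolding lineL[symmetric] by (rule rp2_map_abs[OF invertible_transpose_inv[OF iP] l0])
  then show ?thesis using t(1)
   by (simp add: Inr pgl_action_def billiard_configuration_def param_config_def l_def)
 qed
 then have act: "pgl_action P (billiard_configuration v c) = (\<lambda>j. abs_rp2 (param_config j u))" by blast
 have "pgl_orbit (billiard_configuration v c) = pgl_orbit (\<lambda>j. abs_rp2 (param_config j u))"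
  using pgl_orbit_action[OF iP, of "billiard_configuration v c"] act by simp
 moreover have "det A \<noteq> 0" using AQ by (metis invertible_def invertible_det_nz)
 then have "det (param_matrix u) \<noteq> 0" unfolding M using a12 \<open>det P \<noteq> 0\<close> by (simp add: det_scaleR3 det_mul)
 moreover have "param_config j u \<noteq> 0" for j using line0 cen0 by (cases j) (simp_all add: param_config_def)
 ultimately show ?thesis using that by blast
qed

section \<open>An open set of reflective billiards\<close>

lemma triple_matrix: "(g *v x) \<bullet> cross3 (g *v y) (g *v z) = det g * (x \<bullet> cross3 y z)" for g :: "real^3^3"
proof -
 have "(g *v x) \<bullet> cross3 (g *v y) (g *v z) = x \<bullet> (transpose g *v cross3 (g *v y) (g *v z))"
  unfolding inner_matrix_transpose[of x "transpose g"] transpose_transpose ..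
 then show ?thesis unfolding cross_matrix_mult by simp
qed

lemma generic_centres:
 assumes gen: "\<And>i j k. distinct [i, j, k] \<Longrightarrow> rep_rp2 (c i) \<bullet> cross3 (rep_rp2 (c j)) (rep_rp2 (c k)) \<noteq> 0"
 shows "inj c" "no_four_collinear c"
proof -
 show "inj c"
 proof (rule injI, rule ccontr)
  fix i j :: 5 assume ij: "c i = c j" "i \<noteq> j"
  define k where "k = (if j = i + 1 then i + 2 else i + 1)"
  have "k \<noteq> i" "k \<noteq> j" using shift5[of i] by (auto simp: k_def)
  then show False using gen[of k i j] ij by simp
 qed
 show "no_four_collinear c"
  unfolding no_four_collinear_def
 proof (intro allI impI notI)
  fix S :: "5 set" assume S: "card S = 4" "\<exists>l. l \<noteq> 0 \<and> (\<forall>i\<in>S. l \<bullet> rep_rp2 (c i) = 0)"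
  obtain T where T: "T \<subseteq> S" "card T = 3" using obtain_subset_with_card_n[of 3 S] S(1) by auto
  obtain i j k where ijk: "T = {i, j, k}" "distinct [i, j, k]" using T(2) unfolding card_3_iff by auto
  obtain l where l: "l \<noteq> 0" "\<And>i. i \<in> S \<Longrightarrow> l \<bullet> rep_rp2 (c i) = 0" using S(2) by blast
  have "i \<in> S" "j \<in> S" "k \<in> S" using T(1) ijk(1) by auto
  then have "l = 0" using inner_three_zero[OF gen[OF ijk(2)], of l] l(2) by (simp add: inner_commute)
  then show False using l(1) by simp
 qed
qed

lemma good_start_scale:
 assumes "\<And>i. t i \<noteq> 0" shows "good_start v (\<lambda>i. t i *\<^sub>R a i) x y \<longleftrightarrow> good_start v a x y"
proof -
 have "reflect (t i *\<^sub>R a i) m z = reflect (a i) m z" for i m z using assms[of i] by (simp add: reflect_def)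
 then show ?thesis by (simp add: good_start_def third_def fourth_def fifth_def hit_def)
qed

text \<open>An affine chart in which the configurations near the following parameter are convex billiards.\<close>

definition chart_matrix :: "real^3^3" where
 "chart_matrix = vector [vector [1, 0, 0], vector [0, 0, 1], vector [1, - 1, 1]]"

definition chart_dual :: "real^3^3" where
 "chart_dual = vector [vector [1, 1, 0], vector [0, 1, 1], vector [0, - 1, 0]]"

text \<open>All conditions being open, any parameter with a convex pentagon and an orbit that meets its sides in the cyclic
 order would do.\<close>

definition sample :: params where "sample = (- 3, - 3, 1, 1)"

lemma chart_matrix_inv: "matrix_inv chart_matrix = transpose chart_dual" "invertible chart_matrix"
proof -
 have "chart_matrix ** transpose chart_dual = mat 1"
  by (simp add: vec_eq_iff forall_3 chart_matrix_def chart_dual_def matrix_matrix_mult_def transpose_def sum_3 mat_def)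
 then show "matrix_inv chart_matrix = transpose chart_dual" "invertible chart_matrix" by (rule matrix_inv_eqI)+
qed

lemma chart_dual_inv: "transpose chart_matrix *v (chart_dual *v x) = x"
proof -
 have "transpose chart_matrix ** chart_dual = mat 1"
  by (simp add: vec_eq_iff forall_3 chart_matrix_def chart_dual_def matrix_matrix_mult_def transpose_def sum_3 mat_def)
 then show ?thesis by (simp only: matrix_vector_mul_assoc matrix_vector_mul_lid)
qed

definition chart_line :: "params \<Rightarrow> 5 \<Rightarrow> real^3" where "chart_line u i = chart_dual *v param_line u i"

definition chart_centre :: "params \<Rightarrow> 5 \<Rightarrow> real^3" where "chart_centre u i = chart_matrix *v param_config (Inl i) u"

definition vertex :: "params \<Rightarrow> 5 \<Rightarrow> real^2" where
 "vertex u i = unchart (cross3 (chart_line u (i + 4)) (chart_line u i))"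

definition centre :: "params \<Rightarrow> 5 \<Rightarrow> rp2" where "centre u i = abs_rp2 (chart_centre u i)"

lemma frame_simps [simp]:
 "frame 0 = vector [1, 0, 0]" "frame 1 = vector [0, 1, 0]" "frame 2 = vector [0, 0, 1]" "frame 3 = vector [1, 1, 1]"
 by (simp_all add: frame_def)

lemma param_matrix_vec: "param_matrix (a, b, c, d) *v x =
  vector [(d * a - c * b - 2 * c) * x $ 1 + c * x $ 2 + d * x $ 3, c * x $ 1 + a * x $ 2 + x $ 3, d * x $ 1 + x $ 2 + b * x $ 3]"
 by (simp add: vec_eq_iff forall_3 param_matrix_def matrix_vector_mult_def sum_3)

lemma chart_matrix_vec: "chart_matrix *v x = vector [x $ 1, x $ 3, x $ 1 - x $ 2 + x $ 3]"
 "chart_dual *v x = vector [x $ 1 + x $ 2, x $ 2 + x $ 3, - x $ 2]"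
 by (simp_all add: vec_eq_iff forall_3 chart_matrix_def chart_dual_def matrix_vector_mult_def sum_3)

lemma vec3_ops:
 "vector [a, b, c] + vector [a', b', c'] = (vector [a + a', b + b', c + c'] :: real^3)"
 "vector [a, b, c] - vector [a', b', c'] = (vector [a - a', b - b', c - c'] :: real^3)"
 "r *\<^sub>R vector [a, b, c] = (vector [r * a, r * b, r * c] :: real^3)"
 "(vector [a, b, c] :: real^3) \<bullet> vector [a', b', c'] = a * a' + b * b' + c * c'"
 "cross3 (vector [a, b, c]) (vector [a', b', c']) = vector [b * c' - c * b', c * a' - a * c', a * b' - b * a']"
 by (simp_all add: vec_eq_iff forall_3 inner_vec_def sum_3 cross3_def)

lemma sample_line_4: "param_line sample 4 = vector [- 16, - 10, - 6]"
 by (simp add: param_line_def triple_axis_def sample_def param_matrix_vec vec3_ops)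

lemma sample_lines:
 "chart_line sample 0 = vector [1, 0, 0]" "chart_line sample 1 = vector [1, 1, - 1]" "chart_line sample 2 = vector [0, 1, 0]"
 "chart_line sample 3 = vector [2, 2, - 1]" "chart_line sample 4 = vector [- 26, - 16, 10]"
 using sample_line_4 by (simp_all add: chart_line_def chart_matrix_vec) (simp_all add: param_line_def chart_matrix_vec)

lemma sample_configs:
 "param_config (Inl 0) sample = vector [- 2, 1, 1]" "param_config (Inl 1) sample = vector [1, - 3, 1]"
 "param_config (Inl 2) sample = vector [1, 1, - 3]" "param_config (Inl 3) sample = vector [0, - 1, - 1]"
 "param_config (Inl 4) sample = vector [16, 8, - 8]"
 unfolding param_config_def sum.case sample_line_4 by (simp_all add: sample_def param_matrix_vec) (simp_all add: param_line_def)

lemma sample_centres: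
 "chart_centre sample 0 = vector [- 2, 1, - 2]" "chart_centre sample 1 = vector [1, 1, 5]" "chart_centre sample 2 = vector [1, - 3, - 3]"
 "chart_centre sample 3 = vector [0, - 1, 0]" "chart_centre sample 4 = vector [16, - 8, 0]"
 by (simp_all add: chart_centre_def sample_configs chart_matrix_vec)

lemma sample_vertices:
 "vertex sample 0 = vector [0, 5 / 8]" "vertex sample 1 = vector [0, 1]" "vertex sample 2 = vector [1, 0]"
 "vertex sample 3 = vector [1 / 2, 0]" "vertex sample 4 = vector [1 / 5, 3 / 10]"
 by (simp_all add: vertex_def sample_lines num5 vec3_ops unchart_def vec_eq_iff forall_2)

lemma chart_vector: "chart (vector [a, b]) = vector [a, b, 1]"
 by (simp add: chart_def)

lemma sample_sides:
 "side_line (vertex sample) 0 = vector [- 3 / 8, 0, 0]" "side_line (vertex sample) 1 = vector [1, 1, - 1]"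
 "side_line (vertex sample) 2 = vector [0, - 1 / 2, 0]" "side_line (vertex sample) 3 = vector [- 3 / 10, - 3 / 10, 3 / 20]"
 "side_line (vertex sample) 4 = vector [- 13 / 40, - 1 / 5, 1 / 8]"
 by (simp_all add: side_line_def sample_vertices num5 chart_vector vec3_ops)

lemma sample_pentagon: "pentagon (vertex sample) (- 1)"
proof -
 have "\<forall>i k. k \<noteq> i \<longrightarrow> k \<noteq> i + 1 \<longrightarrow> - 1 * (side_line (vertex sample) i \<bullet> chart (vertex sample k)) > 0"
  unfolding all_5 by (simp add: sample_sides sample_vertices num5 chart_vector vec3_ops)
 then show ?thesis by unfold_locales blast
qed

text \<open>A pentagonal periodic orbit of this billiard.\<close>

lemma sample_good: "good_start (vertex sample) (chart_centre sample) (vector [0, 11 / 17]) (vector [1 / 2, 1 / 2])"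
proof -
 let ?v = "vertex sample" and ?a = "chart_centre sample"
 let ?x = "vector [0, 11 / 17] :: real^2" and ?y = "vector [1 / 2, 1 / 2] :: real^2"
 have on: "on_side ?v i z \<longleftrightarrow> side_line ?v i \<bullet> chart z = 0 \<and> (\<forall>k. k \<noteq> i \<longrightarrow> side_line ?v k \<bullet> chart z < 0)" for i z
  unfolding pentagon.open_side_iff[OF sample_pentagon] pentagon.f_def[OF sample_pentagon] by simp
 have h3: "hit (side_line ?v 2) (side_line ?v 1) (?a 1) ?x ?y = vector [- 11 / 68, 0, - 1 / 4]"
  by (simp add: hit_def reflect_def sample_sides sample_centres chart_vector vec3_ops)
 have t: "third ?v ?a ?x ?y = vector [11 / 17, 0]" unfolding third_def h3 by (simp add: unchart_def)
 have h4: "hit (side_line ?v 3) (side_line ?v 2) (?a 2) ?y (vector [11 / 17, 0]) = vector [- 19 / 680, - 15 / 680, - 1 / 10]"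
  by (simp add: hit_def reflect_def sample_sides sample_centres chart_vector vec3_ops)
 have f: "fourth ?v ?a ?x ?y = vector [19 / 68, 15 / 68]" unfolding fourth_def t h4 by (simp add: unchart_def)
 have h5: "hit (side_line ?v 4) (side_line ?v 3) (?a 3) (vector [11 / 17, 0]) (vector [19 / 68, 15 / 68]) =
   vector [- 9 / 9248, - 81 / 9248, - 9 / 544]"
  by (simp add: hit_def reflect_def sample_sides sample_centres chart_vector vec3_ops)
 have g: "fifth ?v ?a ?x ?y = vector [1 / 17, 9 / 17]" unfolding fifth_def t f h5 by (simp add: unchart_def)
 show ?thesis
  unfolding good_start_def t f g h3 h4 h5 on all_5 by (simp add: sample_sides chart_vector vec3_ops)
qed

lemma chart_relation:
 assumes nz: "\<And>i. chart_line u i \<bullet> chart_centre u i \<noteq> 0"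
 defines "h \<equiv> \<lambda>i. homology (chart_centre u i) (chart_line u i)"
 shows "h 4 ** h 3 ** h 2 ** h 1 ** h 0 = - mat 1"
proof -
 obtain a b c d where u: "u = (a, b, c, d)" by (cases u)
 let ?A = "param_matrix u"
 define B where "B = chart_matrix ** ?A ** transpose chart_matrix"
 have symA: "transpose ?A = ?A" by (simp add: u vec_eq_iff forall_3 transpose_def param_matrix_def)
 then have "transpose B = B" by (simp add: B_def matrix_transpose_mul matrix_mul_assoc)
 then interpret S: symmetric_matrix B by unfold_locales
 have Bl: "B *v chart_line u i = chart_centre u i" for i
 proof -
  have "B *v chart_line u i = chart_matrix *v (?A *v (transpose chart_matrix *v (chart_dual *v param_line u i)))"
   by (simp only: B_def chart_line_def matrix_vector_mul_assoc matrix_mul_assoc)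
  then show ?thesis unfolding chart_dual_inv by (simp add: chart_centre_def param_config_def)
 qed
 have inner: "chart_line u i \<bullet> (chart_matrix *v x) = param_line u i \<bullet> x" for i x
  unfolding inner_matrix_transpose chart_line_def chart_dual_inv ..
 have ax: "S.ax (chart_line u i) (chart_line u j) (chart_line u k) =
   chart_matrix *v triple_axis ?A (param_line u i) (param_line u j) (param_line u k)" for i j k
  using triple_axis_congruence[of 1 chart_matrix ?A "chart_line u i" "chart_line u j" "chart_line u k"]
  unfolding chart_line_def chart_dual_inv B_def by simp
 have line: "param_line u i = frame i" if "i \<noteq> 4" for i using that by (simp add: param_line_def)
 have "S.h (chart_line u 4) ** S.h (chart_line u 3) ** S.h (chart_line u 2) ** S.h (chart_line u 1) ** S.h (chart_line u 0) = - mat 1"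
 proof (rule S.five_relation)
  show "chart_line u i \<bullet> (B *v chart_line u i) \<noteq> 0" for i unfolding Bl by (rule nz)
  have "chart_line u 1 \<bullet> (B *v chart_line u 2) = 1"
   unfolding Bl chart_centre_def inner param_config_def
   by (simp add: line) (simp add: u param_matrix_vec vec3_ops)
  then show "chart_line u 1 \<bullet> (B *v chart_line u 2) \<noteq> 0" by simp
  show "chart_line u 3 \<bullet> S.ax (chart_line u 0) (chart_line u 1) (chart_line u 2) = 0"
   unfolding ax inner by (simp add: line triple_axis_def) (simp add: u param_matrix_vec vec3_ops algebra_simps)
  show "chart_line u 4 \<bullet> S.ax (chart_line u 0) (chart_line u 1) (chart_line u 2) = 0"
   "chart_line u 4 \<bullet> S.ax (chart_line u 1) (chart_line u 2) (chart_line u 3) = 0"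
   unfolding ax inner by (simp_all add: line param_line_def[of u 4] dot_cross_self)
 qed
 then show ?thesis unfolding h_def Bl .
qed

lemma vertex_side_line:
 assumes third: "\<And>i. cross3 (chart_line u (i + 4)) (chart_line u i) $ 3 \<noteq> 0"
 shows "\<exists>r. side_line (vertex u) i = r *\<^sub>R chart_line u i"
proof -
 let ?l = "chart_line u"
 define s where "s i = 1 / cross3 (?l (i + 4)) (?l i) $ 3" for i
 have chart: "chart (vertex u i) = s i *\<^sub>R cross3 (?l (i + 4)) (?l i)" for i
  unfolding vertex_def chart_unchart[OF third] s_def ..
 have "side_line (vertex u) i = (s i * s (i + 1)) *\<^sub>R cross3 (cross3 (?l (i + 4)) (?l i)) (cross3 (?l i) (?l (i + 1)))"
  unfolding side_line_def chart shift5 add.assoc[of i 1 4] by (simp add: num5 cross_mult_left cross_mult_right)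
 also have "\<dots> = (s i * s (i + 1) * (?l (i + 4) \<bullet> cross3 (?l i) (?l (i + 1)))) *\<^sub>R ?l i"
  by (simp add: cross3_def inner_vec_def sum_3 vec_eq_iff forall_3 algebra_simps)
 finally show ?thesis by blast
qed

lemma chart_billiard:
 assumes third: "\<And>i. cross3 (chart_line u (i + 4)) (chart_line u i) $ 3 \<noteq> 0"
  and pent: "pentagon (vertex u) \<sigma>"
  and nz: "\<And>i. chart_line u i \<bullet> chart_centre u i \<noteq> 0"
  and gen: "\<And>i j k. distinct [i, j, k] \<Longrightarrow> param_config (Inl i) u \<bullet> cross3 (param_config (Inl j) u) (param_config (Inl k) u) \<noteq> 0"
  and good: "good_start (vertex u) (chart_centre u) x y"
 shows "convex_5_reflective (vertex u) (centre u)" "\<And>k. param_config k u \<noteq> 0"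
  "pgl_orbit (billiard_configuration (vertex u) (centre u)) = pgl_orbit (\<lambda>k. abs_rp2 (param_config k u))"
proof -
 have "\<exists>r. side_line (vertex u) i = r *\<^sub>R chart_line u i" for i using vertex_side_line[OF third] .
 then obtain r where side: "\<And>i. side_line (vertex u) i = r i *\<^sub>R chart_line u i" by metis
 have r: "r i \<noteq> 0" for i using pentagon.pos[OF pent, of "i + 2" i] side[of i] by (auto simp: num5)
 have cen0: "param_config (Inl i) u \<noteq> 0" for i using nz[of i] by (auto simp: chart_centre_def)
 have line0: "param_line u i \<noteq> 0" for i using nz[of i] by (auto simp: chart_line_def)
 show ne: "param_config k u \<noteq> 0" for k
  using cen0 line0 by (cases k) (simp_all add: param_config_def)
 have cc0: "chart_centre u i \<noteq> 0" for i using nz[of i] by auto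
 have "\<exists>t. t \<noteq> 0 \<and> rep_rp2 (centre u i) = t *\<^sub>R chart_centre u i" for i
  using rep_abs_rp2[OF cc0[of i]] unfolding centre_def by metis
 then obtain t where t: "\<And>i. t i \<noteq> 0" "\<And>i. rep_rp2 (centre u i) = t i *\<^sub>R chart_centre u i" by metis
 interpret billiard "vertex u" \<sigma> "centre u"
 proof (intro billiard.intro billiard_axioms.intro pent)
  show "side_line (vertex u) i \<bullet> rep_rp2 (centre u i) \<noteq> 0" for i using r t nz by (simp add: side)
 qed
 have H: "H i = homology (chart_centre u i) (chart_line u i)" for i
  unfolding side_reflection_def t side by (rule homology_scale[OF t(1) r])
 have rel: "H 4 ** H 3 ** H 2 ** H 1 ** H 0 = - mat 1" unfolding H by (rule chart_relation[OF nz])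
 have "M = - mat 1" unfolding M_def by (rule rotate_relation[OF rel H_involution])
 moreover have "good x y" using good good_start_scale[of t "vertex u" "chart_centre u"] t by simp
 ultimately have refl: "reflective_along (vertex u) (centre u) 5 of_nat" by (rule reflectiveI)
 have "det chart_matrix \<noteq> 0" using chart_matrix_inv(2) by (simp add: invertible_det_nz)
 then have "rep_rp2 (centre u i) \<bullet> cross3 (rep_rp2 (centre u j)) (rep_rp2 (centre u k)) \<noteq> 0" if "distinct [i, j, k]" for i j k
  using gen[OF that] t(1) by (simp add: t(2) cross_mult_left cross_mult_right chart_centre_def triple_matrix)
 from generic_centres[of "centre u", OF this] show "convex_5_reflective (vertex u) (centre u)"
  using refl convex_billiard_iff billiard_axioms unfolding convex_5_reflective_def by blast
 have "billiard_configuration (vertex u) (centre u) k = pgl_action chart_matrix (\<lambda>k. abs_rp2 (param_config k u)) k" for k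
 proof (cases k)
  case (Inl i)
  then show ?thesis
   by (simp add: billiard_configuration_def pgl_action_def centre_def chart_centre_def rp2_map_abs[OF chart_matrix_inv(2) cen0])
 next
  case (Inr i)
  have "invertible chart_dual" using invertible_transpose_inv[OF chart_matrix_inv(2)] chart_matrix_inv(1) by simp
  then show ?thesis using r
   by (simp add: Inr billiard_configuration_def pgl_action_def side chart_matrix_inv(1) param_config_def chart_line_def
     rp2_map_abs line0)
 qed
 then have "billiard_configuration (vertex u) (centre u) = pgl_action chart_matrix (\<lambda>k. abs_rp2 (param_config k u))" by blast
 then show "pgl_orbit (billiard_configuration (vertex u) (centre u)) = pgl_orbit (\<lambda>k. abs_rp2 (param_config k u))"
  by (simp add: pgl_orbit_action[OF chart_matrix_inv(2)])
qed

definition param_class :: "params \<Rightarrow> (5 + 5 \<Rightarrow> rp2) set" where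
 "param_class u = pgl_orbit (\<lambda>k. abs_rp2 (param_config k u))"

definition reflective_params :: "params set" where
 "reflective_params = {u. det (param_matrix u) \<noteq> 0 \<and> (\<forall>k. param_config k u \<noteq> 0) \<and> param_class u \<in> billiard_moduli_set}"

lemma moduli_eq_image: "billiard_moduli_set = param_class ` reflective_params"
proof
 show "billiard_moduli_set \<subseteq> param_class ` reflective_params"
 proof
  fix s assume s: "s \<in> billiard_moduli_set"
  then obtain v c where vc: "convex_5_reflective v c" "s = pgl_orbit (billiard_configuration v c)"
   unfolding billiard_moduli_set_def by blast
  obtain u where u: "det (param_matrix u) \<noteq> 0" "\<And>k. param_config k u \<noteq> 0" "s = param_class u"
   using reflective_normal_form[OF vc(1)] unfolding vc(2) param_class_def by metis
  then have "u \<in> reflective_params" using s by (simp add: reflective_params_def)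
  then show "s \<in> param_class ` reflective_params" using u(3) by blast
 qed
qed (auto simp: reflective_params_def)

lemma tendsto_polynomial:
 fixes f :: "'a::euclidean_space \<Rightarrow> 'b::euclidean_space"
 assumes "poly_map f" shows "(f \<longlongrightarrow> f a) (nhds a)"
 using continuous_polymonial_function[OF assms] by (simp add: continuous_at tendsto_at_iff_tendsto_nhds)

lemma eventually_reflective_params: "eventually (\<lambda>u. u \<in> reflective_params) (nhds sample)"
proof -
 let ?F = "nhds sample"
 let ?x = "vector [0, 11 / 17] :: real^2" and ?y = "vector [1 / 2, 1 / 2] :: real^2"
 have conf: "((\<lambda>u. param_config k u) \<longlongrightarrow> param_config k sample) ?F" for k
  by (rule tendsto_polynomial[OF polynomial_param_config])
 have mv: "((\<lambda>u. g *v z u) \<longlongrightarrow> g *v z0) F" if "(z \<longlongrightarrow> z0) F" for g :: "real^3^3" and z z0 and F :: "params filter"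
  by (rule bounded_linear.tendsto[OF matrix_vector_mul_bounded_linear that])
 have line: "((\<lambda>u. chart_line u i) \<longlongrightarrow> chart_line sample i) ?F" for i
  unfolding chart_line_def using mv[OF conf[of "Inr i"]] by (simp add: param_config_def)
 have cen: "((\<lambda>u. chart_centre u i) \<longlongrightarrow> chart_centre sample i) ?F" for i
  unfolding chart_centre_def by (rule mv[OF conf])
 have cross: "((\<lambda>u. cross3 (chart_line u (i + 4)) (chart_line u i)) \<longlongrightarrow> cross3 (chart_line sample (i + 4)) (chart_line sample i)) ?F" for i
  by (intro tendsto_intros line)
 have third0: "cross3 (chart_line sample (i + 4)) (chart_line sample i) $ 3 \<noteq> 0" for i
 proof -
  have "\<forall>i. cross3 (chart_line sample (i + 4)) (chart_line sample i) $ 3 \<noteq> 0"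
   unfolding all_5 by (simp add: num5 sample_lines vec3_ops)
  then show ?thesis by blast
 qed
 have vert: "((\<lambda>u. vertex u i) \<longlongrightarrow> vertex sample i) ?F" for i
  unfolding vertex_def by (rule tendsto_unchart[OF cross third0])
 have "eventually (\<lambda>u. cross3 (chart_line u (i + 4)) (chart_line u i) $ 3 \<noteq> 0) ?F" for i
  by (rule tendsto_imp_eventually_ne[OF tendsto_vec_nth[OF cross] third0])
 then have E1: "eventually (\<lambda>u. \<forall>i. cross3 (chart_line u (i + 4)) (chart_line u i) $ 3 \<noteq> 0) ?F"
  by (intro eventually_all_finite)
 have E2: "eventually (\<lambda>u. pentagon (vertex u) (- 1)) ?F" by (rule eventually_pentagon[OF vert sample_pentagon])
 have "\<forall>i. chart_line sample i \<bullet> chart_centre sample i \<noteq> 0"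
  unfolding all_5 by (simp add: sample_lines sample_centres vec3_ops)
 then have "eventually (\<lambda>u. chart_line u i \<bullet> chart_centre u i \<noteq> 0) ?F" for i
  by (intro tendsto_imp_eventually_ne[OF tendsto_inner[OF line cen]]) blast
 then have E3: "eventually (\<lambda>u. \<forall>i. chart_line u i \<bullet> chart_centre u i \<noteq> 0) ?F" by (intro eventually_all_finite)
 have gen0: "\<forall>i j k. distinct [i, j, k] \<longrightarrow> param_config (Inl i) sample \<bullet> cross3 (param_config (Inl j) sample) (param_config (Inl k) sample) \<noteq> 0"
  unfolding all_5 by (simp add: sample_configs vec3_ops)
 have "eventually (\<lambda>u. distinct [i, j, k] \<longrightarrow> param_config (Inl i) u \<bullet> cross3 (param_config (Inl j) u) (param_config (Inl k) u) \<noteq> 0) ?F" for i j k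
 proof (cases "distinct [i, j, k]")
  case True
  have "((\<lambda>u. param_config (Inl i) u \<bullet> cross3 (param_config (Inl j) u) (param_config (Inl k) u)) \<longlongrightarrow>
   param_config (Inl i) sample \<bullet> cross3 (param_config (Inl j) sample) (param_config (Inl k) sample)) ?F"
   by (intro tendsto_intros conf)
  then have "eventually (\<lambda>u. param_config (Inl i) u \<bullet> cross3 (param_config (Inl j) u) (param_config (Inl k) u) \<noteq> 0) ?F"
   by (rule tendsto_imp_eventually_ne) (use gen0 True in blast)
  then show ?thesis by eventually_elim simp
 qed (simp only: simp_thms eventually_True)
 then have E4: "eventually (\<lambda>u. \<forall>i j k. distinct [i, j, k] \<longrightarrow>
   param_config (Inl i) u \<bullet> cross3 (param_config (Inl j) u) (param_config (Inl k) u) \<noteq> 0) ?F"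
  by (intro eventually_all_finite)
 have side0: "side_line (vertex sample) i \<bullet> chart_centre sample i \<noteq> 0" for i
 proof -
  have "\<forall>i. side_line (vertex sample) i \<bullet> chart_centre sample i \<noteq> 0"
   unfolding all_5 by (simp add: sample_sides sample_centres vec3_ops)
  then show ?thesis by blast
 qed
 have const: "param_line u 4 = param_line u 4 \<and> chart_line u 0 = vector [1, 0, 0] \<and> chart_line u 1 = vector [1, 1, - 1]" for u
  by (simp add: chart_line_def param_line_def chart_matrix_vec)
 have on: "eventually (\<lambda>u. on_side (vertex u) i z) ?F"
  if z: "on_side (vertex sample) i z" and zero: "\<And>u. chart_line u i \<bullet> chart z = 0" for i z
 proof (rule eventually_open_side[OF vert sample_pentagon tendsto_const z])
  show "eventually (\<lambda>u. side_line (vertex u) i \<bullet> chart z = 0) ?F"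
   using E1
  proof eventually_elim
   case (elim u)
   then show ?case using vertex_side_line[of u i] zero[of u] by auto
  qed
 qed
 have s: "on_side (vertex sample) 0 ?x" "on_side (vertex sample) 1 ?y" using sample_good unfolding good_start_def by blast+
 have E5: "eventually (\<lambda>u. good_start (vertex u) (chart_centre u) ?x ?y) ?F"
  by (rule eventually_good_start[OF vert sample_pentagon cen side0 tendsto_const tendsto_const eventually_conj[OF on[OF s(1)] on[OF s(2)]] sample_good])
   (simp_all add: const chart_vector vec3_ops)
 from E1 E2 E3 E4 E5 show ?thesis
 proof eventually_elim
  case (elim u)
  note b = chart_billiard[OF elim(1)[rule_format] elim(2) elim(3)[rule_format] elim(4)[rule_format] elim(5)]
  have "param_class u \<in> billiard_moduli_set"
   unfolding billiard_moduli_set_def param_class_def using b(1) b(3)[symmetric] by blast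
  moreover have "det (param_matrix u) \<noteq> 0"
  proof -
   have "det (param_matrix u) * (frame 0 \<bullet> cross3 (frame 1) (frame 2)) \<noteq> 0"
    using elim(4)[rule_format, of 0 1 2] by (simp add: param_config_def param_line_def triple_matrix)
   then show ?thesis by simp
  qed
  ultimately show ?case using b(2) by (simp add: reflective_params_def)
 qed
qed

section \<open>Coordinates on the moduli space\<close>

text \<open>The factor by which the representative of line \<open>i\<close> has to be multiplied so that the sum of the
 first three becomes the fourth; all factors are multiplied by the same determinant to avoid division.\<close>

definition frame_factor :: "(5 \<Rightarrow> real^3) \<Rightarrow> 5 \<Rightarrow> real" where
 "frame_factor l i = (if i = 0 then l 3 \<bullet> cross3 (l 1) (l 2) else if i = 1 then l 0 \<bullet> cross3 (l 3) (l 2)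
   else l 0 \<bullet> cross3 (l 1) (l 3))"

definition gram_entry :: "(real^3)^(5 + 5) \<Rightarrow> 5 \<Rightarrow> 5 \<Rightarrow> real" where
 "gram_entry y i j = frame_factor (\<lambda>m. y $ Inr m) i * frame_factor (\<lambda>m. y $ Inl m) j * (y $ Inr i \<bullet> y $ Inl j)"

lemma prod_5: "(\<Prod>i\<in>UNIV. g (i::5)) = g 0 * g 1 * g 2 * g 3 * (g 4 :: real)"
proof -
 have "(UNIV :: 5 set) = {0, 1, 2, 3, 4}" using all_5[of "\<lambda>i. i \<in> {0, 1, 2, 3, 4}"] by auto
 then show ?thesis unfolding \<open>UNIV = {0, 1, 2, 3, 4}\<close> by (simp add: mult.assoc)
qed

definition gram_degree :: "5 + 5 \<Rightarrow> nat" where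
 "gram_degree k = (if k = Inl 4 \<or> k = Inr 4 then 0 else 1)"

lemma prod_gram_degree: "(\<Prod>k\<in>UNIV. t k ^ gram_degree k) =
  (t (Inl 0) * t (Inl 1) * t (Inl 2) * t (Inl 3)) * (t (Inr 0) * t (Inr 1) * t (Inr 2) * t (Inr 3) :: real)"
proof -
 have "(\<Prod>k\<in>UNIV <+> UNIV. t k ^ gram_degree k) =
   (\<Prod>i\<in>UNIV. t (Inl i) ^ gram_degree (Inl i)) * (\<Prod>i\<in>UNIV. t (Inr i) ^ gram_degree (Inr i))"
  by (subst prod.Plus) (simp_all add: o_def)
 then show ?thesis by (simp only: UNIV_Plus_UNIV prod_5) (simp add: gram_degree_def)
qed

lemma gram_entry_scale:
 assumes "i \<in> {0, 1, 2}" "j \<in> {0, 1, 2}"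
 shows "gram_entry (\<chi> k. t k *\<^sub>R y $ k) i j = (\<Prod>k\<in>UNIV. t k ^ gram_degree k) * gram_entry y i j"
 unfolding prod_gram_degree using assms
 by (auto simp: gram_entry_def frame_factor_def cross_mult_left cross_mult_right)

lemma frame_factor_matrix: "frame_factor (\<lambda>m. g *v l m) i = det g * frame_factor l i"
 by (simp add: frame_factor_def triple_matrix)

lemma real_polynomial_inner:
 fixes f g :: "'a::euclidean_space \<Rightarrow> real^3"
 assumes "poly_map f" "poly_map g" shows "real_poly (\<lambda>u. f u \<bullet> g u)"
proof -
 have "poly_map (\<lambda>u. \<Sum>i\<in>UNIV. f u $ i * g u $ i)"
  by (intro polynomial_function_sum polynomial_times polynomial_entry assms) simp
 then show ?thesis by (simp add: real_polynomial_function_eq inner_vec_def)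
qed

lemma polynomial_gram_entry: "real_poly (\<lambda>y. gram_entry y i j)"
proof -
 have "real_poly (\<lambda>y :: (real^3)^(5 + 5). frame_factor (\<lambda>m. y $ s m) i)" for s i
  unfolding frame_factor_def
  by (cases "i = 0"; cases "i = 1") (auto intro!: real_polynomial_inner polynomial_nth polynomial_cross3)
 then show ?thesis
  unfolding gram_entry_def by (intro real_polynomial_function.intros(4) real_polynomial_inner polynomial_nth)
qed

abbreviation config_reps :: "(5 + 5 \<Rightarrow> rp2) \<Rightarrow> (real^3)^(5 + 5)" where
 "config_reps x \<equiv> \<chi> k. rep_rp2 (x k)"

definition gram_vector :: "(real^3)^(5 + 5) \<Rightarrow> params" where
 "gram_vector y = (gram_entry y 1 1, gram_entry y 2 2, gram_entry y 0 1, gram_entry y 0 2)"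

definition coordinates :: "(5 + 5 \<Rightarrow> rp2) \<Rightarrow> params" where
 "coordinates x = (1 / gram_entry (config_reps x) 1 2) *\<^sub>R gram_vector (config_reps x)"

definition chart_domain :: "(5 + 5 \<Rightarrow> rp2) set" where
 "chart_domain = {x. gram_entry (config_reps x) 1 2 \<noteq> 0}"

lemma coordinates_proportional:
 assumes q: "q \<noteq> 0" and e: "\<And>i j. i \<in> {0, 1, 2} \<Longrightarrow> j \<in> {0, 1, 2} \<Longrightarrow> gram_entry y i j = q * gram_entry z i j"
 shows "(1 / gram_entry y 1 2) *\<^sub>R gram_vector y = (1 / gram_entry z 1 2) *\<^sub>R gram_vector z"
  "gram_entry y 1 2 \<noteq> 0 \<longleftrightarrow> gram_entry z 1 2 \<noteq> 0"
 using q by (simp_all add: gram_vector_def e)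

text \<open>The entries all have the same multidegree, so the choice of representatives cancels in the quotients; the determinants of
 the dual actions on points and lines are inverse to each other.\<close>

lemma coordinates_invariant:
 assumes g: "invertible g"
 shows "coordinates (pgl_action g x) = coordinates x" "pgl_action g x \<in> chart_domain \<longleftrightarrow> x \<in> chart_domain"
proof -
 let ?G = "transpose (matrix_inv g)"
 define z :: "(real^3)^(5 + 5)" where
  "z = (\<chi> k. case k of Inl i \<Rightarrow> g *v rep_rp2 (x k) | Inr i \<Rightarrow> ?G *v rep_rp2 (x k))"
 have iG: "invertible ?G" by (rule invertible_transpose_inv[OF g])
 have z0: "z $ k \<noteq> 0" for k
  by (cases k) (simp_all only: z_def vec_lambda_beta sum.case matrix_vector_mult_eq_0_invertible[OF g]
    matrix_vector_mult_eq_0_invertible[OF iG] rep_rp2_nonzero not_False_eq_True)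
 have act: "pgl_action g x k = abs_rp2 (z $ k)" for k
  by (cases k) (simp_all only: pgl_action_def rp2_map_def z_def vec_lambda_beta sum.case)
 have "\<exists>t. t \<noteq> 0 \<and> rep_rp2 (pgl_action g x k) = t *\<^sub>R z $ k" for k
  using rep_abs_rp2[OF z0[of k]] unfolding act by metis
 then obtain t where t: "\<And>k. t k \<noteq> 0" "\<And>k. rep_rp2 (pgl_action g x k) = t k *\<^sub>R z $ k" by metis
 define q where "q = (\<Prod>k\<in>UNIV. t k ^ gram_degree k)"
 have q: "q \<noteq> 0" "\<And>i j. i \<in> {0, 1, 2} \<Longrightarrow> j \<in> {0, 1, 2} \<Longrightarrow>
   gram_entry (\<chi> k. t k *\<^sub>R z $ k) i j = q * gram_entry z i j"
  by (simp add: q_def prod_gram_degree t(1), simp only: q_def gram_entry_scale)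
 have dets: "det ?G * det g = 1"
 proof -
  have "det (matrix_inv g ** g) = 1" using matrix_inv_mult[OF g] by simp
  then show ?thesis by (simp add: det_mul)
 qed
 have "gram_entry z i j = gram_entry (config_reps x) i j" for i j
 proof -
  have ip: "(?G *v a) \<bullet> (g *v b) = a \<bullet> b" for a b
  proof -
   have "transpose g *v (?G *v a) = a"
   proof -
    have "transpose g ** ?G = mat 1" using matrix_inv_mult[OF g] by (metis matrix_transpose_mul transpose_mat)
    then show ?thesis by (simp only: matrix_vector_mul_assoc matrix_vector_mul_lid)
   qed
   then show ?thesis unfolding inner_matrix_transpose by simp
  qed
  have "gram_entry z i j = (det ?G * det g) * gram_entry (config_reps x) i j"
   unfolding gram_entry_def z_def vec_lambda_beta sum.case frame_factor_matrix ip by (simp add: mult_ac)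
  then show ?thesis unfolding dets by simp
 qed
 then have "gram_entry (config_reps (pgl_action g x)) i j = q * gram_entry (config_reps x) i j"
  if "i \<in> {0, 1, 2}" "j \<in> {0, 1, 2}" for i j unfolding t(2) q(2)[OF that] by simp
 from coordinates_proportional[OF q(1) this]
 show "coordinates (pgl_action g x) = coordinates x" "pgl_action g x \<in> chart_domain \<longleftrightarrow> x \<in> chart_domain"
  unfolding coordinates_def chart_domain_def by simp_all
qed

lemma coordinates_param:
 assumes nz: "\<And>k. param_config k u \<noteq> 0" and det: "det (param_matrix u) \<noteq> 0"
 shows "coordinates (\<lambda>k. abs_rp2 (param_config k u)) = u" "(\<lambda>k. abs_rp2 (param_config k u)) \<in> chart_domain"
proof -
 define z :: "(real^3)^(5 + 5)" where "z = (\<chi> k. param_config k u)"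
 obtain a b c d where u: "u = (a, b, c, d)" by (cases u)
 have "\<exists>t. t \<noteq> 0 \<and> rep_rp2 (abs_rp2 (param_config k u)) = t *\<^sub>R z $ k" for k
  using rep_abs_rp2[OF nz[of k]] unfolding z_def vec_lambda_beta by metis
 then obtain t where t: "\<And>k. t k \<noteq> 0" "\<And>k. rep_rp2 (abs_rp2 (param_config k u)) = t k *\<^sub>R z $ k" by metis
 define q where "q = (\<Prod>k\<in>UNIV. t k ^ gram_degree k)"
 have q: "q \<noteq> 0" "\<And>i j. i \<in> {0, 1, 2} \<Longrightarrow> j \<in> {0, 1, 2} \<Longrightarrow>
   gram_entry (\<chi> k. t k *\<^sub>R z $ k) i j = q * gram_entry z i j"
  by (simp add: q_def prod_gram_degree t(1), simp only: q_def gram_entry_scale)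
 note pr = coordinates_proportional[OF q, folded t(2)]
 have cr: "frame_factor (param_line u) i = 1" if "i \<in> {0, 1, 2}" for i
  using that by (auto simp: frame_factor_def param_line_def vec3_ops)
 have "gram_entry z i j = det (param_matrix u) * (frame i \<bullet> (param_matrix u *v frame j))"
  if ij: "i \<in> {0, 1, 2}" "j \<in> {0, 1, 2}" for i j
  using ij unfolding gram_entry_def z_def vec_lambda_beta param_config_def sum.case frame_factor_matrix cr[OF ij(1)] cr[OF ij(2)]
  by (auto simp: param_line_def)
 then have e: "gram_entry z 1 2 = det (param_matrix u)" "gram_entry z 1 1 = det (param_matrix u) * a"
  "gram_entry z 2 2 = det (param_matrix u) * b" "gram_entry z 0 1 = det (param_matrix u) * c"
  "gram_entry z 0 2 = det (param_matrix u) * d"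
  by (simp_all add: u param_matrix_vec vec3_ops)
 have "(1 / gram_entry z 1 2) *\<^sub>R gram_vector z = u" using det unfolding gram_vector_def e by (simp add: u)
 then show "coordinates (\<lambda>k. abs_rp2 (param_config k u)) = u" unfolding coordinates_def using pr(1) by (simp add: t(2))
 show "(\<lambda>k. abs_rp2 (param_config k u)) \<in> chart_domain"
  using pr(2) det unfolding chart_domain_def by (simp add: t(2) e(1))
qed

definition class_coordinates :: "(5 + 5 \<Rightarrow> rp2) set \<Rightarrow> params" where
 "class_coordinates s = coordinates (SOME x. x \<in> s)"

lemma class_coordinates_orbit: "class_coordinates (pgl_orbit x) = coordinates x"
proof -
 have "(SOME y. y \<in> pgl_orbit x) \<in> pgl_orbit x" by (rule someI[of _ x]) (rule pgl_orbit_self)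
 then show ?thesis using coordinates_invariant(1) unfolding class_coordinates_def pgl_orbit_def by auto
qed

lemma moduli_quotient: "quotient_map zariski moduli_topology pgl_orbit"
 unfolding moduli_topology_def by (rule quotient_map_quotient_topology)

lemma topspace_moduli: "topspace moduli_topology = range pgl_orbit"
 using quotient_imp_surjective_map[OF moduli_quotient] by simp

text \<open>The domain of the coordinates is open and saturated, so that the quotient map restricts to it.\<close>

lemma continuous_class_coordinates:
 "continuous_map (subtopology moduli_topology (pgl_orbit ` chart_domain)) zariski_affine class_coordinates"
proof (rule continuous_compose_quotient_map)
 have mh: "mh_deg gram_degree (\<lambda>y. gram_entry y 1 2)" unfolding mh_deg_def using gram_entry_scale[of 1 2] by blast
 have op: "openin zariski chart_domain"
  unfolding chart_domain_def by (intro openin_zariski_nonzero polynomial_gram_entry multihomogeneousI[OF mh])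
 have sat: "{x \<in> topspace zariski. pgl_orbit x \<in> pgl_orbit ` chart_domain} = chart_domain"
 proof (intro equalityI subsetI)
  fix x assume "x \<in> {x \<in> topspace zariski. pgl_orbit x \<in> pgl_orbit ` chart_domain}"
  then obtain y where y: "y \<in> chart_domain" "pgl_orbit x = pgl_orbit y" by auto
  then have "x \<in> pgl_orbit y" using pgl_orbit_self by metis
  then show "x \<in> chart_domain" using y(1) coordinates_invariant(2) unfolding pgl_orbit_def by auto
 qed auto
 show "quotient_map (subtopology zariski chart_domain) (subtopology moduli_topology (pgl_orbit ` chart_domain)) pgl_orbit"
 proof (rule quotient_map_restriction[OF moduli_quotient sat], rule disjI1)
  show "openin moduli_topology (pgl_orbit ` chart_domain)"
   unfolding moduli_topology_def openin_quotient_topology using sat op by auto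
 qed
 have poly: "poly_map gram_vector"
  unfolding gram_vector_def
  by (intro polynomial_function_iff_Basis_inner[THEN iffD2] ballI) (auto simp: Basis_prod_def polynomial_gram_entry)
 have "continuous_map (subtopology zariski chart_domain) zariski_affine coordinates"
  unfolding coordinates_def
 proof (rule continuous_map_rational[OF poly polynomial_gram_entry _ mh])
  show "gram_vector (\<chi> i. t i *\<^sub>R y $ i) = (\<Prod>i\<in>UNIV. t i ^ gram_degree i) *\<^sub>R gram_vector y" for t y
   by (simp add: gram_vector_def gram_entry_scale)
 qed (simp add: chart_domain_def)
 then show "continuous_map (subtopology zariski chart_domain) zariski_affine (class_coordinates \<circ> pgl_orbit)"
  by (simp add: o_def class_coordinates_orbit)
qed

lemma continuous_param_class:
 assumes "\<And>u k. u \<in> D \<Longrightarrow> param_config k u \<noteq> 0"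
 shows "continuous_map (subtopology zariski_affine D) moduli_topology param_class"
proof -
 have "continuous_map (subtopology zariski_affine D) zariski (\<lambda>u k. abs_rp2 (param_config k u))"
  by (rule continuous_map_abs_polynomial[OF polynomial_param_config assms])
 from continuous_map_compose[OF this quotient_imp_continuous_map[OF moduli_quotient]]
 show ?thesis by (simp add: o_def param_class_def[abs_def])
qed

text \<open>So the moduli space is homeomorphic to a set of parameters that contains a Euclidean ball.\<close>

lemma moduli_homeomorphic:
 "homeomorphic_maps billiard_moduli (subtopology zariski_affine reflective_params) class_coordinates param_class"
proof -
 have inv: "class_coordinates (param_class u) = u" if "u \<in> reflective_params" for u
  using that coordinates_param(1)[of u] by (simp add: reflective_params_def param_class_def class_coordinates_orbit)
 have dom: "billiard_moduli_set \<subseteq> pgl_orbit ` chart_domain"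
  unfolding moduli_eq_image using coordinates_param(2) by (auto simp: reflective_params_def param_class_def)
 have top: "topspace billiard_moduli = billiard_moduli_set"
  using dom by (auto simp: billiard_moduli_def topspace_moduli)
 have "continuous_map billiard_moduli zariski_affine class_coordinates"
  unfolding billiard_moduli_def by (rule continuous_map_from_subtopology_mono[OF continuous_class_coordinates dom])
 moreover have "class_coordinates ` billiard_moduli_set \<subseteq> reflective_params"
  unfolding moduli_eq_image using inv by auto
 ultimately have "continuous_map billiard_moduli (subtopology zariski_affine reflective_params) class_coordinates"
  by (simp add: continuous_map_in_subtopology top image_subset_iff_funcset)
 moreover have "continuous_map (subtopology zariski_affine reflective_params) moduli_topology param_class"
  by (rule continuous_param_class) (simp add: reflective_params_def)
 then have "continuous_map (subtopology zariski_affine reflective_params) billiard_moduli param_class"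
  unfolding billiard_moduli_def by (auto simp: continuous_map_in_subtopology moduli_eq_image)
 ultimately show ?thesis
  unfolding homeomorphic_maps_def top using inv by (auto simp: moduli_eq_image)
qed

lemma open_reflective_params: obtains W where "open W" "sample \<in> W" "W \<subseteq> reflective_params"
 using eventually_reflective_params unfolding eventually_nhds by blast

theorem irreducible_billiard_moduli: "irreducible_space billiard_moduli"
proof -
 obtain W where W: "open W" "sample \<in> W" "W \<subseteq> reflective_params" by (rule open_reflective_params)
 have "interior reflective_params \<noteq> {}" using interior_maximal[OF W(3,1)] W(2) by blast
 then have "irreducible_in zariski_affine reflective_params" by (rule irreducible_in_zariski_affine)
 then have "irreducible_in (subtopology zariski_affine reflective_params) reflective_params"
  unfolding irreducible_in_subtopology by simp
 then have "irreducible_in billiard_moduli (param_class ` reflective_params)"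
  using moduli_homeomorphic unfolding homeomorphic_maps_def by (intro irreducible_in_image) blast+
 moreover have "topspace billiard_moduli = param_class ` reflective_params"
  unfolding moduli_eq_image[symmetric] billiard_moduli_def topspace_subtopology topspace_moduli
  by (auto simp: billiard_moduli_set_def)
 ultimately show ?thesis unfolding irreducible_space_iff[of billiard_moduli] by simp
qed

text \<open>The coordinate flats through the sample parameter cut out a chain of length four.\<close>

definition flat_projection :: "nat \<Rightarrow> params \<Rightarrow> params" where
 "flat_projection k = (\<lambda>(a, b, c, d). (if 0 < k then a else - 3, if 1 < k then b else - 3, if 2 < k then c else 1, if 3 < k then d else 1))"

lemma polynomial_flat_projection: "poly_map (flat_projection k)"
proof -
 have co: "real_poly (\<lambda>u :: params. fst u)" "real_poly (\<lambda>u :: params. fst (snd u))"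
  "real_poly (\<lambda>u :: params. fst (snd (snd u)))" "real_poly (\<lambda>u :: params. snd (snd (snd u)))"
  using polynomial_coord4 by (simp_all add: real_polynomial_function_eq)
 have ite: "real_poly (\<lambda>u. if b then f u else r)" if "real_poly f" for b r and f :: "params \<Rightarrow> real"
  using that by (cases b) (simp_all add: real_polynomial_function.intros(2))
 show ?thesis
  unfolding flat_projection_def case_prod_beta
  by (intro polynomial_function_iff_Basis_inner[THEN iffD2] ballI) (auto simp: Basis_prod_def intro!: ite co)
qed

theorem krull_dim_billiard_moduli: "krull_dim billiard_moduli = 4"
proof -
 let ?K = "subtopology zariski_affine reflective_params"
 obtain W where W: "open W" "sample \<in> W" "W \<subseteq> reflective_params" by (rule open_reflective_params)
 define U where "U k = {u. flat_projection k u \<in> W}" for k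
 define S where "S k = flat_projection k ` U k" for k
 have opU: "open (U k)" for k
 proof -
  have "continuous_on UNIV (flat_projection k)" by (rule continuous_on_polymonial_function[OF polynomial_flat_projection])
  then have "open (flat_projection k -` W)" using W(1) by (simp add: continuous_on_open_vimage)
  then show ?thesis by (simp add: U_def vimage_def)
 qed
 have sU: "sample \<in> U k" for k using W(2) by (simp add: U_def sample_def flat_projection_def)
 have SW: "S k \<subseteq> W" for k by (auto simp: S_def U_def)
 have "enat 4 \<le> krull_dim ?K"
 proof (rule krull_dim_ge, rule irr_chainI_closure)
  show "irreducible_in ?K (S k)" for k
  proof -
   have "continuous_map (subtopology zariski_affine (U k)) zariski_affine (flat_projection k)"
    by (intro continuous_map_from_subtopology continuous_map_polynomial polynomial_flat_projection)
   moreover have "interior (U k) \<noteq> {}" using opU sU by (auto simp: interior_open)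
   ultimately have "irreducible_in zariski_affine (S k)" unfolding S_def by (rule irreducible_in_polynomial_image)
   then show ?thesis unfolding irreducible_in_subtopology using SW W(3) by blast
  qed
  show "S k \<subseteq> S (Suc k)" for k
  proof
   fix z assume "z \<in> S k"
   then obtain u where u: "flat_projection k u \<in> W" "z = flat_projection k u" by (auto simp: S_def U_def)
   have "flat_projection (Suc k) (flat_projection k u) = flat_projection k u"
    by (cases u) (simp add: flat_projection_def)
   then show "z \<in> S (Suc k)" using u unfolding S_def U_def by (intro image_eqI[of _ _ z]) auto
  qed
  fix k :: nat assume "k < 4"
  then consider "k = 0" | "k = 1" | "k = 2" | "k = 3" by linarith
  then obtain co e :: "params \<Rightarrow> real" and r :: real and z where co: "real_poly co" "\<And>u. co (flat_projection k u) = r"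
    "co (flat_projection (Suc k) z) \<noteq> r"
  proof cases
   case 1
   then show ?thesis
    using that[of fst "- 3" "(0, 0, 0, 0)"] polynomial_coord4(1) by (simp add: flat_projection_def case_prod_beta real_polynomial_function_eq)
  next
   case 2
   then show ?thesis
    using that[of "\<lambda>u. fst (snd u)" "- 3" "(0, 0, 0, 0)"] polynomial_coord4(2) by (simp add: flat_projection_def case_prod_beta real_polynomial_function_eq)
  next
   case 3
   then show ?thesis
    using that[of "\<lambda>u. fst (snd (snd u))" 1 "(0, 0, 0, 0)"] polynomial_coord4(3) by (simp add: flat_projection_def case_prod_beta real_polynomial_function_eq)
  next
   case 4
   then show ?thesis
    using that[of "\<lambda>u. snd (snd (snd u))" 1 "(0, 0, 0, 0)"] polynomial_coord4(4) by (simp add: flat_projection_def case_prod_beta real_polynomial_function_eq)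
  qed
  have pr: "real_poly (\<lambda>u. co u - r)"
   using co(1) by (intro real_polynomial_function_diff real_polynomial_function.intros(2))
  have "closedin ?K ({u. co u - r = 0} \<inter> reflective_params)"
   using closedin_zariski_affine_zero[OF pr] by (auto simp: closedin_subtopology)
  moreover have "S k \<subseteq> {u. co u - r = 0} \<inter> reflective_params" using SW W(3) co(2) by (auto simp: S_def U_def)
  moreover have "\<not> S (Suc k) \<subseteq> {u. co u - r = 0} \<inter> reflective_params"
  proof
   assume sub: "S (Suc k) \<subseteq> {u. co u - r = 0} \<inter> reflective_params"
   have "real_poly (\<lambda>u. co (flat_projection (Suc k) u) - r)"
    using real_polynomial_function_compose[OF polynomial_flat_projection pr] by (simp add: o_def)
   then have "co (flat_projection (Suc k) z) - r = 0"
   proof (rule real_polynomial_function_eq_zero[OF _ opU])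
    show "U (Suc k) \<noteq> {}" using sU by blast
    show "co (flat_projection (Suc k) u) - r = 0" if "u \<in> U (Suc k)" for u
     using sub that unfolding S_def by blast
   qed
   then show False using co(3) by simp
  qed
  ultimately show "\<exists>C. closedin ?K C \<and> S k \<subseteq> C \<and> \<not> S (Suc k) \<subseteq> C" by blast
 qed
 moreover have "krull_dim ?K \<le> krull_dim (zariski_affine :: params topology)"
  by (rule krull_dim_embedding[where h = id]) (simp add: embedding_map_def homeomorphic_map_id image_id)
 moreover have "krull_dim (zariski_affine :: params topology) \<le> enat 4"
 proof (rule krull_dim_le)
  show "n \<le> 4" if "irr_chain (zariski_affine :: params topology) n C" for n C
   using irr_chain_zariski_affine[OF that] by (simp add: numeral_eq_Suc)
 qed
 ultimately have "krull_dim ?K = 4" by (simp add: numeral_eq_enat antisym)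
 then show ?thesis using krull_dim_homeomorphic_maps[OF moduli_homeomorphic] by simp
qed

lemma poly_fun_params: "real_poly f \<Longrightarrow> poly_fun 4 (\<lambda>a. f (a 0, a 1, a 2, a 3))" for f :: "params \<Rightarrow> real"
proof (induction rule: real_polynomial_function.induct)
 case (linear f)
 interpret bounded_linear f by (rule linear)
 have "f (x, y, z, w) = f (1, 0, 0, 0) * x + (f (0, 1, 0, 0) * y + (f (0, 0, 1, 0) * z + f (0, 0, 0, 1) * w))" for x y z w
 proof -
  have "(x, y, z, w) = x *\<^sub>R (1, 0, 0, 0) + (y *\<^sub>R (0, 1, 0, 0) + (z *\<^sub>R (0, 0, 1, 0) + w *\<^sub>R (0, 0, 0, 1 :: real)))" by simp
  then have "f (x, y, z, w) = f (x *\<^sub>R (1, 0, 0, 0) + (y *\<^sub>R (0, 1, 0, 0) + (z *\<^sub>R (0, 0, 1, 0) + w *\<^sub>R (0, 0, 0, 1))))" by (rule arg_cong)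
  then show ?thesis by (simp only: add scaleR) (simp add: mult.commute)
 qed
 then have eq: "(\<lambda>a. f (a 0, a 1, a 2, a 3)) = (\<lambda>a :: nat \<Rightarrow> real. f (1, 0, 0, 0) * a 0 + (f (0, 1, 0, 0) * a 1 +
   (f (0, 0, 1, 0) * a 2 + f (0, 0, 0, 1) * a 3)))" by (intro ext)
 show ?case unfolding eq by (intro poly_fun.add poly_fun.mult poly_fun.const poly_fun.coord) simp_all
next
 case (const c)
 show ?case by (rule poly_fun.const)
qed (auto intro: poly_fun.add poly_fun.mult)

text \<open>A nonzero polynomial does not vanish on a ball, so the parameters of billiards are dense.\<close>

theorem unirational_billiard_moduli: "unirational billiard_moduli_set"
proof -
 obtain W where W: "open W" "sample \<in> W" "W \<subseteq> reflective_params" by (rule open_reflective_params)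
 define D where "D = {u. \<forall>k. param_config k u \<noteq> 0}"
 define tup :: "(nat \<Rightarrow> real) \<Rightarrow> params" where "tup a = (a 0, a 1, a 2, a 3)" for a
 have surj: "\<exists>a. tup a = u" for u
 proof -
  obtain a b c d where "u = (a, b, c, d)" by (cases u)
  then have "tup (\<lambda>n. if n = 0 then a else if n = 1 then b else if n = 2 then c else d) = u" by (simp add: tup_def)
  then show ?thesis by blast
 qed
 have WD: "W \<subseteq> D" using W(3) by (auto simp: D_def reflective_params_def)
 have poly: "poly_fun 4 (\<lambda>a. param_config k (tup a) $ j)" for k j
  unfolding tup_def by (rule poly_fun_params) (rule polynomial_component_vec[OF polynomial_param_config])
 have cont: "continuous_map (subtopology zariski_affine D) moduli_topology param_class"
  by (rule continuous_param_class) (simp add: D_def)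
 have dense: "D \<subseteq> subtopology zariski_affine D closure_of W"
 proof
  fix u assume u: "u \<in> D"
  have "\<exists>y. y \<in> W \<and> y \<in> T" if T: "u \<in> T" "openin (subtopology zariski_affine D) T" for T
  proof -
   obtain T' where T': "openin zariski_affine T'" "T = T' \<inter> D" using T(2) by (auto simp: openin_subtopology)
   obtain f where f: "real_poly f" "f u \<noteq> 0" "{y. f y \<noteq> 0} \<subseteq> T'"
    using openin_zariski_affineE[OF T'(1), of u] T(1) T'(2) by auto
   have "\<exists>y\<in>W. f y \<noteq> 0" using real_polynomial_function_eq_zero[OF f(1) W(1), of u] W(2) f(2) by blast
   then show ?thesis using f(3) WD T'(2) by blast
  qed
  then show "u \<in> subtopology zariski_affine D closure_of W" using u by (simp add: in_closure_of)
 qed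
 have im: "{pgl_orbit (\<lambda>k. abs_rp2 (param_config k (tup a))) | a. \<forall>k. param_config k (tup a) \<noteq> 0} = param_class ` D"
  unfolding param_class_def D_def using surj by (auto simp: image_iff) metis
 have "moduli_topology closure_of (param_class ` D) = moduli_topology closure_of billiard_moduli_set"
 proof (rule antisym)
  have "param_class ` D \<subseteq> param_class ` (subtopology zariski_affine D closure_of W)" using dense by (rule image_mono)
  also have "\<dots> \<subseteq> moduli_topology closure_of (param_class ` W)" by (rule continuous_map_image_closure_subset[OF cont])
  also have "\<dots> \<subseteq> moduli_topology closure_of billiard_moduli_set"
   unfolding moduli_eq_image using W(3) by (intro closure_of_mono image_mono)
  finally show "moduli_topology closure_of (param_class ` D) \<subseteq> moduli_topology closure_of billiard_moduli_set"
   by (rule closure_of_minimal) simp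
  show "moduli_topology closure_of billiard_moduli_set \<subseteq> moduli_topology closure_of (param_class ` D)"
   unfolding moduli_eq_image by (intro closure_of_mono image_mono) (auto simp: D_def reflective_params_def)
 qed
 moreover obtain a where "tup a = sample" using surj by blast
 then have "\<exists>a. \<forall>k. param_config k (tup a) \<noteq> 0" using WD W(2) unfolding D_def by (intro exI[of _ a]) auto
 ultimately show ?thesis
  unfolding unirational_def im[symmetric] using poly
  by (intro exI[of _ 4] exI[of _ "\<lambda>k a. param_config k (tup a)"]) blast
qed

section \<open>The main result\<close>

theorem corollary5p41:
  shows
    "(\<forall>(v :: 5 \<Rightarrow> real^2) (c :: 5 \<Rightarrow> rp2). convex_5_reflective v c \<longrightarrow>
        (\<exists>Q n\<^sub>0 n\<^sub>1 n\<^sub>2 w n\<^sub>4 R. nondegenerate_form Q \<and> construction Q n\<^sub>0 n\<^sub>1 n\<^sub>2 w n\<^sub>4 R \<and>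
           (\<forall>i. side_reflection v c i = R i)))
     \<and> (\<forall>Q. nondegenerate_form Q \<longrightarrow>
          irreducible_space (parameter_topology Q) \<and>
          krull_dim (parameter_topology Q) = 7 \<and>
          krull_dim (configuration_moduli Q)
            = 7 - krull_dim (subtopology zariski_affine (orthogonal_group Q)) \<and>
          krull_dim (configuration_moduli Q) = 4)
     \<and> krull_dim billiard_moduli = 4
     \<and> irreducible_space billiard_moduli
     \<and> unirational billiard_moduli_set"
proof (intro conjI allI impI)
  fix v c assume "convex_5_reflective v c"
  then show "\<exists>Q n\<^sub>0 n\<^sub>1 n\<^sub>2 w n\<^sub>4 R. nondegenerate_form Q \<and> construction Q n\<^sub>0 n\<^sub>1 n\<^sub>2 w n\<^sub>4 R \<and> (\<forall>i. side_reflection v c i = R i)"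
    by (rule reflective_construction)
next
  fix Q assume "nondegenerate_form Q"
  then interpret form Q by unfold_locales
  show "irreducible_space (parameter_topology Q)"
    using irreducible_parameter_space by (simp add: parameter_topology_def)
  show "krull_dim (parameter_topology Q) = 7" by (rule krull_dim_parameter_space)
  show "krull_dim (configuration_moduli Q) = 4" by (rule krull_dim_configuration_moduli)
  then show "krull_dim (configuration_moduli Q) = 7 - krull_dim (subtopology zariski_affine (orthogonal_group Q))"
    unfolding krull_dim_orthogonal_group by (simp add: numeral_eq_enat)
qed (rule krull_dim_billiard_moduli irreducible_billiard_moduli unirational_billiard_moduli)+

end
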